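(* Let $\varphi:(0,\infty)\times(0,\infty)\to(0,\infty)$ be a $C^1$ function, and let $\alpha_1,\dots,\alpha_n\ge 0$ be constants at least two of which are non-zero. Put $\ell:=\min\{k:\alpha_k>0\}$. Suppose that $$\ell-1+x\,\partial_1(\log\varphi)(x,y)>0\quad\text{and}\quad \partial_2\varphi(x,y)\ge 0\qquad\text{for all }(x,y)\in(0,\infty)\times(0,\infty).$$ Let $u\in C^2(\mathbb{S}^n)$ be a positive, even, convex function satisfying $$\sum_{k}\alpha_k\,u\,\sigma_k(\bar\nabla^2u+\bar g u,\bar g)=\varphi(u,|Du|)\qquad\text{on }\mathbb{S}^n .$$ Then $u$ is constant.
   Context: $\mathbb{S}^n\subset\mathbb{R}^{n+1}$ is the unit sphere centred at the origin, with standard round metric $\bar g$ and Levi-Civita connection $\bar\nabla$; $\langle\cdot,\cdot\rangle$ is the Euclidean inner product and $D$ the standard flat connection of $\mathbb{R}^{n+1}$. For a function $u$ on $\mathbb{S}^n$, $Du$ at $x\in\mathbb{S}^n$ denotes the Euclidean gradient at $x$ of the 1-homogeneous extension of $u$ to $\mathbb{R}^{n+1}\setminus\{0\}$, i.e. $Du(x)=\bar\nabla u(x)+u(x)x$, so $|Du|^2=u^2+|\bar\nabla u|^2$. $\sigma_k(\bar\nabla^2u+\bar gu,\bar g)$ is the $k$-th elementary symmetric function of the $n$ eigenvalues of $\bar\nabla^2u+\bar g u$ with respect to $\bar g$. A function $u\in C^2(\mathbb{S}^n)$ is convex if all the eigenvalues of $\bar\nabla^2u+\bar g u$ with respect to $\bar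 g$ are non-negative at every point, and even if $u(x)=u(-x)$ for all $x\in\mathbb{S}^n$. $\partial_1,\partial_2$ are the partial derivatives with respect to the first and second argument. *)

theory Defs
  imports "HOL-Analysis.Analysis"
begin

section \<open>Calculus on the unit sphere of a Euclidean space\<close>

text \<open>
  A function on the unit sphere is a function on the ambient space of which only the values on
  the sphere matter; for a point x of the sphere, the tangent space there is the orthogonal
  complement of x.
\<close>

abbreviation unit_sphere :: "'a::euclidean_space set" where
  "unit_sphere \<equiv> sphere 0 1"

definition tangent_space :: "'a::euclidean_space \<Rightarrow> 'a set" where
  "tangent_space x = {v. v \<bullet> x = 0}"

definition tproj :: "'a::euclidean_space \<Rightarrow> 'a \<Rightarrow> 'a" where
  "tproj x v = v - (v \<bullet> x) *\<^sub>R x"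

text \<open>
  The derivative within the sphere is determined only on tangent vectors, so its direction is
  first projected to the tangent space; see \<open>sderiv_eq\<close> below. For maps into the
  ambient space this is the flat derivative D in tangential directions.
\<close>

definition sderiv :: "('a::euclidean_space \<Rightarrow> 'b::euclidean_space) \<Rightarrow> 'a \<Rightarrow> 'a \<Rightarrow> 'b" where
  "sderiv f x v = frechet_derivative f (at x within unit_sphere) (tproj x v)"

definition sphere_C1 :: "('a::euclidean_space \<Rightarrow> 'b::euclidean_space) \<Rightarrow> bool" where
  "sphere_C1 f \<longleftrightarrow> f differentiable_on unit_sphere \<and>
     (\<forall>v. continuous_on unit_sphere (\<lambda>x. sderiv f x v))"

text \<open>The Riemannian gradient for the round metric: the tangent vector g with
  \<open>g \<bullet> v = sderiv u x v\<close>, see \<open>sgrad_inner\<close>.\<close>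

definition sgrad :: "('a::euclidean_space \<Rightarrow> real) \<Rightarrow> 'a \<Rightarrow> 'a" where
  "sgrad u x = (\<Sum>b\<in>Basis. sderiv u x b *\<^sub>R b)"

definition sphere_C2 :: "('a::euclidean_space \<Rightarrow> real) \<Rightarrow> bool" where
  "sphere_C2 u \<longleftrightarrow> sphere_C1 u \<and> sphere_C1 (sgrad u)"

text \<open>The Levi-Civita connection of the round metric, applied to a tangent vector field:
  the tangential part of the flat derivative.\<close>

definition levi_civita :: "('a::euclidean_space \<Rightarrow> 'a) \<Rightarrow> 'a \<Rightarrow> 'a \<Rightarrow> 'a" where
  "levi_civita X x v = tproj x (sderiv X x v)"

definition shess :: "('a::euclidean_space \<Rightarrow> real) \<Rightarrow> 'a \<Rightarrow> 'a \<Rightarrow> 'a \<Rightarrow> real" where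
  "shess u x v w = levi_civita (sgrad u) x v \<bullet> w"

text \<open>The bilinear form (Hessian of u) + u g on the tangent space, g the round metric.\<close>

definition hess_form :: "('a::euclidean_space \<Rightarrow> real) \<Rightarrow> 'a \<Rightarrow> 'a \<Rightarrow> 'a \<Rightarrow> real" where
  "hess_form u x v w = shess u x v w + u x * (v \<bullet> w)"

definition hom1_ext :: "('a::euclidean_space \<Rightarrow> real) \<Rightarrow> 'a \<Rightarrow> real" where
  "hom1_ext u y = norm y * u (y /\<^sub>R norm y)"

definition Dgrad :: "('a::euclidean_space \<Rightarrow> real) \<Rightarrow> 'a \<Rightarrow> 'a" where
  "Dgrad u x = (THE g. GDERIV (hom1_ext u) x :> g)"


section \<open>Eigenvalues of a bilinear form with respect to the metric\<close>

definition eigenspace_on :: "'a::euclidean_space set \<Rightarrow> ('a \<Rightarrow> 'a \<Rightarrow> real) \<Rightarrow> real \<Rightarrow> 'a set" where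
  "eigenspace_on T B c = {v \<in> T. \<forall>w\<in>T. B v w = c * (v \<bullet> w)}"

definition eigenvalue_on :: "'a::euclidean_space set \<Rightarrow> ('a \<Rightarrow> 'a \<Rightarrow> real) \<Rightarrow> real \<Rightarrow> bool" where
  "eigenvalue_on T B c \<longleftrightarrow> (\<exists>v \<in> eigenspace_on T B c. v \<noteq> 0)"

text \<open>
  To count multiplicities, an eigenvalue c with eigenspace of dimension m is represented by the
  m pairs (c, 0), ..., (c, m - 1). For symmetric B on a subspace T this gives dim T pairs.
\<close>

definition eigen_index :: "'a::euclidean_space set \<Rightarrow> ('a \<Rightarrow> 'a \<Rightarrow> real) \<Rightarrow> (real \<times> nat) set" where
  "eigen_index T B = {(c, i). i < dim (eigenspace_on T B c)}"

definition elem_sym :: "nat \<Rightarrow> 'i set \<Rightarrow> ('i \<Rightarrow> real) \<Rightarrow> real" where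
  "elem_sym k I f = (\<Sum>S | S \<subseteq> I \<and> card S = k. \<Prod>i\<in>S. f i)"

definition sigma_hess :: "nat \<Rightarrow> ('a::euclidean_space \<Rightarrow> real) \<Rightarrow> 'a \<Rightarrow> real" where
  "sigma_hess k u x = elem_sym k (eigen_index (tangent_space x) (hess_form u x)) fst"

definition sphere_convex :: "('a::euclidean_space \<Rightarrow> real) \<Rightarrow> bool" where
  "sphere_convex u \<longleftrightarrow>
     (\<forall>x\<in>unit_sphere. \<forall>c. eigenvalue_on (tangent_space x) (hess_form u x) c \<longrightarrow> c \<ge> 0)"

definition sphere_even :: "('a::euclidean_space \<Rightarrow> real) \<Rightarrow> bool" where
  "sphere_even u \<longleftrightarrow> (\<forall>x\<in>unit_sphere. u (- x) = u x)"


section \<open>Functions of two positive real variables\<close>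

definition pos_quadrant :: "(real \<times> real) set" where
  "pos_quadrant = {0<..} \<times> {0<..}"

text \<open>For an open set S.\<close>

definition C1_on_open :: "('a::euclidean_space) set \<Rightarrow> ('a \<Rightarrow> 'b::euclidean_space) \<Rightarrow> bool" where
  "C1_on_open S f \<longleftrightarrow> (\<forall>p\<in>S. f differentiable (at p)) \<and>
     (\<forall>h. continuous_on S (\<lambda>p. frechet_derivative f (at p) h))"

definition partial1 :: "(real \<times> real \<Rightarrow> real) \<Rightarrow> real \<Rightarrow> real \<Rightarrow> real" where
  "partial1 f x y = deriv (\<lambda>s. f (s, y)) x"

definition partial2 :: "(real \<times> real \<Rightarrow> real) \<Rightarrow> real \<Rightarrow> real \<Rightarrow> real" where
  "partial2 f x y = deriv (\<lambda>t. f (x, t)) y"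


section \<open>Basic facts\<close>

lemma has_derivative_norm_sphere:
  fixes x :: "'a::euclidean_space"
  assumes "x \<in> unit_sphere"
  shows "(norm has_derivative (\<lambda>h. h \<bullet> x)) (at x)"
proof -
  have "norm x = 1" "x \<noteq> 0" using assms by auto
  then show ?thesis
    using GDERIV_norm[of x] by (simp add: gderiv_def sgn_div_norm)
qed

lemma has_derivative_normalize:
  fixes x :: "'a::euclidean_space"
  assumes "x \<in> unit_sphere"
  shows "((\<lambda>y. y /\<^sub>R norm y) has_derivative tproj x) (at x)"
proof -
  have [simp]: "norm x = 1" "x \<noteq> 0" using assms by auto
  show ?thesis
    by (rule has_derivative_eq_rhs[OF has_derivative_scaleR[OF
          Deriv.has_derivative_inverse[OF _ has_derivative_norm_sphere[OF assms]] has_derivative_ident]])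
      (auto simp: tproj_def fun_eq_iff)
qed

lemma has_derivative_hom0_ext:
  fixes f :: "'a::euclidean_space \<Rightarrow> 'b::euclidean_space"
  assumes "(f has_derivative f') (at x within unit_sphere)" and x: "x \<in> unit_sphere"
  shows "((\<lambda>y. f (y /\<^sub>R norm y)) has_derivative (\<lambda>v. f' (tproj x v))) (at x)"
proof -
  have [simp]: "norm x = 1" "x \<noteq> 0" using x by auto
  have "((\<lambda>y. f (y /\<^sub>R norm y)) has_derivative (\<lambda>v. f' (tproj x v))) (at x within - {0})"
  proof (rule has_derivative_in_compose[where f="\<lambda>y. y /\<^sub>R norm y" and g=f])
    show "((\<lambda>y. y /\<^sub>R norm y) has_derivative tproj x) (at x within - {0})"
      using has_derivative_normalize[OF x] by (rule has_derivative_at_withinI)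
    have "(\<lambda>y::'a. y /\<^sub>R norm y) ` (- {0}) \<subseteq> unit_sphere"
      by (auto simp: field_simps split: if_splits)
    then show "(f has_derivative f')
        (at (x /\<^sub>R norm x) within (\<lambda>y. y /\<^sub>R norm y) ` (- {0}))"
      using assms(1) by (auto intro: has_derivative_subset)
  qed
  moreover have "at x within - {0} = at x"
    by (rule at_within_open) auto
  ultimately show ?thesis by simp
qed

lemma sderiv_eq:
  assumes "(f has_derivative f') (at x within unit_sphere)" and "x \<in> unit_sphere"
  shows "sderiv f x v = f' (tproj x v)"
proof -
  have "(f has_derivative frechet_derivative f (at x within unit_sphere)) (at x within unit_sphere)"
    using assms(1) frechet_derivative_works differentiable_def by blast
  from has_derivative_unique[OF has_derivative_hom0_ext[OF this assms(2)]
      has_derivative_hom0_ext[OF assms]]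
  show ?thesis unfolding sderiv_def by meson
qed

lemma has_derivative_sderiv:
  assumes "f differentiable (at x within unit_sphere)" and "x \<in> unit_sphere"
  shows "((\<lambda>y. f (y /\<^sub>R norm y)) has_derivative sderiv f x) (at x)"
  using has_derivative_hom0_ext[OF assms(1)[unfolded frechet_derivative_works] assms(2)]
  unfolding sderiv_def .

lemma sgrad_inner:
  assumes "u differentiable (at x within unit_sphere)" and "x \<in> unit_sphere"
  shows "sgrad u x \<bullet> v = sderiv u x v"
proof -
  have "linear (sderiv u x)"
    using has_derivative_sderiv[OF assms] has_derivative_linear by blast
  then have "sderiv u x v = (\<Sum>b\<in>Basis. (v \<bullet> b) *\<^sub>R sderiv u x b)"
    by (metis (no_types, lifting) euclidean_representation linear_scale linear_sum sum.cong)
  also have "\<dots> = sgrad u x \<bullet> v"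
    unfolding sgrad_def inner_sum_left
    by (rule sum.cong) (auto simp: inner_commute)
  finally show ?thesis by simp
qed

lemma Dgrad_eq:
  assumes "u differentiable (at x within unit_sphere)" and x: "x \<in> unit_sphere"
  shows "Dgrad u x = sgrad u x + u x *\<^sub>R x"
proof -
  have [simp]: "norm x = 1" "x \<noteq> 0" using x by auto
  have "(hom1_ext u has_derivative (\<lambda>h. h \<bullet> (sgrad u x + u x *\<^sub>R x))) (at x)"
    unfolding hom1_ext_def
    by (rule has_derivative_eq_rhs[OF has_derivative_mult[OF has_derivative_norm_sphere[OF x]
          has_derivative_sderiv[OF assms]]])
      (simp add: fun_eq_iff inner_add_right sgrad_inner[OF assms, symmetric] inner_commute[of "sgrad u x"])
  then have gd: "GDERIV (hom1_ext u) x :> sgrad u x + u x *\<^sub>R x"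
    unfolding gderiv_def .
  show ?thesis
    unfolding Dgrad_def
  proof (rule the_equality[where P="\<lambda>g. GDERIV (hom1_ext u) x :> g", OF gd])
    fix g assume "GDERIV (hom1_ext u) x :> g"
    then have "(\<lambda>h. h \<bullet> g) = (\<lambda>h. h \<bullet> (sgrad u x + u x *\<^sub>R x))"
      using gd has_derivative_unique unfolding gderiv_def by blast
    then show "g = sgrad u x + u x *\<^sub>R x"
      by (metis vector_eq_ldot)
  qed
qed

end

theory Submission
  imports Defs "HOL-Probability.Probability"
begin

text \<open>
 The 1-homogeneous extension of \<open>u\<close> is the support function \<open>h\<close> of a symmetric convex body. Let \<open>X\<close> be its
 gradient and let \<open>e\<^sub>k\<close> be the \<open>k\<close>-th elementary symmetric function of its Hessian. Write \<open>M\<close> for the mean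
 over the sphere and \<open>B\<^sub>k = M (h e\<^sub>k |\<nabla>u|^2)\<close>.

 (I) \<open>k M (h |X|^2 e\<^sub>k) \<le> M (h^2 (e\<^sub>1 e\<^sub>k - (k + 1) e\<^sub>k\<^sub>+\<^sub>1))\<close>. On a subspace, apply the Brascamp--Lieb inequality
 with the even potential \<open>h^2 / 2\<close> to its derivative in a transversal direction, which is odd. Then average
 over Gaussian random subspaces, which turns the Gram determinants into the \<open>e\<^sub>k\<close>.

 (II) \<open>(n + 2 - k) M (h^3 e\<^sub>k) - 2 M (h |X|^2 e\<^sub>k) \<le> (k + 1) M (h^2 e\<^sub>k\<^sub>+\<^sub>1)\<close>. The map \<open>x + s Y x\<close> preserves volume in
 total when \<open>Y\<close> has compact support and \<open>s\<close> is small. So all elementary symmetric functions of \<open>DY\<close> have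
 integral 0; take \<open>Y\<close> to be a cutoff times a power of \<open>h\<close> times \<open>X\<close>.

 Adding (I) and (II) gives \<open>n M (h^3 e\<^sub>k) - M (h^2 e\<^sub>1 e\<^sub>k) \<le> (2 - k) B\<^sub>k\<close>. The divergence theorem for
 \<open>u \<phi>(u, |Du|) \<nabla>u\<close>, the equation and these inequalities, weighted by \<open>\<alpha>\<^sub>k\<close>, yield
 \<open>M (\<phi> |\<nabla>u|^2 (l - 1 + u \<partial>\<^sub>1 log \<phi>)) \<le> 0\<close>, whence \<open>\<nabla>u = 0\<close>.
\<close>

text \<open>Low regularity and degeneracy shape the argument. As \<open>u\<close> is only C^2,
  \<open>h^2 / 2\<close> has a Lipschitz gradient but in general no second derivative at the origin,
  and the Hessian of \<open>h\<close> may degenerate. So Brascamp--Lieb is extracted from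
  Prekopa--Leindler in the variable dual to that of the conjugate, where the Hessian of
  \<open>h^2 / 2\<close> is used only off a null set; degenerate \<open>h\<close> are reached by
  adding a small ball to the body. Evenness enters (I) because an odd function has mean 0, so no
  variance correction is left. The factor \<open>k\<close> in (I) is \<open>k + 1\<close>, the
  dimension of a slice through the base point, minus 1 for the radial square in the Hessian
  \<open>(X \<bullet> v) *R X + h *R A v\<close> of \<open>h^2 / 2\<close>. The constant
  \<open>n + 2 - k\<close> in (II) is the divergence factor of the field
  \<open>|x|^(1 - k) x\<close> in dimension \<open>n + 1\<close>. The two inequalities fit together
  because they bound the mean of \<open>h^2 e_(k+1)\<close> from opposite sides. Means over the
  sphere are Gaussian integrals of extensions of degree 0, so no surface measure occurs and
  constants of proportionality cancel.\<close>

abbreviation lebesgue_nn :: "('a::euclidean_space \<Rightarrow> ennreal) \<Rightarrow> ennreal" (binder "\<integral>" 10) where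
  "lebesgue_nn f \<equiv> integral\<^sup>N lborel f"

notation scaleR (infixr "*R" 75)

section \<open>Changes of variables for Lebesgue measure\<close>

lemma nn_integral_lborel_translate:
 fixes f :: "'a::euclidean_space => ennreal"
 assumes [measurable]: "f \<in> borel_measurable borel"
 shows "(\<integral>x. f (x + a)) = (\<integral>x. f x)"
proof -
 have "(\<integral>x. f x) = (\<integral>\<^sup>+x. f x \<partial>(distr lborel borel ((+) a)))"
  by (simp add: lborel_distr_plus)
 also have "... = (\<integral>x. f (a + x))"
  by (subst nn_integral_distr) auto
 finally show ?thesis by (simp add: add.commute)
qed

lemma nn_integral_lborel_uminus:
 fixes f :: "'a::euclidean_space => ennreal"
 assumes [measurable]: "f \<in> borel_measurable borel"
 shows "(\<integral>x. f (- x)) = (\<integral>x. f x)"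
proof -
 have "(\<integral>x. f x) = (\<integral>\<^sup>+x. f x \<partial>(density (distr lborel borel (\<lambda>x. 0 + (-1) *R x)) (\<lambda>_. \<bar>-1::real\<bar> ^ DIM('a))))"
  by (subst lborel_affine[of "-1" 0, symmetric]) auto
 also have "... = (\<integral>x. f (- x))"
  by (simp add: density_1 nn_integral_distr)
 finally show ?thesis by simp
qed

lemma nn_integral_lborel_scaleR:
 fixes f :: "'a::euclidean_space => ennreal"
 assumes [measurable]: "f \<in> borel_measurable borel" and c: "c > 0"
 shows "(\<integral>x. f x) = ennreal (c ^ DIM('a)) * (\<integral>x. f (c *R x))"
proof -
 have "(\<integral>x. f x) = (\<integral>\<^sup>+x. f x \<partial>(density (distr lborel borel (\<lambda>x. 0 + c *R x)) (\<lambda>_. \<bar>c\<bar> ^ DIM('a))))"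
  using c by (subst lborel_affine[of c 0, symmetric]) auto
 also have "... = (\<integral>x. ennreal (c ^ DIM('a)) * f (c *R x))"
  using c by (subst nn_integral_density) (auto simp: nn_integral_distr)
 finally show ?thesis by (simp add: nn_integral_cmult)
qed

text \<open>Both measures \<open>dy\<close> and the image of \<open>dx\<close> are translation invariant, hence proportional;
 the unit ball determines the factor.\<close>

lemma nn_integral_lborel_isometry:
 fixes f :: "'a::euclidean_space => 'b::euclidean_space" and h :: "'b => ennreal"
 assumes lin: "linear f" and iso: "\<And>x. norm (f x) = norm x" and dim: "DIM('a) = DIM('b)"
  and [measurable]: "h \<in> borel_measurable borel"
 shows "(\<integral>x. h (f x)) = (\<integral>y. h y)"
proof -
 have contf: "continuous_on UNIV f"
  using lin linear_continuous_on linear_conv_bounded_linear by blast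
 hence [measurable]: "f \<in> borel_measurable borel" by (simp add: borel_measurable_continuous_onI)
 have inj: "inj f"
  using lin iso by (metis linear_injective_0 norm_eq_zero)
 have surj: "surj f"
 proof -
  have "dim (range f) = DIM('a)"
   using dim_image_eq[OF lin] inj by (metis dim_UNIV inj_on_subset subset_UNIV span_UNIV)
  thus ?thesis
   using dim dim_eq_full linear_subspace_image[OF lin subspace_UNIV]
   by (metis span_eq_iff)
 qed
 define g :: "'b => ennreal" where "g = indicator (ball 0 1)"
 have [measurable]: "g \<in> borel_measurable borel"
  unfolding g_def by (intro borel_measurable_indicator) simp
 have gf: "g (f x) = indicator (ball 0 1) x" for x unfolding g_def using iso by (simp add: indicator_def)
 \<comment> \<open>Uniqueness of Haar measure: translating \<open>y\<close> by \<open>f x\<close>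
   and then \<open>x\<close> by a preimage of \<open>y\<close> exchanges the roles of the two
   factors. Surjectivity of \<open>f\<close> supplies the preimage.\<close>
 have "(\<integral>y. h y) * (\<integral>x. g (f x)) = (\<integral>x. (\<integral>y. h y * g (f x)))"
  by (simp add: nn_integral_multc nn_integral_cmult)
 also have "... = (\<integral>x. (\<integral>y. h (y + f x) * g (f x)))"
 proof (rule nn_integral_cong)
  fix x :: 'a
  show "(\<integral>y. h y * g (f x)) = (\<integral>y. h (y + f x) * g (f x))"
   using nn_integral_lborel_translate[of "\<lambda>y. h y * g (f x)" "f x"] by simp
 qed
 also have "... = (\<integral>y. (\<integral>x. h (y + f x) * g (f x)))"
  by (rule lborel_pair.Fubini'[symmetric]) measurable
 also have "... = (\<integral>y. (\<integral>x. h (f x) * g (f x - y)))"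
 proof (rule nn_integral_cong)
  fix y :: 'b
  obtain z where z: "f z = y" using surj by (metis surjD)
  have "(\<integral>x. h (f x) * g (f x - y)) = (\<integral>x. h (f (x + z)) * g (f (x + z) - y))"
   using nn_integral_lborel_translate[of "\<lambda>x. h (f x) * g (f x - y)" z] by simp
  also have "... = (\<integral>x. h (y + f x) * g (f x))"
   using lin z by (simp add: linear_add add.commute)
  finally show "(\<integral>x. h (y + f x) * g (f x)) = (\<integral>x. h (f x) * g (f x - y))" by simp
 qed
 also have "... = (\<integral>x. (\<integral>y. h (f x) * g (f x - y)))"
  by (rule lborel_pair.Fubini') measurable
 also have "... = (\<integral>x. h (f x) * (\<integral>y. g y))"
 proof (rule nn_integral_cong)
  fix x :: 'a
  have "(\<integral>y. g (f x - y)) = (\<integral>y. g (f x - - y))"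
   using nn_integral_lborel_uminus[of "\<lambda>y. g (f x - y)"] by simp
  also have "... = (\<integral>y. g y)"
   using nn_integral_lborel_translate[of g "f x"] by (simp add: add.commute)
  finally show "(\<integral>y. h (f x) * g (f x - y)) = h (f x) * (\<integral>y. g y)"
   by (simp add: nn_integral_cmult)
 qed
 also have "... = (\<integral>x. h (f x)) * (\<integral>y. g y)"
  by (simp add: nn_integral_multc)
 finally have eq: "(\<integral>y. h y) * (\<integral>x. g (f x)) = (\<integral>x. h (f x)) * (\<integral>y. g y)" .
 have b1: "(\<integral>x. g (f x)) = ennreal (measure lborel (ball (0::'a) 1))"
  unfolding gf using emeasure_lborel_ball_finite[of "0::'a" 1]
  by (simp add: emeasure_eq_ennreal_measure less_top)
 have b2: "(\<integral>y. g y) = ennreal (measure lborel (ball (0::'b) 1))"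
  unfolding g_def using emeasure_lborel_ball_finite[of "0::'b" 1]
  by (simp add: emeasure_eq_ennreal_measure less_top)
 have "measure lborel (ball (0::'a) 1) = measure lborel (ball (0::'b) 1)"
  using content_ball[of 1 "0::'a"] content_ball[of 1 "0::'b"] dim by simp
 moreover have "measure lborel (ball (0::'b) 1) > 0" by (rule content_ball_pos) simp
 ultimately show ?thesis using eq b1 b2
  by (simp add: mult.commute[of _ "ennreal _"] ennreal_mult_cancel_left)
qed


lemma AE_lborel_nonzero: "AE x in lborel. x \<noteq> (0::'a::euclidean_space)"
 by (rule AE_I'[of "{0}"]) auto

text \<open>A form of polar coordinates without a surface measure. Scaling \<open>y\<close> by
  \<open>norm x\<close>, then \<open>x\<close> by \<open>inverse (norm z)\<close>, then
  \<open>z\<close> by \<open>norm x\<close> moves the weight \<open>w1\<close> off the variable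
  \<open>x\<close>; the angular part \<open>\<Theta>\<close> survives because it has degree 0. What
  remains of \<open>w1\<close> does not depend on \<open>\<Theta>\<close>.\<close>

lemma nn_integral_polar_aux:
 fixes w1 w2 :: "real => ennreal" and \<Theta> :: "'a::euclidean_space => ennreal"
 assumes [measurable]: "w1 \<in> borel_measurable borel" "w2 \<in> borel_measurable borel" "\<Theta> \<in> borel_measurable borel"
  and hom: "\<And>c x. c > 0 ==> x \<noteq> 0 ==> \<Theta> (c *R x) = \<Theta> x"
 shows "(\<integral>x. w1 (norm x) * \<Theta> x) * (\<integral>y. w2 (norm (y::'a))) =
  (\<integral>x. w2 (norm x) * \<Theta> x) *
  (\<integral>z. ennreal (inverse (norm z) ^ DIM('a) * inverse (norm z) ^ DIM('a)) * w1 (inverse (norm (z::'a))))"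
proof -
 let ?N = "DIM('a)"
 let ?W = "\<lambda>x z :: 'a. ennreal ((norm x * inverse (norm z)) ^ ?N * inverse (norm z) ^ ?N)"
 let ?V = "\<lambda>x z :: 'a. inverse (norm z) *R x"
 have "(\<integral>x. w1 (norm x) * \<Theta> x) * (\<integral>y. w2 (norm (y::'a))) =
  (\<integral>x. w1 (norm x) * \<Theta> x * (\<integral>y. w2 (norm (y::'a))))"
  by (simp add: nn_integral_multc)
 also have "... = (\<integral>x. (\<integral>z. w1 (norm x) * \<Theta> x * ennreal (norm x ^ ?N) * w2 (norm x * norm (z::'a))))"
 proof (rule nn_integral_cong_AE, use AE_lborel_nonzero in eventually_elim)
  fix x :: 'a assume "x \<noteq> 0"
  hence "(\<integral>y. w2 (norm (y::'a))) = ennreal (norm x ^ ?N) * (\<integral>z. w2 (norm x * norm (z::'a)))"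
   by (subst nn_integral_lborel_scaleR[of _ "norm x"]) auto
  thus "w1 (norm x) * \<Theta> x * (\<integral>y. w2 (norm (y::'a))) = (\<integral>z. w1 (norm x) * \<Theta> x * ennreal (norm x ^ ?N) * w2 (norm x * norm (z::'a)))"
   by (simp add: nn_integral_cmult mult.assoc)
 qed
 also have "... = (\<integral>z. (\<integral>x. w1 (norm x) * \<Theta> x * ennreal (norm x ^ ?N) * w2 (norm x * norm (z::'a))))"
  by (rule lborel_pair.Fubini') measurable
 also have "... = (\<integral>z. (\<integral>x. w2 (norm x) * \<Theta> x * ?W x z * w1 (norm x * inverse (norm (z::'a)))))"
 proof (rule nn_integral_cong_AE, use AE_lborel_nonzero in eventually_elim)
  fix z :: 'a assume z: "z \<noteq> 0"
  have "(\<integral>x. w1 (norm x) * \<Theta> x * ennreal (norm x ^ ?N) * w2 (norm x * norm z))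
   = ennreal (inverse (norm z) ^ ?N) * (\<integral>x. w1 (norm (?V x z)) * \<Theta> (?V x z) * ennreal (norm (?V x z) ^ ?N) * w2 (norm (?V x z) * norm z))"
   using z by (subst nn_integral_lborel_scaleR[of _ "inverse (norm z)"]) auto
  also have "... = (\<integral>x. ennreal (inverse (norm z) ^ ?N) * (w1 (norm (?V x z)) * \<Theta> (?V x z) * ennreal (norm (?V x z) ^ ?N) * w2 (norm (?V x z) * norm z)))"
   by (subst nn_integral_cmult) auto
  also have "... = (\<integral>x. w2 (norm x) * \<Theta> x * ?W x z * w1 (norm x * inverse (norm z)))"
  proof (rule nn_integral_cong_AE, use AE_lborel_nonzero in eventually_elim)
   fix x :: 'a assume x: "x \<noteq> 0"
   have n: "norm (?V x z) = norm x * inverse (norm z)" by simp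
   have e: "ennreal (inverse (norm z) ^ ?N) * (a * b * ennreal ((norm x * inverse (norm z)) ^ ?N) * c)
     = c * b * ?W x z * a" for a b c
    by (subst ennreal_mult) (auto simp: mult_ac)
   have h: "\<Theta> (?V x z) = \<Theta> x" using hom[of "inverse (norm z)" x] x z by simp
   have c: "norm x * inverse (norm z) * norm z = norm x" using z by simp
   show "ennreal (inverse (norm z) ^ ?N) * (w1 (norm (?V x z)) * \<Theta> (?V x z) * ennreal (norm (?V x z) ^ ?N) * w2 (norm (?V x z) * norm z)) = w2 (norm x) * \<Theta> x * ?W x z * w1 (norm x * inverse (norm z))"
    unfolding n h e c ..
  qed
  finally show "(\<integral>x. w1 (norm x) * \<Theta> x * ennreal (norm x ^ ?N) * w2 (norm x * norm z)) = (\<integral>x. w2 (norm x) * \<Theta> x * ?W x z * w1 (norm x * inverse (norm z)))" .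
 qed
 also have "... = (\<integral>x. (\<integral>z. w2 (norm x) * \<Theta> x * ?W x z * w1 (norm x * inverse (norm (z::'a)))))"
  by (rule lborel_pair.Fubini'[symmetric]) measurable
 also have "... = (\<integral>x. w2 (norm x) * \<Theta> x * (\<integral>z. ennreal (inverse (norm z) ^ ?N * inverse (norm z) ^ ?N) * w1 (inverse (norm (z::'a)))))"
 proof (rule nn_integral_cong_AE, use AE_lborel_nonzero in eventually_elim)
  fix x :: 'a assume x: "x \<noteq> 0"
  have "(\<integral>z. w2 (norm x) * \<Theta> x * ?W x z * w1 (norm x * inverse (norm (z::'a))))
   = w2 (norm x) * \<Theta> x * (\<integral>z. ?W x z * w1 (norm x * inverse (norm (z::'a))))"
   by (simp add: nn_integral_cmult mult.assoc)
  also have "(\<integral>z. ?W x z * w1 (norm x * inverse (norm (z::'a))))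
   = ennreal (norm x ^ ?N) * (\<integral>z. ennreal ((norm x * inverse (norm (norm x *R z))) ^ ?N * inverse (norm (norm x *R z)) ^ ?N) * w1 (norm x * inverse (norm (norm x *R (z::'a)))))"
   using x by (subst nn_integral_lborel_scaleR[of _ "norm x"]) auto
  also have "... = (\<integral>z. ennreal (norm x ^ ?N) * (ennreal ((norm x * inverse (norm (norm x *R z))) ^ ?N * inverse (norm (norm x *R z)) ^ ?N) * w1 (norm x * inverse (norm (norm x *R (z::'a))))))"
   by (simp add: nn_integral_cmult)
  also have "... = (\<integral>z. ennreal (inverse (norm z) ^ ?N * inverse (norm z) ^ ?N) * w1 (inverse (norm (z::'a))))"
  proof (rule nn_integral_cong)
   fix z :: 'a
   have a: "norm x * inverse (norm (norm x *R z)) = inverse (norm z)"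
    using x by (simp add: field_simps)
   have b: "norm x ^ ?N * (inverse (norm z) ^ ?N * inverse (norm (norm x *R z)) ^ ?N) = inverse (norm z) ^ ?N * inverse (norm z) ^ ?N"
   proof -
    have "norm x ^ ?N * inverse (norm (norm x *R z)) ^ ?N = inverse (norm z) ^ ?N"
     using a by (metis power_mult_distrib)
    thus ?thesis by (simp add: mult.left_commute)
   qed
   show "ennreal (norm x ^ ?N) * (ennreal ((norm x * inverse (norm (norm x *R z))) ^ ?N * inverse (norm (norm x *R z)) ^ ?N) * w1 (norm x * inverse (norm (norm x *R z)))) = ennreal (inverse (norm z) ^ ?N * inverse (norm z) ^ ?N) * w1 (inverse (norm z))"
    unfolding a mult.assoc[symmetric]
    by (subst ennreal_mult[symmetric]) (auto simp: b simp del: norm_scaleR)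
  qed
  finally show "(\<integral>z. w2 (norm x) * \<Theta> x * ?W x z * w1 (norm x * inverse (norm (z::'a))))
   = w2 (norm x) * \<Theta> x * (\<integral>z. ennreal (inverse (norm z) ^ ?N * inverse (norm z) ^ ?N) * w1 (inverse (norm (z::'a))))" .
 qed
 also have "... = (\<integral>x. w2 (norm x) * \<Theta> x) *
  (\<integral>z. ennreal (inverse (norm z) ^ ?N * inverse (norm z) ^ ?N) * w1 (inverse (norm (z::'a))))"
  by (simp add: nn_integral_multc)
 finally show ?thesis .
qed

text \<open>The case of constant \<open>\<Theta>\<close> identifies the factor left over in
  \<open>nn_integral_polar_aux\<close>; a positive finite integral of \<open>w2\<close> allows
  cancellation there.\<close>

lemma nn_integral_polar:
 fixes w1 w2 :: "real => ennreal" and \<Theta> :: "'a::euclidean_space => ennreal"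
 assumes [measurable]: "w1 \<in> borel_measurable borel" "w2 \<in> borel_measurable borel" "\<Theta> \<in> borel_measurable borel"
  and hom: "\<And>c x. c > 0 ==> x \<noteq> 0 ==> \<Theta> (c *R x) = \<Theta> x"
  and w2: "(\<integral>y. w2 (norm (y::'a))) \<noteq> 0" "(\<integral>y. w2 (norm (y::'a))) \<noteq> \<infinity>"
 shows "(\<integral>x. w1 (norm x) * \<Theta> x) * (\<integral>y. w2 (norm (y::'a))) =
  (\<integral>x. w2 (norm x) * \<Theta> x) * (\<integral>y. w1 (norm (y::'a)))"
proof -
 have "(\<integral>z. ennreal (inverse (norm z) ^ DIM('a) * inverse (norm z) ^ DIM('a)) * w1 (inverse (norm (z::'a))))
   = (\<integral>y. w1 (norm (y::'a)))"
  using nn_integral_polar_aux[of w1 w2 "\<lambda>_::'a. 1"] w2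
  by (simp add: mult.commute[of _ "\<integral>\<^sup>+y. w2 (norm (y::'a)) \<partial>lborel"] ennreal_mult_cancel_left)
 thus ?thesis using nn_integral_polar_aux[of w1 w2 \<Theta>] hom by simp
qed

section \<open>The Prekopa--Leindler inequality\<close>

text \<open>One-dimensional Brunn--Minkowski. With \<open>a\<close> close to the supremum of
  \<open>A\<close> and \<open>b\<close> close to the infimum of \<open>B\<close>, the halved sets
  \<open>P\<close> of \<open>A + b\<close> and \<open>Q\<close> of \<open>a + B\<close> lie in
  \<open>C\<close> and overlap in an interval of length at most \<open>e / 2\<close>. As
  \<open>C\<close> merely contains all midpoints, measurability of a sumset is not at issue.\<close>

lemma emeasure_midpoint_aux:
 fixes A B C :: "real set"
 assumes [measurable]: "A \<in> sets borel" "B \<in> sets borel" "C \<in> sets borel"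
  and ne: "A \<noteq> {}" "B \<noteq> {}" and bd: "bounded A" "bounded B"
  and mid: "\<And>a b. a \<in> A ==> b \<in> B ==> (a + b) / 2 \<in> C"
 shows "emeasure lborel A + emeasure lborel B \<le> 2 * emeasure lborel C"
proof (rule ennreal_le_epsilon)
 fix e :: real assume e: "e > 0"
 have bda: "bdd_above A" "bdd_below B" using bd by (auto dest: bounded_imp_bdd_above bounded_imp_bdd_below)
 obtain a where a: "a \<in> A" "a > Sup A - e/2"
  using less_cSup_iff[OF ne(1) bda(1), of "Sup A - e/2"] e by auto
 obtain b where b: "b \<in> B" "b < Inf B + e/2"
  using cInf_less_iff[OF ne(2) bda(2), of "Inf B + e/2"] e by auto
 define P where "P = {y. 2 * y - b \<in> A}"
 define Q where "Q = {y. 2 * y - a \<in> B}"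
 have [measurable]: "P \<in> sets borel" "Q \<in> sets borel"
  unfolding P_def Q_def by measurable
 have shift: "emeasure lborel S = 2 * emeasure lborel {y. 2 * y - c \<in> S}"
  if [measurable]: "S \<in> sets borel" for S :: "real set" and c
 proof -
  have "emeasure lborel S = (\<integral>x. indicator S x)" by simp
  also have "... = (\<integral>x. indicator S (x - c))"
   using nn_integral_lborel_translate[of "indicator S" "-c"] by simp
  also have "... = 2 * (\<integral>x. indicator S (2 *R x - c))"
   by (subst nn_integral_lborel_scaleR[of _ 2]) auto
  also have "(\<integral>x. indicator S (2 *R x - c)) = (\<integral>x. indicator {y. 2 * y - c \<in> S} x)"
   by (rule nn_integral_cong) (auto simp: indicator_def)
  also have "... = emeasure lborel {y. 2 * y - c \<in> S}"
   by (rule nn_integral_indicator) measurable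
  finally show ?thesis .
 qed
 have sub: "P \<union> Q \<subseteq> C"
 proof
  fix y assume "y \<in> P \<union> Q"
  thus "y \<in> C" unfolding P_def Q_def using mid[of "2*y-b" b] mid[of a "2*y-a"] a b by auto
 qed
 have int: "P \<inter> Q \<subseteq> {(a + Inf B) / 2 .. (Sup A + b) / 2}"
 proof
  fix y assume "y \<in> P \<inter> Q"
  hence "2 * y - b \<le> Sup A" "Inf B \<le> 2 * y - a"
   unfolding P_def Q_def using cSup_upper[OF _ bda(1)] cInf_lower[OF _ bda(2)] by auto
  thus "y \<in> {(a + Inf B) / 2 .. (Sup A + b) / 2}" by auto
 qed
 have small: "emeasure lborel (P \<inter> Q) \<le> ennreal (e / 2)"
 proof -
  have "emeasure lborel (P \<inter> Q) \<le> emeasure lborel {(a + Inf B) / 2 .. (Sup A + b) / 2}"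
   by (rule emeasure_mono[OF int]) auto
  also have "... \<le> ennreal (e / 2)"
  proof (cases "(a + Inf B) / 2 \<le> (Sup A + b) / 2")
   case True
   thus ?thesis using a b by (auto intro!: ennreal_leI simp: field_simps)
  next
   case False
   thus ?thesis by auto
  qed
  finally show ?thesis .
 qed
 have "emeasure lborel A + emeasure lborel B = 2 * emeasure lborel P + 2 * emeasure lborel Q"
  using shift[of A b] shift[of B a] by (simp add: P_def Q_def)
 also have "... = 2 * (emeasure lborel (P \<union> Q) + emeasure lborel (P \<inter> Q))"
  by (subst emeasure_Un_Int[symmetric]) (auto simp: distrib_left)
 also have "... \<le> 2 * (emeasure lborel C + ennreal (e / 2))"
  using emeasure_mono[OF sub, of lborel] small by (intro mult_left_mono add_mono) auto
 also have "... = 2 * emeasure lborel C + ennreal e"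
 proof -
  have "2 * ennreal (e / 2) = ennreal e"
   using e by (subst ennreal_numeral[symmetric], subst ennreal_mult[symmetric]) auto
  thus ?thesis by (simp add: distrib_left)
 qed
 finally show "emeasure lborel A + emeasure lborel B \<le> 2 * emeasure lborel C + ennreal e" .
qed

lemma emeasure_midpoint:
 fixes A B C :: "real set"
 assumes [measurable]: "A \<in> sets borel" "B \<in> sets borel" "C \<in> sets borel"
  and ne: "A \<noteq> {}" "B \<noteq> {}"
  and mid: "\<And>a b. a \<in> A ==> b \<in> B ==> (a + b) / 2 \<in> C"
 shows "emeasure lborel A + emeasure lborel B \<le> 2 * emeasure lborel C"
proof -
 obtain a b where ab: "a \<in> A" "b \<in> B" using ne by auto
 define An where "An n = A \<inter> {- real n .. real n}" for n
 define Bn where "Bn n = B \<inter> {- real n .. real n}" for n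
 have lim: "(\<lambda>n. emeasure lborel (S \<inter> {- real n .. real n})) \<longlonglongrightarrow> emeasure lborel S"
  if [measurable]: "S \<in> sets borel" for S :: "real set"
 proof -
  have "(\<Union>n. S \<inter> {- real n .. real n}) = S"
  proof (intro equalityI subsetI)
   fix x assume "x \<in> S"
   moreover obtain n where "\<bar>x\<bar> \<le> real n" using real_arch_simple by blast
   ultimately show "x \<in> (\<Union>n. S \<inter> {- real n .. real n})" by (auto simp: abs_le_iff intro!: exI[of _ n])
  qed auto
  moreover have "incseq (\<lambda>n. S \<inter> {- real n .. real n})" by (auto simp: incseq_def)
  ultimately show ?thesis
   using Lim_emeasure_incseq[of "\<lambda>n. S \<inter> {- real n .. real n}" lborel] that
   by (metis (no_types, lifting) image_subset_iff sets.Int sets_lborel atLeastAtMost_borel)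
 qed
 have "(\<lambda>n. emeasure lborel (An n) + emeasure lborel (Bn n)) \<longlonglongrightarrow> emeasure lborel A + emeasure lborel B"
  unfolding An_def Bn_def by (intro tendsto_add lim) auto
 moreover have "\<forall>\<^sub>F n in sequentially. emeasure lborel (An n) + emeasure lborel (Bn n) \<le> 2 * emeasure lborel C"
 proof -
  obtain m where m: "\<bar>a\<bar> + \<bar>b\<bar> \<le> real m" using real_arch_simple by blast
  show ?thesis
  proof (rule eventually_sequentiallyI[of m])
   fix n assume "m \<le> n"
   hence n: "\<bar>a\<bar> + \<bar>b\<bar> \<le> real n" using m by linarith
   show "emeasure lborel (An n) + emeasure lborel (Bn n) \<le> 2 * emeasure lborel C"
   proof (rule emeasure_midpoint_aux)
    show "An n \<noteq> {}" "Bn n \<noteq> {}" unfolding An_def Bn_def using ab n by force+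
    show "bounded (An n)" "bounded (Bn n)" unfolding An_def Bn_def by (auto intro: bounded_subset[OF bounded_closed_interval])
    show "An n \<in> sets borel" "Bn n \<in> sets borel" unfolding An_def Bn_def by measurable
   qed (auto simp: An_def Bn_def mid)
  qed
 qed
 ultimately show ?thesis by (rule tendsto_upperbound) auto
qed

text \<open>Fubini for the region under the graph. The factor \<open>indicator {0..}\<close> keeps
  genuine levels only, since \<open>ennreal t\<close> is 0 for every negative
  \<open>t\<close>.\<close>

lemma nn_integral_layer_cake:
 fixes f :: "real => ennreal"
 assumes [measurable]: "f \<in> borel_measurable borel"
 shows "(\<integral>x. f x) = (\<integral>t. indicator {0..} t * emeasure lborel {x. ennreal t < f x})"
proof -
 have "f x = (\<integral>t. indicator {0..} t * indicator {x. ennreal t < f x} x)" for x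
 proof (cases "f x")
  case (real r)
  have "(\<integral>t. indicator {0..} t * indicator {x. ennreal t < f x} x) = (\<integral>t. indicator {0..<r} t)"
   using real by (intro nn_integral_cong) (auto simp: indicator_def ennreal_less_iff)
  thus ?thesis using real by simp
 next
  case top
  have "(\<integral>t. indicator {0..} t * indicator {x. ennreal t < f x} x) = (\<integral>t. indicator {0..} (t::real))"
   using top by (intro nn_integral_cong) (auto simp: indicator_def)
  also have "... = \<infinity>"
  proof (rule ccontr)
   assume "(\<integral>t. indicator {0..} (t::real)) \<noteq> \<infinity>"
   hence fin: "emeasure lborel ({0..} :: real set) \<noteq> \<infinity>" by simp
   then obtain r where r: "emeasure lborel ({0..} :: real set) = ennreal r" "r \<ge> 0"
    by (metis ennreal_cases infinity_ennreal_def)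
   have "emeasure lborel {0..r+1} \<le> emeasure lborel ({0..} :: real set)"
    by (rule emeasure_mono) auto
   thus False using r by (simp add: ennreal_le_iff)
  qed
  finally show ?thesis using top by simp
 qed
 hence "(\<integral>x. f x) = (\<integral>x. (\<integral>t. indicator {0..} t * indicator {x. ennreal t < f x} x))"
  by (metis (no_types))
 also have "... = (\<integral>t. (\<integral>x. indicator {0..} t * indicator {x. ennreal t < f x} x))"
  by (rule lborel_pair.Fubini') measurable
 also have "... = (\<integral>t. indicator {0..} t * emeasure lborel {x. ennreal t < f x})"
  by (intro nn_integral_cong) (simp add: nn_integral_cmult)
 finally show ?thesis .
qed

lemma ennreal_four_mult_le: "4 * (x * y) \<le> (x + y)^2" for x y :: ennreal
proof (cases "x = top \<or> y = top")
 case True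
 thus ?thesis by (auto simp: power2_eq_square)
next
 case False
 then obtain a b where ab: "x = ennreal a" "y = ennreal b" "a \<ge> 0" "b \<ge> 0"
  by (metis ennreal_cases)
 have "4 * (a * b) \<le> (a + b)^2"
  using sum_squares_ge_zero[of "a - b" 0] by (simp add: power2_eq_square algebra_simps)
 hence "ennreal (4 * (a * b)) \<le> ennreal ((a + b)^2)" by (rule ennreal_leI)
 thus ?thesis using ab by (simp add: ennreal_mult ennreal_power[symmetric])
qed

lemma ennreal_mult_strict_mono':
 assumes "a < c" "b < (d :: ennreal)"
 shows "a * b < c * d"
proof -
 have real: "\<exists>r\<ge>0. x = ennreal r" if "x < y" for x y :: ennreal
  using that by (cases x) auto
 obtain a' b' where ab: "a = ennreal a'" "b = ennreal b'" "a' \<ge> 0" "b' \<ge> 0"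
  using real[OF assms(1)] real[OF assms(2)] by blast
 obtain c1 d1 where cd1: "a < c1" "c1 < c" "b < d1" "d1 < d"
  using dense[OF assms(1)] dense[OF assms(2)] by auto
 obtain c' d' where cd: "c1 = ennreal c'" "d1 = ennreal d'" "c' \<ge> 0" "d' \<ge> 0"
  using real[OF cd1(2)] real[OF cd1(4)] by blast
 have "c' > a'" "d' > b'" using cd cd1 ab by (auto simp: ennreal_less_iff)
 hence "a' * b' < c' * d'" using ab by (intro mult_strict_mono') auto
 hence "ennreal (a' * b') < ennreal (c' * d')" using ab by (simp add: ennreal_less_iff)
 hence "a * b < c1 * d1"
  using ab cd by (simp add: ennreal_mult)
 also have "... \<le> c * d" using cd1 by (intro mult_mono) auto
 finally show ?thesis .
qed

abbreviation level :: "real => (real => ennreal) => real => ennreal" where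
 "level d f t \<equiv> indicator {0..} t * emeasure lborel {x. ennreal (d * t) < f x}"

text \<open>Levels are measured relative to the suprema \<open>a\<close> and \<open>b\<close>: for
  \<open>t < 1\<close> the sets where \<open>f > a t\<close> and \<open>g > b t\<close> are both
  nonempty, and their midpoints lie where \<open>h > c t\<close> with \<open>c^2 = a b\<close>.
  Brunn--Minkowski integrated over \<open>t\<close> gives \<open>X + Y \<le> 2 Z\<close>, and the
  arithmetic-geometric mean inequality turns the sum into a product. Boundedness keeps
  \<open>a\<close> and \<open>b\<close> finite.\<close>

lemma Prekopa_Leindler_bounded:
 fixes f g h :: "real => ennreal"
 assumes [measurable]: "f \<in> borel_measurable borel" "g \<in> borel_measurable borel" "h \<in> borel_measurable borel"
  and bf: "\<And>x. f x \<le> ennreal M" and bg: "\<And>x. g x \<le> ennreal M"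
  and mid: "\<And>x y. f x * g y \<le> (h ((x + y) / 2))^2"
 shows "(\<integral>x. f x) * (\<integral>x. g x) \<le> (\<integral>x. h x)^2"
proof (cases "(SUP x. f x) = 0 \<or> (SUP x. g x) = 0")
 case True
 hence "(\<forall>x. f x = 0) \<or> (\<forall>x. g x = 0)"
  by (auto simp: SUP_eq_iff bot_ennreal[symmetric])
 thus ?thesis by auto
next
 case False
 have "(SUP x. f x) \<le> ennreal M" "(SUP x. g x) \<le> ennreal M" using bf bg by (auto intro!: SUP_least)
 hence "(SUP x. f x) < top" "(SUP x. g x) < top"
  using ennreal_less_top[of M] le_less_trans by blast+
 then obtain a b where ab: "(SUP x. f x) = ennreal a" "(SUP x. g x) = ennreal b" "a \<ge> 0" "b \<ge> 0"
  by (metis ennreal_cases less_irrefl)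
 with False have pos: "a > 0" "b > 0" by (auto simp: less_le)
 define c where "c = sqrt (a * b)"
 have c: "c > 0" "c^2 = a * b" using pos by (auto simp: c_def)
 have scaled: "(\<integral>x. k x) = ennreal d * (\<integral>t. level d k t)"
  if [measurable]: "k \<in> borel_measurable borel" and d: "d > 0" for k :: "real => ennreal" and d
 proof -
  have "(\<integral>x. k x) = (\<integral>t. indicator {0..} t * emeasure lborel {x. ennreal t < k x})"
   by (rule nn_integral_layer_cake) measurable
  also have "... = ennreal (d ^ DIM(real)) * (\<integral>t. indicator {0..} (d *R t) * emeasure lborel {x. ennreal (d *R t) < k x})"
   by (rule nn_integral_lborel_scaleR) (use d in measurable)
  also have "... = ennreal d * (\<integral>t. level d k t)"
   using d by (auto intro!: arg_cong[where f="\<lambda>x. ennreal d * x"] nn_integral_cong simp: indicator_def zero_le_mult_iff)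
  finally show ?thesis .
 qed
 define X where "X = (\<integral>t. level a f t)"
 define Y where "Y = (\<integral>t. level b g t)"
 define Z where "Z = (\<integral>t. level c h t)"
 have "X + Y = (\<integral>t. level a f t + level b g t)"
  unfolding X_def Y_def by (rule nn_integral_add[symmetric]) measurable
 also have "... \<le> (\<integral>t. 2 * level c h t)"
 proof (rule nn_integral_mono)
  fix t :: real
  show "level a f t + level b g t
    \<le> 2 * level c h t"
  proof (cases "t \<ge> 0")
   case t: True
   show ?thesis
   proof (cases "t < 1")
    case True
    have "emeasure lborel {x. ennreal (a * t) < f x} + emeasure lborel {x. ennreal (b * t) < g x} \<le> 2 * emeasure lborel {x. ennreal (c * t) < h x}"
    proof (rule emeasure_midpoint)
     have "ennreal (a * t) < (SUP x. f x)" "ennreal (b * t) < (SUP x. g x)"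
      using ab pos True t by (auto intro!: ennreal_lessI)
     thus "{x. ennreal (a * t) < f x} \<noteq> {}" "{x. ennreal (b * t) < g x} \<noteq> {}"
      by (auto simp: less_SUP_iff)
     fix x y assume "x \<in> {x. ennreal (a * t) < f x}" "y \<in> {x. ennreal (b * t) < g x}"
     hence "ennreal (a * t) * ennreal (b * t) < f x * g y"
      by (intro ennreal_mult_strict_mono') auto
     also have "... \<le> (h ((x + y) / 2))^2" by (rule mid)
     finally have *: "ennreal (a * t) * ennreal (b * t) < (h ((x + y) / 2))^2" .
     have "(a * t) * (b * t) = (c * t)^2"
      unfolding power_mult_distrib c(2) by (simp add: power2_eq_square mult_ac)
     moreover have "ennreal (a * t) * ennreal (b * t) = ennreal ((a * t) * (b * t))"
      using t pos by (intro ennreal_mult[symmetric]) auto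
     moreover have "ennreal (c * t) ^ 2 = ennreal ((c * t)^2)"
      using t c(1) by (intro ennreal_power) auto
     ultimately have "ennreal (a * t) * ennreal (b * t) = ennreal (c * t) ^ 2" by simp
     with * have "ennreal (c * t) ^ 2 < (h ((x + y) / 2))^2" by simp
     thus "(x + y) / 2 \<in> {x. ennreal (c * t) < h x}"
      by (metis mem_Collect_eq not_le power_mono zero_le)
    qed measurable
    thus ?thesis using t by simp
   next
    case False
    have "{x. ennreal (a * t) < f x} = {}" "{x. ennreal (b * t) < g x} = {}"
    proof -
     have "f x \<le> ennreal (a * t)" for x
      using SUP_upper[of x UNIV f] ab pos False by (auto intro: order_trans ennreal_leI)
     thus "{x. ennreal (a * t) < f x} = {}" by (auto simp: not_less)
     have "g x \<le> ennreal (b * t)" for x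
      using SUP_upper[of x UNIV g] ab pos False by (auto intro: order_trans ennreal_leI)
     thus "{x. ennreal (b * t) < g x} = {}" by (auto simp: not_less)
    qed
    thus ?thesis by simp
   qed
  qed simp
 qed
 also have "... = 2 * Z" unfolding Z_def by (rule nn_integral_cmult) measurable
 finally have XYZ: "X + Y \<le> 2 * Z" .
 have "4 * (X * Y) \<le> (X + Y)^2" by (rule ennreal_four_mult_le)
 also have "... \<le> (2 * Z)^2" by (rule power_mono[OF XYZ]) simp
 also have "... = 4 * Z^2" by (simp add: power_mult_distrib)
 finally have XY: "X * Y \<le> Z^2"
  by (subst (asm) ennreal_mult_le_mult_iff) auto
 have "(\<integral>x. f x) * (\<integral>x. g x) = (ennreal a * X) * (ennreal b * Y)"
  unfolding X_def Y_def using scaled[of f a] scaled[of g b] pos by simp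
 also have "... = ennreal (a * b) * (X * Y)"
  using pos by (simp add: ennreal_mult mult_ac)
 also have "... \<le> ennreal (a * b) * Z^2" by (rule mult_left_mono[OF XY]) simp
 also have "... = (ennreal c * Z)^2"
  using c by (simp add: power_mult_distrib ennreal_power)
 also have "ennreal c * Z = (\<integral>x. h x)"
  unfolding Z_def using scaled[of h c] c by simp
 finally show ?thesis .
qed

text \<open>Truncating \<open>f\<close> and \<open>g\<close> only lowers the left side of the
  midpoint hypothesis, so it holds with the same \<open>h\<close>; the suprema over the two
  truncation levels are then taken independently.\<close>

lemma Prekopa_Leindler_real:
 fixes f g h :: "real => ennreal"
 assumes [measurable]: "f \<in> borel_measurable borel" "g \<in> borel_measurable borel" "h \<in> borel_measurable borel"
  and mid: "\<And>x y. f x * g y \<le> (h ((x + y) / 2))^2"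
 shows "(\<integral>x. f x) * (\<integral>x. g x) \<le> (\<integral>x. h x)^2"
proof -
 have trunc: "(\<integral>x. k x) = (SUP n. \<integral>\<^sup>+x. min (k x) (ennreal (real n)) \<partial>lborel)"
  if [measurable]: "k \<in> borel_measurable borel" for k :: "real => ennreal"
 proof -
  have "k x = (SUP n. min (k x) (ennreal (real n)))" for x
  proof (rule antisym)
   show "k x \<le> (SUP n. min (k x) (ennreal (real n)))"
   proof (cases "k x")
    case (real r)
    obtain n where "r \<le> real n" using real_arch_simple by blast
    hence "min (k x) (ennreal (real n)) = k x" using real by (auto simp: min_def intro: ennreal_leI)
    thus ?thesis using SUP_upper[of n UNIV "\<lambda>n. min (k x) (ennreal (real n))"] by simp
   next
    case top
    have "min (k x) (ennreal (real n)) = of_nat n" for n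
     unfolding top ennreal_of_nat_eq_real_of_nat[symmetric] by (rule min_absorb2) simp
    thus ?thesis using top by (simp add: ennreal_SUP_of_nat_eq_top)
   qed
  qed (auto intro!: SUP_least)
  hence "(\<integral>x. k x) = (\<integral>x. (SUP n. min (k x) (ennreal (real n))))"
   by (intro nn_integral_cong)
  also have "... = (SUP n. \<integral>\<^sup>+x. min (k x) (ennreal (real n)) \<partial>lborel)"
   by (rule nn_integral_monotone_convergence_SUP)
    (auto simp: incseq_def le_fun_def intro!: min.mono ennreal_leI simp del: min_less_iff_conj min.bounded_iff)
  finally show ?thesis .
 qed
 have "(\<integral>x. min (f x) (ennreal (real n))) * (\<integral>x. min (g x) (ennreal (real m))) \<le> (\<integral>x. h x)^2" for m n
 proof (rule Prekopa_Leindler_bounded[where M="real (max m n)"])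
  fix x y
  have "min (f x) (ennreal (real n)) * min (g y) (ennreal (real m)) \<le> f x * g y"
   by (intro mult_mono) auto
  also have "... \<le> (h ((x + y) / 2))^2" by (rule mid)
  finally show "min (f x) (ennreal (real n)) * min (g y) (ennreal (real m)) \<le> (h ((x + y) / 2))^2" .
 qed (auto intro!: min.coboundedI2 ennreal_leI)
 thus ?thesis
  unfolding trunc[of f, OF assms(1)] trunc[of g, OF assms(2)]
  by (auto simp: SUP_mult_left_ennreal SUP_mult_right_ennreal intro!: SUP_least)
qed

text \<open>Induction on the coordinates: integrating out one coordinate with the one-dimensional
  inequality yields marginals that satisfy the midpoint hypothesis in the remaining ones. Points are
  taken \<open>extensional\<close>, as the elements of the product space are.\<close>

lemma Prekopa_Leindler_PiM:
 fixes f g h :: "('i => real) => ennreal"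
 assumes "finite I"
  and "f \<in> borel_measurable (Pi\<^sub>M I (\<lambda>_. lborel))" "g \<in> borel_measurable (Pi\<^sub>M I (\<lambda>_. lborel))"
   "h \<in> borel_measurable (Pi\<^sub>M I (\<lambda>_. lborel))"
  and "\<And>x y. x \<in> extensional I ==> y \<in> extensional I ==> f x * g y \<le> (h (\<lambda>i\<in>I. (x i + y i) / 2))^2"
 shows "(\<integral>\<^sup>+x. f x \<partial>Pi\<^sub>M I (\<lambda>_. lborel)) * (\<integral>\<^sup>+x. g x \<partial>Pi\<^sub>M I (\<lambda>_. lborel)) \<le> (\<integral>\<^sup>+x. h x \<partial>Pi\<^sub>M I (\<lambda>_. lborel))^2"
 using assms
proof (induction I arbitrary: f g h rule: finite_induct)
 case empty
 thus ?case
  using empty.prems(4)[of "\<lambda>_. undefined" "\<lambda>_. undefined"]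
  by (simp add: nn_integral_empty PiM_empty nn_integral_count_space_finite)
next
 case (insert i I)
 interpret product_sigma_finite "\<lambda>_::'i. lborel :: real measure" by standard
 note [measurable] = insert.prems(1-3)
 have eq: "(\<integral>\<^sup>+x. k x \<partial>Pi\<^sub>M (insert i I) (\<lambda>_. lborel)) = (\<integral>\<^sup>+x. (\<integral>t. k (x(i := t))) \<partial>Pi\<^sub>M I (\<lambda>_. lborel))"
  if "k \<in> borel_measurable (Pi\<^sub>M (insert i I) (\<lambda>_. lborel))" for k :: "('i => real) => ennreal"
  by (rule product_nn_integral_insert[OF insert.hyps(1,2) that])
 have meas: "(\<lambda>x. \<integral>\<^sup>+t. k (x(i := t)) \<partial>lborel) \<in> borel_measurable (Pi\<^sub>M I (\<lambda>_. lborel))"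
  if [measurable]: "k \<in> borel_measurable (Pi\<^sub>M (insert i I) (\<lambda>_. lborel))" for k :: "('i => real) => ennreal"
  by measurable
 show ?case
  unfolding eq[OF insert.prems(1)] eq[OF insert.prems(2)] eq[OF insert.prems(3)]
 proof (rule insert.IH)
  fix x y :: "'i => real" assume xy: "x \<in> extensional I" "y \<in> extensional I"
  define z where "z = (\<lambda>i\<in>I. (x i + y i) / 2)"
  have z: "z \<in> space (Pi\<^sub>M I (\<lambda>_. lborel))" unfolding z_def by (auto simp: space_PiM)
  have xs: "x \<in> space (Pi\<^sub>M I (\<lambda>_. lborel))" "y \<in> space (Pi\<^sub>M I (\<lambda>_. lborel))"
   using xy by (auto simp: space_PiM PiE_def)
  have m1: "(\<lambda>t. k (x(i := t))) \<in> borel_measurable borel"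
   if [measurable]: "k \<in> borel_measurable (Pi\<^sub>M (insert i I) (\<lambda>_. lborel))" and x: "x \<in> space (Pi\<^sub>M I (\<lambda>_. lborel))"
   for k :: "('i => real) => ennreal" and x
  proof -
   have "(\<lambda>t. x(i := t)) \<in> measurable lborel (Pi\<^sub>M (insert i I) (\<lambda>_. lborel))"
    by (rule measurable_fun_upd[where J=I]) (use x in auto)
   from measurable_compose[OF this that(1)] show ?thesis by simp
  qed
  show "(\<integral>t. f (x(i := t))) * (\<integral>t. g (y(i := t))) \<le> (\<integral>t. h ((\<lambda>i\<in>I. (x i + y i) / 2)(i := t)))^2"
   unfolding z_def[symmetric]
  proof (rule Prekopa_Leindler_real)
   fix s t
   have "(\<lambda>j\<in>insert i I. ((x(i := s)) j + (y(i := t)) j) / 2) = z(i := (s + t) / 2)"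
    unfolding z_def using insert.hyps by (auto simp: fun_eq_iff)
   moreover have "x(i := s) \<in> extensional (insert i I)" "y(i := t) \<in> extensional (insert i I)"
    using xy by (auto simp: extensional_def)
   ultimately show "f (x(i := s)) * g (y(i := t)) \<le> (h (z(i := (s + t) / 2)))^2"
    using insert.prems(4)[of "x(i := s)" "y(i := t)"] by (simp only:)
  qed (use m1 xs z insert.prems in auto)
 qed (rule meas[OF insert.prems(1)], rule meas[OF insert.prems(2)], rule meas[OF insert.prems(3)])
qed

theorem Prekopa_Leindler:
 fixes f g h :: "'a::euclidean_space => ennreal"
 assumes [measurable]: "f \<in> borel_measurable borel" "g \<in> borel_measurable borel" "h \<in> borel_measurable borel"
  and mid: "\<And>x y. f x * g y \<le> (h ((1/2) *R (x + y)))^2"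
 shows "(\<integral>x. f x) * (\<integral>x. g x) \<le> (\<integral>x. h x)^2"
proof -
 define e :: "('a => real) => 'a" where "e x = (\<Sum>b\<in>Basis. x b *R b)" for x
 have [measurable]: "e \<in> measurable (Pi\<^sub>M Basis (\<lambda>_. lborel)) borel"
  unfolding e_def[abs_def] by measurable
 have eq: "(\<integral>x. k x) = (\<integral>\<^sup>+x. k (e x) \<partial>Pi\<^sub>M Basis (\<lambda>_. lborel))"
  if [measurable]: "k \<in> borel_measurable borel" for k :: "'a => ennreal"
  unfolding lborel_eq[where 'a='a] e_def[symmetric]
  by (subst nn_integral_distr) auto
 show ?thesis
  unfolding eq[OF assms(1)] eq[OF assms(2)] eq[OF assms(3)]
 proof (rule Prekopa_Leindler_PiM)
  fix x y :: "'a => real"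
  have "e (\<lambda>i\<in>Basis. (x i + y i) / 2) = (1/2) *R (e x + e y)"
   unfolding e_def by (simp add: sum.distrib[symmetric] scaleR_sum_right scaleR_add_left[symmetric] scaleR_add_right add_divide_distrib)
  thus "f (e x) * g (e y) \<le> (h (e (\<lambda>i\<in>Basis. (x i + y i) / 2)))^2"
   using mid[of "e x" "e y"] by simp
 qed auto
qed

section \<open>The Brascamp--Lieb inequality for odd functions\<close>

text \<open>The substitution rule invoked concerns absolutely integrable vector-valued functions:
  \<open>h\<close> embeds the reals into \<open>real^1\<close>, and finiteness of the integral
  provides absolute integrability. The image of \<open>g\<close> may miss a null set.\<close>

lemma nn_integral_change_of_variables:
 fixes g :: "real^'n::{finite,wellorder} => real^'n::_" and \<phi> :: "real^'n::_ => real"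
 assumes T: "T \<in> sets lebesgue"
  and der: "\<And>p. p \<in> T ==> (g has_derivative g' p) (at p within T)"
  and inj: "inj_on g T"
  and neg: "negligible (- (g ` T))"
  and [measurable]: "\<phi> \<in> borel_measurable borel" and pos: "\<And>y. 0 \<le> \<phi> y"
  and fin: "(\<integral>y. \<phi> y) < \<infinity>"
 shows "(\<integral>y. \<phi> y) = (\<integral>p. ennreal (\<bar>det (matrix (g' p))\<bar> * \<phi> (g p)) * indicator T p)"
proof -
 define h :: "real => real^1" where "h r = r *R axis 1 1" for r
 have blh: "bounded_linear h" unfolding h_def by (rule bounded_linear_scaleR_left)
 have blk: "bounded_linear (\<lambda>v::real^1. v $ 1)" by (rule bounded_linear_vec_nth)
 have hk [simp]: "h r $ 1 = r" for r by (simp add: h_def)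
 have kh: "h (v $ 1) = v" for v by (simp add: h_def vec_eq_iff forall_1)
 have "integrable lborel \<phi>" using fin pos by (intro integrableI_nonneg) auto
 hence "integrable lebesgue \<phi>" by (simp add: integrable_completion)
 hence aU: "\<phi> absolutely_integrable_on UNIV" by (simp add: set_integrable_def)
 have meas: "g ` T \<in> sets lebesgue"
  using neg by (metis Compl_in_sets_lebesgue negligible_imp_sets)
 have aT: "\<phi> absolutely_integrable_on (g ` T)"
  using set_integrable_subset[OF aU meas] by simp
 let ?G = "\<lambda>p. \<bar>det (matrix (g' p))\<bar> * \<phi> (g p)"
 have "(h \<circ> \<phi>) absolutely_integrable_on (g ` T)"
  by (rule absolutely_integrable_linear[OF aT blh])
 from has_absolute_integral_change_of_variables[OF T der inj, of "h \<circ> \<phi>" "integral (g ` T) (h \<circ> \<phi>)"] this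
 have 1: "(\<lambda>p. \<bar>det (matrix (g' p))\<bar> *R (h \<circ> \<phi>) (g p)) absolutely_integrable_on T"
  and 2: "integral T (\<lambda>p. \<bar>det (matrix (g' p))\<bar> *R (h \<circ> \<phi>) (g p)) = integral (g ` T) (h \<circ> \<phi>)"
  by auto
 have e: "(\<lambda>p. \<bar>det (matrix (g' p))\<bar> *R (h \<circ> \<phi>) (g p)) = h \<circ> ?G"
  by (auto simp: h_def fun_eq_iff)
 have "((\<lambda>v::real^1. v $ 1) \<circ> (h \<circ> ?G)) absolutely_integrable_on T"
  by (rule absolutely_integrable_linear[OF _ blk]) (use 1 in \<open>simp only: e\<close>)
 hence aG: "?G absolutely_integrable_on T" by (simp add: comp_def)
 have "h (integral T ?G) = h (integral (g ` T) \<phi>)"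
  using 2 unfolding e
  by (simp add: integral_linear[OF set_lebesgue_integral_eq_integral(1)[OF aG] blh]
    integral_linear[OF set_lebesgue_integral_eq_integral(1)[OF aT] blh])
 hence int: "integral T ?G = integral (g ` T) \<phi>" by (metis hk)
 have "(\<phi> has_integral integral UNIV \<phi>) UNIV"
  using aU set_lebesgue_integral_eq_integral(1) by blast
 hence "(\<integral>y. \<phi> y) = ennreal (integral UNIV \<phi>)"
  using nn_integral_has_integral_lebesgue'[of UNIV \<phi>] pos by auto
 also have "integral UNIV \<phi> = integral (g ` T) \<phi>"
  by (rule integral_spike_set) (use neg in \<open>auto elim: negligible_subset\<close>)
 also have "... = integral T ?G" using int by simp
 also have "ennreal ... = (\<integral>p. ennreal (?G p) * indicator T p)"
  using nn_integral_has_integral_lebesgue'[of T ?G "integral T ?G"] pos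
   set_lebesgue_integral_eq_integral(1)[OF aG] by (auto simp: has_integral_integral)
 finally show ?thesis .
qed

text \<open>Moments of the normal density with variance \<open>1 / (2 * c)\<close>.\<close>

lemma gaussian_integrals_real:
 assumes c: "c > 0"
 shows "(\<integral>y. ennreal (exp (- c * y^2))) = ennreal (sqrt pi / sqrt c)"
  and "(\<integral>y. ennreal (y^2 * exp (- c * y^2))) = ennreal (1 / (2 * c) * (sqrt pi / sqrt c))"
proof -
 define s where "s = 1 / sqrt (2 * c)"
 have s: "s > 0" "s^2 = 1 / (2 * c)" using c by (simp_all add: s_def power_divide)
 have e: "exp (- c * y^2) = sqrt pi / sqrt c * normal_density 0 s y" for y
  using c by (simp add: normal_density_def s(2) real_sqrt_divide)
 have i: "has_bochner_integral lborel (\<lambda>y. sqrt pi / sqrt c * (normal_density 0 s y * (y - 0) ^ (2 * k)))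
   (sqrt pi / sqrt c * (fact (2 * k) / ((2 / s^2) ^ k * fact k)))" for k
  by (intro has_bochner_integral_mult_right normal_moment_even[OF s(1)])
 have "(\<integral>y. ennreal (y ^ (2 * k) * exp (- c * y^2))) = ennreal (sqrt pi / sqrt c * (fact (2 * k) / ((4 * c) ^ k * fact k)))" for k
  using i[of k] c zero_le_even_power'[of _ k, where ?'a = real] unfolding e has_bochner_integral_iff s(2)
  by (subst nn_integral_eq_integral) (auto intro!: AE_I2 divide_nonneg_nonneg mult_nonneg_nonneg simp: mult_ac)
 from this[of 0] this[of 1] show "(\<integral>y. ennreal (exp (- c * y^2))) = ennreal (sqrt pi / sqrt c)"
  "(\<integral>y. ennreal (y^2 * exp (- c * y^2))) = ennreal (1 / (2 * c) * (sqrt pi / sqrt c))"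
  by (simp_all add: numeral_eq_Suc[of "Num.Bit0 num.One"] mult.commute)
qed

lemma nn_integral_exp_norm_square_finite:
 assumes "a > 0"
 shows "(\<integral>\<^sup>+x. ennreal (exp (- a * (norm x)^2)) \<partial>(lborel :: 'a::euclidean_space measure)) < \<infinity>"
proof -
 have "exp (- a * (norm x)^2) = (\<Prod>b\<in>Basis. exp (- a * (x \<bullet> b)^2))" for x :: 'a
  by (subst norm_eq_sqrt_inner, subst euclidean_inner)
   (simp add: exp_sum[symmetric] sum_distrib_left sum_nonneg power2_eq_square)
 hence "(\<integral>\<^sup>+x. ennreal (exp (- a * (norm x)^2)) \<partial>(lborel :: 'a measure)) =
   (\<integral>\<^sup>+x. (\<Prod>b\<in>Basis. ennreal (exp (- a * (x \<bullet> b)^2))) \<partial>(lborel :: 'a measure))"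
  by (simp add: prod_ennreal)
 also have "... = (\<Prod>b\<in>(Basis::'a set). (\<integral>x. ennreal (exp (- a * x^2))))"
  by (rule nn_integral_lborel_prod) auto
 also have "... < \<infinity>"
  unfolding gaussian_integrals_real(1)[OF assms] by (simp add: power_less_top_ennreal)
 finally show ?thesis .
qed


text \<open>An estimate on the gradient near \<open>p\<close> is integrated by applying the mean
  value theorem to the remainder along the segment from \<open>p\<close> to \<open>p + v\<close>; no
  second derivative of \<open>W\<close> away from \<open>p\<close> enters.\<close>

lemma Taylor_remainder_of_gradient:
 fixes W :: "'a::euclidean_space => real"
 assumes W: "\<And>p. (W has_derivative (\<lambda>v. g p \<bullet> v)) (at p)"
  and K: "linear k"
  and e: "\<And>v. norm v \<le> r ==> norm (g (p + v) - g p - k v) \<le> e * norm v" and v: "norm v \<le> r"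
 shows "\<bar>W (p + v) - W p - g p \<bullet> v - (k v \<bullet> v) / 2\<bar> \<le> e * (norm v)^2"
proof (cases "v = 0")
 case False
 have "0 \<le> norm (g (p + v) - g p - k v)" by simp
 hence "0 \<le> e * norm v" using e[OF v] by linarith
 hence e0: "e \<ge> 0" using False by (simp add: zero_le_mult_iff)
 define \<phi> where "\<phi> \<tau> = W (p + \<tau> *R v) - \<tau> * (g p \<bullet> v) - \<tau>\<^sup>2 / 2 * (k v \<bullet> v)" for \<tau>
 have der: "(\<phi> has_real_derivative (g (p + \<tau> *R v) \<bullet> v - g p \<bullet> v - \<tau> * (k v \<bullet> v))) (at \<tau>)" for \<tau>
 proof -
  have "((\<lambda>\<tau>. W (p + \<tau> *R v)) has_derivative (\<lambda>s. g (p + \<tau> *R v) \<bullet> (s *R v))) (at \<tau>)"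
   by (rule has_derivative_compose[OF _ W]) (auto intro!: derivative_eq_intros)
  hence "((\<lambda>\<tau>. W (p + \<tau> *R v)) has_real_derivative (g (p + \<tau> *R v) \<bullet> v)) (at \<tau>)"
   by (rule has_derivative_imp_has_field_derivative) simp
  thus ?thesis unfolding \<phi>_def by (auto intro!: derivative_eq_intros)
 qed
 obtain z where z: "0 < z" "z < 1" "\<phi> 1 - \<phi> 0 = (1 - 0) * (g (p + z *R v) \<bullet> v - g p \<bullet> v - z * (k v \<bullet> v))"
  using MVT2[of 0 1 \<phi>, OF _ der] by auto
 have nz: "norm (z *R v) \<le> r"
 proof -
  have "norm (z *R v) \<le> norm v" using z by (simp add: mult_left_le_one_le)
  thus ?thesis using v by simp
 qed
 have "\<phi> 1 - \<phi> 0 = (g (p + z *R v) - g p - k (z *R v)) \<bullet> v"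
  using z(3) linear_scale[OF K, of z v] by (simp add: inner_diff_left)
 hence "\<bar>\<phi> 1 - \<phi> 0\<bar> \<le> norm (g (p + z *R v) - g p - k (z *R v)) * norm v"
  by (simp add: Cauchy_Schwarz_ineq2)
 also have "... \<le> (e * norm (z *R v)) * norm v"
  by (intro mult_right_mono e nz) simp
 also have "... \<le> (e * norm v) * norm v"
  using z e0 by (intro mult_right_mono mult_left_mono) (auto simp: mult_left_le_one_le)
 finally show ?thesis by (simp add: \<phi>_def power2_eq_square mult.assoc)
qed simp

text \<open>The Brascamp--Lieb inequality for an even potential and an odd function, written in the
 variable \<open>p\<close> dual to the one in which the potential is \<open>W\<^sup>*\<close>: the exponent is
 \<open>- W\<^sup>* (g p)\<close>, where \<open>g\<close> is the gradient of \<open>W\<close>. It is the second-order part at \<open>t = 0\<close> of the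
 inequality that the Prekopa--Leindler theorem gives for the conjugates of \<open>W + t F\<close>, \<open>W - t F\<close>
 and \<open>W\<close>.\<close>

locale even_potential =
 fixes W F :: "real^'n::{finite,wellorder} => real" and g f q :: "real^'n::_ => real^'n::_"
  and K :: "real^'n::_ => real^'n::_ => real^'n::_" and S :: "(real^'n::_) set" and c C L M :: real
 assumes W: "\<And>p. (W has_derivative (\<lambda>v. g p \<bullet> v)) (at p)"
  and c: "c > 0" and strong: "\<And>p v. W p + g p \<bullet> v + c / 2 * (norm v)^2 \<le> W (p + v)"
  and C: "C > 0" and growth: "\<And>p. W p \<le> C * (norm p)^2"
  and even: "\<And>p. W (- p) = W p" and odd: "\<And>p. F (- p) = - F p"
  and lip: "\<And>p q. \<bar>F p - F q\<bar> \<le> L * norm (p - q)"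
  and lipg: "\<And>p q. norm (g p - g q) \<le> M * norm (p - q)"
  and negS: "negligible S" and closedS: "closed S"
  and K: "\<And>p. p \<notin> S ==> (g has_derivative K p) (at p)"
  and f: "\<And>p. p \<notin> S ==> (F has_derivative (\<lambda>v. f p \<bullet> v)) (at p)"
  and q: "\<And>p. p \<notin> S ==> K p (q p) = f p"
  and symK: "\<And>p v w. p \<notin> S ==> K p v \<bullet> w = v \<bullet> K p w"
  and psd: "\<And>p v. p \<notin> S ==> K p v \<bullet> v \<ge> 0"
  and contK: "\<And>v. continuous_on (- S) (\<lambda>p. K p v)"
begin

text \<open>The Legendre conjugate of \<open>W + t F\<close>. The supremum is finite because the
  strong convexity of \<open>W\<close> outweighs the Lipschitz perturbation
  \<open>t F\<close>.\<close>

definition V :: "real => (real, 'n) vec => real" where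
 "V t y = (SUP p. y \<bullet> p - W p - t * F p)"

lemma L_nonneg: "L \<ge> 0"
proof -
 have "0 \<le> \<bar>F (axis undefined 1) - F 0\<bar>" by simp
 also have "... \<le> L * norm (axis undefined (1::real) - 0 :: (real, 'n) vec)" by (rule lip)
 finally show ?thesis by (simp add: norm_axis_1)
qed

lemma bound_quadratic: "b * s - c / 2 * s^2 \<le> b^2 / (2 * c)" for b s :: real
proof -
 have "(b * s - c / 2 * s^2) * (2 * c) \<le> b^2"
  using zero_le_power2[of "c * s - b"] by (simp add: power2_eq_square algebra_simps)
 thus ?thesis using c by (simp add: pos_le_divide_eq)
qed

text \<open>At \<open>y = g p\<close> the point \<open>p\<close> attains the supremum in
  \<open>V 0 y\<close>; a step \<open>v\<close> loses at least \<open>c / 2 * (norm v)^2\<close> and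
  regains at most what the Lipschitz function \<open>t F\<close> offers. Both the finiteness of
  \<open>V\<close> and the localisation of near-maximisers rest on this.\<close>

lemma increment_bound:
 "(g p \<bullet> (p + v) - W (p + v) - t * F (p + v)) - (g p \<bullet> p - W p - t * F p) \<le> \<bar>t\<bar> * L * norm v - c / 2 * (norm v)^2"
proof -
 have "\<bar>t * (F (p + v) - F p)\<bar> \<le> \<bar>t\<bar> * (L * norm v)"
  unfolding abs_mult using lip[of "p + v" p] by (intro mult_left_mono) auto
 hence "- (t * (F (p + v) - F p)) \<le> \<bar>t\<bar> * L * norm v" by (simp add: abs_le_iff mult.assoc)
 thus ?thesis using strong[of p v] by (simp add: inner_add_right algebra_simps)
qed

lemma bdd_V: "bdd_above (range (\<lambda>p. y \<bullet> p - W p - t * F p))"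
proof (rule bdd_aboveI2)
 fix p :: "(real, 'n) vec"
 have "(y - g 0) \<bullet> p \<le> norm (y - g 0) * norm p" by (rule norm_cauchy_schwarz)
 hence "y \<bullet> p - W p - t * F p \<le> - W 0 - t * F 0 + ((norm (y - g 0) + \<bar>t\<bar> * L) * norm p - c / 2 * (norm p)^2)"
  using increment_bound[of 0 p t] by (simp add: inner_diff_left algebra_simps)
 also have "... \<le> - W 0 - t * F 0 + (norm (y - g 0) + \<bar>t\<bar> * L)^2 / (2 * c)"
  using bound_quadratic by simp
 finally show "y \<bullet> p - W p - t * F p \<le> - W 0 - t * F 0 + (norm (y - g 0) + \<bar>t\<bar> * L)^2 / (2 * c)" .
qed

lemma V_upper: "y \<bullet> p - W p - t * F p \<le> V t y"
 unfolding V_def by (rule cSUP_upper[OF _ bdd_V]) simp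

lemma V_least: "(\<And>p. y \<bullet> p - W p - t * F p \<le> b) ==> V t y \<le> b"
 unfolding V_def by (rule cSUP_least) auto

lemma V_borel [measurable]: "V t \<in> borel_measurable borel"
proof (rule borel_measurableI_greater)
 fix a
 have "{y \<in> space borel. a < V t y} = (\<Union>p. {y. a < y \<bullet> p - W p - t * F p})"
  unfolding V_def by (auto simp: less_cSUP_iff[OF _ bdd_V])
 moreover have "open (\<Union>p. {y. a < y \<bullet> p - W p - t * F p})"
  by (intro open_UN ballI open_Collect_less continuous_intros)
 ultimately show "{y \<in> space borel. a < V t y} \<in> sets borel" by simp
qed

lemma V_uminus: "V (- t) y = V t (- y)"
proof (rule antisym)
 show "V (- t) y \<le> V t (- y)"
  using V_upper[of "- y" "- p" t for p] by (intro V_least) (simp add: even odd)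
 show "V t (- y) \<le> V (- t) y"
  using V_upper[of y "- p" "- t" for p] by (intro V_least) (simp add: even odd)
qed

text \<open>At a common \<open>p\<close> the perturbations \<open>t * F p\<close> and
  \<open>- t * F p\<close> cancel.\<close>

lemma V_midpoint: "V 0 ((1/2) *R (x + y)) \<le> (V t x + V (- t) y) / 2"
proof (rule V_least)
 fix p
 show "((1/2) *R (x + y)) \<bullet> p - W p - 0 * F p \<le> (V t x + V (- t) y) / 2"
  using V_upper[of x p t] V_upper[of y p "- t"] by (simp add: inner_add_left field_simps)
qed

text \<open>Prekopa--Leindler for the pair \<open>t\<close>, \<open>- t\<close> bounds a product of
  two integrals by a square. The parity of \<open>W\<close> and \<open>F\<close>, through
  \<open>V_uminus\<close>, makes the two factors equal, so each of them is bounded.\<close>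

lemma nn_integral_V_le: "(\<integral>y. exp (- V t y)) \<le> (\<integral>y. exp (- V 0 y))"
proof -
 have sym: "(\<integral>y. exp (- V (- t) y)) = (\<integral>y. exp (- V t y))"
  using nn_integral_lborel_uminus[of "\<lambda>y. ennreal (exp (- V t y))"] by (simp add: V_uminus)
 have "(\<integral>y. exp (- V t y)) * (\<integral>y. exp (- V (- t) y)) \<le> (\<integral>y. exp (- V 0 y))^2"
 proof (rule Prekopa_Leindler)
  fix x y
  have "exp (- V t x) * exp (- V (- t) y) \<le> exp (- V 0 ((1/2) *R (x + y))) ^ 2"
   using V_midpoint[of x y t] by (simp add: exp_add[symmetric] exp_double[symmetric] mult.commute)
  thus "ennreal (exp (- V t x)) * ennreal (exp (- V (- t) y)) \<le> (ennreal (exp (- V 0 ((1/2) *R (x + y)))))^2"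
   by (simp add: ennreal_mult[symmetric] ennreal_power ennreal_leI)
 qed auto
 hence le: "(\<integral>y. exp (- V t y)) * (\<integral>y. exp (- V t y)) \<le> (\<integral>y. exp (- V 0 y)) * (\<integral>y. exp (- V 0 y))"
  unfolding sym power2_eq_square .
 show ?thesis
 proof (rule ccontr)
  assume "\<not> ?thesis"
  hence lt: "(\<integral>y. exp (- V 0 y)) < (\<integral>y. exp (- V t y))" by simp
  from ennreal_mult_strict_mono'[OF lt lt] le show False by simp
 qed
qed

text \<open>Testing the supremum at \<open>y / (2 C)\<close>, the maximiser of
  \<open>y \<bullet> p - C * (norm p)^2\<close>, bounds \<open>V 0\<close> below by a quadratic
  function, which gives a Gaussian majorant at \<open>t = 0\<close>.\<close>

lemma nn_integral_V_finite: "(\<integral>y. exp (- V t y)) < \<infinity>"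
proof -
 have "(\<integral>y. exp (- V 0 y)) \<le> (\<integral>\<^sup>+y. exp (- (1 / (4 * C)) * (norm y)^2) \<partial>(lborel :: (real, 'n) vec measure))"
 proof (intro nn_integral_mono ennreal_leI)
  fix y :: "(real, 'n) vec"
  have "y \<bullet> ((1 / (2 * C)) *R y) - C * (norm ((1 / (2 * C)) *R y))^2 = 1 / (4 * C) * (norm y)^2"
   using C by (simp add: power2_eq_square dot_square_norm field_simps)
  hence "1 / (4 * C) * (norm y)^2 \<le> V 0 y"
   using V_upper[of y "(1 / (2 * C)) *R y" 0] growth[of "(1 / (2 * C)) *R y"] by simp
  thus "exp (- V 0 y) \<le> exp (- (1 / (4 * C)) * (norm y)^2)" by simp
 qed
 also have "... < \<infinity>" using nn_integral_exp_norm_square_finite[of "1 / (4 * C)"] C by simp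
 finally show ?thesis using nn_integral_V_le[of t] by (rule le_less_trans[rotated])
qed

text \<open>Injectivity is strong convexity used at both points. For surjectivity,
  \<open>W p - y \<bullet> p\<close> attains its minimum, and the critical point equation reads
  \<open>g p = y\<close>.\<close>

lemma gradient_bij: "bij g"
proof (rule bijI)
 show "inj g"
 proof (rule injI)
  fix p p' assume eq: "g p = g p'"
  have "c / 2 * (norm (p' - p))^2 + c / 2 * (norm (p - p'))^2 \<le> 0"
   using strong[of p "p' - p"] strong[of p' "p - p'"] eq by (simp add: inner_diff_right)
  moreover have "norm (p - p') = norm (p' - p)" by (rule norm_minus_commute)
  ultimately have "c * (norm (p' - p))^2 \<le> 0" by (simp add: field_simps)
  thus "p = p'" using c by (simp add: mult_le_0_iff)
 qed
 show "surj g"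
 proof -
  have "\<exists>p. g p = y" for y
  proof -
   have contW: "continuous_on UNIV W"
    using W by (meson continuous_at_imp_continuous_on has_derivative_continuous)
   \<comment> \<open>Beyond this radius the quadratic term of \<open>strong\<close> at 0 exceeds the
     linear term \<open>(y - g 0) \<bullet> p\<close>, so the function stays above its value at
     0.\<close>
   define r where "r = 2 * norm (y - g 0) / c + 1"
   have "r > 0" using c by (simp add: r_def add_nonneg_pos)
   have "continuous_on (cball 0 r) (\<lambda>p. W p - y \<bullet> p)"
    by (intro continuous_intros continuous_on_subset[OF contW]) auto
   then obtain p where p: "p \<in> cball 0 r" "\<And>p'. p' \<in> cball 0 r ==> W p - y \<bullet> p \<le> W p' - y \<bullet> p'"
    using continuous_attains_inf[of "cball 0 r" "\<lambda>p. W p - y \<bullet> p"] \<open>r > 0\<close> by auto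
   have glob: "W p - y \<bullet> p \<le> W p' - y \<bullet> p'" for p'
   proof (cases "p' \<in> cball 0 r")
    case False
    hence n: "norm p' \<ge> r" by simp
    have "(y - g 0) \<bullet> p' \<le> norm (y - g 0) * norm p'" by (rule norm_cauchy_schwarz)
    moreover have "norm (y - g 0) * norm p' \<le> c / 2 * (norm p')^2"
    proof -
     have "2 * norm (y - g 0) / c \<le> norm p'" using n by (simp add: r_def)
     hence "norm (y - g 0) \<le> c / 2 * norm p'" using c by (simp add: field_simps)
     from mult_right_mono[OF this, of "norm p'"] show ?thesis by (simp add: power2_eq_square)
    qed
    ultimately have "W 0 \<le> W p' - y \<bullet> p'"
     using strong[of 0 p'] by (simp add: inner_diff_left)
    moreover have "W p - y \<bullet> p \<le> W 0" using p(2)[of 0] \<open>r > 0\<close> by simp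
    ultimately show ?thesis by simp
   qed (use p in auto)
   have "((\<lambda>p. W p - y \<bullet> p) has_derivative (\<lambda>v. g p \<bullet> v - y \<bullet> v)) (at p)"
    by (intro derivative_intros W)
   hence "(\<lambda>v. g p \<bullet> v - y \<bullet> v) = (\<lambda>v. 0)"
    using differential_zero_maxmin[of p UNIV "\<lambda>p. W p - y \<bullet> p"] glob by auto
   hence "(g p - y) \<bullet> (g p - y) = 0" by (metis inner_diff_left)
   thus ?thesis by auto
  qed
  thus ?thesis by (metis surjI)
 qed
qed

lemma continuous_g: "continuous_on UNIV g"
proof (rule continuous_at_imp_continuous_on, rule ballI)
 fix p :: "(real, 'n) vec"
 have "((\<lambda>x. M * norm (x - p)) \<longlongrightarrow> M * norm (p - p)) (at p)"
  by (intro tendsto_intros)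
 hence lim: "((\<lambda>x. M * norm (x - p)) \<longlongrightarrow> 0) (at p)" by simp
 have "((\<lambda>x. g x - g p) \<longlongrightarrow> 0) (at p)"
  by (rule Lim_null_comparison[OF _ lim]) (use lipg in auto)
 thus "isCont g p" unfolding isCont_def by (simp add: LIM_zero_iff)
qed

lemma F_borel [measurable]: "F \<in> borel_measurable borel"
proof -
 have "continuous_on UNIV F"
 proof (rule continuous_at_imp_continuous_on, rule ballI)
  fix p :: "(real, 'n) vec"
  have "((\<lambda>x. L * norm (x - p)) \<longlongrightarrow> L * norm (p - p)) (at p)"
   by (intro tendsto_intros)
  hence lim: "((\<lambda>x. L * norm (x - p)) \<longlongrightarrow> 0) (at p)" by simp
  have "((\<lambda>x. F x - F p) \<longlongrightarrow> 0) (at p)"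
   by (rule Lim_null_comparison[OF _ lim]) (use lip in auto)
  thus "isCont F p" unfolding isCont_def by (simp add: LIM_zero_iff)
 qed
 thus ?thesis by (rule borel_measurable_continuous_onI)
qed

lemma g_borel [measurable]: "g \<in> borel_measurable borel"
 using continuous_g by (rule borel_measurable_continuous_onI)

lemma W_borel [measurable]: "W \<in> borel_measurable borel"
 using W by (intro borel_measurable_continuous_onI) (meson continuous_at_imp_continuous_on has_derivative_continuous)

text \<open>The density of \<open>exp (- V 0 y)\<close> in the variable \<open>p\<close> with
  \<open>y = g p\<close>, where the conjugate takes the value \<open>g p \<bullet> p - W p\<close>.
  It is set to 0 on \<open>S\<close>, where \<open>K\<close> need not be a derivative.\<close>

definition E :: "(real, 'n) vec => real" where
 "E p = indicator (- S) p * (\<bar>det (matrix (K p))\<bar> * exp (W p - g p \<bullet> p))"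

lemma E_nonneg: "E p \<ge> 0" unfolding E_def by simp

lemma E_borel [measurable]: "E \<in> borel_measurable borel"
proof -
 have "continuous_on (- S) (\<lambda>p. det (matrix (K p)))"
  unfolding det_def matrix_def
  by (intro continuous_intros) (auto intro!: continuous_on_component contK)
 hence "continuous_on (- S) (\<lambda>p. \<bar>det (matrix (K p))\<bar>)" by (intro continuous_intros)
 hence "(\<lambda>p. indicator (- S) p *R \<bar>det (matrix (K p))\<bar>) \<in> borel_measurable borel"
  using closedS by (intro borel_measurable_continuous_on_indicator) auto
 hence [measurable]: "(\<lambda>p. indicator (- S) p * \<bar>det (matrix (K p))\<bar>) \<in> borel_measurable borel"
  by simp
 have "E = (\<lambda>p. (indicator (- S) p * \<bar>det (matrix (K p))\<bar>) * exp (W p - g p \<bullet> p))"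
  by (auto simp: E_def fun_eq_iff)
 thus ?thesis by simp
qed

text \<open>The excess of the conjugate at \<open>g p\<close> over its test value at
  \<open>p\<close>. It vanishes at \<open>t = 0\<close> and is of second order in \<open>t\<close>;
  its coefficient carries the right side of the Brascamp--Lieb inequality.\<close>

definition \<rho> :: "real => (real, 'n) vec => real" where
 "\<rho> t p = V t (g p) - (g p \<bullet> p - W p - t * F p)"

lemma \<rho>_nonneg: "\<rho> t p \<ge> 0"
 unfolding \<rho>_def using V_upper[of "g p" p t] by simp

lemma \<rho>_le: "\<rho> t p \<le> t^2 * L^2 / (2 * c)"
proof -
 have "V t (g p) \<le> (g p \<bullet> p - W p - t * F p) + t^2 * L^2 / (2 * c)"
 proof (rule V_least)
  fix p'
  show "g p \<bullet> p' - W p' - t * F p' \<le> g p \<bullet> p - W p - t * F p + t^2 * L^2 / (2 * c)"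
   using increment_bound[of p "p' - p" t] bound_quadratic[of "\<bar>t\<bar> * L" "norm (p' - p)"]
   by (simp add: power_mult_distrib)
 qed
 thus ?thesis unfolding \<rho>_def by simp
qed

lemma \<rho>_zero: "\<rho> 0 p = 0"
 using \<rho>_le[of 0 p] \<rho>_nonneg[of 0 p] by simp

lemma \<rho>_borel [measurable]: "\<rho> t \<in> borel_measurable borel"
 unfolding \<rho>_def by measurable

text \<open>Substitution \<open>y = g p\<close>. Being Lipschitz, the bijection \<open>g\<close>
  sends the null set \<open>S\<close> to a null set, so nothing is lost off the image of the
  complement.\<close>

lemma nn_integral_V_eq: "(\<integral>y. exp (- V t y)) = (\<integral>p. E p * exp (t * F p - \<rho> t p))"
proof -
 have "(\<integral>y. exp (- V t y)) = (\<integral>p. ennreal (\<bar>det (matrix (K p))\<bar> * exp (- V t (g p))) * indicator (- S) p)"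
 proof (rule nn_integral_change_of_variables)
  show "- S \<in> sets lebesgue" using closedS by (simp add: lebesgue_openin borel_closed)
  show "(g has_derivative K p) (at p within - S)" if "p \<in> - S" for p
   using K that by (auto intro: has_derivative_at_withinI)
  show "inj_on g (- S)" using gradient_bij by (auto simp: bij_def intro: inj_on_subset)
  have "negligible (g ` S)"
  proof (rule negligible_locally_Lipschitz_image[OF _ negS])
   fix p assume "p \<in> S"
   show "\<exists>T B. open T \<and> p \<in> T \<and> (\<forall>y\<in>S \<inter> T. norm (g y - g p) \<le> B * norm (y - p))"
    using lipg by (intro exI[of _ UNIV] exI[of _ M]) auto
  qed simp
  moreover have "- (g ` (- S)) = g ` S"
   using gradient_bij by (simp add: bij_image_Compl_eq)
  ultimately show "negligible (- (g ` (- S)))" by simp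
  show "(\<integral>y. exp (- V t y)) < \<infinity>" by (rule nn_integral_V_finite)
 qed auto
 also have "... = (\<integral>p. E p * exp (t * F p - \<rho> t p))"
 proof (rule nn_integral_cong)
  fix p
  have "exp (- V t (g p)) = exp (W p - g p \<bullet> p) * exp (t * F p - \<rho> t p)"
   unfolding \<rho>_def by (simp add: exp_add[symmetric])
  thus "ennreal (\<bar>det (matrix (K p))\<bar> * exp (- V t (g p))) * indicator (- S) p = ennreal (E p * exp (t * F p - \<rho> t p))"
   unfolding E_def by (simp add: indicator_def mult.assoc)
 qed
 finally show ?thesis .
qed

end

section \<open>Expansion to second order in the parameter\<close>

lemma ennreal_le_ennreal_add: "a \<le> b + c ==> 0 \<le> b ==> 0 \<le> c ==> ennreal a \<le> ennreal b + ennreal c"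
 using ennreal_leI[of a "b + c"] ennreal_plus[of b c] by simp

context even_potential
begin

text \<open>The maximiser of the perturbed function lies within distance of order \<open>t\<close>
  from \<open>p\<close>, where \<open>W\<close> and \<open>F\<close> may be replaced by their Taylor
  polynomials; maximising the resulting quadratic polynomial gives the coefficient
  \<open>(f p \<bullet> q p) / 2\<close>, where \<open>q p\<close> solves
  \<open>K p (q p) = f p\<close>.\<close>

lemma \<rho>_asymp:
 assumes p: "p \<notin> S" and e: "e > 0"
 shows "\<exists>d>0. \<forall>t. \<bar>t\<bar> < d \<longrightarrow> \<rho> t p \<le> t^2 * ((f p \<bullet> q p) / 2 + e)"
proof -
 \<comment> \<open>Steps longer than \<open>\<bar>t\<bar> * m\<close> cannot raise the value, by
   \<open>increment_bound\<close>.\<close>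
 define m where "m = 2 * L / c"
 have m: "m \<ge> 0" using L_nonneg c by (simp add: m_def)
 \<comment> \<open>On steps of length at most \<open>\<bar>t\<bar> * m\<close> the Taylor errors of
   \<open>W\<close> and \<open>t F\<close> add up to \<open>e' * (m^2 + m) * t^2\<close>, hence to
   at most \<open>e * t^2\<close>.\<close>
 define e' where "e' = e / (m^2 + m + 1)"
 have den: "m^2 + m + 1 > 0" using m by (simp add: add_nonneg_pos)
 have e': "e' > 0" "e' * (m^2 + m) \<le> e"
  using e den m by (auto simp: e'_def field_simps)
 obtain d1 where d1: "d1 > 0" "\<And>v. norm v < d1 ==> norm (g (p + v) - g p - K p v) \<le> e' * norm v"
 proof -
  obtain d where "d > 0" "\<And>y. norm (y - p) < d ==> norm (g y - g p - K p (y - p)) \<le> e' * norm (y - p)"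
   using K[OF p] e' unfolding has_derivative_at_alt by blast
  thus ?thesis by (intro that[of d]) (auto, metis add_diff_cancel_left')
 qed
 obtain d2 where d2: "d2 > 0" "\<And>v. norm v < d2 ==> \<bar>F (p + v) - F p - f p \<bullet> v\<bar> \<le> e' * norm v"
 proof -
  obtain d where "d > 0" "\<And>y. norm (y - p) < d ==> norm (F y - F p - f p \<bullet> (y - p)) \<le> e' * norm (y - p)"
   using f[OF p] e' unfolding has_derivative_at_alt by blast
  thus ?thesis by (intro that[of d]) (auto, metis add_diff_cancel_left')
 qed
 define d where "d = min d1 d2 / (2 * (m + 1))"
 have d: "d > 0" using d1 d2 m by (simp add: d_def)
 have \<theta>: "f p \<bullet> q p \<ge> 0" using psd[OF p, of "q p"] q[OF p] by simp
 have linK: "linear (K p)" using K[OF p] has_derivative_linear by blast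
 have main: "\<rho> t p \<le> t^2 * ((f p \<bullet> q p) / 2 + e)" if t: "\<bar>t\<bar> < d" for t
 proof -
  have "V t (g p) \<le> (g p \<bullet> p - W p - t * F p) + t^2 * ((f p \<bullet> q p) / 2 + e)"
  proof (rule V_least)
   fix p'
   define v where "v = p' - p"
   have p': "p' = p + v" by (simp add: v_def)
   have "(g p \<bullet> (p + v) - W (p + v) - t * F (p + v)) - (g p \<bullet> p - W p - t * F p) \<le> t^2 * ((f p \<bullet> q p) / 2 + e)"
   proof (cases "norm v \<le> \<bar>t\<bar> * m")
    case True
    have small: "\<bar>t\<bar> * m < min d1 d2"
    proof -
     have a: "\<bar>t\<bar> * m \<le> d * m" using t m by (intro mult_right_mono) auto
     have "m < 2 * (m + 1)" using m by simp
     from mult_strict_left_mono[OF this d] have b: "d * m < d * (2 * (m + 1))" .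
     have nz: "2 * (m + 1) \<noteq> 0" using m by simp
     have "d * (2 * (m + 1)) = min d1 d2"
      unfolding d_def by (rule nonzero_eq_divide_eq[OF nz, THEN iffD1]) (rule refl)
     with a b show ?thesis by linarith
    qed
    have v1: "norm v < d1" "norm v < d2" using True small by auto
    have "\<bar>W (p + v) - W p - g p \<bullet> v - (K p v \<bullet> v) / 2\<bar> \<le> e' * (norm v)^2"
     by (rule Taylor_remainder_of_gradient[OF W linK, of "norm v"]) (use d1(2) v1 in auto)
    hence T1: "- (W (p + v) - W p - g p \<bullet> v) \<le> - (K p v \<bullet> v) / 2 + e' * (norm v)^2" by (simp add: abs_le_iff)
    have "\<bar>t * (F (p + v) - F p - f p \<bullet> v)\<bar> \<le> \<bar>t\<bar> * (e' * norm v)"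
     unfolding abs_mult using d2(2)[OF v1(2)] by (intro mult_left_mono) auto
    hence T2: "- t * (F (p + v) - F p) \<le> - t * (f p \<bullet> v) + \<bar>t\<bar> * (e' * norm v)"
     by (simp add: abs_le_iff algebra_simps)
    \<comment> \<open>Completing the square: positivity of \<open>K p\<close> at
      \<open>v + t *R q p\<close> bounds the quadratic expression in \<open>v\<close> by its value
      at the critical point \<open>- t *R q p\<close>.\<close>
    have "0 \<le> K p (v + t *R q p) \<bullet> (v + t *R q p)" by (rule psd[OF p])
    also have "... = K p v \<bullet> v + 2 * t * (f p \<bullet> v) + t^2 * (f p \<bullet> q p)"
    proof -
     have "K p v \<bullet> q p = f p \<bullet> v"
      unfolding inner_commute[of "f p" v] using symK[OF p, of v "q p"] unfolding q[OF p] .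
     thus ?thesis
      by (simp add: linear_add[OF linK] linear_scale[OF linK] inner_add_left inner_add_right power2_eq_square q[OF p] algebra_simps)
    qed
    finally have sq: "- (K p v \<bullet> v) / 2 - t * (f p \<bullet> v) \<le> t^2 * (f p \<bullet> q p) / 2" by simp
    have "e' * (norm v)^2 + \<bar>t\<bar> * (e' * norm v) \<le> e' * (\<bar>t\<bar> * m)^2 + \<bar>t\<bar> * (e' * (\<bar>t\<bar> * m))"
     using True e' by (intro add_mono mult_left_mono power_mono) auto
    also have "... = t^2 * (e' * (m^2 + m))" by (simp add: power2_eq_square algebra_simps)
    also have "... \<le> t^2 * e" using e' by (intro mult_left_mono) auto
    finally have err: "e' * (norm v)^2 + \<bar>t\<bar> * (e' * norm v) \<le> t^2 * e" .
    have "(g p \<bullet> (p + v) - W (p + v) - t * F (p + v)) - (g p \<bullet> p - W p - t * F p)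
     = - (W (p + v) - W p - g p \<bullet> v) + (- t * (F (p + v) - F p))"
     by (simp add: inner_add_right algebra_simps)
    also have "... \<le> t^2 * (f p \<bullet> q p) / 2 + t^2 * e" using T1 T2 sq err by linarith
    finally show ?thesis by (simp add: algebra_simps)
   next
    case False
    hence n: "norm v > \<bar>t\<bar> * m" by simp
    have "c / 2 * (norm v)^2 \<ge> c / 2 * ((\<bar>t\<bar> * m) * norm v)"
     using n c unfolding power2_eq_square by (intro mult_left_mono mult_right_mono) auto
    also have "c / 2 * ((\<bar>t\<bar> * m) * norm v) = \<bar>t\<bar> * L * norm v" using c by (simp add: m_def)
    finally have "\<bar>t\<bar> * L * norm v - c / 2 * (norm v)^2 \<le> 0" by simp
    also have "0 \<le> t^2 * ((f p \<bullet> q p) / 2 + e)" using \<theta> e by simp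
    finally show ?thesis using increment_bound[of p v t] by linarith
   qed
   thus "g p \<bullet> p' - W p' - t * F p' \<le> g p \<bullet> p - W p - t * F p + t^2 * (f p \<bullet> q p / 2 + e)"
    unfolding p' by simp
  qed
  thus ?thesis unfolding \<rho>_def by simp
 qed
 thus ?thesis using d by blast
qed

text \<open>Third-order Taylor polynomials bound the exponential from below, the fourth-order
  remainder being nonnegative; the odd terms of \<open>exp x\<close> and \<open>exp (- x)\<close>
  cancel.\<close>

lemma exp_sum_ge: "exp (- r) * (2 + x^2) \<le> exp (x - a) + exp (- x - b)"
 if "a \<le> r" "b \<le> r" for a b r x :: real
proof -
 have "(exp x + exp (- x)) \<ge> 2 + x^2"
 proof -
  have "1 + y + y^2 / 2 + y ^ 3 / 6 \<le> exp y" for y :: real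
  proof -
   obtain s where "exp y = (\<Sum>m<4. y ^ m / fact m) + exp s / fact 4 * y ^ 4"
    using Maclaurin_exp_le[of y 4] by blast
   moreover have "(\<Sum>m<4. y ^ m / fact m) = 1 + y + y^2 / 2 + y ^ 3 / 6"
    by (simp add: numeral_eq_Suc)
   moreover have "exp s / fact 4 * y ^ 4 \<ge> 0" by simp
   ultimately show ?thesis by linarith
  qed
  from this[of x] this[of "- x"] show ?thesis by simp
 qed
 hence "exp (- r) * (2 + x^2) \<le> exp (- r) * (exp x + exp (- x))" by (intro mult_left_mono) auto
 also have "... = exp (x - r) + exp (- x - r)" by (simp add: distrib_left exp_add[symmetric])
 also have "... \<le> exp (x - a) + exp (- x - b)" using that by (intro add_mono) auto
 finally show ?thesis .
qed

text \<open>A bound common to both signs of \<open>t\<close> lets a single factor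
  \<open>exp (- \<sigma> t p)\<close> be pulled out when the inequalities for \<open>t\<close> and
  \<open>- t\<close> are added.\<close>

definition \<sigma> :: "real => (real, 'n) vec => real" where
 "\<sigma> t p = max (\<rho> t p) (\<rho> (- t) p)"

lemma \<sigma>_borel [measurable]: "\<sigma> t \<in> borel_measurable borel"
 unfolding \<sigma>_def[abs_def] by measurable

lemma \<sigma>_nonneg: "\<sigma> t p \<ge> 0" unfolding \<sigma>_def using \<rho>_nonneg[of t p] by simp

lemma \<sigma>_le: "\<sigma> t p \<le> t^2 * (L^2 / (2 * c))"
 unfolding \<sigma>_def using \<rho>_le[of t p] \<rho>_le[of "- t" p] by simp

lemma E_finite: "(\<integral>p. E p) < \<infinity>"
 using nn_integral_V_eq[of 0] nn_integral_V_finite[of 0] by (simp add: \<rho>_zero)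

text \<open>Adding the inequalities for \<open>t\<close> and \<open>- t\<close> cancels the linear
  terms and leaves \<open>(t * F p)^2\<close>. The zeroth-order part \<open>A\<close> is finite and
  can be cancelled; \<open>1 \<le> exp (- \<sigma>) + \<sigma>\<close> makes it appear on the right
  side too.\<close>

lemma second_order_inequality:
 assumes t: "t > 0"
 shows "(\<integral>p. E p * (exp (- \<sigma> t p) * (F p)^2)) \<le> (\<integral>p. E p * (2 * \<sigma> t p / t^2))"
proof -
 have le: "(\<integral>p. E p * exp (s * F p - \<rho> s p)) \<le> (\<integral>p. E p)" for s
  using nn_integral_V_le[of s] nn_integral_V_eq[of s] nn_integral_V_eq[of 0] by (simp add: \<rho>_zero)
 define A where "A = (\<integral>p. 2 * (E p * exp (- \<sigma> t p)))"
 have "A + (\<integral>p. E p * (exp (- \<sigma> t p) * (t * F p)^2)) = (\<integral>p. E p * (exp (- \<sigma> t p) * (2 + (t * F p)^2)))"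
  unfolding A_def
  by (subst nn_integral_add[symmetric])
   (auto intro!: nn_integral_cong simp: ennreal_plus[symmetric] E_nonneg algebra_simps simp del: ennreal_plus)
 also have "... \<le> (\<integral>p. ennreal (E p * exp (t * F p - \<rho> t p)) + ennreal (E p * exp ((- t) * F p - \<rho> (- t) p)))"
 proof (intro nn_integral_mono)
  fix p
  have "E p * (exp (- \<sigma> t p) * (2 + (t * F p)^2)) \<le> E p * (exp (t * F p - \<rho> t p) + exp (- (t * F p) - \<rho> (- t) p))"
   by (intro mult_left_mono exp_sum_ge E_nonneg) (auto simp: \<sigma>_def)
  thus "ennreal (E p * (exp (- \<sigma> t p) * (2 + (t * F p)^2))) \<le> ennreal (E p * exp (t * F p - \<rho> t p)) + ennreal (E p * exp ((- t) * F p - \<rho> (- t) p))"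
   unfolding distrib_left[of "E p" "exp (t * F p - \<rho> t p)"]
   using E_nonneg by (auto intro!: ennreal_le_ennreal_add)
 qed
 also have "... = (\<integral>p. E p * exp (t * F p - \<rho> t p)) + (\<integral>p. E p * exp ((- t) * F p - \<rho> (- t) p))"
  by (rule nn_integral_add) measurable
 also have "... \<le> (\<integral>p. E p) + (\<integral>p. E p)" by (intro add_mono le)
 also have "... = (\<integral>p. 2 * E p)"
  by (subst nn_integral_add[symmetric]) (auto intro!: nn_integral_cong simp: ennreal_plus[symmetric] E_nonneg simp del: ennreal_plus)
 also have "... \<le> (\<integral>p. ennreal (2 * (E p * exp (- \<sigma> t p))) + ennreal (E p * (2 * \<sigma> t p)))"
 proof (intro nn_integral_mono)
  fix p
  have "1 \<le> exp (- \<sigma> t p) + \<sigma> t p" using exp_ge_add_one_self[of "- \<sigma> t p"] by simp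
  hence "2 * E p * 1 \<le> 2 * E p * (exp (- \<sigma> t p) + \<sigma> t p)" by (intro mult_left_mono) (auto simp: E_nonneg)
  hence "2 * E p \<le> 2 * (E p * exp (- \<sigma> t p)) + E p * (2 * \<sigma> t p)" by (simp add: algebra_simps)
  thus "ennreal (2 * E p) \<le> ennreal (2 * (E p * exp (- \<sigma> t p))) + ennreal (E p * (2 * \<sigma> t p))"
   by (rule ennreal_le_ennreal_add) (auto simp: E_nonneg \<sigma>_nonneg)
 qed
 also have "... = A + (\<integral>p. E p * (2 * \<sigma> t p))"
  unfolding A_def by (rule nn_integral_add) measurable
 finally have sum: "A + (\<integral>p. E p * (exp (- \<sigma> t p) * (t * F p)^2)) \<le> A + (\<integral>p. E p * (2 * \<sigma> t p))" .
 have "A \<le> (\<integral>p. 2 * E p)"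
  unfolding A_def
  by (intro nn_integral_mono ennreal_leI mult_left_mono mult_left_le) (auto simp: E_nonneg \<sigma>_nonneg)
 also have "... = 2 * (\<integral>p. E p)"
  by (subst nn_integral_cmult[symmetric]) (auto simp: ennreal_mult E_nonneg)
 also have "... < \<infinity>" using E_finite by (simp add: ennreal_mult_less_top)
 finally have "A \<noteq> top" by simp
 with sum have "(\<integral>p. E p * (exp (- \<sigma> t p) * (t * F p)^2)) \<le> (\<integral>p. E p * (2 * \<sigma> t p))"
  by (simp add: ennreal_add_left_cancel_le)
 hence "ennreal (1 / t^2) * (\<integral>p. E p * (exp (- \<sigma> t p) * (t * F p)^2)) \<le> ennreal (1 / t^2) * (\<integral>p. E p * (2 * \<sigma> t p))"
  by (rule mult_left_mono) simp
 also have "ennreal (1 / t^2) * (\<integral>p. E p * (exp (- \<sigma> t p) * (t * F p)^2)) = (\<integral>p. E p * (exp (- \<sigma> t p) * (F p)^2))"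
  using t by (subst nn_integral_cmult[symmetric])
   (auto intro!: nn_integral_cong simp: ennreal_mult[symmetric] E_nonneg power_mult_distrib field_simps)
 also have "ennreal (1 / t^2) * (\<integral>p. E p * (2 * \<sigma> t p)) = (\<integral>p. E p * (2 * \<sigma> t p / t^2))"
  using t by (subst nn_integral_cmult[symmetric])
   (auto intro!: nn_integral_cong simp: ennreal_mult[symmetric] E_nonneg \<sigma>_nonneg field_simps)
 finally show ?thesis .
qed

text \<open>Along a sequence of \<open>t\<close> tending to 0, Fatou's lemma treats the left side
  and its reverse the right side, where \<open>\<sigma> \<le> t^2 * B\<close> yields an integrable
  majorant; \<open>\<rho>_asymp\<close> evaluates the limit superior.\<close>

theorem Brascamp_Lieb_odd:
 "(\<integral>p. E p * (F p)^2) \<le> (\<integral>p. E p * (f p \<bullet> q p))"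
proof -
 define t where "t n = inverse (real (Suc n))" for n
 have t: "t n > 0" for n by (simp add: t_def)
 have t0: "t \<longlonglongrightarrow> 0" unfolding t_def by (rule LIMSEQ_inverse_real_of_nat)
 define B where "B = L^2 / (2 * c)"
 have B: "B \<ge> 0" using c by (simp add: B_def)
 have \<sigma>0: "(\<lambda>n. \<sigma> (t n) p) \<longlonglongrightarrow> 0" for p
 proof (rule tendsto_sandwich)
  show "\<forall>\<^sub>F n in sequentially. 0 \<le> \<sigma> (t n) p" by (simp add: \<sigma>_nonneg)
  show "\<forall>\<^sub>F n in sequentially. \<sigma> (t n) p \<le> (t n)^2 * B" unfolding B_def by (intro always_eventually allI \<sigma>_le)
  show "(\<lambda>n. (t n)\<^sup>2 * B) \<longlonglongrightarrow> 0" using tendsto_mult_right[OF tendsto_power[OF t0, of 2], of B] by simp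
 qed simp
 have "(\<integral>p. E p * (F p)^2) = (\<integral>p. liminf (\<lambda>n. ennreal (E p * (exp (- \<sigma> (t n) p) * (F p)^2))))"
 proof (rule nn_integral_cong)
  fix p
  have "(\<lambda>n. E p * (exp (- \<sigma> (t n) p) * (F p)^2)) \<longlonglongrightarrow> E p * (exp (- 0) * (F p)^2)"
   by (intro tendsto_intros \<sigma>0)
  hence "(\<lambda>n. ennreal (E p * (exp (- \<sigma> (t n) p) * (F p)^2))) \<longlonglongrightarrow> ennreal (E p * (F p)^2)"
   by (intro tendsto_ennrealI) simp
  thus "ennreal (E p * (F p)^2) = liminf (\<lambda>n. ennreal (E p * (exp (- \<sigma> (t n) p) * (F p)^2)))"
   by (simp add: lim_imp_Liminf)
 qed
 also have "... \<le> liminf (\<lambda>n. \<integral>\<^sup>+p. E p * (exp (- \<sigma> (t n) p) * (F p)^2) \<partial>lborel)"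
  by (rule nn_integral_liminf) measurable
 also have "... \<le> liminf (\<lambda>n. \<integral>\<^sup>+p. E p * (2 * \<sigma> (t n) p / (t n)^2) \<partial>lborel)"
  by (intro Liminf_mono always_eventually allI second_order_inequality t)
 also have "... \<le> limsup (\<lambda>n. \<integral>\<^sup>+p. E p * (2 * \<sigma> (t n) p / (t n)^2) \<partial>lborel)"
  by (rule Liminf_le_Limsup) simp
 also have "... \<le> (\<integral>p. limsup (\<lambda>n. ennreal (E p * (2 * \<sigma> (t n) p / (t n)^2))))"
 proof (rule nn_integral_limsup[where w="\<lambda>p. ennreal (2 * B) * ennreal (E p)"])
  have "(\<integral>p. ennreal (2 * B) * ennreal (E p)) = ennreal (2 * B) * (\<integral>p. E p)"
   by (rule nn_integral_cmult) measurable
  thus "(\<integral>p. ennreal (2 * B) * ennreal (E p)) < \<infinity>"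
   using E_finite by (simp add: ennreal_mult_less_top)
  show "AE p in lborel. ennreal (E p * (2 * \<sigma> (t n) p / (t n)^2)) \<le> ennreal (2 * B) * ennreal (E p)" for n
  proof (rule AE_I2)
   fix p
   have "2 * \<sigma> (t n) p / (t n)^2 \<le> 2 * B"
    using \<sigma>_le[of "t n" p] t[of n] unfolding B_def[symmetric] by (simp add: divide_le_eq mult.commute)
   hence "E p * (2 * \<sigma> (t n) p / (t n)^2) \<le> E p * (2 * B)" by (rule mult_left_mono) (rule E_nonneg)
   thus "ennreal (E p * (2 * \<sigma> (t n) p / (t n)^2)) \<le> ennreal (2 * B) * ennreal (E p)"
    using B by (subst ennreal_mult[symmetric]) (auto simp: E_nonneg mult.commute intro!: ennreal_leI)
  qed
 qed auto
 also have "... \<le> (\<integral>p. E p * (f p \<bullet> q p))"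
 proof (rule nn_integral_mono)
  fix p
  show "limsup (\<lambda>n. ennreal (E p * (2 * \<sigma> (t n) p / (t n)^2))) \<le> ennreal (E p * (f p \<bullet> q p))"
  proof (cases "p \<in> S")
   case True
   thus ?thesis by (simp add: E_def Limsup_const)
  next
   case False
   show ?thesis
   proof (rule ennreal_le_epsilon)
    fix e :: real assume e: "e > 0"
    define e1 where "e1 = e / (2 * (E p + 1))"
    have E1: "E p + 1 > 0" using E_nonneg[of p] by simp
    have e1: "e1 > 0" "E p * (2 * e1) \<le> e"
     using e E1 E_nonneg[of p] by (auto simp: e1_def field_simps)
    obtain d where d: "d > 0" "\<And>s. \<bar>s\<bar> < d ==> \<rho> s p \<le> s^2 * ((f p \<bullet> q p) / 2 + e1)"
     using \<rho>_asymp[OF False e1(1)] by blast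
    have "\<forall>\<^sub>F n in sequentially. t n < d" using t0 d by (auto intro: order_tendstoD)
    hence "\<forall>\<^sub>F n in sequentially. ennreal (E p * (2 * \<sigma> (t n) p / (t n)^2)) \<le> ennreal (E p * (f p \<bullet> q p)) + ennreal e"
    proof eventually_elim
     case (elim n)
     have "\<sigma> (t n) p \<le> (t n)^2 * ((f p \<bullet> q p) / 2 + e1)"
      unfolding \<sigma>_def using d(2)[of "t n"] d(2)[of "- t n"] elim t[of n] by simp
     hence "2 * \<sigma> (t n) p / (t n)^2 \<le> (f p \<bullet> q p) + 2 * e1"
      using t[of n] by (simp add: divide_le_eq algebra_simps)
     hence "E p * (2 * \<sigma> (t n) p / (t n)^2) \<le> E p * ((f p \<bullet> q p) + 2 * e1)"
      by (rule mult_left_mono) (rule E_nonneg)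
     also have "... \<le> E p * (f p \<bullet> q p) + e" using e1(2) by (simp add: distrib_left)
     finally have "ennreal (E p * (2 * \<sigma> (t n) p / (t n)^2)) \<le> ennreal (E p * (f p \<bullet> q p) + e)" by (rule ennreal_leI)
     moreover have "f p \<bullet> q p \<ge> 0" using psd[OF False, of "q p"] q[OF False] by simp
     ultimately show ?case using e E_nonneg[of p] by simp
    qed
    thus "limsup (\<lambda>n. ennreal (E p * (2 * \<sigma> (t n) p / (t n)^2))) \<le> ennreal (E p * (f p \<bullet> q p)) + ennreal e"
     by (rule Limsup_bounded)
   qed
  qed
 qed
 finally show ?thesis .
qed

end

section \<open>Elementary symmetric functions of matrices\<close>

text \<open>This is \<open>det (mat 1 + s *R M)\<close> as a polynomial in \<open>s\<close>. Its
  coefficients are the elementary symmetric functions of the eigenvalues, yet polynomial in the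
  entries and available for matrices that are not symmetric, such as the derivative of a
  field.\<close>

definition char_poly_rev :: "real^'n^'n => real poly" where
 "char_poly_rev M = det (\<chi> i j. [:if i = j then 1 else 0, M $ i $ j:])"

definition esym :: "nat => real^'n^'n => real" where
 "esym k M = coeff (char_poly_rev M) k"

lemma poly_char_poly_rev:
 fixes M :: "real^'n^'n"
 shows "poly (char_poly_rev M) s = det (mat 1 + s *R M)"
proof -
 have "poly (char_poly_rev M) s =
  (\<Sum>p\<in>{p. p permutes (UNIV::'n set)}. of_int (sign p) * (\<Prod>i\<in>UNIV. (if i = p i then 1 else 0) + s * M $ i $ p i))"
  unfolding char_poly_rev_def det_def by (simp add: poly_sum poly_prod)
 thus ?thesis
  unfolding det_def by (simp add: mat_def)
qed

lemma continuous_on_coeff_mult: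
 fixes p q :: "'b::topological_space => real poly"
 assumes "\<And>k. continuous_on S (\<lambda>x. coeff (p x) k)" "\<And>k. continuous_on S (\<lambda>x. coeff (q x) k)"
 shows "continuous_on S (\<lambda>x. coeff (p x * q x) k)"
 unfolding coeff_mult by (intro continuous_intros assms)

lemma continuous_on_coeff_prod:
 fixes p :: "'i => 'b::topological_space => real poly"
 assumes "\<And>i k. i \<in> I ==> continuous_on S (\<lambda>x. coeff (p i x) k)"
 shows "continuous_on S (\<lambda>x. coeff (\<Prod>i\<in>I. p i x) k)"
 using assms
proof (induction I arbitrary: k rule: infinite_finite_induct)
 case (insert i I)
 thus ?case by (simp add: continuous_on_coeff_mult)
qed (auto simp: )

lemma continuous_on_esym:
 fixes M :: "'b::topological_space => real^'n^'n"
 assumes "\<And>i j. continuous_on S (\<lambda>x. M x $ i $ j)"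
 shows "continuous_on S (\<lambda>x. esym k (M x))"
proof -
 have 1: "continuous_on S (\<lambda>x. coeff [:c, M x $ i $ j:] k)" for c i j k
  by (cases k; cases "k - 1") (auto simp: coeff_pCons assms split: nat.splits)
 have 2: "continuous_on S (\<lambda>x. coeff (of_int z * (\<Prod>i\<in>UNIV. [:if i = p i then 1 else 0, M x $ i $ p i:])) k)" for z p
  by (intro continuous_on_coeff_mult continuous_on_coeff_prod 1) (rule continuous_on_const)
 show ?thesis unfolding esym_def char_poly_rev_def det_def coeff_sum
  by (intro continuous_on_sum) (use 2 in simp)
qed

lemma elem_sym_insert:
 assumes "finite I" "i \<notin> I"
 shows "elem_sym (Suc k) (insert i I) f = elem_sym (Suc k) I f + f i * elem_sym k I f"
proof -
 let ?P = "\<lambda>k. {S. S \<subseteq> I \<and> card S = k}"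
 have eq: "{S. S \<subseteq> insert i I \<and> card S = Suc k} = ?P (Suc k) \<union> insert i ` ?P k"
 proof (intro equalityI subsetI)
  fix S assume "S \<in> {S. S \<subseteq> insert i I \<and> card S = Suc k}"
  hence S: "S \<subseteq> insert i I" "card S = Suc k" by auto
  have "finite S" using S(2) by (metis card.infinite nat.distinct(1))
  show "S \<in> ?P (Suc k) \<union> insert i ` ?P k"
  proof (cases "i \<in> S")
   case True
   hence "S = insert i (S - {i})" "S - {i} \<subseteq> I" "card (S - {i}) = k" using S \<open>finite S\<close> by auto
   thus ?thesis by blast
  qed (use S in auto)
 next
  fix S assume "S \<in> ?P (Suc k) \<union> insert i ` ?P k"
  thus "S \<in> {S. S \<subseteq> insert i I \<and> card S = Suc k}"
  proof
   assume "S \<in> insert i ` ?P k"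
   then obtain S' where "S = insert i S'" "S' \<subseteq> I" "card S' = k" by auto
   moreover have "finite S'" "i \<notin> S'" using \<open>S' \<subseteq> I\<close> assms finite_subset by auto
   ultimately show ?thesis by auto
  qed auto
 qed
 have fin: "finite (?P m)" for m using assms by simp
 have inj: "inj_on (insert i) (?P k)"
  using assms by (intro inj_onI) (metis (no_types, lifting) insert_ident mem_Collect_eq subsetD)
 have "elem_sym (Suc k) (insert i I) f = elem_sym (Suc k) I f + (\<Sum>S\<in>insert i ` ?P k. \<Prod>i\<in>S. f i)"
  unfolding elem_sym_def eq using assms by (intro sum.union_disjoint) auto
 also have "(\<Sum>S\<in>insert i ` ?P k. \<Prod>i\<in>S. f i) = (\<Sum>S\<in>?P k. \<Prod>i\<in>insert i S. f i)"
  by (subst sum.reindex[OF inj]) simp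
 also have "... = (\<Sum>S\<in>?P k. f i * (\<Prod>i\<in>S. f i))"
  using assms by (intro sum.cong refl prod.insert) (auto intro: finite_subset)
 finally show ?thesis unfolding elem_sym_def by (simp add: sum_distrib_left)
qed

lemma elem_sym_0 [simp]: "finite I ==> elem_sym 0 I f = 1"
proof -
 assume "finite I"
 hence "{S. S \<subseteq> I \<and> card S = 0} = {{}}" by (auto dest: finite_subset)
 thus ?thesis unfolding elem_sym_def by simp
qed

lemma coeff_prod_linear: "finite I ==> coeff (\<Prod>i\<in>I. [:1, f i:]) k = elem_sym k I (f :: 'i => real)"
proof (induction I arbitrary: k rule: finite_induct)
 case empty
 have "{S. S \<subseteq> {} \<and> card S = k} = (if k = 0 then {{}} else ({} :: 'i set set))" by auto
 thus ?case unfolding elem_sym_def by (simp add: coeff_1)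
next
 case (insert i I)
 thus ?case
  by (cases k) (auto simp: elem_sym_insert coeff_pCons)
qed

section \<open>Rank-one perturbations\<close>

lemma matrix_matrix_add_rdistrib: "(A + B) ** C = A ** C + B ** (C :: real^'n^'n)" for A B :: "real^'n^'n"
 by (simp add: vec_eq_iff matrix_matrix_mult_def sum.distrib distrib_right)

text \<open>The matrix determinant lemma. A rotation takes \<open>c\<close> to a multiple of an axis
  vector; then a single row of the identity is altered, and Cramer's rule applies to the
  transpose.\<close>

lemma det_identity_plus_rank_one:
 fixes c b :: "real^'n"
 shows "det (\<chi> i j. (if i = j then 1 else 0) + c $ i * b $ j) = 1 + c \<bullet> b"
proof -
 obtain k :: 'n where True by auto
 have "norm c = norm (norm c *R axis k (1::real))" by (simp add: norm_axis_1)
 then obtain f where f: "orthogonal_transformation f" "f c = norm c *R axis k (1::real)"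
  by (rule orthogonal_transformation_exists)
 define Q where "Q = matrix f"
 have lin: "linear f" using f(1) orthogonal_transformation_linear by blast
 have Q: "orthogonal_matrix Q" unfolding Q_def using f(1) orthogonal_transformation_matrix by blast
 have Qv: "Q *v x = f x" for x unfolding Q_def using lin by (simp add: matrix_works)
 let ?A = "\<chi> i j. (if i = j then 1 else 0) + c $ i * b $ j"
 have "det ?A = det (Q ** ?A ** transpose Q)"
 proof -
  have "det Q * det (transpose Q) = 1"
   using Q unfolding orthogonal_matrix_def by (metis det_I det_mul mult.commute)
  thus ?thesis by (simp add: det_mul mult.commute mult.left_commute del: det_transpose)
 qed
 also have "Q ** ?A ** transpose Q = (\<chi> i j. (if i = j then 1 else 0) + (Q *v c) $ i * (Q *v b) $ j)"
 proof -
  have "?A = mat 1 + (\<chi> i j. c $ i * b $ j)" by (simp add: vec_eq_iff mat_def)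
  hence "Q ** ?A ** transpose Q = Q ** transpose Q + Q ** (\<chi> i j. c $ i * b $ j) ** transpose Q"
   by (simp add: matrix_add_ldistrib matrix_matrix_add_rdistrib)
  also have "Q ** transpose Q = mat 1" using Q by (simp add: orthogonal_matrix_def)
  also have "Q ** (\<chi> i j. c $ i * b $ j) ** transpose Q = (\<chi> i j. (Q *v c) $ i * (Q *v b) $ j)"
  proof -
   have "Q ** (\<chi> i j. c $ i * b $ j) = (\<chi> i j. (Q *v c) $ i * b $ j)"
    by (simp add: vec_eq_iff matrix_matrix_mult_def matrix_vector_mult_def sum_distrib_right mult.assoc)
   moreover have "(\<chi> i j. d $ i * b $ j) ** transpose Q = (\<chi> i j. d $ i * (Q *v b) $ j)" for d :: "real^'n"
    by (simp add: vec_eq_iff matrix_matrix_mult_def matrix_vector_mult_def transpose_def sum_distrib_left mult_ac)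
   ultimately show ?thesis by simp
  qed
  finally show ?thesis by (simp add: vec_eq_iff mat_def)
 qed
 also have "det ... = det (transpose (\<chi> i j. (if i = j then 1 else 0) + (Q *v c) $ i * (Q *v b) $ j))"
  by simp
 also have "transpose (\<chi> i j. (if i = j then 1 else 0) + (Q *v c) $ i * (Q *v b) $ j)
   = (\<chi> i j. if j = k then (mat 1 *v (axis k 1 + norm c *R (Q *v b))) $ i else (mat 1 :: real^'n^'n) $ i $ j)"
  unfolding Qv f(2) matrix_vector_mul_lid by (auto simp: vec_eq_iff transpose_def mat_def axis_def)
 also have "det ... = (axis k 1 + norm c *R (Q *v b)) $ k * det (mat 1 :: real^'n^'n)"
  by (rule cramer_lemma)
 also have "... = 1 + (Q *v c) \<bullet> (Q *v b)" unfolding Qv f(2) by (simp add: inner_axis')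
 also have "(Q *v c) \<bullet> (Q *v b) = c \<bullet> b" unfolding Qv using f(1) by (simp add: orthogonal_transformation_def)
 finally show ?thesis .
qed

text \<open>The diagonal factor is split off, which uses nonzero entries. For the entries
  \<open>1 + s * l i\<close> of later use this holds as soon as \<open>s\<close> is small.\<close>

lemma det_diagonal_plus_rank_one:
 fixes a b :: "real^'n"
 assumes "\<And>i. d i \<noteq> 0"
 shows "det (\<chi> i j. (if i = j then d i else 0) + a $ i * b $ j) = (\<Prod>i\<in>UNIV. d i) + (\<Sum>i\<in>UNIV. a $ i * b $ i * (\<Prod>j\<in>UNIV - {i}. d j))"
proof -
 define c :: "real^'n" where "c = (\<chi> i. a $ i / d i)"
 have "(\<chi> i j. (if i = j then d i else 0) + a $ i * b $ j) = (\<chi> i j. if i = j then d i else 0) ** (\<chi> i j. (if i = j then 1 else 0) + c $ i * b $ j)"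
 proof -
  have ds: "(\<Sum>k\<in>UNIV. (if i = k then d i else 0) * f k) = d i * f i" for i and f :: "'n => real"
  proof -
   have "(\<Sum>k\<in>UNIV. (if i = k then d i else 0) * f k) = (\<Sum>k\<in>UNIV. if i = k then d i * f k else 0)"
    by (rule sum.cong) auto
   thus ?thesis by simp
  qed
  show ?thesis
   unfolding vec_eq_iff matrix_matrix_mult_def by (simp add: ds) (simp add: c_def assms distrib_left)
 qed
 hence "det (\<chi> i j. (if i = j then d i else 0) + a $ i * b $ j) = (\<Prod>i\<in>UNIV. d i) * (1 + c \<bullet> b)"
  by (simp add: det_mul det_identity_plus_rank_one det_diagonal)
 also have "... = (\<Prod>i\<in>UNIV. d i) + (\<Sum>i\<in>UNIV. (\<Prod>i\<in>UNIV. d i) * (c $ i * b $ i))"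
  by (simp add: distrib_left inner_vec_def sum_distrib_left)
 also have "(\<Sum>i\<in>UNIV. (\<Prod>i\<in>UNIV. d i) * (c $ i * b $ i)) = (\<Sum>i\<in>UNIV. a $ i * b $ i * (\<Prod>j\<in>UNIV - {i}. d j))"
 proof (rule sum.cong[OF refl])
  fix i :: 'n
  have "(\<Prod>i\<in>UNIV. d i) = d i * (\<Prod>j\<in>UNIV - {i}. d j)" by (rule prod.remove) auto
  thus "(\<Prod>i\<in>UNIV. d i) * (c $ i * b $ i) = a $ i * b $ i * (\<Prod>j\<in>UNIV - {i}. d j)"
   using assms[of i] by (simp add: c_def)
 qed
 finally show ?thesis .
qed

lemma orthonormal_conjugate:
 fixes M :: "real^'n^'n" and v :: "'n => real^'n"
 assumes v: "\<And>i j. v i \<bullet> v j = (if i = j then 1 else 0)"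
 shows "det M = det (\<chi> i j. v i \<bullet> (M *v v j))"
proof -
 define Q :: "real^'n^'n" where "Q = (\<chi> i j. v j $ i)"
 have QQ: "transpose Q ** Q = mat 1"
  using v by (auto simp: Q_def vec_eq_iff matrix_matrix_mult_def transpose_def mat_def inner_vec_def)
 have "det (transpose Q) * det Q = 1" using QQ by (metis det_I det_mul)
 hence "det M = det (transpose Q ** M ** Q)" by (simp add: det_mul mult.commute mult.left_commute del: det_transpose)
 also have "transpose Q ** M ** Q = transpose Q ** (M ** Q)" by (simp add: matrix_mul_assoc)
 also have "... = (\<chi> i j. v i \<bullet> (M *v v j))"
  by (simp add: Q_def vec_eq_iff matrix_matrix_mult_def matrix_vector_mult_def transpose_def inner_vec_def)
 finally show ?thesis .
qed

lemma poly_eq_near_0: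
 fixes p q :: "real poly"
 assumes "e > 0" "\<And>s. 0 < s ==> s < e ==> poly p s = poly q s"
 shows "p = q"
proof (rule ccontr)
 assume "p \<noteq> q"
 hence "finite {s. poly (p - q) s = 0}" by (intro poly_roots_finite) simp
 moreover have "{0<..<e} \<subseteq> {s. poly (p - q) s = 0}" using assms(2) by auto
 ultimately have "finite {0<..<e}" by (rule finite_subset[rotated])
 thus False using assms(1) by (simp add: infinite_Ioo)
qed

text \<open>In the eigenbasis the matrix is diagonal plus rank one. The entries
  \<open>1 + s * l i\<close> do not vanish for \<open>s < 1 / (1 + X)\<close>, and agreement for
  such \<open>s\<close> suffices for an identity of polynomials.\<close>

lemma char_poly_rev_rank_one:
 fixes M :: "real^'n^'n" and v :: "'n => real^'n"
 assumes v: "\<And>i j. v i \<bullet> v j = (if i = j then 1 else 0)" and eig: "\<And>i. M *v v i = l i *R v i"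
 shows "char_poly_rev (M + (\<chi> i j. a $ i * b $ j)) =
  (\<Prod>i\<in>UNIV. [:1, l i:]) + (\<Sum>i\<in>UNIV. [:0, (a \<bullet> v i) * (b \<bullet> v i):] * (\<Prod>j\<in>UNIV - {i}. [:1, l j:]))"
proof (rule poly_eq_near_0)
 define X where "X = (\<Sum>i\<in>UNIV. \<bar>l i\<bar>)"
 have X: "X \<ge> 0" "\<bar>l i\<bar> \<le> X" for i
  unfolding X_def by (rule sum_nonneg, simp) (rule member_le_sum, auto)
 show "1 / (1 + X) > 0" using X by (simp add: add_pos_nonneg)
 fix s assume s: "0 < s" "s < 1 / (1 + X)"
 have "s * (1 + X) < 1" using s(2) X by (simp add: pos_less_divide_eq add_pos_nonneg)
 hence sX: "s * X < 1" using s(1) by (simp add: distrib_left)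
 have nz: "1 + s * l i \<noteq> 0" for i
 proof -
  have "\<bar>s * l i\<bar> = s * \<bar>l i\<bar>" using s(1) by (simp only: abs_mult abs_of_pos)
  also have "... \<le> s * X" by (rule mult_left_mono[OF X(2)]) (use s(1) in linarith)
  finally have "- 1 < s * l i" using sX by linarith
  thus ?thesis by linarith
 qed
 let ?R = "\<chi> i j. a $ i * b $ j"
 have R: "?R *v w = (b \<bullet> w) *R a" for w
 proof -
  have "(\<Sum>j\<in>UNIV. a $ i * b $ j * w $ j) = (\<Sum>j\<in>UNIV. b $ j * w $ j) * a $ i" for i
   unfolding sum_distrib_right by (rule sum.cong) auto
  thus ?thesis by (simp add: vec_eq_iff matrix_vector_mult_def inner_vec_def)
 qed
 have "poly (char_poly_rev (M + ?R)) s = det (\<chi> i j. v i \<bullet> ((mat 1 + s *R (M + ?R)) *v v j))"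
  unfolding poly_char_poly_rev by (rule orthonormal_conjugate[OF v])
 also have "(\<chi> i j. v i \<bullet> ((mat 1 + s *R (M + ?R)) *v v j))
  = (\<chi> i j. (if i = j then 1 + s * l i else 0) + (\<chi> i. s * (a \<bullet> v i)) $ i * (\<chi> i. b \<bullet> v i) $ j)"
 proof -
  have "(mat 1 + s *R (M + ?R)) *v v j = v j + s *R (l j *R v j + (b \<bullet> v j) *R a)" for j
   by (simp add: matrix_vector_mult_add_rdistrib scaleR_matrix_vector_assoc[symmetric] R eig)
  hence "v i \<bullet> ((mat 1 + s *R (M + ?R)) *v v j) = (if i = j then 1 + s * l i else 0) + s * (a \<bullet> v i) * (b \<bullet> v j)" for i j
   by (simp only: inner_add_right inner_scaleR_right v) (simp add: inner_commute[of a] algebra_simps)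
  thus ?thesis by (simp add: vec_eq_iff)
 qed
 also have "det ... = (\<Prod>i\<in>UNIV. 1 + s * l i) + (\<Sum>i\<in>UNIV. (\<chi> i. s * (a \<bullet> v i)) $ i * (\<chi> i. b \<bullet> v i) $ i * (\<Prod>j\<in>UNIV - {i}. 1 + s * l j))"
  by (rule det_diagonal_plus_rank_one[OF nz])
 finally show "poly (char_poly_rev (M + ?R)) s = poly ((\<Prod>i\<in>UNIV. [:1, l i:]) + (\<Sum>i\<in>UNIV. [:0, (a \<bullet> v i) * (b \<bullet> v i):] * (\<Prod>j\<in>UNIV - {i}. [:1, l j:]))) s"
  by (simp add: poly_sum poly_prod mult_ac)
qed

lemma esym_eigenvalues:
 fixes M :: "real^'n^'n" and v :: "'n => real^'n"
 assumes v: "\<And>i j. v i \<bullet> v j = (if i = j then 1 else 0)" and eig: "\<And>i. M *v v i = l i *R v i"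
 shows "esym k M = elem_sym k UNIV l"
proof -
 have "M + (\<chi> i j. (0::real^'n) $ i * (0::real^'n) $ j) = M" by (simp add: vec_eq_iff)
 hence "char_poly_rev M = (\<Prod>i\<in>UNIV. [:1, l i:])"
  using char_poly_rev_rank_one[of v M l "0::real^'n" "0::real^'n", OF v eig] by (simp del: zero_index)
 thus ?thesis unfolding esym_def by (simp add: coeff_prod_linear)
qed

lemma esym_rank_one:
 fixes M :: "real^'n^'n" and v :: "'n => real^'n"
 assumes v: "\<And>i j. v i \<bullet> v j = (if i = j then 1 else 0)" and eig: "\<And>i. M *v v i = l i *R v i"
 shows "esym (Suc k) (M + (\<chi> i j. a $ i * b $ j)) =
  elem_sym (Suc k) UNIV l + (\<Sum>i\<in>UNIV. (a \<bullet> v i) * (b \<bullet> v i) * elem_sym k (UNIV - {i}) l)"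
 unfolding esym_def char_poly_rev_rank_one[OF v eig]
 by (simp add: coeff_prod_linear coeff_sum)

section \<open>The spectral theorem\<close>

lemma symmetric_eigenbasis_subspace:
 fixes f :: "'a::euclidean_space => 'a"
 assumes lin: "linear f" and sym: "\<And>v w. f v \<bullet> w = v \<bullet> f w"
 shows "subspace S ==> f ` S \<subseteq> S ==>
  \<exists>B. B \<subseteq> S \<and> S \<subseteq> span B \<and> pairwise orthogonal B \<and> (\<forall>b\<in>B. norm b = 1 \<and> (\<exists>l. f b = l *R b))"
proof (induction "dim S" arbitrary: S rule: less_induct)
 case less
 show ?case
 proof (cases "S = {0}")
  case True
  thus ?thesis by (intro exI[of _ "{}"]) auto
 next
  case False
  then obtain z where z: "z \<in> S" "z \<noteq> 0" using subspace_0[OF less.prems(1)] by auto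
  define C where "C = S \<inter> sphere 0 1"
  have "compact C" unfolding C_def using closed_subspace[OF less.prems(1)] by (intro closed_Int_compact) auto
  moreover have "(1 / norm z) *R z \<in> C" unfolding C_def using z less.prems(1) by (auto simp: subspace_scale)
  moreover have "continuous_on C (\<lambda>v. f v \<bullet> v)"
   using lin by (intro continuous_intros linear_continuous_on) (simp add: linear_conv_bounded_linear)
  ultimately obtain v where v: "v \<in> C" "\<And>w. w \<in> C ==> f w \<bullet> w \<le> f v \<bullet> v"
   using continuous_attains_sup[of C "\<lambda>v. f v \<bullet> v"] by blast
  define l where "l = f v \<bullet> v"
  have vS: "v \<in> S" and nv: "norm v = 1" using v by (auto simp: C_def)
  have le: "f w \<bullet> w \<le> l * (w \<bullet> w)" if "w \<in> S" for w
  proof (cases "w = 0")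
   case False
   have "(1 / norm w) *R w \<in> C" unfolding C_def using False that less.prems(1) by (auto simp: subspace_scale)
   from v(2)[OF this] have "f w \<bullet> w / (norm w * norm w) \<le> l"
    unfolding l_def by (simp add: linear_scale[OF lin])
   thus ?thesis using False by (simp add: divide_le_eq dot_square_norm power2_eq_square)
  qed (simp add: linear_0[OF lin])
  \<comment> \<open>First-order condition at the maximiser \<open>v\<close> of the quadratic form on
    the unit sphere of \<open>S\<close>; it makes \<open>f v\<close> parallel to \<open>v\<close>,
    and the orthogonal complement of \<open>v\<close> in \<open>S\<close> is the subspace for the
    induction.\<close>
  have orth: "f v \<bullet> w = 0" if w: "w \<in> S" "v \<bullet> w = 0" for w
  proof (rule ccontr)
   assume ne: "f v \<bullet> w \<noteq> 0"
   define d where "d = l * (w \<bullet> w) - f w \<bullet> w"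
   have ineq: "2 * t * (f v \<bullet> w) \<le> t^2 * d" for t
   proof -
    have "v + t *R w \<in> S" using vS w less.prems(1) by (simp add: subspace_add subspace_scale)
    from le[OF this] have "f v \<bullet> v + t * (f v \<bullet> w) + t * (f w \<bullet> v) + t^2 * (f w \<bullet> w) \<le> l * (v \<bullet> v + t^2 * (w \<bullet> w))"
     using w(2) by (simp add: linear_add[OF lin] linear_scale[OF lin] inner_add_left inner_add_right inner_commute[of w v] power2_eq_square algebra_simps)
    moreover have "f w \<bullet> v = f v \<bullet> w" using sym[of v w] by (simp add: inner_commute)
    moreover have "v \<bullet> v = 1" using nv by (simp add: dot_square_norm)
    ultimately show ?thesis unfolding d_def l_def by (simp add: algebra_simps)
   qed
   define s where "s = f v \<bullet> w"
   have s: "s \<noteq> 0" using ne by (simp add: s_def)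
   \<comment> \<open>A step so short that the quadratic term \<open>t^2 * d\<close> is at most half
     of the linear term \<open>2 * t * s\<close>, which contradicts \<open>ineq\<close>.\<close>
   define t where "t = s / (\<bar>d\<bar> + 1)"
   have "2 * s^2 / (\<bar>d\<bar> + 1) \<le> s^2 / (\<bar>d\<bar> + 1) * (d / (\<bar>d\<bar> + 1))"
    using ineq[of t] unfolding t_def s_def[symmetric] by (simp add: power2_eq_square mult_ac)
   also have "... \<le> s^2 / (\<bar>d\<bar> + 1) * 1"
    by (intro mult_left_mono) (auto simp: divide_le_eq)
   finally have "2 * s^2 \<le> s^2" by (simp add: divide_le_cancel)
   moreover have "s^2 > 0" using s by simp
   ultimately show False by linarith
  qed
  have fv: "f v = l *R v"
  proof -
   define r where "r = f v - l *R v"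
   have "r \<in> S" using vS less.prems by (auto simp: r_def intro!: subspace_diff subspace_scale)
   moreover have vr: "v \<bullet> r = 0" using nv by (simp add: r_def inner_diff_right l_def inner_commute dot_square_norm)
   ultimately have "f v \<bullet> r = 0" by (rule orth)
   hence "r \<bullet> r = 0" using vr by (simp add: r_def inner_diff_left)
   thus ?thesis by (simp add: r_def)
  qed
  define T where "T = {w \<in> S. v \<bullet> w = 0}"
  have subT: "subspace T" unfolding T_def using less.prems(1)
   by (auto simp: subspace_def inner_add_right)
  have "v \<notin> T" using nv by (simp add: T_def norm_eq_1)
  moreover have "T \<subseteq> S" by (auto simp: T_def)
  ultimately have "T \<subset> S" using vS by blast
  hence dimT: "dim T < dim S"
   by (metis dim_psubset less.prems(1) span_eq_iff subT)
  have fT: "f ` T \<subseteq> T"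
  proof
   fix y assume "y \<in> f ` T"
   then obtain w where w: "w \<in> S" "v \<bullet> w = 0" "y = f w" by (auto simp: T_def)
   have "v \<bullet> f w = f v \<bullet> w" using sym[of v w] by simp
   thus "y \<in> T" using w less.prems(2) by (auto simp: T_def fv)
  qed
  obtain B where B: "B \<subseteq> T" "T \<subseteq> span B" "pairwise orthogonal B" "\<forall>b\<in>B. norm b = 1 \<and> (\<exists>l. f b = l *R b)"
   using less.hyps[OF dimT subT fT] by blast
  show ?thesis
  proof (intro exI[of _ "insert v B"] conjI)
   show "insert v B \<subseteq> S" using B vS by (auto simp: T_def)
   show "S \<subseteq> span (insert v B)"
   proof
    fix w assume w: "w \<in> S"
    have "w - (v \<bullet> w) *R v \<in> T" using w vS nv less.prems(1)
     by (auto simp: T_def inner_diff_right dot_square_norm intro!: subspace_diff subspace_scale)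
    hence "w - (v \<bullet> w) *R v \<in> span (insert v B)" using B(2) span_mono[of B "insert v B"] by auto
    moreover have "(v \<bullet> w) *R v \<in> span (insert v B)" by (intro span_scale span_base) simp
    ultimately show "w \<in> span (insert v B)" using span_add by fastforce
   qed
   show "pairwise orthogonal (insert v B)"
    using B(1,3) by (auto simp: pairwise_insert T_def orthogonal_def inner_commute)
   show "\<forall>b\<in>insert v B. norm b = 1 \<and> (\<exists>l. f b = l *R b)" using B(4) nv fv by auto
  qed
 qed
qed

text \<open>The subspace form is applied to the orthogonal complement of \<open>x\<close>, so that
  \<open>x\<close> itself, with eigenvalue 0, completes the basis. In the applications
  \<open>x\<close> is the radial direction.\<close>

lemma symmetric_eigenbasis:
 fixes f :: "real^'n => real^'n"
 assumes lin: "linear f" and sym: "\<And>v w. f v \<bullet> w = v \<bullet> f w" and x: "norm x = 1" "f x = 0"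
 obtains v :: "'n => real^'n" and l :: "'n => real" and i0 :: 'n where "\<And>i j. v i \<bullet> v j = (if i = j then 1 else 0)" "\<And>i. f (v i) = l i *R v i"
  "v i0 = x" "l i0 = 0"
proof -
 define S where "S = {w. x \<bullet> w = 0}"
 have subS: "subspace S" unfolding S_def by (rule subspace_hyperplane)
 have fS: "f ` S \<subseteq> S" using sym[of x] x by (auto simp: S_def)
 obtain B where B: "B \<subseteq> S" "S \<subseteq> span B" "pairwise orthogonal B" "\<forall>b\<in>B. norm b = 1 \<and> (\<exists>l. f b = l *R b)"
  using symmetric_eigenbasis_subspace[OF lin sym subS fS] by blast
 define A where "A = insert x B"
 have xx: "x \<bullet> x = 1" using x by (simp add: dot_square_norm)
 have pw: "pairwise orthogonal A"
  using B(1,3) by (auto simp: A_def pairwise_insert S_def orthogonal_def inner_commute)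
 have nA: "norm b = 1" if "b \<in> A" for b using that B(4) x by (auto simp: A_def)
 have indep: "independent A"
  by (rule pairwise_orthogonal_independent[OF pw]) (use nA in force)
 have "UNIV \<subseteq> span A"
 proof
  fix w :: "real^'n"
  have "w - (x \<bullet> w) *R x \<in> S" using xx by (simp add: S_def inner_diff_right)
  hence "w - (x \<bullet> w) *R x \<in> span A" using B(2) span_mono[of B A] by (auto simp: A_def)
  moreover have "(x \<bullet> w) *R x \<in> span A" by (intro span_scale span_base) (simp add: A_def)
  ultimately show "w \<in> span A" using span_add by fastforce
 qed
 hence "card A = CARD('n)"
  using basis_card_eq_dim[of A UNIV] indep by simp
 then obtain v where v: "bij_betw v (UNIV :: 'n set) A"
  using finite_same_card_bij[of "UNIV :: 'n set" A] independent_imp_finite[OF indep] by auto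
 have vA: "v i \<in> A" for i using v by (auto simp: bij_betw_def)
 have "\<forall>b\<in>A. \<exists>l. f b = l *R b" using B(4) x by (auto simp: A_def)
 then obtain l' where l': "\<And>b. b \<in> A ==> f b = l' b *R b" by metis
 obtain i0 where i0: "v i0 = x" using v by (metis A_def bij_betw_imp_surj_on image_iff insertI1)
 show ?thesis
 proof (rule that[of v "\<lambda>i. l' (v i)" i0])
  fix i j :: 'n
  show "v i \<bullet> v j = (if i = j then 1 else 0)"
  proof (cases "i = j")
   case True
   thus ?thesis using nA[OF vA[of j]] by (simp add: dot_square_norm)
  next
   case False
   hence "v i \<noteq> v j" using v by (auto simp: bij_betw_def inj_on_def)
   thus ?thesis using pw vA[of i] vA[of j] False by (auto simp: pairwise_def orthogonal_def)
  qed
  show "f (v i) = l' (v i) *R v i" by (rule l'[OF vA])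
  show "v i0 = x" by (rule i0)
  have "l' x *R x = 0" using l'[of x] x by (simp add: A_def)
  thus "l' (v i0) = 0" using x i0 by auto
 qed
qed

section \<open>Integrals of minors of a derivative\<close>

text \<open>The library changes variables only on \<open>real^'n\<close> with a well-ordered index type; \<open>'a wo\<close> is a
 well-ordered copy of \<open>'a\<close> to which the statements are transported.\<close>

typedef (overloaded) 'a wo = "{..<CARD('a::finite)}"
 by (rule exI[of _ 0]) (simp add: zero_less_card_finite)

setup_lifting type_definition_wo

instantiation wo :: (finite) linorder
begin
lift_definition less_eq_wo :: "'a wo => 'a wo => bool" is "(\<le>)" .
lift_definition less_wo :: "'a wo => 'a wo => bool" is "(<)" .
instance by standard (transfer; auto)+
end

instance wo :: (finite) finite
proof
 show "finite (UNIV :: 'a wo set)"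
  using type_definition.univ[OF type_definition_wo] by (metis finite_imageI finite_lessThan)
qed

instance wo :: (finite) wellorder
proof -
 have "wf {(x, y :: 'a wo). x < y}"
  by (rule wf_subset[OF wf_measure[of Rep_wo]]) (auto simp: less_wo.rep_eq)
 thus "OFCLASS('a wo, wellorder_class)"
  by (rule wf_wellorderI) intro_classes
qed

lemma card_wo: "CARD('a::finite wo) = CARD('a)"
 using type_definition.card[OF type_definition_wo] by simp

section \<open>Transport along a bijection of index types\<close>

lemma lborel_distr_isometry:
 fixes f :: "'a::euclidean_space => 'b::euclidean_space"
 assumes lin: "linear f" and iso: "\<And>x. norm (f x) = norm x" and dim: "DIM('a) = DIM('b)"
 shows "distr lborel borel f = lborel"
proof (rule measure_eqI)
 have [measurable]: "f \<in> borel_measurable borel"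
  using lin linear_continuous_on linear_conv_bounded_linear borel_measurable_continuous_onI by blast
 fix A assume "A \<in> sets (distr lborel borel f)"
 hence [measurable]: "A \<in> sets borel" by simp
 have "emeasure (distr lborel borel f) A = (\<integral>\<^sup>+x. indicator A x \<partial>distr lborel borel f)"
  by (subst nn_integral_indicator) auto
 also have "... = (\<integral>x. indicator A (f x))" by (rule nn_integral_distr) auto
 also have "... = (\<integral>y. indicator A y)" by (rule nn_integral_lborel_isometry[OF lin iso dim]) auto
 finally show "emeasure (distr lborel borel f) A = emeasure lborel A" by simp
qed simp

text \<open>Conjugation by \<open>h\<close> turns each transposition into the transposition of the
  images, so the number of factors, and with it the sign, is preserved.\<close>

lemma swapidseq_conjugate:
 assumes "bij (h :: 'a => 'b)"
 shows "swapidseq n p ==> swapidseq n (h \<circ> p \<circ> inv h)"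
proof (induction rule: swapidseq.induct)
 case id
 have "h (inv h y) = y" for y using assms by (simp add: bij_is_surj surj_f_inv_f)
 hence "h \<circ> id \<circ> inv h = id" by (intro ext) simp
 thus ?case by (simp only: swapidseq.id)
next
 case (comp_Suc n p a b)
 have "h \<circ> (Transposition.transpose a b \<circ> p) \<circ> inv h = Transposition.transpose (h a) (h b) \<circ> (h \<circ> p \<circ> inv h)"
 proof
  fix x
  have "h (Transposition.transpose a b y) = Transposition.transpose (h a) (h b) (h y)" for y
   using assms by (auto simp: Transposition.transpose_def bij_def inj_eq)
  thus "(h \<circ> (Transposition.transpose a b \<circ> p) \<circ> inv h) x = (Transposition.transpose (h a) (h b) \<circ> (h \<circ> p \<circ> inv h)) x" by simp
 qed
 moreover have "h a \<noteq> h b" using comp_Suc assms by (auto simp: bij_def inj_eq)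
 ultimately show ?case using comp_Suc by (metis swapidseq.comp_Suc)
qed

lemma sign_conjugate:
 assumes h: "bij (h :: 'a::finite => 'b::finite)" and p: "p permutes UNIV"
 shows "sign (h \<circ> p \<circ> inv h) = sign p"
proof -
 have "permutation p" using p by (simp add: permutation_permutes) (metis finite)
 then obtain n where n: "swapidseq n p" unfolding permutation_def by blast
 hence "evenperm p = even n" by (rule evenperm_unique) (rule refl)
 moreover have "evenperm (h \<circ> p \<circ> inv h) = even n"
  by (rule evenperm_unique[OF swapidseq_conjugate[OF h n]]) (rule refl)
 ultimately show ?thesis by (simp add: sign_def)
qed

lemma permutes_UNIV_iff_bij: "p permutes UNIV \<longleftrightarrow> bij p"
 by (auto simp: permutes_bij intro: bij_imp_permutes)

lemma det_reindex:
 fixes M :: "real^'n^'n" and h :: "'n => 'k::finite"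
 assumes h: "bij h"
 shows "det (\<chi> a b. M $ inv h a $ inv h b) = det M"
proof -
 have hi: "inv h (h i) = i" "h (inv h j) = j" for i j using h by (auto simp: bij_def surj_f_inv_f)
 have bij: "bij_betw (\<lambda>p. h \<circ> p \<circ> inv h) {p. p permutes (UNIV :: 'n set)} {p. p permutes (UNIV :: 'k set)}"
 proof (rule bij_betwI[where g="\<lambda>q. inv h \<circ> q \<circ> h"])
  show "(\<lambda>p. h \<circ> p \<circ> inv h) \<in> {p. p permutes UNIV} \<rightarrow> {p. p permutes UNIV}"
   using h by (auto simp: permutes_UNIV_iff_bij intro!: bij_comp bij_imp_bij_inv)
  show "(\<lambda>q. inv h \<circ> q \<circ> h) \<in> {p. p permutes UNIV} \<rightarrow> {p. p permutes UNIV}"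
   using h by (auto simp: permutes_UNIV_iff_bij intro!: bij_comp bij_imp_bij_inv)
 qed (auto simp: fun_eq_iff hi)
 have "det (\<chi> a b. M $ inv h a $ inv h b) = (\<Sum>p | p permutes (UNIV :: 'k set). of_int (sign p) * (\<Prod>a\<in>UNIV. M $ inv h a $ inv h (p a)))"
  by (simp add: det_def)
 also have "... = (\<Sum>p | p permutes (UNIV :: 'n set). of_int (sign (h \<circ> p \<circ> inv h)) * (\<Prod>a\<in>UNIV. M $ inv h a $ inv h ((h \<circ> p \<circ> inv h) a)))"
  by (rule sum.reindex_bij_betw[OF bij, symmetric])
 also have "... = (\<Sum>p | p permutes (UNIV :: 'n set). of_int (sign p) * (\<Prod>i\<in>UNIV. M $ i $ p i))"
 proof (rule sum.cong[OF refl])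
  fix p assume "p \<in> {p. p permutes (UNIV :: 'n set)}"
  hence "sign (h \<circ> p \<circ> inv h) = sign p" by (intro sign_conjugate h) simp
  moreover have "(\<Prod>a\<in>UNIV. M $ inv h a $ inv h ((h \<circ> p \<circ> inv h) a)) = (\<Prod>i\<in>UNIV. M $ i $ p i)"
  proof -
   have "bij_betw (inv h) UNIV UNIV" using h bij_imp_bij_inv by blast
   from prod.reindex_bij_betw[OF this, of "\<lambda>i. M $ i $ p i"] show ?thesis by (simp add: hi)
  qed
  ultimately show "of_int (sign (h \<circ> p \<circ> inv h)) * (\<Prod>a\<in>UNIV. M $ inv h a $ inv h ((h \<circ> p \<circ> inv h) a)) = of_int (sign p) * (\<Prod>i\<in>UNIV. M $ i $ p i)" by simp
 qed
 also have "... = det M" by (simp add: det_def)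
 finally show ?thesis .
qed

lemma esym_reindex:
 fixes M :: "real^'n^'n" and h :: "'n => 'k::finite"
 assumes h: "bij h"
 shows "esym k (\<chi> a b. M $ inv h a $ inv h b) = esym k M"
proof -
 have "poly (char_poly_rev (\<chi> a b. M $ inv h a $ inv h b)) s = poly (char_poly_rev M) s" for s
 proof -
  have "inv h a = inv h b \<longleftrightarrow> a = b" for a b using h by (metis bij_inv_eq_iff)
  hence "mat 1 + s *R (\<chi> a b. M $ inv h a $ inv h b) = (\<chi> a b. (mat 1 + s *R M) $ inv h a $ inv h b)"
   by (simp add: vec_eq_iff mat_def)
  thus ?thesis unfolding poly_char_poly_rev by (simp only: det_reindex[OF h])
 qed
 hence "char_poly_rev (\<chi> a b. M $ inv h a $ inv h b) = char_poly_rev M" by (simp add: poly_eq_poly_eq_iff[symmetric] fun_eq_iff)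
 thus ?thesis by (simp add: esym_def)
qed

lemma degree_char_poly_rev: "degree (char_poly_rev (M :: real^'n^'n)) \<le> CARD('n)"
proof -
 have 1: "degree (\<Prod>i\<in>UNIV. [:if i = p i then 1 else 0, M $ i $ p i:]) \<le> CARD('n)" for p
 proof -
  have "degree (\<Prod>i\<in>UNIV. [:if i = p i then 1 else 0, M $ i $ p i:]) \<le> sum (degree \<circ> (\<lambda>i. [:if i = p i then 1 else 0, M $ i $ p i:])) UNIV"
   by (rule degree_prod_sum_le) simp
  also have "... \<le> (\<Sum>i\<in>(UNIV :: 'n set). 1)" by (intro sum_mono) auto
  finally show ?thesis by simp
 qed
 show ?thesis unfolding char_poly_rev_def det_def
 proof (rule degree_sum_le)
  fix p :: "'n => 'n"
  have "degree (of_int (sign p) * (\<Prod>i\<in>UNIV. [:if i = p i then 1 else 0, M $ i $ p i:])) \<le> degree (of_int (sign p) :: real poly) + degree (\<Prod>i\<in>UNIV. [:if i = p i then 1 else 0, M $ i $ p i:])"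
   by (rule degree_mult_le)
  also have "... \<le> CARD('n)" using 1 by simp
  finally show "degree (of_int (sign p) * (\<Prod>i\<in>UNIV. (\<chi> i j. [:if i = j then 1 else 0, M $ i $ j:]) $ i $ p i)) \<le> CARD('n)" by simp
 qed (simp add: finite_permutations)
qed

lemma det_expand_esym: "det (mat 1 + s *R M) = (\<Sum>k\<le>CARD('n). esym k M * s ^ k)" for M :: "real^'n^'n"
proof -
 have "poly (char_poly_rev M) s = (\<Sum>k\<le>CARD('n). coeff (char_poly_rev M) k * s ^ k)"
  unfolding poly_altdef
  by (rule sum.mono_neutral_left) (use degree_char_poly_rev[of M] in \<open>auto simp: coeff_eq_0 not_le\<close>)
 thus ?thesis by (simp add: poly_char_poly_rev esym_def)
qed

lemma esym_0_matrix: "k > 0 ==> esym k (0 :: real^'n^'n) = 0"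
proof -
 assume k: "k > 0"
 have "char_poly_rev (0 :: real^'n^'n) = 1"
  by (simp add: poly_eq_poly_eq_iff[symmetric] fun_eq_iff poly_char_poly_rev)
 thus ?thesis using k by (simp add: esym_def)
qed

text \<open>For small \<open>s\<close> the map \<open>x + s Y x\<close> is a bijection, since
  \<open>s Y\<close> is a contraction. It is the identity where \<open>Y\<close> vanishes, so it
  maps the ball onto itself, and the transformed volume is the same for all such
  \<open>s\<close>.\<close>

lemma volume_near_identity:
 fixes Y :: "real^'n::{finite,wellorder} => real^'n::_"
 assumes der: "\<And>x. (Y has_derivative Y' x) (at x)"
  and cont: "\<And>v. continuous_on UNIV (\<lambda>x. Y' x v)"
  and supp: "\<And>x. norm x \<ge> R ==> Y x = 0"
 obtains s0 where "s0 > 0" "\<And>s x. 0 < s ==> s < s0 ==> det (mat 1 + s *R matrix (Y' x)) > 0"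
  "\<And>s. 0 < s ==> s < s0 ==>
   (\<integral>x. ennreal (indicator (cball 0 R) x * det (mat 1 + s *R matrix (Y' x)))) = emeasure lborel (cball (0::(real,'n) vec) R)"
proof -
 have lin: "linear (Y' x)" for x using der has_derivative_linear by blast
 have out: "Y' x v = 0" if "norm x > R" for x v
 proof -
  have "open {x :: (real,'n) vec. norm x > R}" by (intro open_Collect_less continuous_intros)
  hence "((\<lambda>_. 0) has_derivative Y' x) (at x)"
   by (rule has_derivative_transform_within_open[OF der]) (use that supp in auto)
  hence "Y' x = (\<lambda>_. 0)" using has_derivative_unique has_derivative_const by blast
  thus ?thesis by simp
 qed
 have "\<exists>b. \<forall>x. norm (Y' x (axis i 1)) \<le> b" for i
 proof -
  have "bounded ((\<lambda>x. Y' x (axis i 1)) ` cball 0 R)"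
   by (intro compact_imp_bounded compact_continuous_image continuous_on_subset[OF cont]) auto
  then obtain b where b: "\<forall>x\<in>cball 0 R. norm (Y' x (axis i 1)) \<le> b"
   unfolding bounded_iff by blast
  have "norm (Y' x (axis i 1)) \<le> max b 0" for x
   by (cases "norm x \<le> R") (use b out[of x] in \<open>auto simp: le_max_iff_disj\<close>)
  thus ?thesis by blast
 qed
 then obtain b where b: "\<And>i x. norm (Y' x (axis i 1)) \<le> b i" by metis
 define B where "B = (\<Sum>i\<in>UNIV. b i)"
 have b0: "b i \<ge> 0" for i using b[of 0 i] norm_ge_zero order_trans by blast
 have B: "norm (Y' x v) \<le> B * norm v" for x v
 proof -
  have "Y' x v = Y' x (\<Sum>i\<in>UNIV. v $ i *R axis i 1)" by (simp add: basis_expansion[of v, unfolded scalar_mult_eq_scaleR])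
  also have "... = (\<Sum>i\<in>UNIV. v $ i *R Y' x (axis i 1))"
   by (simp add: linear_sum[OF lin] linear_scale[OF lin])
  also have "norm ... \<le> (\<Sum>i\<in>UNIV. norm v * b i)"
   by (intro order_trans[OF norm_sum] sum_mono) (auto intro!: mult_mono component_le_norm_cart b)
  finally show ?thesis by (simp add: B_def sum_distrib_left mult.commute)
 qed
 have B0: "B \<ge> 0" unfolding B_def by (intro sum_nonneg b0)
 have lip: "norm (Y x - Y y) \<le> B * norm (x - y)" for x y
  by (rule differentiable_bound[of UNIV Y Y'])
   (use der B in \<open>auto intro!: onorm_le has_derivative_at_withinI\<close>)
 define s0 where "s0 = 1 / (B + 1)"
 show ?thesis
 proof (rule that[of s0])
  show "s0 > 0" using B0 by (simp add: s0_def)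
  have sB: "s * B < 1" if s: "0 < s" "s < s0" for s
  proof -
   have "s * (B + 1) < 1" using s(2) B0 unfolding s0_def by (subst (asm) pos_less_divide_eq) auto
   thus ?thesis using s(1) by (simp add: distrib_left)
  qed
  \<comment> \<open>As a function of \<open>s\<close> the determinant is a polynomial with value 1
    at 0; a zero before \<open>s\<close> would produce a kernel vector shorter than itself.\<close>
  show pos: "det (mat 1 + s *R matrix (Y' x)) > 0" if s: "0 < s" "s < s0" for s x
  proof (rule ccontr)
   assume "\<not> ?thesis"
   hence le: "poly (char_poly_rev (matrix (Y' x))) s \<le> 0" by (simp add: poly_char_poly_rev)
   have "poly (char_poly_rev (matrix (Y' x))) 0 = 1" by (simp add: poly_char_poly_rev)
   moreover have "continuous_on {0..s} (poly (char_poly_rev (matrix (Y' x))))"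
    by (rule continuous_at_imp_continuous_on) (simp add: poly_isCont)
   ultimately obtain t where t: "0 \<le> t" "t \<le> s" "poly (char_poly_rev (matrix (Y' x))) t = 0"
    using IVT2'[of "poly (char_poly_rev (matrix (Y' x)))" s 0 0] le s by auto
   hence "det (mat 1 + t *R matrix (Y' x)) = 0" by (simp add: poly_char_poly_rev)
   hence "\<not> invertible (mat 1 + t *R matrix (Y' x))" by (simp add: invertible_det_nz)
   hence "\<not> (\<forall>v. (mat 1 + t *R matrix (Y' x)) *v v = 0 \<longrightarrow> v = 0)"
    unfolding invertible_left_inverse matrix_left_invertible_ker .
   then obtain v where v: "v \<noteq> 0" "(mat 1 + t *R matrix (Y' x)) *v v = 0"
    by blast
   have "matrix (Y' x) *v v = Y' x v" using lin by (simp add: matrix_works)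
   hence "v = - (t *R Y' x v)"
    using v(2) by (simp add: matrix_vector_mult_add_rdistrib scaleR_matrix_vector_assoc[symmetric] eq_neg_iff_add_eq_0)
   hence "norm v = t * norm (Y' x v)" using t by (metis norm_minus_cancel norm_scaleR abs_of_nonneg)
   also have "... \<le> t * (B * norm v)" using t by (intro mult_left_mono B) auto
   also have "... \<le> s * (B * norm v)" using t B0 by (intro mult_right_mono) auto
   also have "... < norm v" using sB[OF s] v(1) by (simp add: mult.assoc[symmetric])
   finally show False by simp
  qed
  show "(\<integral>x. ennreal (indicator (cball 0 R) x * det (mat 1 + s *R matrix (Y' x)))) = emeasure lborel (cball (0::(real,'n) vec) R)"
   if s: "0 < s" "s < s0" for s
  proof -
   define \<Phi> where "\<Phi> x = x + s *R Y x" for x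
   have inj: "inj \<Phi>"
   proof (rule injI, rule ccontr)
    fix x y assume eq: "\<Phi> x = \<Phi> y" and ne: "x \<noteq> y"
    have "x - y = s *R (Y y - Y x)" using eq by (simp add: \<Phi>_def algebra_simps)
    hence "norm (x - y) = s * norm (Y y - Y x)" using s by simp
    also have "... \<le> s * (B * norm (x - y))" using lip[of x y] s by (simp add: norm_minus_commute)
    also have "... < norm (x - y)" using sB[OF s] ne by (simp add: mult.assoc[symmetric])
    finally show False by simp
   qed
   have surj: "\<Phi> ` UNIV = UNIV"
   proof (intro equalityI subsetI UNIV_I)
    fix y :: "(real,'n) vec"
    have "\<exists>!x\<in>UNIV. y - s *R Y x = x"
    proof (rule Banach_fix[of UNIV "s * B"])
     show "dist (y - s *R Y x) (y - s *R Y z) \<le> s * B * dist x z" for x z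
     proof -
      have "dist (y - s *R Y x) (y - s *R Y z) = norm (s *R (Y z - Y x))"
       by (simp add: dist_norm algebra_simps)
      also have "... \<le> s * (B * norm (z - x))" using lip[of z x] s by simp
      finally show "dist (y - s *R Y x) (y - s *R Y z) \<le> s * B * dist x z"
       by (simp add: dist_norm norm_minus_commute mult.assoc)
     qed
    qed (use s B0 sB[OF s] in \<open>auto simp: complete_UNIV\<close>)
    then obtain x where "y - s *R Y x = x" by blast
    hence "y = \<Phi> x" by (simp add: \<Phi>_def algebra_simps)
    thus "y \<in> \<Phi> ` UNIV" by blast
   qed
   have fixR: "\<Phi> x = x" if "norm x \<ge> R" for x using supp[OF that] by (simp add: \<Phi>_def)
   \<comment> \<open>A point of the ball cannot be sent outside: its image would be a fixed point
     and would have two preimages.\<close>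
   have ball: "\<Phi> x \<in> cball 0 R \<longleftrightarrow> x \<in> cball 0 R" for x
   proof (cases "norm x \<ge> R")
    case False
    have "norm (\<Phi> x) \<le> R"
    proof (rule ccontr)
     assume *: "\<not> norm (\<Phi> x) \<le> R"
     hence "\<Phi> (\<Phi> x) = \<Phi> x" by (intro fixR) simp
     hence "\<Phi> x = x" using inj by (simp add: inj_eq)
     thus False using * False by simp
    qed
    thus ?thesis using False by simp
   qed (simp add: fixR)
   have d\<Phi>: "(\<Phi> has_derivative (\<lambda>v. v + s *R Y' x v)) (at x)" for x
    unfolding \<Phi>_def by (rule has_derivative_add[OF has_derivative_ident has_derivative_scaleR_right[OF der]])
   have m: "matrix (\<lambda>v. v + s *R Y' x v) = mat 1 + s *R matrix (Y' x)" for x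
    by (simp add: vec_eq_iff matrix_def mat_def axis_def)
   have "emeasure lborel (cball (0::(real,'n) vec) R) = (\<integral>\<^sup>+y. ennreal (indicator (cball 0 R) y) \<partial>(lborel :: ((real,'n) vec) measure))"
    by (simp add: ennreal_indicator)
   also have "... = (\<integral>x. ennreal (\<bar>det (matrix (\<lambda>v. v + s *R Y' x v))\<bar> * indicator (cball 0 R) (\<Phi> x)) * indicator UNIV x)"
   proof (rule nn_integral_change_of_variables)
    show "negligible (- \<Phi> ` UNIV)" unfolding surj by simp
    show "(\<integral>\<^sup>+y. ennreal (indicator (cball 0 R) y) \<partial>(lborel :: ((real,'n) vec) measure)) < \<infinity>"
     using emeasure_lborel_cball_finite[of "0::(real,'n) vec" R] by (simp add: ennreal_indicator)
   qed (use inj d\<Phi> in \<open>auto intro!: borel_measurable_indicator\<close>)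
   also have "... = (\<integral>x. ennreal (indicator (cball 0 R) x * det (mat 1 + s *R matrix (Y' x))))"
    unfolding m using ball pos[OF s] by (intro nn_integral_cong) (simp add: indicator_def mult.commute less_imp_le)
   finally show ?thesis by simp
  qed
 qed
qed

lemma esym_zero_of_degree: "k > CARD('n) ==> esym k M = 0" for M :: "real^'n^'n"
 unfolding esym_def using degree_char_poly_rev[of M] by (simp add: coeff_eq_0)

text \<open>The determinant in \<open>volume_near_identity\<close> expands into
  \<open>esym k\<close> with coefficient \<open>s ^ k\<close>. Its integral is constant for small
  \<open>s\<close>, so every coefficient except that of \<open>s ^ 0\<close> vanishes.\<close>

lemma integral_esym_derivative_wellorder:
 fixes Y :: "real^'n::{finite,wellorder} => real^'n::_"
 assumes der: "\<And>x. (Y has_derivative Y' x) (at x)"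
  and cont: "\<And>v. continuous_on UNIV (\<lambda>x. Y' x v)"
  and supp: "\<And>x. norm x \<ge> R ==> Y x = 0" and k: "k > 0"
 shows "(LINT x|lborel. indicator (cball 0 R) x *R esym k (matrix (Y' x))) = 0"
proof -
 obtain s0 where s0: "s0 > 0" "\<And>s x. 0 < s ==> s < s0 ==> det (mat 1 + s *R matrix (Y' x)) > 0"
  "\<And>s. 0 < s ==> s < s0 ==>
   (\<integral>x. ennreal (indicator (cball 0 R) x * det (mat 1 + s *R matrix (Y' x)))) = emeasure lborel (cball (0::(real,'n) vec) R)"
  using volume_near_identity[of Y Y' R] der cont supp by blast
 define c where "c k = (LINT x|lborel. indicator (cball 0 R) x *R esym k (matrix (Y' x)))" for k
 have "continuous_on UNIV (\<lambda>x. esym k (matrix (Y' x)))" for k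
  by (rule continuous_on_esym) (auto simp: matrix_def intro!: continuous_on_component cont)
 hence int: "integrable lborel (\<lambda>x. indicator (cball 0 R) x *R esym k (matrix (Y' x)))" for k
  by (intro borel_integrable_compact) (auto intro: continuous_on_subset)
 let ?vol = "measure lborel (cball (0::(real,'n) vec) R)"
 have "(\<Sum>k\<le>CARD('n). monom (c k) k) = [:?vol:]"
 proof (rule poly_eq_near_0[OF s0(1)])
  fix s assume s: "0 < s" "s < s0"
  have e: "indicator (cball 0 R) x * det (mat 1 + s *R matrix (Y' x)) =
   (\<Sum>k\<le>CARD('n). s ^ k *R (indicator (cball 0 R) x *R esym k (matrix (Y' x))))" for x
   unfolding det_expand_esym by (simp add: sum_distrib_left mult_ac)
  have "poly (\<Sum>k\<le>CARD('n). monom (c k) k) s = (\<Sum>k\<le>CARD('n). s ^ k *R c k)"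
   by (simp add: poly_sum poly_monom mult.commute)
  also have "... = (LINT x|lborel. indicator (cball 0 R) x * det (mat 1 + s *R matrix (Y' x)))"
   unfolding e c_def using int by (subst Bochner_Integration.integral_sum) auto
  also have "... = ?vol"
  proof -
   have nn: "0 \<le> indicator (cball 0 R) x * det (mat 1 + s *R matrix (Y' x))" for x
    using s0(2)[OF s, of x] by (simp add: indicator_def less_imp_le)
   have "integrable lborel (\<lambda>x. indicator (cball 0 R) x * det (mat 1 + s *R matrix (Y' x)))"
    unfolding e using int by (intro Bochner_Integration.integrable_sum) auto
   moreover have "AE x in lborel. 0 \<le> indicator (cball 0 R) x * det (mat 1 + s *R matrix (Y' x))"
    using nn by simp
   ultimately have "ennreal (LINT x|lborel. indicator (cball 0 R) x * det (mat 1 + s *R matrix (Y' x))) = (\<integral>x. ennreal (indicator (cball 0 R) x * det (mat 1 + s *R matrix (Y' x))))"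
    by (rule nn_integral_eq_integral[symmetric])
   hence eq: "ennreal (LINT x|lborel. indicator (cball 0 R) x * det (mat 1 + s *R matrix (Y' x))) = emeasure lborel (cball (0::(real,'n) vec) R)"
    unfolding s0(3)[OF s] .
   have "(LINT x|lborel. indicator (cball 0 R) x * det (mat 1 + s *R matrix (Y' x))) \<ge> 0"
    by (rule Bochner_Integration.integral_nonneg) (rule nn)
   thus ?thesis unfolding measure_def eq[symmetric] by simp
  qed
  finally show "poly (\<Sum>k\<le>CARD('n). monom (c k) k) s = poly [:?vol:] s" by simp
 qed
 hence "coeff (\<Sum>k\<le>CARD('n). monom (c k) k) k = coeff [:?vol:] k" by simp
 hence z: "k \<le> CARD('n) ==> c k = 0"
  using k by (simp add: coeff_sum coeff_pCons split: nat.splits)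
 show ?thesis
 proof (cases "k \<le> CARD('n)")
  case True
  thus ?thesis using z by (simp add: c_def)
 next
  case False
  thus ?thesis by (simp add: esym_zero_of_degree)
 qed
qed

theorem integral_esym_derivative:
 fixes Y :: "real^'m => real^'m"
 assumes der: "\<And>x. (Y has_derivative Y' x) (at x)"
  and cont: "\<And>v. continuous_on UNIV (\<lambda>x. Y' x v)"
  and supp: "\<And>x. norm x \<ge> R ==> Y x = 0" and k: "k > 0"
 shows "(LINT x|lborel. indicator (cball 0 R) x *R esym k (matrix (Y' x))) = 0"
proof -
 have "\<exists>h. bij_betw h (UNIV :: 'm set) (UNIV :: 'm wo set)"
  by (rule finite_same_card_bij) (auto simp: card_wo)
 then obtain h where h: "bij (h :: 'm => 'm wo)" by blast
 have hi: "inv h (h i) = i" "h (inv h j) = j" for i j using h by (auto simp: bij_def surj_f_inv_f)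
 define L :: "real^'m wo => real^'m" where "L x = (\<chi> i. x $ h i)" for x
 define L' :: "real^'m => real^'m wo" where "L' x = (\<chi> a. x $ inv h a)" for x
 have LL: "L (L' x) = x" "L' (L y) = y" for x y by (simp_all add: L_def L'_def vec_eq_iff hi)
 have linL: "linear L" and linL': "linear L'" by (auto simp: L_def L'_def linear_iff vec_eq_iff)
 have normL: "norm (L x) = norm x" for x
 proof -
  have "(\<Sum>i\<in>UNIV. (x $ h i)\<^sup>2) = (\<Sum>a\<in>UNIV. (x $ a)\<^sup>2)"
   using sum.reindex_bij_betw[OF h, of "\<lambda>a. (x $ a)\<^sup>2"] by simp
  thus ?thesis by (simp add: norm_vec_def L2_set_def L_def)
 qed
 have normL': "norm (L' x) = norm x" for x using normL[of "L' x"] by (simp add: LL)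
 have distr: "distr lborel borel L = lborel"
  by (rule lborel_distr_isometry[OF linL normL]) (simp add: card_wo)
 have [measurable]: "L \<in> borel_measurable borel"
  using linL linear_continuous_on linear_conv_bounded_linear borel_measurable_continuous_onI by blast
 let ?Z = "\<lambda>x. L' (Y (L x))" and ?Z' = "\<lambda>x v. L' (Y' (L x) (L v))"
 have m: "matrix (?Z' x) = (\<chi> a b. matrix (Y' (L x)) $ inv h a $ inv h b)" for x
 proof -
  have ax: "L (axis b 1) = axis (inv h b) 1" for b
   using hi by (auto simp: L_def axis_def vec_eq_iff)
  show ?thesis by (simp add: vec_eq_iff matrix_def L'_def ax)
 qed
 have "(LINT x|lborel. indicator (cball 0 R) x *R esym k (matrix (?Z' x))) = 0"
 proof (rule integral_esym_derivative_wellorder[where Y="?Z"])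
  fix x :: "real^'m wo"
  have "bounded_linear L" "bounded_linear L'" using linL linL' by (simp_all add: linear_conv_bounded_linear)
  thus "(?Z has_derivative ?Z' x) (at x)"
   by (intro bounded_linear.has_derivative[of L'] has_derivative_compose[OF _ der] bounded_linear_imp_has_derivative)
  show "norm x \<ge> R ==> ?Z x = 0" using supp[of "L x"] normL[of x] by (simp add: linear_0[OF linL'])
 next
  fix v :: "real^'m wo"
  have cL: "continuous_on UNIV L" and cL': "continuous_on UNIV L'"
   using linL linL' linear_continuous_on linear_conv_bounded_linear by blast+
  have "continuous_on UNIV (\<lambda>x. Y' (L x) (L v))"
   by (rule continuous_on_compose2[OF cont cL]) simp
  thus "continuous_on UNIV (\<lambda>x. ?Z' x v)"
   by (rule continuous_on_compose2[OF cL']) simp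
 qed (rule k)
 also have "(\<lambda>x. indicator (cball 0 R) x *R esym k (matrix (?Z' x))) = (\<lambda>x. indicator (cball 0 R) (L x) *R esym k (matrix (Y' (L x))))"
  unfolding m esym_reindex[OF h] by (simp add: indicator_def normL)
 also have "(LINT x|lborel. indicator (cball 0 R) (L x) *R esym k (matrix (Y' (L x)))) = (LINT x|distr lborel borel L. indicator (cball 0 R) x *R esym k (matrix (Y' x)))"
 proof (rule integral_distr[symmetric])
  have "continuous_on UNIV (\<lambda>x. esym k (matrix (Y' x)))"
   by (rule continuous_on_esym) (auto simp: matrix_def intro!: continuous_on_component cont)
  hence "(\<lambda>x. esym k (matrix (Y' x))) \<in> borel_measurable borel" by (rule borel_measurable_continuous_onI)
  thus "(\<lambda>x. indicator (cball 0 R) x *R esym k (matrix (Y' x))) \<in> borel_measurable borel"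
   by (intro borel_measurable_scaleR borel_measurable_indicator) auto
 qed auto
 finally show ?thesis unfolding distr by simp
qed

section \<open>Even support functions\<close>

text \<open>\<open>X\<close> and \<open>A\<close> are the gradient and the Hessian of
  \<open>h\<close>. The factor \<open>\<bar>c\<bar>\<close> in the homogeneity encodes evenness. The
  Hessian is positive semidefinite only: it annihilates the radial direction and may degenerate in
  others.\<close>

locale even_support =
 fixes h :: "real^'m => real" and X :: "real^'m => real^'m" and A :: "real^'m => real^'m => real^'m"
 assumes hom: "\<And>c x. h (c *R x) = \<bar>c\<bar> * h x"
  and pos: "\<And>x. x \<noteq> 0 ==> h x > 0"
  and dh: "\<And>x. x \<noteq> 0 ==> (h has_derivative (\<lambda>v. X x \<bullet> v)) (at x)"
  and dX: "\<And>x. x \<noteq> 0 ==> (X has_derivative A x) (at x)"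
  and symA: "\<And>x v w. x \<noteq> 0 ==> A x v \<bullet> w = v \<bullet> A x w"
  and contA: "\<And>v. continuous_on (- {0}) (\<lambda>x. A x v)"
  and psd: "\<And>x v. x \<noteq> 0 ==> A x v \<bullet> v \<ge> 0"
begin

lemma h_zero [simp]: "h 0 = 0"
 using hom[of 0 0] by simp

lemma h_nonneg: "h x \<ge> 0"
 using pos[of x] by (cases "x = 0") auto

lemma linA: "x \<noteq> 0 ==> linear (A x)"
 using dX has_derivative_linear by blast

text \<open>Differentiation of \<open>h (c *R y) = \<bar>c\<bar> * h y\<close> in \<open>y\<close>;
  the sign records that the gradient of an even function is odd.\<close>

lemma X_scale:
 assumes "c \<noteq> 0" "x \<noteq> 0"
 shows "X (c *R x) = sgn c *R X x"
proof -
 have "((\<lambda>y. h (c *R y)) has_derivative (\<lambda>v. X (c *R x) \<bullet> (c *R v))) (at x)"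
  by (rule has_derivative_compose[OF _ dh]) (use assms in \<open>auto intro!: derivative_eq_intros\<close>)
 moreover have "((\<lambda>y. h (c *R y)) has_derivative (\<lambda>v. \<bar>c\<bar> * (X x \<bullet> v))) (at x)"
  unfolding hom by (rule has_derivative_mult_right[OF dh[OF assms(2)]])
 ultimately have "(\<lambda>v. X (c *R x) \<bullet> (c *R v)) = (\<lambda>v. \<bar>c\<bar> * (X x \<bullet> v))"
  by (rule has_derivative_unique)
 hence "c * (X (c *R x) \<bullet> v) = \<bar>c\<bar> * (X x \<bullet> v)" for v by (metis inner_scaleR_right)
 hence "(c *R X (c *R x) - \<bar>c\<bar> *R X x) \<bullet> v = 0" for v by (simp add: inner_diff_left)
 hence "c *R X (c *R x) = \<bar>c\<bar> *R X x" by (metis inner_eq_zero_iff right_minus_eq)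
 hence "(1 / c) *R (c *R X (c *R x)) = (1 / c) *R (\<bar>c\<bar> *R X x)" by simp
 thus ?thesis using assms by (simp add: sgn_real_def abs_real_def split: if_splits)
qed

lemma A_scale:
 assumes "c \<noteq> 0" "x \<noteq> 0"
 shows "A (c *R x) v = (1 / \<bar>c\<bar>) *R A x v"
proof -
 have "((\<lambda>y. X (c *R y)) has_derivative (\<lambda>v. A (c *R x) (c *R v))) (at x)"
  by (rule has_derivative_compose[OF _ dX]) (use assms in \<open>auto intro!: derivative_eq_intros\<close>)
 moreover have "((\<lambda>y. X (c *R y)) has_derivative (\<lambda>v. sgn c *R A x v)) (at x)"
 proof (rule has_derivative_transform_within_open[OF has_derivative_scaleR_right[OF dX[OF assms(2)]], of "- {0}"])
  show "sgn c *R X y = X (c *R y)" if "y \<in> - {0}" for y using X_scale assms that by simp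
 qed (use assms in auto)
 ultimately have "(\<lambda>v. A (c *R x) (c *R v)) = (\<lambda>v. sgn c *R A x v)"
  by (rule has_derivative_unique)
 hence "A (c *R x) (c *R ((1 / c) *R v)) = sgn c *R A x ((1 / c) *R v)" by metis
 thus ?thesis using assms
  by (simp add: linear_scale[OF linA[OF assms(2)]] sgn_real_def abs_real_def split: if_splits)
qed

text \<open>Euler's identity for degree 1, by differentiation along the ray through
  \<open>x\<close>.\<close>

lemma X_inner: assumes "x \<noteq> 0" shows "X x \<bullet> x = h x"
proof -
 have "((\<lambda>c. h (c *R x)) has_derivative (\<lambda>s. X (1 *R x) \<bullet> (s *R x))) (at 1)"
  by (rule has_derivative_compose[OF _ dh]) (use assms in \<open>auto intro!: derivative_eq_intros\<close>)
 moreover have "((\<lambda>c. h (c *R x)) has_derivative (\<lambda>s. s * h x)) (at 1)"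
 proof (rule has_derivative_transform_within_open[of "\<lambda>c. c * h x" _ _ _ "{0<..}"])
  show "((\<lambda>c. c * h x) has_derivative (\<lambda>s. s * h x)) (at 1)" by (auto intro!: derivative_eq_intros)
 qed (auto simp: hom)
 ultimately have "(\<lambda>s. X (1 *R x) \<bullet> (s *R x)) = (\<lambda>s. s * h x)" by (rule has_derivative_unique)
 hence "X (1 *R x) \<bullet> (1 *R x) = 1 * h x" by metis
 thus ?thesis by simp
qed

text \<open>Euler's identity for degree 0: \<open>X\<close> is constant along rays.\<close>

lemma A_radial: assumes "x \<noteq> 0" shows "A x x = 0"
proof -
 have "((\<lambda>c. X (c *R x)) has_derivative (\<lambda>s. A (1 *R x) (s *R x))) (at 1)"
  by (rule has_derivative_compose[OF _ dX]) (use assms in \<open>auto intro!: derivative_eq_intros\<close>)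
 moreover have "((\<lambda>c. X (c *R x)) has_derivative (\<lambda>s. 0)) (at 1)"
 proof (rule has_derivative_transform_within_open[of "\<lambda>c. X x" _ _ _ "{0<..}"])
  show "X x = X (c *R x)" if "c \<in> {0<..}" for c using X_scale[of c x] assms that by simp
 qed auto
 ultimately have "(\<lambda>s. A (1 *R x) (s *R x)) = (\<lambda>s. 0)" by (rule has_derivative_unique)
 hence "A (1 *R x) (1 *R x) = 0" by metis
 thus ?thesis by simp
qed

lemma A_inner_radial: "x \<noteq> 0 ==> A x v \<bullet> x = 0"
 using symA[of x v x] A_radial[of x] by simp

lemma cont_h: "continuous_on (- {0}) h"
 using dh by (intro continuous_at_imp_continuous_on) (auto intro: has_derivative_continuous)

lemma cont_X: "continuous_on (- {0}) X"
 using dX by (intro continuous_at_imp_continuous_on) (auto intro: has_derivative_continuous)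

lemma sphere_bound:
 fixes f :: "real^'m => real"
 assumes "continuous_on (- {0}) f"
 obtains B where "B > 0" "\<And>x. norm x = 1 ==> \<bar>f x\<bar> \<le> B"
proof -
 have "bounded (f ` sphere 0 1)"
  by (intro compact_imp_bounded compact_continuous_image continuous_on_subset[OF assms]) auto
 then obtain B where "B > 0" "\<forall>x\<in>f ` sphere 0 1. norm x \<le> B" unfolding bounded_pos by blast
 thus ?thesis by (intro that[of B]) auto
qed

text \<open>The potential, its gradient \<open>G\<close> and its Hessian \<open>H\<close>. Squaring
  \<open>h\<close> adds the rank-one term in \<open>X\<close>, which makes the radial direction
  nondegenerate, and gives \<open>H\<close> degree 0, so that bounds on the sphere are
  global.\<close>

definition U :: "real^'m => real" where "U x = (h x)^2 / 2"
definition G :: "real^'m => real^'m" where "G x = h x *R X x"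
definition H :: "real^'m => real^'m => real^'m" where "H x v = (X x \<bullet> v) *R X x + h x *R A x v"

lemma U_scale: "U (c *R x) = c^2 * U x"
 by (simp add: U_def hom power_mult_distrib)

lemma G_scale: "G (c *R x) = c *R G x"
proof (cases "c = 0 \<or> x = 0")
 case False
 thus ?thesis by (simp add: G_def hom X_scale sgn_real_def abs_real_def)
qed (auto simp: G_def)

lemma H_scale: "c \<noteq> 0 ==> x \<noteq> 0 ==> H (c *R x) v = H x v"
 by (simp add: H_def hom X_scale A_scale sgn_real_def abs_real_def)

lemma H_self: "x \<noteq> 0 ==> H x x = G x"
 by (simp add: H_def G_def X_inner A_radial)

lemma G_inner_self: "G x \<bullet> x = 2 * U x"
 by (cases "x = 0") (simp_all add: G_def U_def X_inner power2_eq_square)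

lemma linH: "x \<noteq> 0 ==> linear (H x)"
 unfolding H_def using linA[of x]
 by (auto simp: linear_iff inner_add_right algebra_simps)

lemma symH: "x \<noteq> 0 ==> H x v \<bullet> w = v \<bullet> H x w"
 by (simp add: H_def inner_add_left inner_add_right symA inner_commute[of v "X x"])

lemma H_sym_form: "x \<noteq> 0 ==> H x v \<bullet> w = (X x \<bullet> v) * (X x \<bullet> w) + h x * (A x v \<bullet> w)"
 by (simp add: H_def inner_add_left)

lemma contH: "continuous_on (- {0}) (\<lambda>x. H x v)"
 unfolding H_def by (intro continuous_intros cont_X cont_h contA)

lemma U_upper: obtains C where "C > 0" "\<And>x. U x \<le> C * (norm x)^2"
proof -
 obtain B where B: "B > 0" "\<And>x. norm x = 1 ==> \<bar>h x\<bar> \<le> B" using sphere_bound[OF cont_h] by metis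
 have "U x \<le> B^2 / 2 * (norm x)^2" for x
 proof (cases "x = 0")
  case False
  have "h x = norm x * h (x /\<^sub>R norm x)" using hom[of "inverse (norm x)" x] False by (simp add: field_simps)
  also have "... \<le> norm x * B" using B(2)[of "x /\<^sub>R norm x"] False by (intro mult_left_mono) auto
  finally have "(h x)^2 \<le> (norm x * B)^2" using h_nonneg by (intro power_mono) auto
  thus ?thesis by (simp add: U_def power_mult_distrib mult.commute)
 qed (simp add: U_def)
 thus ?thesis using B by (intro that[of "B^2 / 2"]) auto
qed

text \<open>At the origin \<open>h\<close> has a corner, but the quadratic bound on \<open>U\<close>
  forces its derivative to vanish there.\<close>

lemma dU: "(U has_derivative (\<lambda>v. G x \<bullet> v)) (at x)"
proof (cases "x = 0")
 case False
 have "((\<lambda>x. h x * h x) has_derivative (\<lambda>v. h x * (X x \<bullet> v) + (X x \<bullet> v) * h x)) (at x)"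
  by (rule has_derivative_mult[OF dh dh]) (use False in auto)
 from has_derivative_mult_right[OF this, of "1/2"] show ?thesis
  by (simp add: U_def[abs_def] G_def power2_eq_square mult.commute)
next
 case True
 obtain C where C: "C > 0" "\<And>x. U x \<le> C * (norm x)^2" using U_upper by metis
 have "(U has_derivative (\<lambda>v. 0)) (at 0)"
  unfolding has_derivative_at_alt
 proof (intro conjI allI impI)
  fix e :: real assume e: "e > 0"
  show "\<exists>d>0. \<forall>y. norm (y - 0) < d \<longrightarrow> norm (U y - U 0 - 0) \<le> e * norm (y - 0)"
  proof (intro exI[of _ "e / C"] conjI allI impI)
   fix y :: "real^'m" assume "norm (y - 0) < e / C"
   hence "C * norm y \<le> e" using C by (simp add: field_simps)
   hence "C * norm y * norm y \<le> e * norm y" by (rule mult_right_mono) simp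
   hence "U y \<le> e * norm y" using C(2)[of y] by (simp add: power2_eq_square mult.assoc)
   moreover have "U y \<ge> 0" by (simp add: U_def)
   ultimately show "norm (U y - U 0 - 0) \<le> e * norm (y - 0)" by (simp add: U_def)
  qed (use e C in simp)
 qed simp
 moreover have "G 0 = 0" by (simp add: G_def)
 ultimately show ?thesis using True by simp
qed

lemma dG: assumes "x \<noteq> 0" shows "(G has_derivative H x) (at x)"
proof -
 have "((\<lambda>x. h x *R X x) has_derivative (\<lambda>v. h x *R A x v + (X x \<bullet> v) *R X x)) (at x)"
  by (rule has_derivative_scaleR[OF dh dX]) (use assms in auto)
 thus ?thesis by (simp add: G_def[abs_def] H_def[abs_def] add.commute)
qed

text \<open>As \<open>H\<close> has degree 0, compactness of the unit sphere and the finitely many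
  axis directions suffice.\<close>

lemma H_upper: obtains C where "C > 0" "\<And>x v. x \<noteq> 0 ==> norm (H x v) \<le> C * norm v"
proof -
 have "\<exists>B>0. \<forall>x. norm x = 1 \<longrightarrow> norm (H x (axis i 1)) \<le> B" for i
 proof -
  have "continuous_on (- {0}) (\<lambda>x. norm (H x (axis i 1)))" by (intro continuous_intros contH)
  from sphere_bound[OF this] obtain B where "B > 0" "\<And>x. norm x = 1 ==> \<bar>norm (H x (axis i 1))\<bar> \<le> B" by metis
  thus ?thesis by auto
 qed
 then obtain B where B: "\<And>i. B i > 0" "\<And>i x. norm x = 1 ==> norm (H x (axis i 1)) \<le> B i" by metis
 define C where "C = (\<Sum>i\<in>UNIV. B i)"
 have "norm (H x v) \<le> C * norm v" if x: "x \<noteq> 0" for x v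
 proof -
  define y where "y = x /\<^sub>R norm x"
  have y: "norm y = 1" "y \<noteq> 0" using x by (auto simp: y_def)
  have "H x v = H y v" using H_scale[of "inverse (norm x)" x v] x by (simp add: y_def)
  also have "... = H y (\<Sum>i\<in>UNIV. v $ i *R axis i 1)" by (simp add: basis_expansion[of v, unfolded scalar_mult_eq_scaleR])
  also have "... = (\<Sum>i\<in>UNIV. v $ i *R H y (axis i 1))"
   by (simp add: linear_sum[OF linH[OF y(2)]] linear_scale[OF linH[OF y(2)]])
  also have "norm ... \<le> (\<Sum>i\<in>UNIV. norm v * B i)"
   by (intro order_trans[OF norm_sum] sum_mono) (auto intro!: mult_mono component_le_norm_cart B y less_imp_le[OF B(1)])
  finally show ?thesis by (simp add: C_def sum_distrib_left mult.commute)
 qed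
 moreover have "C > 0" unfolding C_def by (rule sum_pos) (auto simp: B)
 ultimately show ?thesis by (rule that[rotated])
qed

text \<open>\<open>G\<close> need not be differentiable at the origin, so mean value arguments run
  only along segments that avoid it. If the segment meets 0, both end points lie on one line through
  0, where \<open>G\<close> is linear by homogeneity.\<close>

lemma segment_or_opposite:
 fixes x y :: "real^'m"
 obtains (avoid) "\<And>s. 0 \<le> s ==> s \<le> 1 ==> y + s *R (x - y) \<noteq> 0"
  | (opp) z a b where "x = a *R z" "y = b *R z" "z \<noteq> 0"
proof (cases "\<forall>s. 0 \<le> s \<and> s \<le> 1 \<longrightarrow> y + s *R (x - y) \<noteq> 0")
 case False
 then obtain s where s: "y + s *R (x - y) = 0" by blast
 show ?thesis
 proof (cases "x - y = 0")
  case True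
  hence "x = 0" "y = 0" using s by auto
  thus ?thesis using opp[of 0 "axis undefined 1" 0] by simp
 next
  case ne: False
  have "y = (- s) *R (x - y)" using s by (simp add: eq_neg_iff_add_eq_0)
  moreover from this have "x = (1 - s) *R (x - y)" by (simp add: algebra_simps)
  ultimately show ?thesis using opp ne by blast
 qed
qed blast

lemma G_lipschitz: obtains M where "M > 0" "\<And>x y. norm (G x - G y) \<le> M * norm (x - y)"
proof -
 obtain C where C: "C > 0" "\<And>x v. x \<noteq> 0 ==> norm (H x v) \<le> C * norm v" using H_upper by metis
 have "norm (G x - G y) \<le> C * norm (x - y)" for x y
 proof (cases x y rule: segment_or_opposite)
  case avoid
  have seg: "z \<noteq> 0" if z: "z \<in> closed_segment y x" for z
  proof -
   obtain u where "z = (1 - u) *R y + u *R x" "0 \<le> u" "u \<le> 1" using z by (auto simp: in_segment)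
   moreover from this have "z = y + u *R (x - y)"
    by (simp add: scaleR_left_diff_distrib scaleR_right_diff_distrib)
   ultimately show ?thesis using avoid[of u] by simp
  qed
  show ?thesis
  proof (rule differentiable_bound[of "closed_segment y x" G H])
   show "(G has_derivative H z) (at z within closed_segment y x)" if "z \<in> closed_segment y x" for z
    using dG[OF seg[OF that]] by (rule has_derivative_at_withinI)
   show "onorm (H z) \<le> C" if "z \<in> closed_segment y x" for z
    using C(2)[OF seg[OF that]] by (rule onorm_le)
  qed auto
 next
  case (opp z a b)
  have "G x - G y = (a - b) *R H z z" using opp by (simp add: G_scale H_self algebra_simps)
  hence "norm (G x - G y) \<le> \<bar>a - b\<bar> * (C * norm z)" using C(2)[of z z] opp by (simp add: mult_left_mono)
  also have "... = C * norm (x - y)" using opp by (simp add: scaleR_diff_left[symmetric])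
  finally show ?thesis .
 qed
 thus ?thesis using C(1) that by blast
qed

end

text \<open>Nondegeneracy on tangent vectors gives the uniform lower bound on \<open>H\<close> from
  which strong convexity of \<open>U\<close> follows.\<close>

locale strict_even_support = even_support h X A
 for h :: "real^'m => real" and X :: "real^'m => real^'m" and A :: "real^'m => real^'m => real^'m" +
 assumes pd: "\<And>x v. x \<noteq> 0 ==> v \<noteq> 0 ==> v \<bullet> x = 0 ==> A x v \<bullet> v > 0"
begin

text \<open>If \<open>X x \<bullet> v\<close> is not 0, the rank-one term is positive. Otherwise
  \<open>v\<close> is not radial, because \<open>X x \<bullet> x = h x > 0\<close>, and
  \<open>A\<close> acts on its nonzero tangential part alone.\<close>

lemma H_pos: assumes x: "x \<noteq> 0" and v: "v \<noteq> 0" shows "H x v \<bullet> v > 0"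
proof (cases "X x \<bullet> v = 0")
 case False
 have "H x v \<bullet> v = (X x \<bullet> v)^2 + h x * (A x v \<bullet> v)" by (simp add: H_sym_form x power2_eq_square)
 moreover have "h x * (A x v \<bullet> v) \<ge> 0" using h_nonneg psd[OF x] by simp
 ultimately show ?thesis using False by (simp add: add_pos_nonneg)
next
 case True
 define s where "s = (v \<bullet> x) / (x \<bullet> x)"
 define w where "w = v - s *R x"
 have wx: "w \<bullet> x = 0" using x by (simp add: w_def s_def inner_diff_left)
 have "w \<noteq> 0"
 proof
  assume "w = 0"
  hence "v = s *R x" by (simp add: w_def)
  hence "s * h x = 0" "s \<noteq> 0" using True v X_inner[OF x] by auto
  thus False using pos[OF x] by simp
 qed
 have "A x v = A x w" by (simp add: w_def linear_diff[OF linA[OF x]] linear_scale[OF linA[OF x]] A_radial[OF x])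
 hence "A x v \<bullet> v = A x w \<bullet> w"
  using A_inner_radial[OF x, of w] by (simp add: w_def inner_diff_right A_inner_radial[OF x])
 also have "... > 0" by (rule pd[OF x \<open>w \<noteq> 0\<close> wx])
 finally show ?thesis using True pos[OF x] by (simp add: H_sym_form x)
qed

lemma H_lower: obtains c where "c > 0" "\<And>x v. x \<noteq> 0 ==> H x v \<bullet> v \<ge> c * (norm v)^2"
proof -
 let ?f = "\<lambda>z :: (real^'m) \<times> (real^'m). H (fst z) (snd z) \<bullet> snd z"
 let ?K = "sphere 0 1 \<times> sphere 0 1 :: ((real^'m) \<times> (real^'m)) set"
 have "continuous_on ?K (\<lambda>z. \<Sum>i\<in>UNIV. snd z $ i * (H (fst z) (axis i 1) \<bullet> snd z))"
  by (intro continuous_intros continuous_on_compose2[OF contH]) auto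
 moreover have "(\<Sum>i\<in>UNIV. snd z $ i * (H (fst z) (axis i 1) \<bullet> snd z)) = ?f z" if "z \<in> ?K" for z
 proof -
  have nz: "fst z \<noteq> 0" using that by auto
  have "H (fst z) (snd z) = H (fst z) (\<Sum>i\<in>UNIV. snd z $ i *R axis i 1)"
   by (simp add: basis_expansion[of "snd z", unfolded scalar_mult_eq_scaleR])
  also have "... = (\<Sum>i\<in>UNIV. snd z $ i *R H (fst z) (axis i 1))"
   by (simp add: linear_sum[OF linH[OF nz]] linear_scale[OF linH[OF nz]])
  finally show ?thesis by (simp add: inner_sum_left)
 qed
 ultimately have "continuous_on ?K ?f" by (simp cong: continuous_on_cong)
 moreover have "compact ?K" by (intro compact_Times) auto
 moreover have "(axis undefined 1, axis undefined 1) \<in> ?K" by (simp add: norm_axis_1)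
 ultimately obtain z where z: "z \<in> ?K" "\<And>z'. z' \<in> ?K ==> ?f z \<le> ?f z'"
  using continuous_attains_inf[of ?K ?f] by blast
 have "?f z > 0" using z(1) by (intro H_pos) auto
 moreover have "H x v \<bullet> v \<ge> ?f z * (norm v)^2" if x: "x \<noteq> 0" for x v
 proof (cases "v = 0")
  case False
  define y where "y = x /\<^sub>R norm x"
  define w where "w = v /\<^sub>R norm v"
  have yw: "norm y = 1" "norm w = 1" "y \<noteq> 0" using x False by (auto simp: y_def w_def)
  have v: "v = norm v *R w" using False by (simp add: w_def)
  have "H x v = H y v" using H_scale[of "inverse (norm x)" x v] x by (simp add: y_def)
  also have "... = norm v *R H y w" by (subst v) (simp add: linear_scale[OF linH[OF yw(3)]])
  finally have "H x v \<bullet> v = norm v * (norm v * (H y w \<bullet> w))" by (subst (2) v) simp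
  also have "... \<ge> norm v * (norm v * ?f z)" using z(2)[of "(y, w)"] yw by (intro mult_left_mono) auto
  finally show ?thesis by (simp add: power2_eq_square mult_ac)
 qed (simp add: linear_0[OF linH[OF x]])
 ultimately show ?thesis using that by blast
qed

lemma G_strongly_monotone:
 assumes c: "\<And>x v. x \<noteq> 0 ==> H x v \<bullet> v \<ge> c * (norm v)^2"
 shows "(G x - G y) \<bullet> (x - y) \<ge> c * (norm (x - y))^2"
proof (cases x y rule: segment_or_opposite)
 case avoid
 define \<phi> where "\<phi> s = G (y + s *R (x - y)) \<bullet> (x - y)" for s
 have d: "(\<phi> has_real_derivative H (y + s *R (x - y)) (x - y) \<bullet> (x - y)) (at s)" if "0 \<le> s" "s \<le> 1" for s
 proof -
  have nz: "y + s *R (x - y) \<noteq> 0" using avoid that by blast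
  have "((\<lambda>s. G (y + s *R (x - y))) has_derivative (\<lambda>r. H (y + s *R (x - y)) (r *R (x - y)))) (at s)"
   by (rule has_derivative_compose[where f="\<lambda>s. y + s *R (x - y)" and g=G, OF _ dG[OF nz]]) (auto intro!: derivative_eq_intros)
  hence "(\<phi> has_derivative (\<lambda>r. H (y + s *R (x - y)) (r *R (x - y)) \<bullet> (x - y))) (at s)"
   unfolding \<phi>_def by (rule has_derivative_inner_left)
  thus ?thesis
   by (rule has_derivative_imp_has_field_derivative) (simp add: linear_scale[OF linH[OF nz]])
 qed
 obtain z where z: "0 < z" "z < 1" "\<phi> 1 - \<phi> 0 = (1 - 0) * (H (y + z *R (x - y)) (x - y) \<bullet> (x - y))"
  using MVT2[of 0 1 \<phi> "\<lambda>s. H (y + s *R (x - y)) (x - y) \<bullet> (x - y)"] d by auto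
 have "y + z *R (x - y) \<noteq> 0" using avoid z by simp
 from c[OF this, of "x - y"] show ?thesis using z(3) by (simp add: \<phi>_def inner_diff_left)
next
 case (opp z a b)
 have "(G x - G y) \<bullet> (x - y) = (a - b)^2 * (H z z \<bullet> z)"
  using opp by (simp add: G_scale H_self scaleR_diff_left[symmetric] power2_eq_square)
 also have "... \<ge> (a - b)^2 * (c * (norm z)^2)" using c opp by (intro mult_left_mono) auto
 also have "(a - b)^2 * (c * (norm z)^2) = c * (norm (x - y))^2"
  using opp by (simp add: scaleR_diff_left[symmetric] power_mult_distrib)
 finally show ?thesis .
qed

text \<open>The mean value theorem turns strong monotonicity of the gradient into strong convexity;
  \<open>U\<close> is differentiable everywhere, so segments through the origin are covered.\<close>

lemma U_strongly_convex:
 assumes c: "\<And>x v. x \<noteq> 0 ==> H x v \<bullet> v \<ge> c * (norm v)^2"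
 shows "U (x + v) \<ge> U x + G x \<bullet> v + c / 2 * (norm v)^2"
proof -
 define \<phi> where "\<phi> s = U (x + s *R v) - s * (G x \<bullet> v) - c / 2 * s^2 * (norm v)^2" for s
 have d: "(\<phi> has_real_derivative (G (x + s *R v) \<bullet> v - G x \<bullet> v - c * s * (norm v)^2)) (at s)" for s
 proof -
  have "((\<lambda>s. U (x + s *R v)) has_derivative (\<lambda>r. G (x + s *R v) \<bullet> (r *R v))) (at s)"
   by (rule has_derivative_compose[OF _ dU]) (auto intro!: derivative_eq_intros)
  hence "((\<lambda>s. U (x + s *R v)) has_real_derivative (G (x + s *R v) \<bullet> v)) (at s)"
   by (rule has_derivative_imp_has_field_derivative) simp
  thus ?thesis unfolding \<phi>_def by (auto intro!: derivative_eq_intros)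
 qed
 obtain z where z: "0 < z" "z < 1" "\<phi> 1 - \<phi> 0 = (1 - 0) * (G (x + z *R v) \<bullet> v - G x \<bullet> v - c * z * (norm v)^2)"
  using MVT2[of 0 1 \<phi>, OF _ d] by auto
 have "z * (G (x + z *R v) \<bullet> v - G x \<bullet> v) \<ge> c * (z * norm v)^2"
  using G_strongly_monotone[OF c, of "x + z *R v" x] z by (simp add: inner_diff_left)
 hence "z * (G (x + z *R v) \<bullet> v - G x \<bullet> v - c * z * (norm v)^2) \<ge> 0"
  by (simp add: power_mult_distrib power2_eq_square algebra_simps)
 hence "\<phi> 1 - \<phi> 0 \<ge> 0" using z by (simp add: zero_le_mult_iff)
 thus ?thesis by (simp add: \<phi>_def)
qed

end

text \<open>A principal minor, padded with the identity so that the type of the matrix does not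
  depend on \<open>J\<close>.\<close>

definition gram_det :: "'w::finite set => ('w => 'w => real) => real" where
 "gram_det J M = det (\<chi> a b. if a \<in> J \<and> b \<in> J then M a b else if a = b then 1 else 0)"

lemma matrix_apply: "linear f ==> matrix f *v x = f x" for f :: "real^'n => real^'k"
 by (simp add: matrix_works)

text \<open>Every matrix on the segment from the identity to \<open>M\<close> is positive definite,
  hence invertible, so the determinant keeps its sign.\<close>

lemma det_pos_of_positive_definite:
 fixes M :: "real^'n^'n"
 assumes "\<And>v. v \<noteq> 0 ==> (M *v v) \<bullet> v > 0"
 shows "det M > 0"
proof (rule ccontr)
 define N where "N t = (1 - t) *R mat 1 + t *R M" for t :: real
 assume "\<not> det M > 0"
 hence "det (N 1) \<le> 0" "0 \<le> det (N 0)" by (auto simp: N_def)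
 moreover have "continuous_on {0..1} (\<lambda>t. det (N t))"
  unfolding det_def N_def by (intro continuous_intros)
 ultimately obtain t where t: "0 \<le> t" "t \<le> 1" "det (N t) = 0"
  using IVT2'[of "\<lambda>t. det (N t)" 1 0 0] by auto
 hence "\<not> invertible (N t)" by (simp add: invertible_det_nz)
 hence "\<not> (\<forall>v. N t *v v = 0 \<longrightarrow> v = 0)"
  unfolding invertible_left_inverse matrix_left_invertible_ker .
 then obtain v where v: "N t *v v = 0" "v \<noteq> 0" by blast
 have "(N t *v v) \<bullet> v = (1 - t) * (v \<bullet> v) + t * ((M *v v) \<bullet> v)"
  by (simp add: N_def matrix_vector_mult_add_rdistrib scaleR_matrix_vector_assoc[symmetric] inner_add_left)
 also have "... > 0"
 proof (cases "t = 0")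
  case False
  thus ?thesis using t v assms[OF v(2)] by (intro add_nonneg_pos mult_nonneg_nonneg mult_pos_pos) auto
 qed (use v in simp)
 finally show False using v by simp
qed

lemma det_zero_of_kernel:
 fixes M :: "real^'n^'n"
 assumes "M *v v = 0" "v \<noteq> 0"
 shows "det M = 0"
proof (rule ccontr)
 assume "det M \<noteq> 0"
 hence "invertible M" by (simp add: invertible_det_nz)
 hence "\<forall>v. M *v v = 0 \<longrightarrow> v = 0"
  unfolding invertible_left_inverse matrix_left_invertible_ker .
 thus False using assms by blast
qed

context even_support
begin

lemma linH': "linear (H x)"
proof (cases "x = 0")
 case True
 thus ?thesis by (auto simp: H_def linear_iff inner_add_right scaleR_add_left)
qed (rule linH)

end

text \<open>A slice is parametrised by \<open>comb\<close>, with adjoint \<open>adj\<close>. The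
  coordinates outside \<open>I\<close>, kept by \<open>rest\<close>, are idle and receive a Gaussian
  weight of their own, so that slices of every dimension are handled on the same space
  \<open>real^'w\<close>.\<close>

definition comb :: "'w set => ('w => real^'m) => real^'w::finite => real^'m" where
 "comb I t p = (\<Sum>a\<in>I. p $ a *R t a)"

definition rest :: "'w set => real^'w => real^'w::finite" where
 "rest I p = (\<chi> a. if a \<in> I then 0 else p $ a)"

definition adj :: "'w set => ('w => real^'m) => real^'m => real^'w::finite" where
 "adj I t y = (\<chi> a. if a \<in> I then t a \<bullet> y else 0)"

lemma linear_comb: "linear (comb I t)"
 by (auto simp: comb_def linear_iff scaleR_add_left sum.distrib scaleR_sum_right)

lemma linear_rest: "linear (rest I)"
 by (auto simp: rest_def linear_iff vec_eq_iff)

lemma linear_adj: "linear (adj I t)"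
 by (auto simp: adj_def linear_iff vec_eq_iff inner_add_right)

lemma adj_inner: "adj I t y \<bullet> p = y \<bullet> comb I t p"
proof -
 have "adj I t y \<bullet> p = (\<Sum>a\<in>UNIV. if a \<in> I then p $ a * (t a \<bullet> y) else 0)"
  unfolding adj_def inner_vec_def by (rule sum.cong) auto
 also have "... = (\<Sum>a\<in>I. p $ a * (t a \<bullet> y))" by (simp add: sum.If_cases)
 finally show ?thesis by (simp add: comb_def inner_sum_right inner_commute)
qed

lemma rest_inner: "rest I p \<bullet> v = rest I p \<bullet> rest I v"
 unfolding inner_vec_def by (rule sum.cong) (auto simp: rest_def)

lemma comb_axis: "comb I t (axis b 1) = (if b \<in> I then t b else 0)"
proof -
 have "comb I t (axis b 1) = (\<Sum>a\<in>I. if a = b then t a else 0)"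
  unfolding comb_def axis_def by (rule sum.cong) auto
 thus ?thesis by simp
qed

lemma rest_axis: "rest I (axis b 1) = (if b \<in> I then 0 else axis b 1)"
 by (auto simp: rest_def axis_def vec_eq_iff)

lemma rest_decomp: "norm (rest I p) \<le> norm p"
proof -
 have "(norm (rest I p))^2 = rest I p \<bullet> p" using rest_inner[of I p p] by (simp add: dot_square_norm)
 also have "... \<le> norm (rest I p) * norm p" by (rule norm_cauchy_schwarz)
 finally have "norm (rest I p) * norm (rest I p) \<le> norm (rest I p) * norm p" by (simp add: power2_eq_square)
 thus ?thesis by (cases "norm (rest I p) = 0") (auto simp: mult_le_cancel_left)
qed

lemma gram_det_expand:
 "gram_det J N = (\<Sum>\<pi> | \<pi> permutes J. of_int (sign \<pi>) * (\<Prod>a\<in>J. N a (\<pi> a)))"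
proof -
 let ?M = "\<lambda>a b. if a \<in> J \<and> b \<in> J then N a b else if a = b then 1 else 0"
 have "gram_det J N = (\<Sum>\<pi> | \<pi> permutes UNIV. of_int (sign \<pi>) * (\<Prod>a\<in>UNIV. ?M a (\<pi> a)))"
  by (simp add: gram_det_def det_def)
 also have "... = (\<Sum>\<pi> | \<pi> permutes J. of_int (sign \<pi>) * (\<Prod>a\<in>UNIV. ?M a (\<pi> a)))"
 proof (rule sum.mono_neutral_right)
  show "\<forall>\<pi>\<in>{\<pi>. \<pi> permutes UNIV} - {\<pi>. \<pi> permutes J}. of_int (sign \<pi>) * (\<Prod>a\<in>UNIV. ?M a (\<pi> a)) = 0"
  proof
   fix \<pi> assume \<pi>: "\<pi> \<in> {\<pi>. \<pi> permutes UNIV} - {\<pi>. \<pi> permutes J}"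
   hence "\<not> (\<forall>a\<in>UNIV - J. \<pi> a = a)" using permutes_superset[of \<pi> UNIV J] by auto
   then obtain a where "a \<notin> J" "\<pi> a \<noteq> a" by blast
   hence "?M a (\<pi> a) = 0" by simp
   hence "(\<Prod>a\<in>UNIV. ?M a (\<pi> a)) = 0" by (intro prod_zero bexI[of _ a]) simp_all
   thus "of_int (sign \<pi>) * (\<Prod>a\<in>UNIV. ?M a (\<pi> a)) = 0" by simp
  qed
 qed (auto intro: permutes_subset)
 also have "... = (\<Sum>\<pi> | \<pi> permutes J. of_int (sign \<pi>) * (\<Prod>a\<in>J. N a (\<pi> a)))"
 proof (rule sum.cong[OF refl])
  fix \<pi> assume "\<pi> \<in> {\<pi>. \<pi> permutes J}"
  hence \<pi>: "\<pi> permutes J" by simp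
  have "(\<Prod>a\<in>UNIV. ?M a (\<pi> a)) = (\<Prod>a\<in>J. ?M a (\<pi> a))"
   by (rule prod.mono_neutral_right) (auto simp: permutes_not_in[OF \<pi>])
  also have "... = (\<Prod>a\<in>J. N a (\<pi> a))"
   by (rule prod.cong) (auto simp: permutes_in_image[OF \<pi>])
  finally show "of_int (sign \<pi>) * (\<Prod>a\<in>UNIV. ?M a (\<pi> a)) = of_int (sign \<pi>) * (\<Prod>a\<in>J. N a (\<pi> a))" by simp
 qed
 finally show ?thesis .
qed

lemma gram_det_cong:
 assumes "\<And>a b. a \<in> J ==> b \<in> J ==> N a b = N' a b"
 shows "gram_det J N = gram_det J N'"
 unfolding gram_det_def using assms by (intro arg_cong[where f=det]) (auto simp: vec_eq_iff)

lemma gram_det_scale: "gram_det J (\<lambda>a b. c * N a b) = c ^ card J * gram_det J N"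
 unfolding gram_det_expand by (simp add: prod.distrib sum_distrib_left mult_ac)

lemma gram_det_block:
 assumes a: "a \<notin> J" and z: "\<And>b. b \<in> J ==> N a b = 0"
 shows "gram_det (insert a J) N = N a a * gram_det J N"
proof -
 have "gram_det (insert a J) N = (\<Sum>\<pi> | \<pi> permutes J. of_int (sign \<pi>) * (\<Prod>b\<in>insert a J. N b (\<pi> b)))"
  unfolding gram_det_expand
 proof (rule sum.mono_neutral_right)
  show "\<forall>\<pi>\<in>{\<pi>. \<pi> permutes insert a J} - {\<pi>. \<pi> permutes J}. of_int (sign \<pi>) * (\<Prod>b\<in>insert a J. N b (\<pi> b)) = 0"
  proof
   fix \<pi> assume \<pi>: "\<pi> \<in> {\<pi>. \<pi> permutes insert a J} - {\<pi>. \<pi> permutes J}"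
   have "\<pi> a \<noteq> a"
   proof
    assume "\<pi> a = a"
    hence "\<pi> permutes J" using \<pi> permutes_superset[of \<pi> "insert a J" J] by auto
    thus False using \<pi> by simp
   qed
   moreover have "\<pi> a \<in> insert a J" using \<pi> permutes_in_image[of \<pi> "insert a J" a] by simp
   ultimately have "N a (\<pi> a) = 0" using z by simp
   hence "(\<Prod>b\<in>insert a J. N b (\<pi> b)) = 0" by (intro prod_zero) auto
   thus "of_int (sign \<pi>) * (\<Prod>b\<in>insert a J. N b (\<pi> b)) = 0" by simp
  qed
 qed (auto intro: permutes_subset)
 also have "... = (\<Sum>\<pi> | \<pi> permutes J. N a a * (of_int (sign \<pi>) * (\<Prod>b\<in>J. N b (\<pi> b))))"
  by (rule sum.cong) (use a in \<open>auto simp: permutes_not_in\<close>)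
 finally show ?thesis by (simp add: gram_det_expand sum_distrib_left)
qed

text \<open>Replacing the vectors by their images under the matrix \<open>L = 1 + u w^T\<close>
  changes the Gram matrix by congruence, so \<open>det L = 1 + u \<bullet> w\<close> occurs
  twice.\<close>

lemma gram_det_rank_one:
 fixes t t' :: "'w::finite => real^'m" and u w :: "real^'w"
 assumes f: "linear f" and u: "\<And>a. a \<notin> I ==> u $ a = 0" and w: "\<And>a. a \<notin> I ==> w $ a = 0"
  and t: "\<And>a. a \<in> I ==> t a = t' a + u $ a *R (\<Sum>c\<in>I. w $ c *R t' c)"
 shows "gram_det I (\<lambda>a b. t a \<bullet> f (t b)) = (1 + u \<bullet> w)^2 * gram_det I (\<lambda>a b. t' a \<bullet> f (t' b))"
proof -
 define y where "y = (\<Sum>c\<in>I. w $ c *R t' c)"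
 define K where "K = (\<lambda>t. (\<chi> a b. if a \<in> I \<and> b \<in> I then t a \<bullet> f (t b) else if a = b then 1 else 0) :: real^'w^'w)"
 define L :: "real^'w^'w" where "L = (\<chi> a b. (if a = b then 1 else 0) + u $ a * w $ b)"
 have sumI: "(\<Sum>c\<in>UNIV. w $ c * g c) = (\<Sum>c\<in>I. w $ c * g c)" for g
  by (rule sum.mono_neutral_right) (auto simp: w)
 have sumd: "(\<Sum>k\<in>UNIV. (if i = k then 1 else 0) * g k) = g i" "(\<Sum>k\<in>UNIV. g k * (if j = k then 1 else 0)) = g j" for i j and g :: "'w => real"
 proof -
  have "(\<Sum>k\<in>UNIV. (if i = k then 1 else 0) * g k) = (\<Sum>k\<in>UNIV. if i = k then g k else 0)" by (rule sum.cong) auto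
  thus "(\<Sum>k\<in>UNIV. (if i = k then 1 else 0) * g k) = g i" by simp
  have "(\<Sum>k\<in>UNIV. g k * (if j = k then 1 else 0)) = (\<Sum>k\<in>UNIV. if j = k then g k else 0)" by (rule sum.cong) auto
  thus "(\<Sum>k\<in>UNIV. g k * (if j = k then 1 else 0)) = g j" by simp
 qed
 have fy: "f y = (\<Sum>c\<in>I. w $ c *R f (t' c))" by (simp add: y_def linear_sum[OF f] linear_scale[OF f])
 have wK: "(\<Sum>c\<in>UNIV. w $ c * K t' $ c $ b) = (if b \<in> I then y \<bullet> f (t' b) else 0)" for b
 proof -
  have "(\<Sum>c\<in>UNIV. w $ c * K t' $ c $ b) = (\<Sum>c\<in>I. w $ c * (if b \<in> I then t' c \<bullet> f (t' b) else 0))"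
   unfolding sumI by (rule sum.cong) (auto simp: K_def)
  thus ?thesis by (simp add: y_def inner_sum_left)
 qed
 have Kw: "(\<Sum>c\<in>UNIV. K t' $ a $ c * w $ c) = (if a \<in> I then t' a \<bullet> f y else 0)" for a
 proof -
  have "(\<Sum>c\<in>UNIV. K t' $ a $ c * w $ c) = (\<Sum>c\<in>UNIV. w $ c * K t' $ a $ c)" by (simp add: mult.commute)
  also have "... = (\<Sum>c\<in>I. w $ c * (if a \<in> I then t' a \<bullet> f (t' c) else 0))"
   unfolding sumI by (rule sum.cong) (auto simp: K_def)
  finally show ?thesis by (simp add: fy inner_sum_right)
 qed
 define z where "z b = (if b \<in> I then y \<bullet> f (t' b) else 0)" for b
 have LK: "L ** K t' = (\<chi> a b. K t' $ a $ b + u $ a * z b)"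
 proof -
  have "(\<Sum>c\<in>UNIV. ((if a = c then 1 else 0) + u $ a * w $ c) * K t' $ c $ b) = K t' $ a $ b + u $ a * z b" for a b
  proof -
   have "(\<Sum>c\<in>UNIV. ((if a = c then 1 else 0) + u $ a * w $ c) * K t' $ c $ b)
    = (\<Sum>c\<in>UNIV. (if a = c then 1 else 0) * K t' $ c $ b) + u $ a * (\<Sum>c\<in>UNIV. w $ c * K t' $ c $ b)"
    by (simp only: distrib_right sum.distrib sum_distrib_left mult.assoc)
   thus ?thesis unfolding sumd wK z_def .
  qed
  thus ?thesis by (simp add: L_def matrix_matrix_mult_def vec_eq_iff)
 qed
 have zw: "(\<Sum>c\<in>UNIV. z c * w $ c) = y \<bullet> f y"
 proof -
  have "(\<Sum>c\<in>UNIV. z c * w $ c) = (\<Sum>c\<in>UNIV. w $ c * z c)" by (simp add: mult.commute)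
  also have "... = (\<Sum>c\<in>I. w $ c * (y \<bullet> f (t' c)))" unfolding sumI by (rule sum.cong) (auto simp: z_def)
  finally show ?thesis by (subst fy) (simp add: inner_sum_right)
 qed
 have "(L ** K t') ** transpose L = K t"
 proof -
  have "(\<Sum>c\<in>UNIV. (K t' $ a $ c + u $ a * z c) * ((if b = c then 1 else 0) + u $ b * w $ c)) = K t $ a $ b" for a b
  proof -
   have "(\<Sum>c\<in>UNIV. (K t' $ a $ c + u $ a * z c) * ((if b = c then 1 else 0) + u $ b * w $ c))
    = (\<Sum>c\<in>UNIV. (K t' $ a $ c + u $ a * z c) * (if b = c then 1 else 0)) + u $ b * ((\<Sum>c\<in>UNIV. K t' $ a $ c * w $ c) + u $ a * (\<Sum>c\<in>UNIV. z c * w $ c))"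
    unfolding sum_distrib_left sum.distrib[symmetric] by (rule sum.cong) (simp_all add: algebra_simps)
   also have "... = K t' $ a $ b + u $ a * z b + u $ b * ((if a \<in> I then t' a \<bullet> f y else 0) + u $ a * (y \<bullet> f y))"
    unfolding sumd Kw zw ..
   also have "... = K t $ a $ b"
   proof (cases "a \<in> I \<and> b \<in> I")
    case True
    thus ?thesis
     by (simp add: K_def t y_def[symmetric] z_def linear_add[OF f] linear_scale[OF f] inner_add_left inner_add_right algebra_simps)
   next
    case False
    thus ?thesis using u[of a] u[of b] by (auto simp: K_def z_def)
   qed
   finally show ?thesis .
  qed
  thus ?thesis unfolding LK by (simp add: L_def transpose_def matrix_matrix_mult_def vec_eq_iff)
 qed
 hence "det (K t) = det L * det (K t') * det L" by (metis det_mul det_transpose)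
 moreover have "det L = 1 + u \<bullet> w" unfolding L_def by (rule det_identity_plus_rank_one)
 ultimately show ?thesis unfolding K_def gram_det_def[symmetric] by (simp add: power2_eq_square)
qed

text \<open>A Schur complement: subtracting from \<open>t s\<close> its projection
  \<open>comb I t q\<close> onto the slice, with respect to the form \<open>f\<close>, decouples it
  from the other vectors without changing the determinant.\<close>

lemma gram_det_border:
 fixes t :: "'w::finite => real^'m"
 assumes f: "linear f" and sym: "\<And>v w. f v \<bullet> w = v \<bullet> f w" and s: "s \<notin> I"
  and q: "\<And>a. a \<in> I ==> t a \<bullet> f (comb I t q) = t a \<bullet> f (t s)"
 shows "gram_det (insert s I) (\<lambda>a b. t a \<bullet> f (t b)) =
  (t s \<bullet> f (t s) - f (t s) \<bullet> comb I t q) * gram_det I (\<lambda>a b. t a \<bullet> f (t b))"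
proof -
 let ?y = "comb I t q"
 define t' where "t' a = (if a = s then t s - ?y else t a)" for a
 have t': "t' a = t a" if "a \<in> I" for a using that s by (auto simp: t'_def)
 have fy: "f (t s - ?y) = f (t s) - f ?y" by (rule linear_diff[OF f])
 have orth: "t b \<bullet> f (t s - ?y) = 0" if "b \<in> I" for b using q[OF that] by (simp add: fy inner_diff_right)
 have yo: "?y \<bullet> f (t s - ?y) = 0" using orth by (simp add: comb_def inner_sum_left)
 have sum: "(\<Sum>c\<in>insert s I. (q - rest I q) $ c *R t' c) = ?y"
  unfolding comb_def using s by (auto simp: rest_def t' intro!: sum.cong)
 have "gram_det (insert s I) (\<lambda>a b. t a \<bullet> f (t b)) = (1 + axis s 1 \<bullet> (q - rest I q))^2 * gram_det (insert s I) (\<lambda>a b. t' a \<bullet> f (t' b))"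
 proof (rule gram_det_rank_one[OF f])
  show "t a = t' a + axis s 1 $ a *R (\<Sum>c\<in>insert s I. (q - rest I q) $ c *R t' c)" for a
   unfolding sum by (simp add: t'_def axis_def)
 qed (auto simp: axis_def rest_def)
 also have "axis s 1 \<bullet> (q - rest I q) = 0" using s by (simp add: inner_axis' rest_def)
 also have "gram_det (insert s I) (\<lambda>a b. t' a \<bullet> f (t' b)) = (t' s \<bullet> f (t' s)) * gram_det I (\<lambda>a b. t' a \<bullet> f (t' b))"
 proof (rule gram_det_block[OF s])
  show "t' s \<bullet> f (t' b) = 0" if "b \<in> I" for b
   using orth[OF that] sym[of "t s - ?y" "t b"] t'[OF that] by (simp add: t'_def inner_commute)
 qed
 also have "gram_det I (\<lambda>a b. t' a \<bullet> f (t' b)) = gram_det I (\<lambda>a b. t a \<bullet> f (t b))"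
  by (rule gram_det_cong) (simp add: t')
 also have "t' s \<bullet> f (t' s) = t s \<bullet> f (t s) - f (t s) \<bullet> ?y"
  using yo sym[of "t s" ?y] by (simp add: t'_def inner_diff_left) (simp add: fy inner_diff_right)
 finally show ?thesis by simp
qed

section \<open>The Brascamp--Lieb inequality on one slice\<close>

context strict_even_support
begin

definition potential :: "'w set => ('w => real^'m) => real^'w::finite => real" where
 "potential I t p = U (comb I t p) + (norm (rest I p))^2 / 2"

abbreviation gram :: "('w => real^'m) => real^'m => 'w => 'w => real" where
 "gram t x a b \<equiv> t a \<bullet> H x (t b)"

lemma matrix_gram:
 "matrix (\<lambda>v. adj I t (H x (comb I t v)) + rest I v) = (\<chi> a b. if a \<in> I \<and> b \<in> I then gram t x a b else if a = b then 1 else 0)"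
 by (auto simp: matrix_def vec_eq_iff comb_axis rest_axis linear_0[OF linH'] adj_def) (auto simp: rest_def axis_def)

text \<open>The potential is \<open>U\<close> on the slice, and \<open>F\<close> is the derivative
  of \<open>U\<close> in the transversal direction \<open>t s\<close>. The term
  \<open>f p \<bullet> q p\<close> is the part of \<open>gram s s\<close> captured by the slice,
  which the Schur complement formula turns into a difference of Gram determinants.\<close>

lemma Brascamp_Lieb_slice_injective:
 fixes t :: "'w::{finite,wellorder} => real^'m"
 assumes I: "I \<noteq> {}" and s: "s \<notin> I"
  and inj: "\<And>p. comb I t p = 0 ==> \<forall>a\<in>I. p $ a = 0"
 shows "(\<integral>p. ennreal ((G (comb I t p) \<bullet> t s)^2 * gram_det I (gram t (comb I t p)) * exp (- potential I t p)))
  \<le> (\<integral>p. ennreal ((gram t (comb I t p) s s * gram_det I (gram t (comb I t p)) - gram_det (insert s I) (gram t (comb I t p))) * exp (- potential I t p)))"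
proof -
 let ?P = "comb I t" and ?R = "rest I :: (real, 'w) vec => (real, 'w) vec" and ?A = "adj I t"
 have blP: "bounded_linear ?P" and blR: "bounded_linear ?R" and blA: "bounded_linear ?A"
  using linear_comb linear_rest linear_adj by (simp_all add: linear_conv_bounded_linear)
 obtain BP where BP: "BP > 0" "\<And>p. norm (?P p) \<le> norm p * BP" using bounded_linear.pos_bounded[OF blP] by blast
 obtain BA where BA: "BA > 0" "\<And>p. norm (?A p) \<le> norm p * BA" using bounded_linear.pos_bounded[OF blA] by blast
 obtain c where c: "c > 0" "\<And>x v. x \<noteq> 0 ==> H x v \<bullet> v \<ge> c * (norm v)^2" using H_lower by metis
 obtain C where C: "C > 0" "\<And>x. U x \<le> C * (norm x)^2" using U_upper by metis
 obtain M where M: "M > 0" "\<And>x y. norm (G x - G y) \<le> M * norm (x - y)" using G_lipschitz by metis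
 have "linear (\<lambda>p. (?P p, ?R p))" using linear_comb[of I t] linear_rest[of I] by (auto simp: linear_iff)
 moreover have "inj (\<lambda>p. (?P p, ?R p))"
 proof (subst linear_injective_0[OF calculation], intro allI impI)
  fix p assume "(?P p, ?R p) = 0"
  hence "?P p = 0" "?R p = 0" by (simp_all add: zero_prod_def)
  thus "p = 0" using inj[of p] by (auto simp: vec_eq_iff rest_def split: if_splits)
 qed
 \<comment> \<open>\<open>comb\<close> and \<open>rest\<close> together are injective and so control
   \<open>norm p\<close> from below; this makes the potential strongly convex in all coordinates,
   the idle ones included.\<close>
 ultimately obtain \<beta> where \<beta>: "\<beta> > 0" "\<And>p. \<beta> * norm p \<le> norm (?P p, ?R p)"
  using linear_inj_bounded_below_pos by blast
 have low: "\<beta>\<^sup>2 * (norm p)^2 \<le> (norm (?P p))^2 + (norm (?R p))^2" for p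
 proof -
  have "(\<beta> * norm p)^2 \<le> (norm (?P p, ?R p))^2" using \<beta> by (intro power_mono) auto
  thus ?thesis by (simp add: norm_Pair power_mult_distrib)
 qed
 \<comment> \<open>Off \<open>S\<close> the point of the slice is not the origin, so
   \<open>G\<close> is differentiable there. By injectivity \<open>S\<close> lies in a coordinate
   hyperplane.\<close>
 define S where "S = {p. ?P p = 0}"
 define W where "W = potential I t"
 define g where "g p = ?A (G (?P p)) + ?R p" for p
 define K where "K p v = ?A (H (?P p) (?P v)) + ?R v" for p v
 define F where "F p = G (?P p) \<bullet> t s" for p
 define f where "f p = ?A (H (?P p) (t s))" for p
 have psdK: "K p v \<bullet> v \<ge> min c 1 * \<beta>\<^sup>2 * (norm v)^2" if "p \<notin> S" for p v
 proof -
  have "K p v \<bullet> v = H (?P p) (?P v) \<bullet> ?P v + (norm (?R v))^2"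
   using rest_inner[of I v v] by (simp add: K_def inner_add_left adj_inner dot_square_norm)
  also have "... \<ge> c * (norm (?P v))^2 + (norm (?R v))^2" using c(2) that by (simp add: S_def)
  also have "c * (norm (?P v))^2 + (norm (?R v))^2 \<ge> min c 1 * (norm (?P v))^2 + min c 1 * (norm (?R v))^2"
   by (intro add_mono mult_right_mono) (auto simp: mult_left_le_one_le c(1) less_imp_le)
  also have "min c 1 * (norm (?P v))^2 + min c 1 * (norm (?R v))^2 \<ge> min c 1 * (\<beta>\<^sup>2 * (norm v)^2)"
   unfolding distrib_left[symmetric] using low c(1) by (intro mult_left_mono) auto
  finally show ?thesis by (simp add: mult.assoc)
 qed
 have cpos: "min c 1 * \<beta>\<^sup>2 > 0" using c(1) \<beta>(1) by simp
 have linK: "linear (K p)" for p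
  unfolding K_def using linear_comb[of I t] linear_rest[of I] linear_adj[of I t] linH'[of "?P p"]
  by (simp add: linear_iff algebra_simps)
 define q where "q p = (SOME v. K p v = f p)" for p
 have q: "K p (q p) = f p" if "p \<notin> S" for p
 proof -
  have "inj (K p)"
  proof (subst linear_injective_0[OF linK], intro allI impI)
   fix v assume "K p v = 0"
   hence le: "min c 1 * \<beta>\<^sup>2 * (norm v)^2 \<le> 0" using psdK[OF that, of v] by simp
   show "v = 0"
   proof (rule ccontr)
    assume "v \<noteq> 0"
    hence "0 < min c 1 * \<beta>\<^sup>2 * (norm v)^2" using cpos by (intro mult_pos_pos[OF cpos]) simp
    with le show False by linarith
   qed
  qed
  hence "surj (K p)" using linK linear_inj_imp_surj by blast
  then obtain v where "f p = K p v" by (rule surjE)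
  hence "\<exists>v. K p v = f p" by metis
  thus ?thesis unfolding q_def by (rule someI_ex)
 qed
 have Wv: "W (p + v) \<ge> W p + g p \<bullet> v + (min c 1 * \<beta>\<^sup>2) / 2 * (norm v)^2" for p v
 proof -
  have "U (?P p + ?P v) \<ge> U (?P p) + G (?P p) \<bullet> ?P v + c / 2 * (norm (?P v))^2"
   by (rule U_strongly_convex[OF c(2)])
  moreover have "(norm (?R p + ?R v))^2 = (norm (?R p))^2 + 2 * (?R p \<bullet> ?R v) + (norm (?R v))^2"
   by (simp add: power2_norm_eq_inner inner_add_left inner_add_right inner_commute)
  moreover have "min c 1 * \<beta>\<^sup>2 * (norm v)^2 \<le> c * (norm (?P v))^2 + (norm (?R v))^2"
  proof -
   have "min c 1 * (\<beta>\<^sup>2 * (norm v)^2) \<le> min c 1 * (norm (?P v))^2 + min c 1 * (norm (?R v))^2"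
    unfolding distrib_left[symmetric] using low c(1) by (intro mult_left_mono) auto
   also have "... \<le> c * (norm (?P v))^2 + 1 * (norm (?R v))^2"
    by (intro add_mono mult_right_mono) auto
   finally show ?thesis by (simp add: mult.assoc)
  qed
  moreover have "(min c 1 * \<beta>\<^sup>2) / 2 * (norm v)^2 = (min c 1 * \<beta>\<^sup>2 * (norm v)^2) / 2"
   "c / 2 * (norm (?P v))^2 = (c * (norm (?P v))^2) / 2" by simp_all
  ultimately show ?thesis
   unfolding W_def potential_def g_def linear_add[OF linear_comb] linear_add[OF linear_rest]
    inner_add_left adj_inner rest_inner[of I p v] by linarith
 qed
 interpret even_potential W F g f q K S "min c 1 * \<beta>\<^sup>2" "C * BP^2 + 1" "M * BP * norm (t s)" "M * BP * BA + 1"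
 proof
  fix p
  have "((\<lambda>p. U (?P p)) has_derivative (\<lambda>v. G (?P p) \<bullet> ?P v)) (at p)"
   by (rule has_derivative_compose[OF bounded_linear_imp_has_derivative[OF blP] dU])
  moreover have "((\<lambda>p. (?R p \<bullet> ?R p)) has_derivative (\<lambda>v. ?R p \<bullet> ?R v + ?R v \<bullet> ?R p)) (at p)"
   by (intro has_derivative_inner bounded_linear_imp_has_derivative[OF blR])
  hence "((\<lambda>p. 1/2 * (?R p \<bullet> ?R p)) has_derivative (\<lambda>v. 1/2 * (?R p \<bullet> ?R v + ?R v \<bullet> ?R p))) (at p)"
   by (rule has_derivative_mult_right)
  ultimately have "((\<lambda>p. U (?P p) + 1/2 * (?R p \<bullet> ?R p)) has_derivative (\<lambda>v. G (?P p) \<bullet> ?P v + 1/2 * (?R p \<bullet> ?R v + ?R v \<bullet> ?R p))) (at p)"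
   by (rule has_derivative_add)
  moreover have "(\<lambda>p. U (?P p) + 1/2 * (?R p \<bullet> ?R p)) = W" by (auto simp: W_def potential_def power2_norm_eq_inner)
  moreover have "(\<lambda>v. G (?P p) \<bullet> ?P v + 1/2 * (?R p \<bullet> ?R v + ?R v \<bullet> ?R p)) = (\<lambda>v. g p \<bullet> v)"
  proof
   fix v
   show "G (?P p) \<bullet> ?P v + 1/2 * (?R p \<bullet> ?R v + ?R v \<bullet> ?R p) = g p \<bullet> v"
    using rest_inner[of I p v] by (simp add: g_def inner_add_left adj_inner inner_commute[of "?R v" "?R p"])
  qed
  ultimately show "(W has_derivative (\<lambda>v. g p \<bullet> v)) (at p)" by simp
 next
  fix p
  have "U (?P p) \<le> C * (norm (?P p))^2" by (rule C(2))
  also have "... \<le> C * (norm p * BP)^2" using BP C(1) by (intro mult_left_mono power_mono) auto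
  finally have "U (?P p) \<le> C * BP^2 * (norm p)^2" by (simp add: power_mult_distrib mult_ac)
  moreover have "(norm (?R p))^2 \<le> (norm p)^2" using rest_decomp[of I p] by (intro power_mono) auto
  ultimately show "W p \<le> (C * BP^2 + 1) * (norm p)^2"
   unfolding W_def potential_def distrib_right using zero_le_power2[of "norm (?R p)"] zero_le_power2[of "norm p"] by linarith
 next
  show "0 < min c 1 * \<beta>\<^sup>2" by (rule cpos)
  show "0 < C * BP^2 + 1" using C(1) by (simp add: add_nonneg_pos)
  show "W (- p) = W p" for p
   using U_scale[of "-1" "?P p"] by (simp add: W_def potential_def linear_neg[OF linear_comb] linear_neg[OF linear_rest])
  show "F (- p) = - F p" for p
   using G_scale[of "-1" "?P p"] by (simp add: F_def linear_neg[OF linear_comb])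
  show "W p + g p \<bullet> v + min c 1 * \<beta>\<^sup>2 / 2 * (norm v)^2 \<le> W (p + v)" for p v by (rule Wv)
 next
  fix p q
  have G1: "norm (G (?P p) - G (?P q)) \<le> M * (norm (p - q) * BP)"
  proof -
   have "norm (G (?P p) - G (?P q)) \<le> M * norm (?P (p - q))" using M(2)[of "?P p" "?P q"] by (simp add: linear_diff[OF linear_comb])
   also have "... \<le> M * (norm (p - q) * BP)" using M(1) BP(2) by (intro mult_left_mono) auto
   finally show ?thesis .
  qed
  have "\<bar>F p - F q\<bar> \<le> norm (G (?P p) - G (?P q)) * norm (t s)"
   unfolding F_def inner_diff_left[symmetric] by (rule Cauchy_Schwarz_ineq2)
  also have "... \<le> (M * (norm (p - q) * BP)) * norm (t s)" by (rule mult_right_mono[OF G1]) simp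
  finally show "\<bar>F p - F q\<bar> \<le> M * BP * norm (t s) * norm (p - q)" by (simp add: mult_ac)
  have "g p - g q = ?A (G (?P p) - G (?P q)) + ?R (p - q)"
   by (simp add: g_def linear_diff[OF linear_adj] linear_diff[OF linear_rest])
  hence "norm (g p - g q) \<le> norm (?A (G (?P p) - G (?P q))) + norm (?R (p - q))" by (simp add: norm_triangle_ineq)
  also have "... \<le> (M * (norm (p - q) * BP)) * BA + norm (p - q)"
  proof (intro add_mono rest_decomp)
   have "norm (?A (G (?P p) - G (?P q))) \<le> norm (G (?P p) - G (?P q)) * BA" by (rule BA(2))
   also have "... \<le> (M * (norm (p - q) * BP)) * BA" using G1 BA(1) by (intro mult_right_mono) auto
   finally show "norm (?A (G (?P p) - G (?P q))) \<le> (M * (norm (p - q) * BP)) * BA" .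
  qed
  finally show "norm (g p - g q) \<le> (M * BP * BA + 1) * norm (p - q)" by (simp add: algebra_simps)
 next
  obtain a where a: "a \<in> I" using I by blast
  have "S \<subseteq> {p. axis a 1 \<bullet> p = 0}" using inj a by (auto simp: S_def inner_axis')
  moreover have "negligible {p :: (real, 'w) vec. axis a 1 \<bullet> p = 0}"
   by (rule negligible_hyperplane) (simp add: axis_eq_0_iff)
  ultimately show "negligible S" by (rule negligible_subset[rotated])
  have "S = ?P -` {0}" by (auto simp: S_def)
  thus "closed S" using closed_vimage[of "{0}" ?P] linear_continuous_on[OF blP]
   by (simp add: continuous_on_eq_continuous_at)
 next
  fix p assume p: "p \<notin> S"
  hence nz: "?P p \<noteq> 0" by (simp add: S_def)
  have GP: "((\<lambda>p. G (?P p)) has_derivative (\<lambda>v. H (?P p) (?P v))) (at p)"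
   by (rule has_derivative_compose[OF bounded_linear_imp_has_derivative[OF blP] dG[OF nz]])
  show "(g has_derivative K p) (at p)"
   unfolding g_def[abs_def] K_def[abs_def]
   by (intro has_derivative_add bounded_linear.has_derivative[OF blA] GP bounded_linear_imp_has_derivative[OF blR])
  have "((\<lambda>p. G (?P p) \<bullet> t s) has_derivative (\<lambda>v. H (?P p) (?P v) \<bullet> t s)) (at p)"
   by (rule has_derivative_inner_left[OF GP])
  moreover have "H (?P p) (?P v) \<bullet> t s = f p \<bullet> v" for v
   unfolding f_def adj_inner symH[OF nz, of "?P v" "t s"] by (rule inner_commute)
  ultimately show "(F has_derivative (\<lambda>v. f p \<bullet> v)) (at p)" by (simp add: F_def[abs_def])
  show "K p (q p) = f p" by (rule q[OF p])
  fix v w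
  show "K p v \<bullet> w = v \<bullet> K p w"
  proof -
   have "K p v \<bullet> w = H (?P p) (?P v) \<bullet> ?P w + ?R v \<bullet> ?R w"
    by (simp add: K_def inner_add_left adj_inner rest_inner[of I v w])
   moreover have "K p w \<bullet> v = H (?P p) (?P w) \<bullet> ?P v + ?R w \<bullet> ?R v"
    by (simp add: K_def inner_add_left adj_inner rest_inner[of I w v])
   moreover have "H (?P p) (?P v) \<bullet> ?P w = H (?P p) (?P w) \<bullet> ?P v"
    using symH[OF nz, of "?P v" "?P w"] by (simp add: inner_commute)
   ultimately show ?thesis by (simp add: inner_commute)
  qed
  have "0 \<le> min c 1 * \<beta>\<^sup>2 * (norm v)^2" using cpos by simp
  thus "K p v \<bullet> v \<ge> 0" using psdK[OF p, of v] by linarith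
 next
  fix v
  have "continuous_on (- S) (\<lambda>p. H (?P p) (?P v))"
   by (rule continuous_on_compose2[OF contH linear_continuous_on[OF blP]]) (auto simp: S_def)
  hence "continuous_on (- S) (\<lambda>p. ?A (H (?P p) (?P v)))"
   by (rule bounded_linear.continuous_on[OF blA])
  thus "continuous_on (- S) (\<lambda>p. K p v)" unfolding K_def by (intro continuous_intros)
 qed
 \<comment> \<open>\<open>W\<close> is homogeneous of degree 2; by Euler's identity its conjugate
   takes the value \<open>W p\<close> at \<open>g p\<close>, so the exponent in \<open>E\<close> is
   again the potential.\<close>
 have ex: "W p - g p \<bullet> p = - W p" for p
 proof -
  have "g p \<bullet> p = 2 * U (?P p) + (norm (?R p))^2"
   using rest_inner[of I p p] by (simp add: g_def inner_add_left adj_inner G_inner_self dot_square_norm)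
  thus ?thesis by (simp add: W_def potential_def)
 qed
 have mK: "matrix (K p) = (\<chi> a b. if a \<in> I \<and> b \<in> I then gram t (?P p) a b else if a = b then 1 else 0)" for p
  unfolding K_def[abs_def] by (rule matrix_gram)
 have dK: "det (matrix (K p)) = gram_det I (gram t (?P p))" for p
  unfolding mK gram_det_def ..
 have posK: "det (matrix (K p)) > 0" if "p \<notin> S" for p
 proof (rule det_pos_of_positive_definite)
  fix v :: "(real, 'w) vec" assume "v \<noteq> 0"
  hence "0 < min c 1 * \<beta>\<^sup>2 * (norm v)^2" using cpos by simp
  thus "0 < (matrix (K p) *v v) \<bullet> v" using psdK[OF that, of v] by (simp add: matrix_apply[OF linK])
 qed
 have border: "gram_det (insert s I) (gram t (?P p)) = (gram t (?P p) s s - f p \<bullet> q p) * gram_det I (gram t (?P p))" if p: "p \<notin> S" for p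
 proof -
  have nz: "?P p \<noteq> 0" using p by (simp add: S_def)
  have "t a \<bullet> H (?P p) (?P (q p)) = t a \<bullet> H (?P p) (t s)" if "a \<in> I" for a
  proof -
   have "K p (q p) $ a = f p $ a" using q[OF p] by simp
   thus ?thesis using that by (simp add: K_def f_def adj_def rest_def)
  qed
  from gram_det_border[OF linH' symH[OF nz] s this] show ?thesis by (simp add: f_def adj_inner)
 qed
 have AE: "AE p in lborel. p \<notin> S"
 proof -
  have "S \<in> sets borel" using closedS by simp
  hence "S \<in> null_sets lborel" using negS by (simp add: negligible_iff_null_sets null_sets_completion_iff)
  thus ?thesis by (rule AE_not_in)
 qed
 have "(\<integral>p. ennreal ((G (?P p) \<bullet> t s)^2 * gram_det I (gram t (?P p)) * exp (- potential I t p))) = (\<integral>p. E p * (F p)^2)"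
 proof (rule nn_integral_cong_AE, use AE in eventually_elim)
  fix p assume p: "p \<notin> S"
  thus "ennreal ((G (?P p) \<bullet> t s)^2 * gram_det I (gram t (?P p)) * exp (- potential I t p)) = ennreal (E p * (F p)^2)"
   using posK[OF p] unfolding E_def unfolding ex unfolding dK F_def W_def by (simp add: mult_ac)
 qed
 also have "... \<le> (\<integral>p. E p * (f p \<bullet> q p))" by (rule Brascamp_Lieb_odd)
 also have "... = (\<integral>p. ennreal ((gram t (?P p) s s * gram_det I (gram t (?P p)) - gram_det (insert s I) (gram t (?P p))) * exp (- potential I t p)))"
 proof (rule nn_integral_cong_AE, use AE in eventually_elim)
  fix p assume p: "p \<notin> S"
  thus "ennreal (E p * (f p \<bullet> q p)) = ennreal ((gram t (?P p) s s * gram_det I (gram t (?P p)) - gram_det (insert s I) (gram t (?P p))) * exp (- potential I t p))"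
   using posK[OF p] unfolding border[OF p] E_def unfolding ex unfolding dK W_def by (simp add: algebra_simps)
 qed
 finally show ?thesis .
qed

text \<open>Linearly dependent vectors \<open>t a\<close> make \<open>gram_det I\<close> vanish, and
  with it the left side.\<close>

theorem Brascamp_Lieb_slice:
 fixes t :: "'w::{finite,wellorder} => real^'m"
 assumes I: "I \<noteq> {}" and s: "s \<notin> I"
 shows "(\<integral>p. ennreal ((G (comb I t p) \<bullet> t s)^2 * gram_det I (gram t (comb I t p)) * exp (- potential I t p)))
  \<le> (\<integral>p. ennreal ((gram t (comb I t p) s s * gram_det I (gram t (comb I t p)) - gram_det (insert s I) (gram t (comb I t p))) * exp (- potential I t p)))"
proof (cases "\<forall>p. comb I t p = 0 \<longrightarrow> (\<forall>a\<in>I. p $ a = 0)")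
 case True
 thus ?thesis using Brascamp_Lieb_slice_injective[OF I s, of t] by blast
next
 case False
 then obtain p a where p: "comb I t p = 0" "a \<in> I" "p $ a \<noteq> 0" by blast
 define v where "v = p - rest I p"
 have v0: "rest I v = 0" by (auto simp: v_def rest_def vec_eq_iff)
 have "comb I t (rest I p) = 0" unfolding comb_def by (rule sum.neutral) (auto simp: rest_def)
 hence cv: "comb I t v = 0" using p by (simp add: v_def linear_diff[OF linear_comb])
 have "v $ a \<noteq> 0" using p by (simp add: v_def rest_def)
 hence vn: "v \<noteq> 0" by auto
 have "gram_det I (gram t x) = 0" for x
 proof -
  have lin: "linear (\<lambda>v. adj I t (H x (comb I t v)) + rest I v)"
   using linear_comb[of I t] linear_rest[of I] linear_adj[of I t] linH'[of x]
   by (simp add: linear_iff algebra_simps)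
  have "matrix (\<lambda>v. adj I t (H x (comb I t v)) + rest I v) *v v = 0"
   by (simp add: matrix_apply[OF lin] cv v0 linear_0[OF linH'] linear_0[OF linear_adj])
  from det_zero_of_kernel[OF this vn] show ?thesis unfolding matrix_gram gram_det_def .
 qed
 thus ?thesis by simp
qed

end

section \<open>Gaussian averages of Gram determinants\<close>

definition gauss :: "'a::euclidean_space => real" where
 "gauss x = exp (- (norm x)\<^sup>2 / 2)"

lemma gauss_pos: "gauss x > 0" by (simp add: gauss_def)

lemma gauss_borel [measurable]: "gauss \<in> borel_measurable borel"
 unfolding gauss_def[abs_def] by measurable

text \<open>A class closed under sums and products whose members are integrable against
  \<open>gauss\<close>; it contains the polynomials in the entries of a random matrix.\<close>

definition poly_bounded :: "('a::euclidean_space => real) => bool" where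
 "poly_bounded R \<longleftrightarrow> R \<in> borel_measurable borel \<and> (\<exists>C d. \<forall>x. \<bar>R x\<bar> \<le> C * (1 + norm x) ^ d)"

lemma poly_bounded_borel: "poly_bounded R ==> R \<in> borel_measurable borel"
 by (simp add: poly_bounded_def)

lemma poly_bounded_const [intro!, simp]: "poly_bounded (\<lambda>x. c)"
proof -
 have "\<bar>c\<bar> \<le> \<bar>c\<bar> * (1 + norm x) ^ 0" for x :: 'a by simp
 hence "\<exists>C d. \<forall>x :: 'a. \<bar>c\<bar> \<le> C * (1 + norm x) ^ d" by blast
 thus ?thesis unfolding poly_bounded_def by simp
qed

lemma poly_bounded_mult [intro]:
 assumes "poly_bounded R" "poly_bounded Q"
 shows "poly_bounded (\<lambda>x. R x * Q x)"
proof -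
 obtain C d where 1: "\<And>x. \<bar>R x\<bar> \<le> C * (1 + norm x) ^ d" using assms by (auto simp: poly_bounded_def)
 obtain C' d' where 2: "\<And>x. \<bar>Q x\<bar> \<le> C' * (1 + norm x) ^ d'" using assms by (auto simp: poly_bounded_def)
 have "\<bar>R x * Q x\<bar> \<le> (C * C') * (1 + norm x) ^ (d + d')" for x
 proof -
  have "\<bar>R x\<bar> * \<bar>Q x\<bar> \<le> (C * (1 + norm x) ^ d) * (C' * (1 + norm x) ^ d')"
   using order_trans[OF abs_ge_zero 1] by (intro mult_mono 1 2) auto
  thus ?thesis by (simp add: abs_mult power_add mult_ac)
 qed
 thus ?thesis using assms unfolding poly_bounded_def by (auto intro!: exI[of _ "C * C'"] exI[of _ "d + d'"])
qed

lemma poly_bounded_add [intro]: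
 assumes "poly_bounded R" "poly_bounded Q"
 shows "poly_bounded (\<lambda>x. R x + Q x)"
proof -
 obtain C d where 1: "\<And>x. \<bar>R x\<bar> \<le> C * (1 + norm x) ^ d" using assms by (auto simp: poly_bounded_def)
 obtain C' d' where 2: "\<And>x. \<bar>Q x\<bar> \<le> C' * (1 + norm x) ^ d'" using assms by (auto simp: poly_bounded_def)
 have "\<bar>R x + Q x\<bar> \<le> (\<bar>C\<bar> + \<bar>C'\<bar>) * (1 + norm x) ^ (d + d')" for x
 proof -
  have "(1 + norm x) ^ d \<le> (1 + norm x) ^ (d + d')" "(1 + norm x) ^ d' \<le> (1 + norm x) ^ (d + d')"
   by (intro power_increasing; simp)+
  hence "\<bar>C\<bar> * (1 + norm x) ^ d + \<bar>C'\<bar> * (1 + norm x) ^ d' \<le> \<bar>C\<bar> * (1 + norm x) ^ (d + d') + \<bar>C'\<bar> * (1 + norm x) ^ (d + d')"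
   by (intro add_mono mult_left_mono) auto
  moreover have "C * (1 + norm x) ^ d \<le> \<bar>C\<bar> * (1 + norm x) ^ d" "C' * (1 + norm x) ^ d' \<le> \<bar>C'\<bar> * (1 + norm x) ^ d'"
   by (intro mult_right_mono; simp)+
  ultimately show ?thesis using 1[of x] 2[of x] unfolding distrib_right by linarith
 qed
 thus ?thesis using assms unfolding poly_bounded_def by (auto intro!: exI[of _ "\<bar>C\<bar> + \<bar>C'\<bar>"] exI[of _ "d + d'"])
qed

lemma poly_bounded_sum [intro]: "(\<And>i. i \<in> I ==> poly_bounded (R i)) ==> poly_bounded (\<lambda>x. \<Sum>i\<in>I. R i x)"
 by (induction I rule: infinite_finite_induct) auto

lemma poly_bounded_prod [intro]: "(\<And>i. i \<in> I ==> poly_bounded (R i)) ==> poly_bounded (\<lambda>x. \<Prod>i\<in>I. R i x)"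
 by (induction I rule: infinite_finite_induct) auto

lemma poly_bounded_linear:
 assumes "linear (f :: 'a::euclidean_space => real)"
 shows "poly_bounded f"
proof -
 have bl: "bounded_linear f" using assms by (simp add: linear_conv_bounded_linear)
 obtain K where K: "K > 0" "\<And>x. norm (f x) \<le> norm x * K" using bounded_linear.pos_bounded[OF bl] by blast
 have "\<bar>f x\<bar> \<le> K * (1 + norm x) ^ 1" for x
 proof -
  have "norm x * K \<le> (1 + norm x) * K" using K(1) by (intro mult_right_mono) auto
  thus ?thesis using K(2)[of x] by (simp add: mult.commute)
 qed
 moreover have "f \<in> borel_measurable borel"
  using linear_continuous_on[OF bl] by (rule borel_measurable_continuous_onI)
 ultimately show ?thesis unfolding poly_bounded_def by blast
qed

lemma poly_bounded_column [intro]: "poly_bounded (\<lambda>T :: real^'m^'w. T $ a \<bullet> v)"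
 by (rule poly_bounded_linear) (auto simp: linear_iff inner_add_left)

lemma integrable_gauss:
 assumes "poly_bounded R"
 shows "integrable lborel (\<lambda>x. R x * gauss x)"
proof -
 obtain C d where 1: "\<And>x. \<bar>R x\<bar> \<le> C * (1 + norm x) ^ d" using assms by (auto simp: poly_bounded_def)
 have [measurable]: "R \<in> borel_measurable borel" using assms by (rule poly_bounded_borel)
 have C: "C \<ge> 0" using order_trans[OF abs_ge_zero 1[of 0]] by simp
 show ?thesis
 proof (rule Bochner_Integration.integrable_bound)
  have "(\<integral>\<^sup>+x. ennreal (exp (- (1/4) * (norm x)^2)) \<partial>(lborel :: 'a measure)) < \<infinity>"
   by (rule nn_integral_exp_norm_square_finite) simp
  thus "integrable lborel (\<lambda>x :: 'a. C * exp (real d * real d) * exp (- (1/4) * (norm x)^2))"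
   by (intro integrable_mult_right integrableI_nonneg) auto
  show "AE x in lborel. norm (R x * gauss x) \<le> norm (C * exp (real d * real d) * exp (- (1/4) * (norm x)^2))"
  proof (rule AE_I2)
   fix x :: 'a
   have "(1 + norm x) ^ d \<le> exp (norm x) ^ d" using exp_ge_add_one_self[of "norm x"] by (intro power_mono) (auto simp: add.commute)
   also have "... = exp (real d * norm x)" by (simp add: exp_of_nat_mult)
   also have "... \<le> exp (real d * real d + (norm x)^2 / 4)"
    using zero_le_power2[of "norm x / 2 - real d"] by (simp add: power2_eq_square algebra_simps)
   finally have "\<bar>R x\<bar> \<le> C * exp (real d * real d + (norm x)^2 / 4)" using 1[of x] C by (meson mult_left_mono order_trans)
   hence "\<bar>R x\<bar> * gauss x \<le> C * exp (real d * real d + (norm x)^2 / 4) * exp (- (norm x)\<^sup>2 / 2)"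
    unfolding gauss_def by (rule mult_right_mono) simp
   also have "... = C * exp (real d * real d) * exp (- (1/4) * (norm x)^2)"
    by (simp add: mult.assoc exp_add[symmetric])
   finally show "norm (R x * gauss x) \<le> norm (C * exp (real d * real d) * exp (- (1/4) * (norm x)^2))"
    using gauss_pos[of x] C by (simp add: abs_mult)
  qed
 qed simp
qed

definition gmean :: "('a::euclidean_space => real) => real" where
 "gmean R = (LINT x|lborel. R x * gauss x)"

lemma gmean_add: "poly_bounded R ==> poly_bounded Q ==> gmean (\<lambda>x. R x + Q x) = gmean R + gmean Q"
 unfolding gmean_def distrib_right by (intro Bochner_Integration.integral_add integrable_gauss)

lemma gmean_cmult: "gmean (\<lambda>x. c * R x) = c * gmean R"
 unfolding gmean_def by (simp add: mult.assoc)

lemma gmean_diff: "poly_bounded R ==> poly_bounded Q ==> gmean (\<lambda>x. R x - Q x) = gmean R - gmean Q"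
 unfolding gmean_def left_diff_distrib by (intro Bochner_Integration.integral_diff integrable_gauss)

lemma gmean_sum: "(\<And>i. i \<in> I ==> poly_bounded (R i)) ==> gmean (\<lambda>x. \<Sum>i\<in>I. R i x) = (\<Sum>i\<in>I. gmean (R i))"
 unfolding gmean_def sum_distrib_right by (intro Bochner_Integration.integral_sum integrable_gauss)

lemma gmean_isometry:
 fixes f :: "'a::euclidean_space => 'a"
 assumes lin: "linear f" and iso: "\<And>x. norm (f x) = norm x" and R: "R \<in> borel_measurable borel"
 shows "gmean (\<lambda>x. R (f x)) = gmean R"
proof -
 have [measurable]: "f \<in> borel_measurable borel"
  using lin linear_continuous_on linear_conv_bounded_linear borel_measurable_continuous_onI by blast
 have "gmean R = (LINT x|distr lborel borel f. R x * gauss x)"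
  unfolding gmean_def by (simp add: lborel_distr_isometry[OF lin iso])
 also have "... = (LINT x|lborel. R (f x) * gauss (f x))"
  by (rule integral_distr) (use R in measurable)
 finally show ?thesis unfolding gmean_def by (simp add: gauss_def iso)
qed

definition set_col :: "'w => (real^'m => real^'m) => real^'m^'w => real^'m^'w" where
 "set_col a f T = (\<chi> b. if b = a then f (T $ b) else T $ b)"

text \<open>A rotation taking \<open>v\<close> to \<open>e\<close>, applied to the vector of index
  \<open>a\<close> alone, preserves \<open>gauss\<close> and does not affect
  \<open>R\<close>.\<close>

lemma gmean_column_unit:
 fixes R :: "real^'m^'w => real"
 assumes R: "poly_bounded R" and ind: "\<And>f T. R (set_col a f T) = R T" and v: "norm v = norm e"
 shows "gmean (\<lambda>T. (T $ a \<bullet> v)\<^sup>2 * R T) = gmean (\<lambda>T. (T $ a \<bullet> e)\<^sup>2 * R T)"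
proof -
 obtain f where f: "orthogonal_transformation f" "f v = e"
  using orthogonal_transformation_exists[OF v] by metis
 have lin: "linear f" using f orthogonal_transformation_linear by blast
 have nf: "norm (f x) = norm x" for x using f(1) orthogonal_transformation by blast
 have "gmean (\<lambda>T. (T $ a \<bullet> e)\<^sup>2 * R T) = gmean (\<lambda>T. (set_col a f T $ a \<bullet> e)\<^sup>2 * R (set_col a f T))"
 proof (rule gmean_isometry[symmetric])
  show "linear (set_col a f)"
   using lin by (auto simp: set_col_def linear_iff vec_eq_iff)
  show "norm (set_col a f T) = norm T" for T :: "real^'m^'w"
  proof -
   have "norm (set_col a f T $ b) = norm (T $ b)" for b by (simp add: set_col_def nf)
   thus ?thesis unfolding norm_vec_def[of "set_col a f T"] norm_vec_def[of T] by simp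
  qed
  show "(\<lambda>T. (T $ a \<bullet> e)\<^sup>2 * R T) \<in> borel_measurable borel"
   unfolding power2_eq_square by (intro poly_bounded_borel poly_bounded_mult R poly_bounded_column)
 qed
 also have "... = gmean (\<lambda>T. (T $ a \<bullet> v)\<^sup>2 * R T)"
 proof -
  have "f x \<bullet> e = x \<bullet> v" for x using f by (metis orthogonal_transformation_def)
  thus ?thesis unfolding ind by (simp add: set_col_def)
 qed
 finally show ?thesis by simp
qed

text \<open>Rotation invariance settles \<open>v = w\<close>, and polarisation does the rest. The
  second moment stays unevaluated: the same constant ends up on both sides of the averaged
  inequality.\<close>

lemma gmean_column:
 fixes R :: "real^'m^'w => real"
 assumes R: "poly_bounded R" and ind: "\<And>f T. R (set_col a f T) = R T" and e: "norm e = 1"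
 shows "gmean (\<lambda>T. ((T $ a \<bullet> v) * (T $ a \<bullet> w)) * R T) = (v \<bullet> w) * gmean (\<lambda>T. (T $ a \<bullet> e)\<^sup>2 * R T)"
proof -
 have sq: "gmean (\<lambda>T. (T $ a \<bullet> v)\<^sup>2 * R T) = (norm v)^2 * gmean (\<lambda>T. (T $ a \<bullet> e)\<^sup>2 * R T)" for v
 proof -
  have "gmean (\<lambda>T. (T $ a \<bullet> v)\<^sup>2 * R T) = gmean (\<lambda>T. (T $ a \<bullet> (norm v *R e))\<^sup>2 * R T)"
   by (rule gmean_column_unit[OF R ind]) (simp add: e)
  also have "... = gmean (\<lambda>T. (norm v)\<^sup>2 * ((T $ a \<bullet> e)^2 * R T))"
   by (simp add: power_mult_distrib mult.assoc)
  finally show ?thesis unfolding gmean_cmult .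
 qed
 have pb: "poly_bounded (\<lambda>T. (T $ a \<bullet> v)\<^sup>2 * R T)" for v
  unfolding power2_eq_square by (intro poly_bounded_mult R poly_bounded_column)
 have pb2: "poly_bounded (\<lambda>T. ((T $ a \<bullet> v) * (T $ a \<bullet> w)) * R T)"
  by (intro poly_bounded_mult R poly_bounded_column)
 define P Q V where "P T = (T $ a \<bullet> v)^2 * R T" and "Q T = (T $ a \<bullet> w)^2 * R T"
  and "V T = ((T $ a \<bullet> v) * (T $ a \<bullet> w)) * R T" for T
 have pbs: "poly_bounded P" "poly_bounded Q" "poly_bounded V"
  using pb pb2 by (simp_all add: P_def[abs_def] Q_def[abs_def] V_def[abs_def])
 have "(\<lambda>T. (T $ a \<bullet> (v + w))\<^sup>2 * R T) = (\<lambda>T. (P T + Q T) + 2 * V T)"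
  by (rule ext) (simp add: P_def Q_def V_def inner_add_right power2_eq_square algebra_simps)
 hence "gmean (\<lambda>T. (T $ a \<bullet> (v + w))\<^sup>2 * R T) = gmean (\<lambda>T. (P T + Q T) + 2 * V T)" by simp
 moreover have "gmean (\<lambda>T. (P T + Q T) + 2 * V T) = gmean (\<lambda>T. P T + Q T) + gmean (\<lambda>T. 2 * V T)"
  by (rule gmean_add) (intro poly_bounded_add poly_bounded_mult poly_bounded_const pbs)+
 moreover have "gmean (\<lambda>T. P T + Q T) = gmean P + gmean Q" by (rule gmean_add[OF pbs(1,2)])
 moreover have "gmean (\<lambda>T. 2 * V T) = 2 * gmean V" by (rule gmean_cmult)
 ultimately have "gmean (\<lambda>T. (T $ a \<bullet> (v + w))\<^sup>2 * R T) = gmean P + gmean Q + 2 * gmean V" by linarith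
 hence "((norm (v + w))^2 - (norm v)\<^sup>2 - (norm w)\<^sup>2) * gmean (\<lambda>T. (T $ a \<bullet> e)\<^sup>2 * R T) = 2 * gmean V"
  unfolding sq[of "v + w"] sq[of v, folded P_def[abs_def]] sq[of w, folded Q_def[abs_def]] by (simp add: left_diff_distrib)
 moreover have "(norm (v + w))^2 - (norm v)\<^sup>2 - (norm w)\<^sup>2 = 2 * (v \<bullet> w)"
  by (simp add: power2_norm_eq_inner inner_add_left inner_add_right inner_commute)
 ultimately have "2 * ((v \<bullet> w) * gmean (\<lambda>T. (T $ a \<bullet> e)\<^sup>2 * R T)) = 2 * gmean V" by simp
 thus ?thesis unfolding V_def[abs_def] by simp
qed

text \<open>Its Gaussian mean is kept as an unevaluated constant; by rotation invariance the choice
  of the unit vector \<open>e\<close> is immaterial.\<close>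

definition gconst :: "'w set => (real^'m) => real^'m^'w => real" where
 "gconst B e T = (\<Prod>a\<in>B. (T $ a \<bullet> e)\<^sup>2)"

text \<open>The vectors are averaged one at a time; \<open>B\<close> collects the indices whose two
  factors have already been replaced by a squared component along \<open>e\<close>.\<close>

lemma gmean_product_aux:
 fixes v w :: "'w::finite => real^'m"
 assumes e: "norm e = 1"
 shows "finite J ==> J \<inter> B = {} ==>
  gmean (\<lambda>T. (\<Prod>a\<in>J. (T $ a \<bullet> v a) * (T $ a \<bullet> w a)) * gconst B e T) = (\<Prod>a\<in>J. v a \<bullet> w a) * gmean (gconst (J \<union> B) e)"
proof (induction J arbitrary: B rule: finite_induct)
 case (insert a J)
 have pb: "poly_bounded (\<lambda>T. (\<Prod>a\<in>J. (T $ a \<bullet> v a) * (T $ a \<bullet> w a)) * gconst B e T)"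
  unfolding gconst_def power2_eq_square by (intro poly_bounded_mult poly_bounded_prod poly_bounded_column)
 have ind: "(\<Prod>b\<in>J. (set_col a f T $ b \<bullet> v b) * (set_col a f T $ b \<bullet> w b)) * gconst B e (set_col a f T) = (\<Prod>b\<in>J. (T $ b \<bullet> v b) * (T $ b \<bullet> w b)) * gconst B e T" for f T
 proof -
  have sc: "set_col a f T $ b = T $ b" if "b \<in> J \<or> b \<in> B" for b
   using that insert.hyps insert.prems by (auto simp: set_col_def)
  show ?thesis unfolding gconst_def
   by (intro arg_cong2[where f="(*)"] prod.cong refl) (simp_all add: sc)
 qed
 have "gmean (\<lambda>T. (\<Prod>b\<in>insert a J. (T $ b \<bullet> v b) * (T $ b \<bullet> w b)) * gconst B e T)
  = gmean (\<lambda>T. ((T $ a \<bullet> v a) * (T $ a \<bullet> w a)) * ((\<Prod>b\<in>J. (T $ b \<bullet> v b) * (T $ b \<bullet> w b)) * gconst B e T))"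
  using insert.hyps by (simp add: mult.assoc)
 also have "... = (v a \<bullet> w a) * gmean (\<lambda>T. (T $ a \<bullet> e)\<^sup>2 * ((\<Prod>b\<in>J. (T $ b \<bullet> v b) * (T $ b \<bullet> w b)) * gconst B e T))"
  by (rule gmean_column[OF pb ind e])
 also have "(\<lambda>T. (T $ a \<bullet> e)\<^sup>2 * ((\<Prod>b\<in>J. (T $ b \<bullet> v b) * (T $ b \<bullet> w b)) * gconst B e T)) = (\<lambda>T. (\<Prod>b\<in>J. (T $ b \<bullet> v b) * (T $ b \<bullet> w b)) * gconst (insert a B) e T)"
  using insert.prems unfolding gconst_def by (auto simp: fun_eq_iff mult_ac)
 also have "gmean ... = (\<Prod>b\<in>J. v b \<bullet> w b) * gmean (gconst (J \<union> insert a B) e)"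
  using insert.hyps insert.prems by (intro insert.IH) auto
 finally show ?case using insert.hyps by simp
qed simp

lemma gmean_product:
 fixes e :: "real^'m" and v w :: "'w::finite => real^'m"
 assumes e: "norm e = 1"
 shows "gmean (\<lambda>T. \<Prod>a\<in>J. (T $ a \<bullet> v a) * (T $ a \<bullet> w a)) = (\<Prod>a\<in>J. v a \<bullet> w a) * gmean (gconst J e)"
 using gmean_product_aux[OF e, of J "{}" v w] by (simp add: gconst_def)

lemma gmean_gconst_pos:
 fixes e :: "real^'m"
 assumes e: "norm e = 1"
 shows "gmean (gconst (J :: 'w::finite set) e) > 0"
proof -
 have pb: "poly_bounded (gconst J e)" unfolding gconst_def power2_eq_square by (intro poly_bounded_mult poly_bounded_prod poly_bounded_column)
 have int: "integrable lborel (\<lambda>T. gconst J e T * gauss T)" by (rule integrable_gauss[OF pb])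
 have nn: "gconst J e T * gauss T \<ge> 0" for T using gauss_pos[of T] unfolding gconst_def by (intro mult_nonneg_nonneg prod_nonneg) auto
 have "\<not> (AE T in lborel. gconst J e T * gauss T = 0)"
 proof
  assume ae: "AE T in lborel. gconst J e T * gauss T = 0"
  have op: "open {T :: real^'m^'w. gconst J e T \<noteq> 0}"
   unfolding gconst_def by (intro open_Collect_neq continuous_intros)
  have "AE T in lborel. T \<notin> {T. gconst J e T \<noteq> 0}"
   using ae by (auto elim!: eventually_mono simp: gauss_def)
  hence "{T. gconst J e T \<noteq> 0} \<in> null_sets lborel"
   using op AE_iff_null_sets[of "{T. gconst J e T \<noteq> 0}" lborel] by simp
  hence "{T :: real^'m^'w. gconst J e T \<noteq> 0} = {}"
   using op by (metis negligible_iff_null_sets null_sets_completionI open_not_negligible)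
  moreover have "gconst J e (\<chi> a. e) = 1" using e by (simp add: gconst_def dot_square_norm)
  ultimately show False by force
 qed
 hence "(LINT T|lborel. gconst J e T * gauss T) \<noteq> 0"
  using integral_nonneg_eq_0_iff_AE[OF int] nn by auto
 moreover have "(LINT T|lborel. gconst J e T * gauss T) \<ge> 0" by (rule Bochner_Integration.integral_nonneg) (rule nn)
 ultimately show ?thesis unfolding gmean_def by linarith
qed

section \<open>Gram determinants in an eigenbasis\<close>

lemma orthonormal_expansion:
 fixes v :: "'n => real^'n"
 assumes v: "\<And>i j. v i \<bullet> v j = (if i = j then 1 else 0)"
 shows "x = (\<Sum>i\<in>UNIV. (x \<bullet> v i) *R v i)"
proof -
 define Q :: "real^'n^'n" where "Q = (\<chi> i j. v j $ i)"
 have QQ: "transpose Q ** Q = mat 1"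
  using v by (auto simp: Q_def vec_eq_iff matrix_matrix_mult_def transpose_def mat_def inner_vec_def)
 hence "Q ** transpose Q = mat 1" by (simp add: matrix_left_right_inverse)
 hence "x = (Q ** transpose Q) *v x" by simp
 also have "... = Q *v (transpose Q *v x)" by (rule matrix_vector_mul_assoc[symmetric])
 also have "... = (\<Sum>i\<in>UNIV. (x \<bullet> v i) *R v i)"
  by (simp add: vec_eq_iff Q_def transpose_def matrix_vector_mult_def inner_vec_def mult.commute)
 finally show ?thesis .
qed

text \<open>If the vectors with index in \<open>I\<close> are independent, the Schur complement is
  \<open>t s \<bullet> f (t s)\<close> minus a value of a nonnegative quadratic form; otherwise both
  determinants vanish.\<close>

lemma fischer_inequality:
 fixes t :: "'w::finite => real^'m"
 assumes f: "linear f" and sym: "\<And>v w. f v \<bullet> w = v \<bullet> f w" and pd: "\<And>v. v \<noteq> 0 ==> f v \<bullet> v > 0" and s: "s \<notin> I"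
 shows "gram_det I (\<lambda>a b. t a \<bullet> f (t b)) \<ge> 0"
  and "gram_det (insert s I) (\<lambda>a b. t a \<bullet> f (t b)) \<le> (t s \<bullet> f (t s)) * gram_det I (\<lambda>a b. t a \<bullet> f (t b))"
proof -
 let ?N = "\<lambda>a b. t a \<bullet> f (t b)"
 define K where "K J v = adj J t (f (comb J t v)) + rest J v" for J v
 have linK: "linear (K J)" for J
  unfolding K_def using linear_comb[of J t] linear_rest[of J] linear_adj[of J t] f
  by (simp add: linear_iff algebra_simps)
 have mK: "matrix (K J) = (\<chi> a b. if a \<in> J \<and> b \<in> J then ?N a b else if a = b then 1 else 0)" for J
  by (auto simp: matrix_def vec_eq_iff K_def comb_axis rest_axis linear_0[OF f] linear_0[OF linear_adj] adj_def) (auto simp: rest_def axis_def)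
 have dK: "det (matrix (K J)) = gram_det J ?N" for J unfolding mK gram_det_def ..
 have fn: "f v \<bullet> v \<ge> 0" for v using pd[of v] by (cases "v = 0") auto
 have Kv: "K J v \<bullet> v = f (comb J t v) \<bullet> comb J t v + (norm (rest J v))^2" for J v
  using rest_inner[of J v v] by (simp add: K_def inner_add_left adj_inner dot_square_norm)
 consider (inj) "\<forall>v. comb I t v = 0 \<longrightarrow> rest I v = 0 \<longrightarrow> v = 0" | (ker) v where "comb I t v = 0" "rest I v = 0" "v \<noteq> 0" by blast
 hence "gram_det I ?N \<ge> 0 \<and> gram_det (insert s I) ?N \<le> ?N s s * gram_det I ?N"
 proof cases
  case ker
  have "K I v = 0" by (simp add: K_def ker linear_0[OF f] linear_0[OF linear_adj])
  hence "det (matrix (K I)) = 0" by (intro det_zero_of_kernel[OF _ ker(3)]) (simp add: matrix_apply[OF linK])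
  moreover have "det (matrix (K (insert s I))) = 0"
  proof (rule det_zero_of_kernel[OF _ ker(3)])
   have va: "v $ a = 0" if "a \<notin> I" for a using ker(2) that by (auto simp: rest_def vec_eq_iff split: if_splits)
   have "comb (insert s I) t v = 0" using ker(1) s by (simp add: comb_def va)
   moreover have "rest (insert s I) v = 0" by (auto simp: rest_def vec_eq_iff va)
   ultimately show "matrix (K (insert s I)) *v v = 0"
    by (simp add: matrix_apply[OF linK] K_def linear_0[OF f] linear_0[OF linear_adj])
  qed
  ultimately show ?thesis unfolding dK by simp
 next
  case inj
  have pos: "K I v \<bullet> v > 0" if "v \<noteq> 0" for v
  proof (cases "comb I t v = 0")
   case True
   hence "rest I v \<noteq> 0" using inj that by blast
   thus ?thesis unfolding Kv using fn[of "comb I t v"] by (intro add_nonneg_pos) auto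
  next
   case False
   thus ?thesis unfolding Kv using pd by (intro add_pos_nonneg) auto
  qed
  have dpos: "det (matrix (K I)) > 0"
   by (rule det_pos_of_positive_definite) (simp add: matrix_apply[OF linK] pos)
  hence "invertible (matrix (K I))" by (simp add: invertible_det_nz)
  then obtain B where B: "matrix (K I) ** B = mat 1" unfolding invertible_def by blast
  define q where "q = B *v adj I t (f (t s))"
  have q: "K I q = adj I t (f (t s))" by (simp add: q_def matrix_apply[OF linK, symmetric] matrix_vector_mul_assoc B)
  have "t a \<bullet> f (comb I t q) = t a \<bullet> f (t s)" if "a \<in> I" for a
   using arg_cong[OF q, of "\<lambda>x. x $ a"] that by (simp add: K_def adj_def rest_def)
  from gram_det_border[OF f sym s this]
  have "gram_det (insert s I) ?N = (?N s s - f (t s) \<bullet> comb I t q) * gram_det I ?N" .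
  also have "... \<le> ?N s s * gram_det I ?N"
  proof (intro mult_right_mono)
   have "f (t s) \<bullet> comb I t q = K I q \<bullet> q" unfolding q by (simp add: adj_inner)
   also have "... \<ge> 0" unfolding Kv using fn by simp
   finally show "?N s s - f (t s) \<bullet> comb I t q \<le> ?N s s" by simp
  qed (use dpos in \<open>simp add: dK\<close>)
  finally show ?thesis using dpos unfolding dK by simp
 qed
 thus "gram_det I ?N \<ge> 0" "gram_det (insert s I) ?N \<le> ?N s s * gram_det I ?N" by auto
qed

text \<open>An ordered version of the elementary symmetric function: each set of
  \<open>card J\<close> indices is the image of \<open>fact (card J)\<close> injections. Signed sums
  over permutations produce it in this form.\<close>

definition inj_sum :: "'w set => ('n::finite => real) => real" where
 "inj_sum J l = (\<Sum>i\<in>{i \<in> J \<rightarrow>\<^sub>E UNIV. inj_on i J}. \<Prod>a\<in>J. l (i a))"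

lemma inj_sum_eq:
 fixes l :: "'n::finite => real"
 assumes J: "finite J"
 shows "inj_sum J l = fact (card J) * elem_sym (card J) UNIV l"
proof -
 let ?F = "{i \<in> J \<rightarrow>\<^sub>E UNIV. inj_on i J} :: ('a => 'n) set" and ?T = "{S :: 'n set. S \<subseteq> UNIV \<and> card S = card J}"
 have finF: "finite ?F" by (rule finite_subset[of _ "J \<rightarrow>\<^sub>E UNIV"]) (auto simp: J intro: finite_PiE)
 have "inj_sum J l = (\<Sum>S\<in>?T. \<Sum>i\<in>{i \<in> ?F. i ` J = S}. \<Prod>a\<in>J. l (i a))"
  unfolding inj_sum_def by (rule sum.group[symmetric]) (use finF in \<open>auto simp: card_image\<close>)
 also have "... = (\<Sum>S\<in>?T. fact (card J) * (\<Prod>j\<in>S. l j))"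
 proof (rule sum.cong[OF refl])
  fix S assume S: "S \<in> ?T"
  have "(\<Sum>i\<in>{i \<in> ?F. i ` J = S}. \<Prod>a\<in>J. l (i a)) = (\<Sum>i\<in>{i \<in> ?F. i ` J = S}. \<Prod>j\<in>S. l j)"
  proof (rule sum.cong[OF refl])
   fix i assume "i \<in> {i \<in> ?F. i ` J = S}"
   hence "inj_on i J" "i ` J = S" by auto
   thus "(\<Prod>a\<in>J. l (i a)) = (\<Prod>j\<in>S. l j)" using prod.reindex[of i J l] by simp
  qed
  moreover have "{i \<in> ?F. i ` J = S} = {i \<in> J \<rightarrow>\<^sub>E S. inj_on i J}"
  proof -
   have "i ` J = S" if "i \<in> J \<rightarrow>\<^sub>E S" "inj_on i J" for i
   proof -
    have "i ` J \<subseteq> S" using that by auto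
    moreover have "card (i ` J) = card S" using S that by (simp add: card_image)
    ultimately show ?thesis by (intro card_subset_eq) auto
   qed
   thus ?thesis by (auto simp: PiE_iff)
  qed
  moreover have "card {i \<in> J \<rightarrow>\<^sub>E S. inj_on i J} = fact (card J)"
   using card_inj_on_subset_funcset[OF J finite, of J S] S
   by (simp add: fact_prod_rev)
  ultimately show "(\<Sum>i\<in>{i \<in> ?F. i ` J = S}. \<Prod>a\<in>J. l (i a)) = fact (card J) * (\<Prod>j\<in>S. l j)" by simp
 qed
 finally show ?thesis by (simp add: elem_sym_def sum_distrib_left)
qed

text \<open>For injective \<open>i\<close> the matrix is the identity, otherwise two rows agree.
  This is how repeated eigenvalue indices drop out of an averaged Gram determinant.\<close>

lemma gram_det_index:
 fixes i :: "'w::finite => 'n"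
 shows "gram_det J (\<lambda>a b. if i a = i b then 1 else 0) = (if inj_on i J then 1 else 0)"
proof (cases "inj_on i J")
 case True
 hence "(\<chi> a b. if a \<in> J \<and> b \<in> J then (if i a = i b then 1 else 0) else if a = b then 1 else 0) = (mat 1 :: real^'w^'w)"
  by (auto simp: vec_eq_iff mat_def inj_on_def)
 thus ?thesis using True unfolding gram_det_def by (simp only:) simp
next
 case False
 then obtain a b where ab: "a \<in> J" "b \<in> J" "a \<noteq> b" "i a = i b" by (auto simp: inj_on_def)
 have "det (\<chi> a b. if a \<in> J \<and> b \<in> J then (if i a = i b then 1 else 0) else if a = b then (1::real) else 0) = 0"
  by (rule det_identical_rows[OF ab(3)]) (use ab in \<open>auto simp: row_def vec_eq_iff\<close>)
 thus ?thesis using False by (simp add: gram_det_def)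
qed

text \<open>Leibniz' formula with every entry expanded in eigenvectors. Reindexing the second
  factors by \<open>inv \<pi>\<close> gathers the two factors that involve the same vector
  \<open>t a\<close>, ready for averaging over independent vectors.\<close>

lemma gram_det_eigen_expand:
 fixes v :: "'n => real^'n" and t :: "'w::finite => real^'n"
 assumes f: "linear f" and v: "\<And>i j. v i \<bullet> v j = (if i = j then 1 else 0)" and eig: "\<And>i. f (v i) = l i *R v i"
 shows "gram_det J (\<lambda>a b. t a \<bullet> f (t b)) = (\<Sum>\<pi> | \<pi> permutes J. \<Sum>i\<in>J \<rightarrow>\<^sub>E UNIV.
  (of_int (sign \<pi>) * (\<Prod>a\<in>J. l (i a))) * (\<Prod>a\<in>J. (t a \<bullet> v (i a)) * (t a \<bullet> v (i (inv \<pi> a)))))"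
proof -
 have e: "x \<bullet> f y = (\<Sum>j\<in>UNIV. l j * ((x \<bullet> v j) * (y \<bullet> v j)))" for x y
 proof -
  have "f y = f (\<Sum>i\<in>UNIV. (y \<bullet> v i) *R v i)" using orthonormal_expansion[OF v, of y] by simp
  also have "... = (\<Sum>i\<in>UNIV. (y \<bullet> v i) *R (l i *R v i))" by (simp add: linear_sum[OF f] linear_scale[OF f] eig)
  finally show ?thesis by (simp add: inner_sum_right mult_ac)
 qed
 have "(\<Prod>a\<in>J. t a \<bullet> f (t (\<pi> a))) = (\<Sum>i\<in>J \<rightarrow>\<^sub>E UNIV. (\<Prod>a\<in>J. l (i a)) * (\<Prod>a\<in>J. (t a \<bullet> v (i a)) * (t a \<bullet> v (i (inv \<pi> a)))))"
  if \<pi>: "\<pi> permutes J" for \<pi>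
 proof -
  have "(\<Prod>a\<in>J. t a \<bullet> f (t (\<pi> a))) = (\<Sum>i\<in>J \<rightarrow>\<^sub>E UNIV. \<Prod>a\<in>J. l (i a) * ((t a \<bullet> v (i a)) * (t (\<pi> a) \<bullet> v (i a))))"
   unfolding e by (rule prod_sum_PiE) auto
  also have "... = (\<Sum>i\<in>J \<rightarrow>\<^sub>E UNIV. (\<Prod>a\<in>J. l (i a)) * (\<Prod>a\<in>J. (t a \<bullet> v (i a)) * (t a \<bullet> v (i (inv \<pi> a)))))"
  proof (rule sum.cong[OF refl])
   fix i :: "'w => 'n"
   have "(\<Prod>a\<in>J. t (\<pi> a) \<bullet> v (i a)) = (\<Prod>a\<in>J. t a \<bullet> v (i (inv \<pi> a)))"
   proof (rule prod.reindex_bij_witness[of _ "inv \<pi>" \<pi>])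
    show "inv \<pi> (\<pi> a) = a" "\<pi> (inv \<pi> a) = a" for a using permutes_inverses[OF \<pi>] by auto
    show "\<pi> a \<in> J" if "a \<in> J" for a using permutes_in_image[OF \<pi>] that by simp
    show "inv \<pi> a \<in> J" if "a \<in> J" for a using permutes_in_image[OF permutes_inv[OF \<pi>]] that by simp
    show "t (\<pi> a) \<bullet> v (i (inv \<pi> (\<pi> a))) = t (\<pi> a) \<bullet> v (i a)" for a using permutes_inverses[OF \<pi>] by simp
   qed
   thus "(\<Prod>a\<in>J. l (i a) * ((t a \<bullet> v (i a)) * (t (\<pi> a) \<bullet> v (i a)))) = (\<Prod>a\<in>J. l (i a)) * (\<Prod>a\<in>J. (t a \<bullet> v (i a)) * (t a \<bullet> v (i (inv \<pi> a))))"
    by (simp add: prod.distrib)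
  qed
  finally show ?thesis .
 qed
 thus ?thesis unfolding gram_det_expand by (intro sum.cong refl) (simp add: sum_distrib_left mult.assoc)
qed

text \<open>Orthonormality keeps only the permutations along whose orbits \<open>i\<close> is
  constant; their signed sum is the determinant of \<open>gram_det_index\<close>.\<close>

lemma inj_sum_sign:
 fixes v :: "'n => real^'n" and J :: "'w::finite set"
 assumes v: "\<And>i j. v i \<bullet> v j = (if i = j then 1 else 0)"
 shows "(\<Sum>\<pi> | \<pi> permutes J. \<Sum>i\<in>J \<rightarrow>\<^sub>E UNIV. (of_int (sign \<pi>) * (\<Prod>a\<in>J. l (i a))) * (\<Prod>a\<in>J. v (i a) \<bullet> v (i (inv \<pi> a)))) = inj_sum J l"
proof -
 have "(\<Sum>\<pi> | \<pi> permutes J. \<Sum>i\<in>J \<rightarrow>\<^sub>E UNIV. (of_int (sign \<pi>) * (\<Prod>a\<in>J. l (i a))) * (\<Prod>a\<in>J. v (i a) \<bullet> v (i (inv \<pi> a))))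
  = (\<Sum>i\<in>J \<rightarrow>\<^sub>E UNIV. \<Sum>\<pi> | \<pi> permutes J. (of_int (sign \<pi>) * (\<Prod>a\<in>J. l (i a))) * (\<Prod>a\<in>J. v (i a) \<bullet> v (i (inv \<pi> a))))"
  by (rule sum.swap)
 also have "... = (\<Sum>i\<in>J \<rightarrow>\<^sub>E UNIV. (\<Prod>a\<in>J. l (i a)) * (if inj_on i J then 1 else 0))"
 proof (rule sum.cong[OF refl])
  fix i :: "'w => 'n"
  have "(\<Sum>\<pi> | \<pi> permutes J. (of_int (sign \<pi>) * (\<Prod>a\<in>J. l (i a))) * (\<Prod>a\<in>J. v (i a) \<bullet> v (i (inv \<pi> a))))
   = (\<Sum>\<pi> | \<pi> permutes J. (of_int (sign \<pi>) * (\<Prod>a\<in>J. l (i a))) * (\<Prod>a\<in>J. v (i a) \<bullet> v (i (\<pi> a))))"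
   by (subst sum_permutations_inverse, rule sum.cong)
    (simp_all add: permutes_inv_inv sign_inverse[OF permutes_imp_permutation[OF finite]])
  also have "... = (\<Prod>a\<in>J. l (i a)) * gram_det J (\<lambda>a b. if i a = i b then 1 else 0)"
   unfolding gram_det_expand v sum_distrib_left by (rule sum.cong) (simp_all add: mult_ac)
  finally show "(\<Sum>\<pi> | \<pi> permutes J. (of_int (sign \<pi>) * (\<Prod>a\<in>J. l (i a))) * (\<Prod>a\<in>J. v (i a) \<bullet> v (i (inv \<pi> a)))) = (\<Prod>a\<in>J. l (i a)) * (if inj_on i J then 1 else 0)"
   unfolding gram_det_index .
 qed
 also have "... = inj_sum J l"
  unfolding inj_sum_def by (subst sum.inter_filter) (auto simp: finite_PiE intro!: sum.cong)
 finally show ?thesis .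
qed

context
 fixes f :: "real^'n => real^'n" and v :: "'n => real^'n" and l :: "'n => real" and e :: "real^'n"
 assumes f: "linear f" and v: "\<And>i j. v i \<bullet> v j = (if i = j then 1 else 0)" and eig: "\<And>i. f (v i) = l i *R v i"
  and e: "norm e = 1"
begin

lemma poly_bounded_gram_det: "poly_bounded (\<lambda>T :: real^'n^'w. gram_det J (\<lambda>a b. T $ a \<bullet> f (T $ b)))"
 unfolding gram_det_eigen_expand[OF f v eig]
 by (intro poly_bounded_sum poly_bounded_mult poly_bounded_const poly_bounded_prod poly_bounded_column)

text \<open>Averaging the eigenvector expansion term by term replaces each pair of factors by an
  inner product of eigenvectors; \<open>inj_sum_sign\<close> sums the result.\<close>

lemma gmean_gram_det:
 "gmean (\<lambda>T :: real^'n^'w. gram_det J (\<lambda>a b. T $ a \<bullet> f (T $ b))) = gmean (gconst J e) * (fact (card J) * elem_sym (card J) UNIV l)"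
proof -
 have "gmean (\<lambda>T :: real^'n^'w. gram_det J (\<lambda>a b. T $ a \<bullet> f (T $ b))) = (\<Sum>\<pi> | \<pi> permutes J. \<Sum>i\<in>J \<rightarrow>\<^sub>E UNIV.
  (of_int (sign \<pi>) * (\<Prod>a\<in>J. l (i a))) * ((\<Prod>a\<in>J. v (i a) \<bullet> v (i (inv \<pi> a))) * gmean (gconst J e)))"
  unfolding gram_det_eigen_expand[OF f v eig]
  by (subst gmean_sum, intro poly_bounded_sum poly_bounded_mult poly_bounded_const poly_bounded_prod poly_bounded_column,
    rule sum.cong[OF refl],
    subst gmean_sum, intro poly_bounded_sum poly_bounded_mult poly_bounded_const poly_bounded_prod poly_bounded_column,
    rule sum.cong[OF refl], subst gmean_cmult, subst gmean_product[OF e], rule refl)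
 also have "... = inj_sum J l * gmean (gconst J e)"
  unfolding inj_sum_sign[OF v, where J=J and l=l, symmetric] sum_distrib_right by (simp add: mult.assoc)
 finally show ?thesis by (simp add: inj_sum_eq mult.commute)
qed

lemma gmean_gram_det_column:
 fixes s :: "'w::finite"
 assumes s: "s \<notin> J"
 shows "gmean (\<lambda>T :: real^'n^'w. gram_det J (\<lambda>a b. T $ a \<bullet> f (T $ b)) * ((T $ s \<bullet> y) * (T $ s \<bullet> y')))
  = (y \<bullet> y') * (gmean (gconst (insert s J) e) * (fact (card J) * elem_sym (card J) UNIV l))"
proof -
 have summand: "gmean (\<lambda>T :: real^'n^'w. c * ((\<Prod>a\<in>J. (T $ a \<bullet> v (i a)) * (T $ a \<bullet> v (i (inv \<pi> a)))) * ((T $ s \<bullet> y) * (T $ s \<bullet> y'))))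
  = c * ((\<Prod>a\<in>J. v (i a) \<bullet> v (i (inv \<pi> a))) * ((y \<bullet> y') * gmean (gconst (insert s J) e)))" for c i \<pi>
 proof -
  let ?v = "\<lambda>a. if a = s then y else v (i a)" and ?w = "\<lambda>a. if a = s then y' else v (i (inv \<pi> a))"
  have "(\<Prod>a\<in>J. (T $ a \<bullet> v (i a)) * (T $ a \<bullet> v (i (inv \<pi> a)))) * ((T $ s \<bullet> y) * (T $ s \<bullet> y'))
   = (\<Prod>a\<in>insert s J. (T $ a \<bullet> ?v a) * (T $ a \<bullet> ?w a))" for T :: "real^'n^'w"
  proof -
   have "(\<Prod>a\<in>J. (T $ a \<bullet> v (i a)) * (T $ a \<bullet> v (i (inv \<pi> a)))) = (\<Prod>a\<in>J. (T $ a \<bullet> ?v a) * (T $ a \<bullet> ?w a))"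
    by (rule prod.cong) (use s in auto)
   thus ?thesis using s by (simp add: mult.commute)
  qed
  moreover have "(\<Prod>a\<in>insert s J. ?v a \<bullet> ?w a) = (\<Prod>a\<in>J. v (i a) \<bullet> v (i (inv \<pi> a))) * (y \<bullet> y')"
  proof -
   have "(\<Prod>a\<in>J. ?v a \<bullet> ?w a) = (\<Prod>a\<in>J. v (i a) \<bullet> v (i (inv \<pi> a)))"
    by (rule prod.cong) (use s in auto)
   thus ?thesis using s by (simp add: mult.commute)
  qed
  ultimately show ?thesis unfolding gmean_cmult using gmean_product[OF e, where J="insert s J" and v="?v" and w="?w"] by (simp only: mult.assoc)
 qed
 have "gmean (\<lambda>T :: real^'n^'w. gram_det J (\<lambda>a b. T $ a \<bullet> f (T $ b)) * ((T $ s \<bullet> y) * (T $ s \<bullet> y'))) = (\<Sum>\<pi> | \<pi> permutes J. \<Sum>i\<in>J \<rightarrow>\<^sub>E UNIV.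
  (of_int (sign \<pi>) * (\<Prod>a\<in>J. l (i a))) * ((\<Prod>a\<in>J. v (i a) \<bullet> v (i (inv \<pi> a))) * ((y \<bullet> y') * gmean (gconst (insert s J) e))))"
  unfolding gram_det_eigen_expand[OF f v eig] sum_distrib_right
  by (subst gmean_sum, intro poly_bounded_sum poly_bounded_mult poly_bounded_const poly_bounded_prod poly_bounded_column,
    rule sum.cong[OF refl],
    subst gmean_sum, intro poly_bounded_sum poly_bounded_mult poly_bounded_const poly_bounded_prod poly_bounded_column,
    rule sum.cong[OF refl], subst mult.assoc, rule summand)
 also have "... = inj_sum J l * ((y \<bullet> y') * gmean (gconst (insert s J) e))"
  unfolding inj_sum_sign[OF v, where J=J and l=l, symmetric] sum_distrib_right by (simp add: mult.assoc)
 finally show ?thesis by (simp add: inj_sum_eq mult_ac)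
qed

lemma gmean_gram_det_form:
 fixes s :: "'w::finite"
 assumes s: "s \<notin> J"
 shows "gmean (\<lambda>T :: real^'n^'w. gram_det J (\<lambda>a b. T $ a \<bullet> f (T $ b)) * (T $ s \<bullet> f (T $ s)))
  = (\<Sum>i\<in>UNIV. l i) * (gmean (gconst (insert s J) e) * (fact (card J) * elem_sym (card J) UNIV l))"
proof -
 have e: "x \<bullet> f x = (\<Sum>j\<in>UNIV. l j * ((x \<bullet> v j) * (x \<bullet> v j)))" for x
 proof -
  have "f x = f (\<Sum>i\<in>UNIV. (x \<bullet> v i) *R v i)" using orthonormal_expansion[OF v, of x] by simp
  also have "... = (\<Sum>i\<in>UNIV. (x \<bullet> v i) *R (l i *R v i))" by (simp add: linear_sum[OF f] linear_scale[OF f] eig)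
  finally show ?thesis by (simp add: inner_sum_right mult_ac)
 qed
 have "gmean (\<lambda>T :: real^'n^'w. gram_det J (\<lambda>a b. T $ a \<bullet> f (T $ b)) * (T $ s \<bullet> f (T $ s)))
  = gmean (\<lambda>T. \<Sum>j\<in>UNIV. l j * (gram_det J (\<lambda>a b. T $ a \<bullet> f (T $ b)) * ((T $ s \<bullet> v j) * (T $ s \<bullet> v j))))"
  unfolding e[of "_ $ s"] sum_distrib_left by (simp add: mult_ac)
 also have "... = (\<Sum>j\<in>UNIV. l j * gmean (\<lambda>T :: real^'n^'w. gram_det J (\<lambda>a b. T $ a \<bullet> f (T $ b)) * ((T $ s \<bullet> v j) * (T $ s \<bullet> v j))))"
  by (subst gmean_sum, intro poly_bounded_mult poly_bounded_const poly_bounded_gram_det poly_bounded_column)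
   (simp only: gmean_cmult)
 finally show ?thesis unfolding gmean_gram_det_column[OF s] by (simp add: v sum_distrib_right)
qed

end

text \<open>The weight \<open>exp (- potential)\<close> once the point of the slice has been moved
  onto the ray of the base point; \<open>l\<close> will be the value of \<open>U\<close> at the base
  point.\<close>

abbreviation split_gauss :: "'w::finite set => real => real^'w => real" where
 "split_gauss I l p \<equiv> exp (- l * (\<Sum>a\<in>I. (p $ a)\<^sup>2) - (norm (rest I p))\<^sup>2 / 2)"

lemma nn_integral_vec_prod:
 fixes f :: "'w::finite => real => ennreal"
 assumes [measurable]: "\<And>a. f a \<in> borel_measurable borel"
 shows "(\<integral>\<^sup>+p. (\<Prod>a\<in>UNIV. f a (p $ a)) \<partial>(lborel :: (real^'w) measure)) = (\<Prod>a\<in>UNIV. \<integral>\<^sup>+y. f a y \<partial>lborel)"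
proof -
 have B: "(Basis :: (real^'w) set) = range (\<lambda>a. axis a 1)" by (auto simp: Basis_vec_def)
 have inj: "inj (\<lambda>a. axis a 1 :: real^'w)" by (auto simp: inj_on_def axis_eq_axis)
 define g where "g b = f (inv (\<lambda>a. axis a 1 :: real^'w) b)" for b
 have g: "g (axis a 1) = f a" for a by (simp add: g_def inv_f_f[OF inj])
 have "(\<integral>\<^sup>+p. (\<Prod>b\<in>Basis. g b (p \<bullet> b)) \<partial>(lborel :: (real^'w) measure)) = (\<Prod>b\<in>Basis. \<integral>\<^sup>+y. g b y \<partial>lborel)"
  by (rule nn_integral_lborel_prod) (auto simp: g_def)
 thus ?thesis unfolding B prod.reindex[OF inj] comp_def g by (simp add: inner_axis)
qed

text \<open>A product of one-dimensional Gaussian integrals, with rate \<open>l\<close> on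
  \<open>I\<close> and \<open>1 / 2\<close> elsewhere. The second moment is the mass times
  \<open>card I / (2 * l)\<close>, the source of the factor \<open>k + 1\<close> in the averaged
  inequality.\<close>

lemma gaussian_integrals_split:
 fixes I :: "'w::finite set"
 obtains c :: real where "c > 0"
  "\<And>l. l > 0 ==> (\<integral>p. ennreal (split_gauss I l p)) = ennreal (c / sqrt l ^ card I)"
  "\<And>l. l > 0 ==> (\<integral>p. ennreal ((\<Sum>a\<in>I. (p $ a)\<^sup>2) * split_gauss I l p))
   = ennreal (card I / (2 * l) * (c / sqrt l ^ card I))"
proof -
 define m where "m = sqrt pi"
 have m: "m > 0" by (simp add: m_def)
 note mm = gaussian_integrals_real[folded m_def]
 define k where "k l a = (if a \<in> I then l else 1/2)" for l :: real and a
 have kpos: "l > 0 ==> k l a > 0" for l a by (simp add: k_def)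
 define c where "c = m ^ card I * (m / sqrt (1/2)) ^ card (- I)"
 have cpos: "c > 0" using m by (simp add: c_def)
 have pr: "(\<Prod>a\<in>UNIV. m / sqrt (k l a)) = c / sqrt l ^ card I" for l
 proof -
  have "(\<Prod>a\<in>UNIV. m / sqrt (k l a)) = (\<Prod>a\<in>I. m / sqrt (k l a)) * (\<Prod>a\<in>-I. m / sqrt (k l a))"
   by (subst prod.union_disjoint[symmetric]) (auto simp: Compl_partition)
  thus ?thesis by (simp add: k_def c_def power_divide)
 qed
 have rest2: "(norm (rest I p))^2 = (\<Sum>a\<in>-I. (p $ a)\<^sup>2)" for p
 proof -
  have "(norm (rest I p))^2 = (\<Sum>a\<in>UNIV. if a \<in> I then 0 else (p $ a)\<^sup>2)"
   unfolding power2_norm_eq_inner inner_vec_def by (rule sum.cong) (auto simp: rest_def power2_eq_square)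
  thus ?thesis by (simp add: sum.If_cases Compl_eq)
 qed
 have ex: "split_gauss I l p = (\<Prod>a\<in>UNIV. exp (- k l a * (p $ a)^2))" for l p
 proof -
  have "(\<Sum>a\<in>UNIV. - k l a * (p $ a)^2) = (\<Sum>a\<in>I. - k l a * (p $ a)^2) + (\<Sum>a\<in>-I. - k l a * (p $ a)^2)"
   by (subst sum.union_disjoint[symmetric]) (auto simp: Compl_partition)
  also have "... = - l * (\<Sum>a\<in>I. (p $ a)\<^sup>2) - (norm (rest I p))\<^sup>2 / 2"
   by (simp add: k_def rest2 sum_distrib_left sum_negf sum_divide_distrib)
  finally show ?thesis by (simp add: exp_sum[symmetric])
 qed
 show ?thesis
 proof (rule that[OF cpos])
  fix l :: real assume l: "l > 0"
  have "(\<integral>p. ennreal (split_gauss I l p))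
   = (\<integral>p. (\<Prod>a\<in>UNIV. ennreal (exp (- k l a * (p $ a)^2))))"
   unfolding ex by (simp add: prod_ennreal)
  also have "... = (\<Prod>a\<in>UNIV. ennreal (m / sqrt (k l a)))"
   by (subst nn_integral_vec_prod) (simp_all only: mm(1)[OF kpos[OF l]], measurable)
  also have "... = ennreal (c / sqrt l ^ card I)"
   by (subst prod_ennreal) (use m kpos[OF l] in \<open>auto simp: pr less_imp_le\<close>)
  finally show "(\<integral>p. ennreal (split_gauss I l p)) = ennreal (c / sqrt l ^ card I)" .
  have one: "(\<integral>p. ennreal ((p $ b)^2 * split_gauss I l p))
   = ennreal (1 / (2 * l) * (c / sqrt l ^ card I))" if b: "b \<in> I" for b
  proof -
   have "(p $ b)^2 * (\<Prod>a\<in>UNIV. exp (- k l a * (p $ a)^2)) = (\<Prod>a\<in>UNIV. (if a = b then (p $ a)\<^sup>2 else 1) * exp (- k l a * (p $ a)^2))" for p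
    by (simp add: prod.distrib)
   hence "(\<integral>p. ennreal ((p $ b)^2 * split_gauss I l p))
    = (\<integral>p. (\<Prod>a\<in>UNIV. ennreal ((if a = b then (p $ a)\<^sup>2 else 1) * exp (- k l a * (p $ a)^2))))"
    unfolding ex by (subst prod_ennreal) auto
   also have "... = (\<Prod>a\<in>UNIV. \<integral>\<^sup>+y. ennreal ((if a = b then y\<^sup>2 else 1) * exp (- k l a * y^2)) \<partial>lborel)"
    by (rule nn_integral_vec_prod) measurable
   also have "... = (\<Prod>a\<in>UNIV. ennreal ((if a = b then 1 / (2 * l) else 1) * (m / sqrt (k l a))))"
   proof (rule prod.cong[OF refl])
    fix a
    have "k l b = l" using b by (simp add: k_def)
    thus "(\<integral>y. ennreal ((if a = b then y\<^sup>2 else 1) * exp (- k l a * y^2))) = ennreal ((if a = b then 1 / (2 * l) else 1) * (m / sqrt (k l a)))"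
     using mm(2)[OF l] mm(1)[OF kpos[OF l], of a] by (cases "a = b") simp_all
   qed
   also have "... = ennreal ((\<Prod>a\<in>UNIV. (if a = b then 1 / (2 * l) else 1)) * (\<Prod>a\<in>UNIV. m / sqrt (k l a)))"
    unfolding prod.distrib[symmetric] by (rule prod_ennreal) (use m l kpos[OF l] in \<open>auto simp: less_imp_le\<close>)
   finally show ?thesis unfolding pr by simp
  qed
  have "(\<integral>p. ennreal ((\<Sum>a\<in>I. (p $ a)\<^sup>2) * split_gauss I l p))
   = (\<integral>p. (\<Sum>b\<in>I. ennreal ((p $ b)^2 * split_gauss I l p)))"
   by (subst sum_ennreal) (auto simp: sum_distrib_right)
  also have "... = (\<Sum>b\<in>I. ennreal (1 / (2 * l) * (c / sqrt l ^ card I)))"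
  proof (subst nn_integral_sum)
   show "(\<lambda>p. ennreal ((p $ b)^2 * split_gauss I l p)) \<in> borel_measurable lborel" for b
    unfolding rest2 by measurable
  qed (rule sum.cong[OF refl], rule one)
  also have "... = ennreal (card I / (2 * l) * (c / sqrt l ^ card I))"
   by (subst sum_ennreal) (use l cpos in auto)
  finally show "(\<integral>p. ennreal ((\<Sum>a\<in>I. (p $ a)\<^sup>2) * split_gauss I l p))
   = ennreal (card I / (2 * l) * (c / sqrt l ^ card I))" .
 qed
qed

section \<open>Averaging the slice inequality\<close>

text \<open>The first component is the base point \<open>x\<close>, the second one a family of independent Gaussian
 vectors. In \<open>tau a0 z\<close> the base point takes the place of the vector of index \<open>a0\<close>; a slice is
 the span of the vectors with index in \<open>I\<close>, and \<open>reflect\<close> moves the base point within it.\<close>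

type_synonym ('m, 'w) frame = "(real, 'm) vec \<times> ((real, 'm) vec, 'w) vec"

definition tau :: "'w::finite => ('m,'w) frame => 'w => real^'m" where
 "tau a0 z a = (if a = a0 then fst z else snd z $ a)"

definition reflect :: "'w::finite => 'w set => real^'w => ('m::finite,'w) frame => ('m,'w) frame" where
 "reflect a0 I u z = (fst z - (2 * u $ a0) *R comb I (tau a0 z) u,
  \<chi> a. if a \<in> I - {a0} then snd z $ a - (2 * u $ a) *R comb I (tau a0 z) u else snd z $ a)"

lemma tau_reflect:
 assumes "a0 \<in> I" "\<And>a. a \<notin> I ==> u $ a = 0"
 shows "tau a0 (reflect a0 I u z) a = tau a0 z a - (2 * u $ a) *R comb I (tau a0 z) u"
 using assms(1) assms(2)[of a] by (auto simp: tau_def reflect_def)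

lemma tau_linear: "tau a0 (z + z') a = tau a0 z a + tau a0 z' a" "tau a0 (c *R z) a = c *R tau a0 z a"
 by (auto simp: tau_def)

lemma comb_tau_linear: "comb I (tau a0 (z + z')) p = comb I (tau a0 z) p + comb I (tau a0 z') p"
 "comb I (tau a0 (c *R z)) p = c *R comb I (tau a0 z) p"
 by (auto simp: comb_def tau_linear scaleR_add_right sum.distrib scaleR_sum_right mult.commute)

lemma linear_reflect: "linear (reflect a0 I u)"
 by (rule linearI) (auto simp: reflect_def comb_tau_linear vec_eq_iff algebra_simps)

text \<open>On the vectors \<open>tau a0 z a\<close> with \<open>a \<in> I\<close> this is a
  Householder reflection of the index space, hence orthogonal; the remaining components of the frame
  are fixed.\<close>

lemma norm_reflect:
 fixes z :: "('m::finite,'w::finite) frame"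
 assumes a0: "a0 \<in> I" and u: "\<And>a. a \<notin> I ==> u $ a = 0" and uu: "u \<bullet> u = 1"
 shows "norm (reflect a0 I u z) = norm z"
proof -
 let ?y = "comb I (tau a0 z) u"
 have n: "(norm z)^2 = (\<Sum>a\<in>I. (norm (tau a0 z a))\<^sup>2) + (\<Sum>a\<in>-(I - {a0}). (norm (snd z $ a))\<^sup>2)" for z :: "('m,'w) frame"
 proof -
  have "(norm z)^2 = (norm (fst z))^2 + (\<Sum>a\<in>UNIV. (norm (snd z $ a))\<^sup>2)"
   by (simp add: norm_prod_def norm_vec_def L2_set_def sum_nonneg)
  also have "(\<Sum>a\<in>UNIV. (norm (snd z $ a))\<^sup>2) = (\<Sum>a\<in>I - {a0}. (norm (snd z $ a))\<^sup>2) + (\<Sum>a\<in>-(I - {a0}). (norm (snd z $ a))\<^sup>2)"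
   by (subst sum.union_disjoint[symmetric]) (auto simp only: Compl_partition finite Compl_disjoint)
  also have "(norm (fst z))^2 + ((\<Sum>a\<in>I - {a0}. (norm (snd z $ a))\<^sup>2) + (\<Sum>a\<in>-(I - {a0}). (norm (snd z $ a))\<^sup>2))
   = (\<Sum>a\<in>I. (norm (tau a0 z a))\<^sup>2) + (\<Sum>a\<in>-(I - {a0}). (norm (snd z $ a))\<^sup>2)"
   using a0 by (simp add: sum.remove[of I a0] tau_def)
  finally show ?thesis .
 qed
 have tr: "tau a0 (reflect a0 I u z) a = tau a0 z a - (2 * u $ a) *R comb I (tau a0 z) u" for a
  by (rule tau_reflect[OF a0 u])
 have "(\<Sum>a\<in>I. (norm (tau a0 (reflect a0 I u z) a))\<^sup>2) = (\<Sum>a\<in>I. (norm (tau a0 z a))\<^sup>2 + 4 * (u $ a * u $ a) * (?y \<bullet> ?y) - 4 * (u $ a * (tau a0 z a \<bullet> ?y)))"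
  unfolding tr power2_norm_eq_inner
  by (rule sum.cong) (auto simp: inner_diff_left inner_diff_right inner_commute algebra_simps)
 also have "... = (\<Sum>a\<in>I. (norm (tau a0 z a))\<^sup>2) + 4 * (\<Sum>a\<in>I. u $ a * u $ a) * (?y \<bullet> ?y) - 4 * (\<Sum>a\<in>I. u $ a * (tau a0 z a \<bullet> ?y))"
  by (simp add: sum.distrib sum_subtractf sum_distrib_left sum_distrib_right mult.assoc)
 also have "(\<Sum>a\<in>I. u $ a * (tau a0 z a \<bullet> ?y)) = ?y \<bullet> ?y" by (subst (3) comb_def) (simp add: inner_sum_right inner_commute)
 also have "(\<Sum>a\<in>I. u $ a * u $ a) = 1"
 proof -
  have "(\<Sum>a\<in>UNIV. u $ a * u $ a) = (\<Sum>a\<in>I. u $ a * u $ a)" by (rule sum.mono_neutral_right) (auto simp: u)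
  thus ?thesis using uu by (simp add: inner_vec_def)
 qed
 finally have "(\<Sum>a\<in>I. (norm (tau a0 (reflect a0 I u z) a))\<^sup>2) = (\<Sum>a\<in>I. (norm (tau a0 z a))\<^sup>2)" by simp
 moreover have "(\<Sum>a\<in>-(I - {a0}). (norm (snd (reflect a0 I u z) $ a))\<^sup>2) = (\<Sum>a\<in>-(I - {a0}). (norm (snd z $ a))\<^sup>2)"
  by (rule sum.cong) (auto simp: reflect_def)
 ultimately have "(norm (reflect a0 I u z))^2 = (norm z)^2" unfolding n[of "reflect a0 I u z"] n[of z] by simp
 thus ?thesis by simp
qed

text \<open>The reflection acts on the Gram matrix by congruence with \<open>1 - 2 u u^T\<close>,
  whose determinant is \<open>- 1\<close>.\<close>

lemma reflect_gram_det:
 fixes z :: "('m::finite,'w::finite) frame"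
 assumes a0: "a0 \<in> I" and u: "\<And>a. a \<notin> I ==> u $ a = 0" and uu: "u \<bullet> u = 1" and f: "linear f" and J: "I \<subseteq> J"
 shows "gram_det J (\<lambda>a b. tau a0 (reflect a0 I u z) a \<bullet> f (tau a0 (reflect a0 I u z) b)) = gram_det J (\<lambda>a b. tau a0 z a \<bullet> f (tau a0 z b))"
proof -
 have tr: "tau a0 (reflect a0 I u z) a = tau a0 z a - (2 * u $ a) *R comb I (tau a0 z) u" for a
  by (rule tau_reflect[OF a0 u])
 have "(\<Sum>c\<in>J. u $ c *R tau a0 z c) = comb I (tau a0 z) u"
  unfolding comb_def by (rule sum.mono_neutral_right) (use u J in auto)
 hence "gram_det J (\<lambda>a b. tau a0 (reflect a0 I u z) a \<bullet> f (tau a0 (reflect a0 I u z) b)) = (1 + ((-2) *R u) \<bullet> u)^2 * gram_det J (\<lambda>a b. tau a0 z a \<bullet> f (tau a0 z b))"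
  by (intro gram_det_rank_one[OF f]) (use u J in \<open>auto simp: tr\<close>)
 thus ?thesis using uu by simp
qed

text \<open>Reflection along \<open>d\<close> exchanges the coefficient vector of \<open>p\<close>
  within \<open>I\<close> with \<open>r\<close> times the axis of \<open>a0\<close>, both of norm
  \<open>r\<close>. The combination with coefficients \<open>p\<close> in the reflected frame is
  thus a multiple of the base point. The hypothesis \<open>ne\<close> says that \<open>d\<close> is
  not 0.\<close>

lemma comb_reflect:
 fixes z :: "('m::finite,'w::finite) frame" and p :: "real^'w"
 assumes a0: "a0 \<in> I" and p: "r > 0" "(\<Sum>a\<in>I. (p $ a)\<^sup>2) = r^2"
  and ne: "p - rest I p \<noteq> r *R axis a0 1"
 defines "d \<equiv> p - rest I p - r *R axis a0 1"
 defines "u \<equiv> d /\<^sub>R norm d"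
 shows "u \<bullet> u = 1" "\<And>a. a \<notin> I ==> u $ a = 0" "comb I (tau a0 (reflect a0 I u z)) p = r *R fst z"
proof -
 have d0: "d \<noteq> 0" using ne by (simp add: d_def)
 thus uu: "u \<bullet> u = 1" by (simp add: u_def dot_square_norm power2_eq_square)
 show u: "u $ a = 0" if "a \<notin> I" for a
 proof -
  have "a \<noteq> a0" using that a0 by blast
  thus ?thesis using that by (simp add: u_def d_def rest_def axis_def)
 qed
 define q where "q = p - rest I p"
 have q: "q $ a = (if a \<in> I then p $ a else 0)" for a by (simp add: q_def rest_def)
 have dq: "d = q - r *R axis a0 1" by (simp add: d_def q_def)
 have qq: "q \<bullet> q = r^2"
 proof -
  have "q \<bullet> q = (\<Sum>a\<in>UNIV. if a \<in> I then (p $ a)\<^sup>2 else 0)" unfolding inner_vec_def by (rule sum.cong) (auto simp: q power2_eq_square)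
  thus ?thesis using p(2) by (simp add: sum.If_cases)
 qed
 have qa: "q \<bullet> axis a0 1 = q $ a0" by (simp add: inner_axis)
 have dd: "d \<bullet> d = 2 * (r^2 - r * q $ a0)"
  by (simp add: dq inner_diff_left inner_diff_right qq qa inner_commute[of "axis a0 1" q] power2_eq_square algebra_simps)
 have qd: "q \<bullet> d = r^2 - r * q $ a0" by (simp add: dq inner_diff_right qq qa)
 have key: "(2 * (q \<bullet> u)) *R u = d"
 proof -
  have "(2 * (q \<bullet> u)) *R u = (2 * (q \<bullet> d) / (d \<bullet> d)) *R d" by (simp add: u_def dot_square_norm power2_eq_square divide_inverse mult_ac)
  also have "2 * (q \<bullet> d) / (d \<bullet> d) = 1" using d0 dd qd by (metis divide_self_if inner_eq_zero_iff)
  finally show ?thesis by simp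
 qed
 have pu: "(\<Sum>a\<in>I. p $ a * u $ a) = q \<bullet> u"
 proof -
  have "q \<bullet> u = (\<Sum>a\<in>UNIV. if a \<in> I then p $ a * u $ a else 0)" unfolding inner_vec_def by (rule sum.cong) (auto simp: q)
  thus ?thesis by (simp add: sum.If_cases)
 qed
 have tr: "tau a0 (reflect a0 I u z) a = tau a0 z a - (2 * u $ a) *R comb I (tau a0 z) u" for a
  by (rule tau_reflect[OF a0 u])
 have "comb I (tau a0 (reflect a0 I u z)) p = (\<Sum>a\<in>I. p $ a *R tau a0 z a - (2 * (p $ a * u $ a)) *R comb I (tau a0 z) u)"
  unfolding comb_def[of I "tau a0 (reflect a0 I u z)"] tr
  by (rule sum.cong) (simp_all add: scaleR_diff_right mult_ac)
 also have "... = comb I (tau a0 z) p - (2 * (q \<bullet> u)) *R comb I (tau a0 z) u"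
  by (simp add: sum_subtractf comb_def[of I "tau a0 z" p] scaleR_sum_left[symmetric] sum_distrib_left[symmetric] pu)
 also have "comb I (tau a0 z) p = comb I (tau a0 z) q" unfolding comb_def by (rule sum.cong) (auto simp: q)
 also have "... - (2 * (q \<bullet> u)) *R comb I (tau a0 z) u = comb I (tau a0 z) (q - (2 * (q \<bullet> u)) *R u)"
  by (simp add: linear_diff[OF linear_comb] linear_scale[OF linear_comb])
 also have "q - (2 * (q \<bullet> u)) *R u = r *R axis a0 1" unfolding key by (simp add: dq)
 also have "comb I (tau a0 z) (r *R axis a0 1) = r *R fst z"
  using a0 by (simp add: linear_scale[OF linear_comb] comb_axis tau_def)
 finally show "comb I (tau a0 (reflect a0 I u z)) p = r *R fst z" .
qed

lemma borel_measurable_nth [measurable (raw)]: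
 "f \<in> borel_measurable M ==> (\<lambda>x. (f x :: 'b::euclidean_space^'n) $ i) \<in> borel_measurable M"
proof -
 have "(\<lambda>y :: 'b^'n. y $ i) \<in> borel_measurable borel" by (intro borel_measurable_continuous_onI continuous_intros)
 thus "f \<in> borel_measurable M ==> (\<lambda>x. (f x :: 'b^'n) $ i) \<in> borel_measurable M"
  by (rule measurable_compose[rotated])
qed

lemma borel_measurable_gram_det [measurable (raw)]:
 assumes "\<And>a b. (\<lambda>x. N x a b) \<in> borel_measurable M"
 shows "(\<lambda>x. gram_det J (N x)) \<in> borel_measurable M"
 unfolding gram_det_expand by (intro borel_measurable_sum borel_measurable_times borel_measurable_prod borel_measurable_const assms)

lemma borel_measurable_tau [measurable (raw)]:
 fixes z :: "'b => ('m::finite,'w::finite) frame"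
 assumes "z \<in> borel_measurable M"
 shows "(\<lambda>x. tau a0 (z x) a) \<in> borel_measurable M"
proof -
 have "continuous_on UNIV (\<lambda>z :: ('m,'w) frame. tau a0 z a)"
  unfolding tau_def by (cases "a = a0") (auto intro!: continuous_intros)
 from measurable_compose[OF assms borel_measurable_continuous_onI[OF this]] show ?thesis .
qed

lemma borel_measurable_comb [measurable (raw)]:
 assumes "\<And>a. (\<lambda>x. t x a) \<in> borel_measurable M" and "p \<in> borel_measurable M"
 shows "(\<lambda>x. comb I (t x) (p x)) \<in> borel_measurable M"
 unfolding comb_def by (intro borel_measurable_sum borel_measurable_scaleR borel_measurable_nth assms)

lemma borel_measurable_rest [measurable (raw)]:
 assumes "p \<in> borel_measurable M"
 shows "(\<lambda>x. rest I (p x)) \<in> borel_measurable M"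
proof -
 have "continuous_on UNIV (rest I)"
  using linear_continuous_on linear_rest linear_conv_bounded_linear by blast
 from measurable_compose[OF assms borel_measurable_continuous_onI[OF this]] show ?thesis .
qed

context even_support
begin

lemma h_measurable [measurable]: "h \<in> borel_measurable borel"
 by (rule borel_measurable_continuous_countable_exceptions[OF _ cont_h]) simp

lemma X_measurable [measurable]: "X \<in> borel_measurable borel"
 by (rule borel_measurable_continuous_countable_exceptions[OF _ cont_X]) simp

lemma G_measurable [measurable]: "G \<in> borel_measurable borel"
 unfolding G_def[abs_def] by measurable

lemma U_measurable [measurable]: "U \<in> borel_measurable borel"
 unfolding U_def[abs_def] by measurable

lemma H_measurable [measurable (raw)]:
 assumes [measurable]: "y \<in> borel_measurable M" "v \<in> borel_measurable M"
 shows "(\<lambda>x. H (y x) (v x)) \<in> borel_measurable M"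
proof -
 have [measurable]: "(\<lambda>x. H x (axis i 1)) \<in> borel_measurable borel" for i
  by (rule borel_measurable_continuous_countable_exceptions[OF _ contH]) simp
 have "H (y x) (v x) = (\<Sum>i\<in>UNIV. v x $ i *R H (y x) (axis i 1))" for x
 proof -
  have "H (y x) (v x) = H (y x) (\<Sum>i\<in>UNIV. v x $ i *R axis i 1)"
   by (simp add: basis_expansion[of "v x", unfolded scalar_mult_eq_scaleR])
  thus ?thesis by (simp add: linear_sum[OF linH'] linear_scale[OF linH'])
 qed
 thus ?thesis by simp
qed

end

lemma AE_not_hyperplane:
 fixes c :: "'a::euclidean_space"
 assumes "c \<noteq> 0"
 shows "AE x in lborel. c \<bullet> x \<noteq> 0"
proof -
 have "closed {x. c \<bullet> x = 0}" by (rule closed_hyperplane)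
 hence "{x. c \<bullet> x = 0} \<in> null_sets lborel"
  using negligible_hyperplane[of c 0] assms by (simp add: negligible_iff_null_sets null_sets_completion_iff)
 thus ?thesis using AE_not_in by fastforce
qed

lemma borel_measurable_fst_snd [measurable (raw)]:
 fixes f :: "'b => 'c::euclidean_space \<times> 'd::euclidean_space"
 assumes "f \<in> borel_measurable M"
 shows "(\<lambda>x. fst (f x)) \<in> borel_measurable M" "(\<lambda>x. snd (f x)) \<in> borel_measurable M"
proof -
 have "fst \<in> borel_measurable (borel :: ('c \<times> 'd) measure)" "snd \<in> borel_measurable (borel :: ('c \<times> 'd) measure)"
  by (auto intro!: borel_measurable_continuous_onI continuous_intros simp: case_prod_beta)
 thus "(\<lambda>x. fst (f x)) \<in> borel_measurable M" "(\<lambda>x. snd (f x)) \<in> borel_measurable M"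
  using measurable_compose[OF assms] by blast+
qed

lemma gauss_pair: "gauss z = gauss (fst z) * gauss (snd z)"
 by (simp add: gauss_def norm_prod_def exp_add[symmetric] add_divide_distrib)

lemma elem_sym_1: "finite I ==> elem_sym (Suc 0) I f = (\<Sum>i\<in>I. f i)"
proof -
 assume "finite I"
 have "{S. S \<subseteq> I \<and> card S = Suc 0} = (\<lambda>i. {i}) ` I" by (auto simp: card_1_singleton_iff card_Suc_eq)
 thus ?thesis unfolding elem_sym_def by (simp add: sum.reindex)
qed

context strict_even_support
begin

abbreviation slice :: "(real^'m => ('m,'w::finite) frame => real) => _" where
 "slice Q I a0 z p \<equiv> Q (comb I (tau a0 z) p) z * exp (- potential I (tau a0 z) p)"

text \<open>For fixed \<open>p\<close>, an isometry of the space of frames that preserves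
  \<open>gauss\<close> and \<open>Q\<close> turns the slice point with coefficients \<open>p\<close>
  into \<open>r *R fst z\<close>. After Fubini \<open>Q\<close> is evaluated at the base point only,
  and the integral over \<open>p\<close> is an explicit Gaussian one. This takes the place of
  integration over a Grassmannian.\<close>

lemma nn_integral_slice:
 fixes Q :: "real^'m => ('m,'w::finite) frame => real" and w :: "real => real" and I :: "'w set"
 assumes Qm: "(\<lambda>\<omega>. Q (fst \<omega>) (snd \<omega>)) \<in> borel_measurable borel" and a0: "a0 \<in> I"
  and inv: "\<And>u y z. u \<bullet> u = 1 ==> (\<And>a. a \<notin> I ==> u $ a = 0) ==> Q y (reflect a0 I u z) = Q y z"
  and scale: "\<And>r x z. r > 0 ==> x \<noteq> 0 ==> Q (r *R x) z = w r * Q x z"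
  and w: "\<And>r. w r \<ge> 0" and wm [measurable]: "w \<in> borel_measurable borel"
 defines "R \<equiv> \<lambda>p :: real^'w. \<Sum>a\<in>I. (p $ a)\<^sup>2"
 shows "(\<integral>z. (\<integral>p. ennreal (gauss z * (slice Q I a0 z p))))
  = (\<integral>z. ennreal (gauss z * Q (fst z) z) * (\<integral>p. ennreal (w (sqrt (R p)) * exp (- U (fst z) * R p - (norm (rest I p))\<^sup>2 / 2))))"
proof -
 have Qm' [measurable (raw)]: "(\<lambda>x. Q (f x) (g x)) \<in> borel_measurable M"
  if "f \<in> borel_measurable M" "g \<in> borel_measurable M" for f g and M :: "'b measure"
  using measurable_compose[OF borel_measurable_Pair[OF that] Qm] by simp
 have Rm [measurable]: "R \<in> borel_measurable borel" unfolding R_def by measurable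
 define F where "F z p = ennreal (gauss z * (slice Q I a0 z p))" for z p
 define F' where "F' z p = ennreal (gauss z * (w (sqrt (R p)) * Q (fst z) z * exp (- U (fst z) * R p - (norm (rest I p))\<^sup>2 / 2)))" for z p
 have Fm: "case_prod F \<in> borel_measurable (lborel \<Otimes>\<^sub>M lborel)" unfolding F_def potential_def by measurable
 have Fm': "case_prod F' \<in> borel_measurable (lborel \<Otimes>\<^sub>M lborel)" unfolding F'_def by measurable
 have Fz: "(\<lambda>z. F z p) \<in> borel_measurable borel" for p unfolding F_def potential_def by measurable
 obtain i :: 'm where True by blast
 have AEz: "AE z in (lborel :: ('m,'w) frame measure). fst z \<noteq> 0"
  using AE_not_hyperplane[of "(axis i 1, 0) :: ('m,'w) frame"]
  by (auto elim!: eventually_mono simp: inner_prod_def zero_prod_def axis_eq_0_iff)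
 have AEp: "AE p in (lborel :: (real^'w) measure). R p > 0"
 proof -
  have "AE p in (lborel :: (real^'w) measure). axis a0 1 \<bullet> p \<noteq> 0"
   by (rule AE_not_hyperplane) (simp add: axis_eq_0_iff)
  thus ?thesis
  proof eventually_elim
   case (elim p)
   hence "0 < (p $ a0)^2" by (simp add: inner_axis')
   also have "... \<le> R p" unfolding R_def using a0 by (intro member_le_sum) auto
   finally show ?case .
  qed
 qed
 have "(\<integral>z. (\<integral>p. F z p)) = (\<integral>p. (\<integral>z. F z p))"
  by (rule lborel_pair.Fubini'[symmetric, OF Fm])
 also have "... = (\<integral>p. (\<integral>z. F' z p))"
 proof (rule nn_integral_cong_AE, use AEp in eventually_elim)
  fix p assume Rp: "R p > 0"
  define r where "r = sqrt (R p)"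
  have r: "r > 0" "(\<Sum>a\<in>I. (p $ a)\<^sup>2) = r^2" using Rp by (auto simp: r_def R_def sum_nonneg)
  obtain \<rho> where \<rho>: "linear \<rho>" "\<And>z. norm (\<rho> z) = norm z" "\<And>y z. Q y (\<rho> z) = Q y z" "\<And>z. comb I (tau a0 (\<rho> z)) p = r *R fst z"
  proof (cases "p - rest I p = r *R axis a0 1")
   case True
   have "comb I (tau a0 z) p = r *R fst z" for z
   proof -
    have "comb I (tau a0 z) p = comb I (tau a0 z) (p - rest I p)" unfolding comb_def by (rule sum.cong) (auto simp: rest_def)
    thus ?thesis unfolding True using a0 by (simp add: linear_scale[OF linear_comb] comb_axis tau_def)
   qed
   thus ?thesis by (intro that[of "\<lambda>z. z"]) (auto intro: linearI)
  next
   case False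
   note cr = comb_reflect[OF a0 r False]
   show ?thesis
    by (rule that[OF linear_reflect norm_reflect[OF a0 cr(2,1)] inv[OF cr(1,2)] cr(3)])
  qed
  have "(\<integral>z. F z p) = (\<integral>z. F (\<rho> z) p)"
   by (rule nn_integral_lborel_isometry[OF \<rho>(1,2) refl Fz, symmetric])
  also have "... = (\<integral>z. F' z p)"
  proof (rule nn_integral_cong_AE, use AEz in eventually_elim)
   fix z :: "('m,'w) frame" assume z: "fst z \<noteq> 0"
   have g: "gauss (\<rho> z) = gauss z" by (simp add: gauss_def \<rho>(2))
   have Us: "U (r *R fst z) = R p * U (fst z)" using r by (simp add: U_scale R_def)
   show "F (\<rho> z) p = F' z p"
    unfolding F_def F'_def potential_def \<rho>(3,4) g scale[OF r(1) z] Us by (simp add: r_def mult.commute)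
  qed
  finally show "(\<integral>z. F z p) = (\<integral>z. F' z p)" .
 qed
 also have "... = (\<integral>z. (\<integral>p. F' z p))"
  by (rule lborel_pair.Fubini'[OF Fm'])
 also have "... = (\<integral>z. ennreal (gauss z * Q (fst z) z) * (\<integral>p. ennreal (w (sqrt (R p)) * exp (- U (fst z) * R p - (norm (rest I p))\<^sup>2 / 2))))"
 proof (rule nn_integral_cong)
  fix z
  have "F' z p = ennreal (gauss z * Q (fst z) z) * ennreal (w (sqrt (R p)) * exp (- U (fst z) * R p - (norm (rest I p))\<^sup>2 / 2))" for p
   unfolding F'_def using w[of "sqrt (R p)"] by (subst ennreal_mult''[symmetric]) (simp_all add: mult_ac)
  thus "(\<integral>p. F' z p) = ennreal (gauss z * Q (fst z) z) * (\<integral>p. ennreal (w (sqrt (R p)) * exp (- U (fst z) * R p - (norm (rest I p))\<^sup>2 / 2)))"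
   by (simp add: nn_integral_cmult)
 qed
 finally show ?thesis unfolding F_def .
qed

text \<open>Subtracting from each vector the multiple of the base point \<open>x\<close> that makes
  it orthogonal to \<open>X x\<close> splits off the block \<open>x \<bullet> H x x = h^2\<close>.
  On the rest \<open>H\<close> acts as \<open>h\<close> times \<open>A\<close>, which does not see
  the radial part subtracted.\<close>

lemma gram_det_radial:
 fixes z :: "('m::finite,'w::finite) frame"
 assumes x: "fst z \<noteq> 0" and a0: "a0 \<notin> J"
 shows "gram_det (insert a0 J) (gram (tau a0 z) (fst z)) =
  (h (fst z))^2 * (h (fst z) ^ card J * gram_det J (\<lambda>a b. snd z $ a \<bullet> A (fst z) (snd z $ b)))"
proof -
 let ?x = "fst z" and ?t = "tau a0 z"
 have hp: "h ?x > 0" using pos[OF x] .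
 define u :: "real^'w" where "u = (\<chi> b. if b \<in> J then X ?x \<bullet> ?t b / h ?x else 0)"
 define t' where "t' b = ?t b - u $ b *R ?x" for b
 have ua: "u $ a0 = 0" using a0 by (simp add: u_def)
 have t'a: "t' a0 = ?x" by (simp add: t'_def ua) (simp add: tau_def)
 have "gram_det (insert a0 J) (\<lambda>a b. ?t a \<bullet> H ?x (?t b)) = (1 + u \<bullet> axis a0 1)^2 * gram_det (insert a0 J) (\<lambda>a b. t' a \<bullet> H ?x (t' b))"
 proof (rule gram_det_rank_one[OF linH'])
  show "?t a = t' a + u $ a *R (\<Sum>c\<in>insert a0 J. axis a0 1 $ c *R t' c)" for a
  proof -
   have "(\<Sum>c\<in>insert a0 J. axis a0 1 $ c *R t' c) = (\<Sum>c\<in>insert a0 J. if c = a0 then t' c else 0)"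
    by (rule sum.cong) (auto simp: axis_def)
   thus ?thesis by (simp add: t'a) (simp add: t'_def)
  qed
 qed (auto simp: u_def axis_def)
 also have "u \<bullet> axis a0 1 = 0" by (simp add: inner_axis ua)
 also have "gram_det (insert a0 J) (\<lambda>a b. t' a \<bullet> H ?x (t' b)) = (t' a0 \<bullet> H ?x (t' a0)) * gram_det J (\<lambda>a b. t' a \<bullet> H ?x (t' b))"
 proof (rule gram_det_block[OF a0])
  fix b assume b: "b \<in> J"
  have "t' a0 \<bullet> H ?x (t' b) = G ?x \<bullet> t' b" unfolding t'a using symH[OF x, of ?x "t' b"] by (simp add: H_self[OF x])
  also have "... = h ?x * (X ?x \<bullet> t' b)" by (simp add: G_def)
  also have "X ?x \<bullet> t' b = 0" using b hp by (simp add: t'_def u_def inner_diff_right X_inner[OF x])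
  finally show "t' a0 \<bullet> H ?x (t' b) = 0" by simp
 qed
 also have "t' a0 \<bullet> H ?x (t' a0) = (h ?x)^2"
  unfolding t'a by (simp add: H_self[OF x] G_def inner_commute[of ?x] X_inner[OF x] power2_eq_square)
 also have "gram_det J (\<lambda>a b. t' a \<bullet> H ?x (t' b)) = gram_det J (\<lambda>a b. h ?x * (snd z $ a \<bullet> A ?x (snd z $ b)))"
 proof (rule gram_det_cong)
  fix a b assume ab: "a \<in> J" "b \<in> J"
  have X0: "X ?x \<bullet> t' b = 0" if "b \<in> J" for b using that hp by (simp add: t'_def u_def inner_diff_right X_inner[OF x])
  have At: "A ?x (t' b) = A ?x (?t b)" for b
   by (simp add: t'_def linear_diff[OF linA[OF x]] linear_scale[OF linA[OF x]] A_radial[OF x])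
  have "?x \<bullet> A ?x v = 0" for v using A_inner_radial[OF x, of v] by (simp add: inner_commute)
  hence "t' a \<bullet> A ?x (t' b) = ?t a \<bullet> A ?x (?t b)" unfolding At by (simp add: t'_def inner_diff_left)
  moreover have "?t a = snd z $ a" "?t b = snd z $ b" using ab a0 by (auto simp: tau_def)
  ultimately show "t' a \<bullet> H ?x (t' b) = h ?x * (snd z $ a \<bullet> A ?x (snd z $ b))"
   using X0[OF ab(2)] by (simp add: H_def inner_add_right)
 qed
 finally show ?thesis by (simp add: gram_det_scale)
qed

lemma gram_det_scale_point: "r > 0 ==> x \<noteq> 0 ==> gram t (r *R x) = gram t x"
 by (simp add: H_scale fun_eq_iff)

text \<open>The slice inequality is integrated over all frames, and both sides are moved to the base
  point. The left integrand has degree 2 in the slice point and picks up a second moment; the right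
  one has degree 0 and picks up the mass.\<close>

lemma Kubota_average:
 fixes I :: "'w::{finite,wellorder} set" and s :: 'w
 assumes a0: "a0 \<in> I" and s: "s \<notin> I"
 obtains c :: real where "c > 0"
  "(\<integral>z. ennreal (gauss z * ((G (fst z) \<bullet> (snd z $ s))^2 * gram_det I (gram (tau a0 z) (fst z)))) *
    ennreal (card I / (2 * U (fst z)) * (c / sqrt (U (fst z)) ^ card I)))
  \<le> (\<integral>\<^sup>+z. ennreal (gauss z * (gram (tau a0 z) (fst z) s s * gram_det I (gram (tau a0 z) (fst z)) - gram_det (insert s I) (gram (tau a0 z) (fst z)))) *
    ennreal (c / sqrt (U (fst z)) ^ card I) \<partial>(lborel :: ('m,'w) frame measure))"
proof -
 obtain c :: real where c: "c > 0"
  "\<And>l. l > 0 ==> (\<integral>p. ennreal (split_gauss I l p)) = ennreal (c / sqrt l ^ card I)"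
  "\<And>l. l > 0 ==> (\<integral>p. ennreal ((\<Sum>a\<in>I. (p $ a)\<^sup>2) * split_gauss I l p))
   = ennreal (card I / (2 * l) * (c / sqrt l ^ card I))"
  by (rule gaussian_integrals_split[of I]) (rule that)
 let ?R = "\<lambda>p :: (real, 'w) vec. \<Sum>a\<in>I. (p $ a)\<^sup>2"
 define QL where "QL y z = (G y \<bullet> (snd z $ s))^2 * gram_det I (gram (tau a0 z) y)" for y and z :: "('m,'w) frame"
 define QR where "QR y z = gram (tau a0 z) y s s * gram_det I (gram (tau a0 z) y) - gram_det (insert s I) (gram (tau a0 z) y)" for y and z :: "('m,'w) frame"
 have ts: "tau a0 z s = snd z $ s" for z :: "('m,'w) frame" using a0 s by (auto simp: tau_def)
 have rs: "snd (reflect a0 I u z) $ s = snd z $ s" for u and z :: "('m,'w) frame" using s by (simp add: reflect_def)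
 have le: "(\<integral>p. ennreal (gauss z * (slice QL I a0 z p)))
  \<le> (\<integral>p. ennreal (gauss z * (slice QR I a0 z p)))" for z
 proof -
  have "(\<integral>p. ennreal (slice QL I a0 z p))
   \<le> (\<integral>p. ennreal (slice QR I a0 z p))"
   unfolding QL_def QR_def using Brascamp_Lieb_slice[of I s "tau a0 z"] a0 s by (auto simp: ts)
  hence "ennreal (gauss z) * (\<integral>p. ennreal (slice QL I a0 z p))
   \<le> ennreal (gauss z) * (\<integral>p. ennreal (slice QR I a0 z p))"
   by (rule mult_left_mono) simp
  moreover have "(\<lambda>p. ennreal (slice QL I a0 z p)) \<in> borel_measurable lborel"
   "(\<lambda>p. ennreal (slice QR I a0 z p)) \<in> borel_measurable lborel"
   unfolding QL_def QR_def potential_def by measurable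
  ultimately show ?thesis
   using gauss_pos[of z] by (simp add: nn_integral_cmult[symmetric] ennreal_mult'[symmetric] less_imp_le)
 qed
 have QLi: "(\<integral>z. (\<integral>p. ennreal (gauss z * (slice QL I a0 z p))))
  = (\<integral>z. ennreal (gauss z * QL (fst z) z) * (\<integral>p. ennreal ((sqrt (?R p))^2 * split_gauss I (U (fst z)) p)))"
 proof (rule nn_integral_slice[OF _ a0, of QL "\<lambda>r. r\<^sup>2"])
  show "(\<lambda>\<omega>. QL (fst \<omega>) (snd \<omega>)) \<in> borel_measurable borel" unfolding QL_def by measurable
  show "QL y (reflect a0 I u z) = QL y z" if "u \<bullet> u = 1" "\<And>a. a \<notin> I ==> u $ a = 0" for u y z
  proof -
   have "gram_det I (gram (tau a0 (reflect a0 I u z)) y) = gram_det I (gram (tau a0 z) y)"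
    by (rule reflect_gram_det[OF a0 that(2,1) linH' subset_refl])
   thus ?thesis unfolding QL_def rs by simp
  qed
  show "QL (r *R x) z = r^2 * QL x z" if "r > 0" "x \<noteq> 0" for r x z
   unfolding QL_def gram_det_scale_point[OF that] G_scale by (simp add: power_mult_distrib)
 qed auto
 have QRi: "(\<integral>z. (\<integral>p. ennreal (gauss z * (slice QR I a0 z p))))
  = (\<integral>z. ennreal (gauss z * QR (fst z) z) * (\<integral>p. ennreal (1 * split_gauss I (U (fst z)) p)))"
 proof (rule nn_integral_slice[OF _ a0, of QR "\<lambda>r. 1"])
  show "(\<lambda>\<omega>. QR (fst \<omega>) (snd \<omega>)) \<in> borel_measurable borel" unfolding QR_def by measurable
  show "QR y (reflect a0 I u z) = QR y z" if "u \<bullet> u = 1" "\<And>a. a \<notin> I ==> u $ a = 0" for u y z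
  proof -
   have "gram_det I (gram (tau a0 (reflect a0 I u z)) y) = gram_det I (gram (tau a0 z) y)"
    by (rule reflect_gram_det[OF a0 that(2,1) linH' subset_refl])
   moreover have "gram_det (insert s I) (gram (tau a0 (reflect a0 I u z)) y) = gram_det (insert s I) (gram (tau a0 z) y)"
    by (rule reflect_gram_det[OF a0 that(2,1) linH' subset_insertI])
   ultimately show ?thesis unfolding QR_def ts rs by simp
  qed
  show "QR (r *R x) z = 1 * QR x z" if "r > 0" "x \<noteq> 0" for r x z
   unfolding QR_def gram_det_scale_point[OF that] using that by (simp add: H_scale)
 qed auto
 obtain i :: 'm where True by blast
 have AEz: "AE z in (lborel :: ('m,'w) frame measure). fst z \<noteq> 0"
  using AE_not_hyperplane[of "(axis i 1, 0) :: ('m,'w) frame"]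
  by (auto elim!: eventually_mono simp: inner_prod_def zero_prod_def axis_eq_0_iff)
 have "(\<integral>z. ennreal (gauss z * QL (fst z) z) * ennreal (card I / (2 * U (fst z)) * (c / sqrt (U (fst z)) ^ card I)))
  = (\<integral>z. ennreal (gauss z * QL (fst z) z) * (\<integral>p. ennreal ((sqrt (?R p))^2 * split_gauss I (U (fst z)) p)))"
 proof (rule nn_integral_cong_AE, use AEz in eventually_elim)
  fix z :: "('m,'w) frame" assume z: "fst z \<noteq> 0"
  hence "U (fst z) > 0" using pos[OF z] by (simp add: U_def)
  thus "ennreal (gauss z * QL (fst z) z) * ennreal (card I / (2 * U (fst z)) * (c / sqrt (U (fst z)) ^ card I))
   = ennreal (gauss z * QL (fst z) z) * (\<integral>p. ennreal ((sqrt (?R p))^2 * split_gauss I (U (fst z)) p))"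
   using c(3) by (simp add: sum_nonneg)
 qed
 also have "... \<le> (\<integral>z. (\<integral>p. ennreal (gauss z * (slice QR I a0 z p))))"
  unfolding QLi[symmetric] by (rule nn_integral_mono) (rule le)
 also have "... = (\<integral>z. ennreal (gauss z * QR (fst z) z) * ennreal (c / sqrt (U (fst z)) ^ card I))"
  unfolding QRi
 proof (rule nn_integral_cong_AE, use AEz in eventually_elim)
  fix z :: "('m,'w) frame" assume z: "fst z \<noteq> 0"
  hence "U (fst z) > 0" using pos[OF z] by (simp add: U_def)
  thus "ennreal (gauss z * QR (fst z) z) * (\<integral>p. ennreal (1 * split_gauss I (U (fst z)) p))
   = ennreal (gauss z * QR (fst z) z) * ennreal (c / sqrt (U (fst z)) ^ card I)"
   using c(2) by simp
 qed
 finally show ?thesis using that[OF c(1)] unfolding QL_def QR_def ts by blast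
qed

end

section \<open>The averaged inequality in terms of the symmetric functions\<close>

context even_support
begin

text \<open>All eigenvalues of the full Hessian are counted. The radial one is 0, so the value
  agrees with the symmetric function on the tangent space.\<close>

definition e_hess :: "nat => real^'m => real" where
 "e_hess k x = esym k (matrix (A x))"

abbreviation grad_form :: "nat => real^'m => real" where
 "grad_form k x \<equiv> h x * (norm (X x))^2 * e_hess k x"

text \<open>What the average of \<open>gram s s * gram_det I - gram_det (insert s I)\<close> leaves,
  up to constants and powers of \<open>h\<close>, besides the radial part
  \<open>grad_form\<close>.\<close>

abbreviation newton_form :: "nat => real^'m => real" where
 "newton_form k x \<equiv> (h x)\<^sup>2 * (e_hess 1 x * e_hess k x - real (k + 1) * e_hess (k + 1) x)"

lemma cont_e_hess: "continuous_on (- {0}) (e_hess k)"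
 unfolding e_hess_def by (rule continuous_on_esym) (auto simp: matrix_def intro!: continuous_intros contA)

lemma e_hess_measurable [measurable]: "e_hess k \<in> borel_measurable borel"
 by (rule borel_measurable_continuous_countable_exceptions[OF _ cont_e_hess]) simp

lemma hess_eigenbasis:
 assumes x: "x \<noteq> 0"
 obtains v :: "'m => real^'m" and l :: "'m => real" and i0 where
  "\<forall>i j. v i \<bullet> v j = (if i = j then 1 else 0)" "\<forall>i. A x (v i) = l i *R v i"
  "v i0 = x /\<^sub>R norm x" "l i0 = 0" "\<forall>i. l i \<ge> 0" "\<forall>k. e_hess k x = elem_sym k UNIV l"
  "\<forall>a b k. esym (Suc k) (matrix (A x) + (\<chi> i j. a $ i * b $ j)) = elem_sym (Suc k) UNIV l + (\<Sum>i\<in>UNIV. (a \<bullet> v i) * (b \<bullet> v i) * elem_sym k (UNIV - {i}) l)"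
proof -
 have 1: "norm (x /\<^sub>R norm x) = 1" using x by simp
 have 2: "A x (x /\<^sub>R norm x) = 0" by (simp add: linear_scale[OF linA[OF x]] A_radial[OF x])
 show thesis
 proof (rule symmetric_eigenbasis[OF linA[OF x] symA[OF x] 1 2])
 fix v :: "'m => real^'m" and l :: "'m => real" and i0
 assume v: "\<And>i j. v i \<bullet> v j = (if i = j then 1 else 0)" "\<And>i. A x (v i) = l i *R v i"
  "v i0 = x /\<^sub>R norm x" "l i0 = 0"
 have l: "l i \<ge> 0" for i
 proof -
  have "A x (v i) \<bullet> v i = l i" using v(1,2) by simp
  thus ?thesis using psd[OF x, of "v i"] by simp
 qed
 have eig: "matrix (A x) *v v i = l i *R v i" for i by (simp add: matrix_apply[OF linA[OF x]] v(2))
 show thesis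
  by (rule that[of v l i0]) (use v(1,3,4) l in \<open>auto simp: v(2) e_hess_def esym_eigenvalues[OF v(1) eig] esym_rank_one[OF v(1) eig]\<close>)
 qed
qed

lemma e_hess_nonneg: "x \<noteq> 0 ==> e_hess k x \<ge> 0"
proof -
 assume x: "x \<noteq> 0"
 obtain l :: "'m => real" where "\<forall>i. l i \<ge> 0" "\<forall>k. e_hess k x = elem_sym k UNIV l"
  by (rule hess_eigenbasis[OF x]) (rule that)
 thus ?thesis by (simp add: elem_sym_def sum_nonneg prod_nonneg)
qed

end

context strict_even_support
begin

text \<open>The slice is spanned by the base point, at index \<open>a0\<close>, and \<open>k\<close>
  Gaussian vectors; \<open>s\<close> is the transversal index. With the base point fixed, averaging
  the vectors turns Gram determinants into \<open>e_hess\<close>. The square of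
  \<open>X x \<bullet> T $ s\<close> inside \<open>gram s s\<close> reproduces
  \<open>grad_form\<close> on the right, which later lowers \<open>k + 1\<close> to
  \<open>k\<close>.\<close>

lemma Kubota_row_sets:
 fixes J :: "'w::{finite,wellorder} set" and s a0 :: 'w
 assumes a0: "a0 \<notin> J" and s: "s \<notin> J" and sa: "s \<noteq> a0"
 defines "k \<equiv> card J"
 shows "(\<integral>x. ennreal (gauss x * (real (k + 1) * (grad_form k x))))
  \<le> (\<integral>x. ennreal (gauss x * (grad_form k x + newton_form k x)))"
proof -
 let ?I = "insert a0 J"
 have cI: "card ?I = k + 1" using a0 by (simp add: k_def)
 have sI: "s \<notin> ?I" using s sa by simp
 define L0 where "L0 c z = ennreal (gauss z * ((G (fst z) \<bullet> (snd z $ s))^2 * gram_det ?I (gram (tau a0 z) (fst z)))) *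
    ennreal (card ?I / (2 * U (fst z)) * (c / sqrt (U (fst z)) ^ card ?I))" for c and z :: "('m,'w) frame"
 define R0 where "R0 c z = ennreal (gauss z * (gram (tau a0 z) (fst z) s s * gram_det ?I (gram (tau a0 z) (fst z)) - gram_det (insert s ?I) (gram (tau a0 z) (fst z)))) *
    ennreal (c / sqrt (U (fst z)) ^ card ?I)" for c and z :: "('m,'w) frame"
 obtain c where c: "c > 0" and main: "(\<integral>z. L0 c z) \<le> (\<integral>z. R0 c z)"
  by (rule Kubota_average[OF insertI1 sI]) (rule that, assumption, simp only: L0_def[abs_def] R0_def[abs_def])
 have L0m [measurable]: "L0 c \<in> borel_measurable borel" and R0m [measurable]: "R0 c \<in> borel_measurable borel"
  unfolding L0_def R0_def by measurable
 \<comment> \<open>From \<open>sqrt (U x) = h x / sqrt 2\<close>.\<close>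
 define c' where "c' = c * sqrt 2 ^ (k + 1)"
 have c'pos: "c' > 0" using c by (simp add: c'_def)
 obtain j :: 'm where True by blast
 define e where "e = (axis j 1 :: real^'m)"
 have e: "norm e = 1" by (simp add: e_def norm_axis_1)
 define \<Gamma> where "\<Gamma> = gmean (gconst (insert s J) e)"
 have \<Gamma>: "\<Gamma> > 0" unfolding \<Gamma>_def by (rule gmean_gconst_pos[OF e])
 have cc: "c / sqrt (U x) ^ (k + 1) = c' / h x ^ (k + 1)" if "x \<noteq> 0" for x
  using pos[OF that] by (simp add: U_def c'_def real_sqrt_divide power_divide)
 have inner: "(\<integral>T. L0 c (x, T)) = ennreal (c' * \<Gamma> * fact k) * ennreal (gauss x * (real (k + 1) * (grad_form k x)))
  \<and> (\<integral>T. R0 c (x, T)) = ennreal (c' * \<Gamma> * fact k) * ennreal (gauss x * (grad_form k x + newton_form k x))"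
  if x: "x \<noteq> 0" for x
 proof -
  have hp: "h x > 0" by (rule pos[OF x])
  obtain v :: "'m => real^'m" and l :: "'m => real" where vl: "\<forall>i j. v i \<bullet> v j = (if i = j then 1 else 0)" "\<forall>i. A x (v i) = l i *R v i"
   "\<forall>k. e_hess k x = elem_sym k UNIV l"
   by (rule hess_eigenbasis[OF x]) (rule that)
  note v = vl(1,2)[rule_format] and el = vl(3)[rule_format]
  define \<Delta> where "\<Delta> K T = gram_det K (\<lambda>a b. T $ a \<bullet> A x (T $ b))" for K and T :: "(real^'m,'w) vec"
  have pbD: "poly_bounded (\<Delta> K)" for K
   unfolding \<Delta>_def[abs_def] by (rule poly_bounded_gram_det[OF linA[OF x] v e])
  have pbc: "poly_bounded (\<lambda>T :: (real^'m,'w) vec. T $ s \<bullet> A x (T $ s))"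
  proof -
   have "(\<lambda>T :: (real^'m,'w) vec. T $ s \<bullet> A x (T $ s)) = (\<lambda>T. gram_det {s} (\<lambda>a b. T $ a \<bullet> A x (T $ b)))"
    by (simp add: gram_det_expand permutes_sing)
   thus ?thesis using poly_bounded_gram_det[OF linA[OF x] v e, of "{s}"] by simp
  qed
  define P where "P T = \<Delta> J T * ((T $ s \<bullet> X x) * (T $ s \<bullet> X x))" for T
  define Q where "Q T = h x * P T + ((h x)^2 * (\<Delta> J T * (T $ s \<bullet> A x (T $ s))) - (h x)\<^sup>2 * \<Delta> (insert s J) T)" for T
  have pbP: "poly_bounded P" unfolding P_def[abs_def] by (intro poly_bounded_mult pbD poly_bounded_column)
  have pbF: "poly_bounded (\<lambda>T. \<Delta> J T * (T $ s \<bullet> A x (T $ s)))" by (intro poly_bounded_mult pbD pbc)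
  have pbR: "poly_bounded (\<lambda>T. (h x)\<^sup>2 * (\<Delta> J T * (T $ s \<bullet> A x (T $ s))) - (h x)\<^sup>2 * \<Delta> (insert s J) T)"
  proof -
   have "poly_bounded (\<lambda>T. (h x)\<^sup>2 * (\<Delta> J T * (T $ s \<bullet> A x (T $ s))) + (- (h x)\<^sup>2) * \<Delta> (insert s J) T)"
    by (intro poly_bounded_add poly_bounded_mult poly_bounded_const pbF pbD pbc)
   thus ?thesis by simp
  qed
  have pbQ: "poly_bounded Q" unfolding Q_def[abs_def] by (intro poly_bounded_add poly_bounded_mult[OF poly_bounded_const] pbP pbR)
  have gP: "gmean P = (norm (X x))^2 * (\<Gamma> * (fact k * e_hess k x))"
   unfolding P_def[abs_def] \<Delta>_def gmean_gram_det_column[OF linA[OF x] v e s] el \<Gamma>_def k_def by (simp add: dot_square_norm)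
  have gF: "gmean (\<lambda>T. \<Delta> J T * (T $ s \<bullet> A x (T $ s))) = e_hess 1 x * (\<Gamma> * (fact k * e_hess k x))"
   unfolding \<Delta>_def gmean_gram_det_form[OF linA[OF x] v e s] el \<Gamma>_def k_def by (simp add: elem_sym_1)
  have gD: "gmean (\<Delta> (insert s J)) = \<Gamma> * (fact (k + 1) * e_hess (k + 1) x)"
   unfolding \<Delta>_def[abs_def] gmean_gram_det[OF linA[OF x] v e] el \<Gamma>_def k_def using s by simp
  have "gmean Q = gmean (\<lambda>T. h x * P T) + gmean (\<lambda>T. (h x)\<^sup>2 * (\<Delta> J T * (T $ s \<bullet> A x (T $ s))) - (h x)\<^sup>2 * \<Delta> (insert s J) T)"
   unfolding Q_def[abs_def] by (rule gmean_add[OF poly_bounded_mult[OF poly_bounded_const pbP] pbR])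
  also have "gmean (\<lambda>T. (h x)\<^sup>2 * (\<Delta> J T * (T $ s \<bullet> A x (T $ s))) - (h x)\<^sup>2 * \<Delta> (insert s J) T)
   = gmean (\<lambda>T. (h x)\<^sup>2 * (\<Delta> J T * (T $ s \<bullet> A x (T $ s)))) - gmean (\<lambda>T. (h x)\<^sup>2 * \<Delta> (insert s J) T)"
   by (rule gmean_diff) (rule poly_bounded_mult[OF poly_bounded_const pbF], rule poly_bounded_mult[OF poly_bounded_const pbD])
  finally have gQ: "gmean Q = (\<Gamma> * fact k) * (grad_form k x + newton_form k x)"
   unfolding gmean_cmult gP gF gD by (simp add: algebra_simps)
  have dI: "gram_det ?I (gram (tau a0 (x, T)) x) = h x * h x ^ (k + 1) * \<Delta> J T" for T
   using gram_det_radial[of "(x, T)" a0 J] x a0 by (simp add: \<Delta>_def k_def power2_eq_square)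
  have dS: "gram_det (insert s ?I) (gram (tau a0 (x, T)) x) = (h x)^2 * h x ^ (k + 1) * \<Delta> (insert s J) T" for T
  proof -
   have "insert s ?I = insert a0 (insert s J)" by blast
   thus ?thesis using gram_det_radial[of "(x, T)" a0 "insert s J"] x a0 s sa by (simp add: \<Delta>_def k_def)
  qed
  have ss: "gram (tau a0 (x, T)) x s s = (T $ s \<bullet> X x) * (T $ s \<bullet> X x) + h x * (T $ s \<bullet> A x (T $ s))" for T
   using sa by (simp add: tau_def H_def inner_add_right inner_commute[of _ "X x"])
  \<comment> \<open>The signs permit passing between \<open>ennreal\<close> and real integrals;
    Fischer's inequality, divided by powers of \<open>h x\<close>, provides both.\<close>
  have fP: "\<Delta> J T \<ge> 0" and fQ: "Q T \<ge> 0" for T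
  proof -
   have Hs: "H x v \<bullet> w = v \<bullet> H x w" for v w by (rule symH[OF x])
   have Hp: "v \<noteq> 0 ==> H x v \<bullet> v > 0" for v by (rule H_pos[OF x])
   have fi: "gram_det ?I (gram (tau a0 (x, T)) x) \<ge> 0"
    "gram_det (insert s ?I) (gram (tau a0 (x, T)) x) \<le> gram (tau a0 (x, T)) x s s * gram_det ?I (gram (tau a0 (x, T)) x)"
    by (rule fischer_inequality[OF linH'[of x] Hs Hp sI]; assumption)+
   have nonneg: "0 \<le> b" if "0 < a" "0 \<le> a * b" for a b :: real
    using mult_pos_neg[OF that(1), of b] that(2) by linarith
   have hh: "0 < h x * h x ^ (k + 1)" using hp by simp
   show "\<Delta> J T \<ge> 0" by (rule nonneg[OF hh]) (use fi(1) in \<open>simp only: dI\<close>)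
   have "0 \<le> h x ^ (k + 1) * Q T" using fi(2) unfolding dI dS ss Q_def P_def by (simp add: algebra_simps power2_eq_square)
   thus "Q T \<ge> 0" by (rule nonneg[rotated]) (use hp in simp)
  qed
  have nP: "P T \<ge> 0" for T unfolding P_def using fP[of T] by simp
  have iP: "(\<integral>T. ennreal (P T * gauss T)) = ennreal (gmean P)"
   unfolding gmean_def by (rule nn_integral_eq_integral[OF integrable_gauss[OF pbP]]) (rule AE_I2, simp add: nP less_imp_le[OF gauss_pos])
  have iQ: "(\<integral>T. ennreal (Q T * gauss T)) = ennreal (gmean Q)"
   unfolding gmean_def by (rule nn_integral_eq_integral[OF integrable_gauss[OF pbQ]]) (rule AE_I2, simp add: fQ less_imp_le[OF gauss_pos])
  have [measurable]: "P \<in> borel_measurable borel" "Q \<in> borel_measurable borel" using pbP pbQ by (simp_all add: poly_bounded_borel)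
  have "L0 c (x, T) = ennreal (gauss x * (c' * (real (k + 1) * h x))) * ennreal (P T * gauss T)" for T
  proof -
   have nn: "real (k + 1) / (2 * U x) * (c' / h x ^ (k + 1)) \<ge> 0" using c'pos hp by (simp add: U_def)
   have eq: "gauss (x, T) * ((G x \<bullet> (T $ s))^2 * (h x * h x ^ (k + 1) * \<Delta> J T)) * (real (k + 1) / (2 * U x) * (c' / h x ^ (k + 1)))
    = gauss x * (c' * (real (k + 1) * h x)) * (P T * gauss T)"
   proof -
    have G2: "(G x \<bullet> (T $ s))^2 = h x * h x * ((T $ s \<bullet> X x) * (T $ s \<bullet> X x))"
     by (simp add: G_def power2_eq_square inner_commute[of "X x"])
    have U2: "2 * U x = h x * h x" by (simp add: U_def power2_eq_square)
    show ?thesis unfolding G2 U2 P_def gauss_pair[of "(x, T)"] using hp by (simp add: field_simps)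
   qed
   have "L0 c (x, T) = ennreal (gauss (x, T) * ((G x \<bullet> (T $ s))^2 * (h x * h x ^ (k + 1) * \<Delta> J T))) * ennreal (real (k + 1) / (2 * U x) * (c' / h x ^ (k + 1)))"
    unfolding L0_def cI fst_conv snd_conv dI cc[OF x] ..
   also have "... = ennreal (gauss x * (c' * (real (k + 1) * h x)) * (P T * gauss T))"
    unfolding ennreal_mult''[OF nn, symmetric] eq ..
   finally show ?thesis using nP[of T] gauss_pos[of T] by (simp add: ennreal_mult'')
  qed
  hence "(\<integral>T. L0 c (x, T)) = ennreal (gauss x * (c' * (real (k + 1) * h x))) * ennreal (gmean P)"
   by (simp add: nn_integral_cmult iP)
  also have "... = ennreal (gauss x * (c' * (real (k + 1) * h x)) * gmean P)"
   using gauss_pos[of x] c'pos hp by (intro ennreal_mult'[symmetric]) auto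
  also have "... = ennreal (c' * \<Gamma> * fact k) * ennreal (gauss x * (real (k + 1) * (grad_form k x)))"
   unfolding gP using c'pos \<Gamma> by (subst ennreal_mult'[symmetric]) (auto simp: mult_ac)
  finally have 1: "(\<integral>T. L0 c (x, T)) = ennreal (c' * \<Gamma> * fact k) * ennreal (gauss x * (real (k + 1) * (grad_form k x)))" .
  have "R0 c (x, T) = ennreal (gauss x * c') * ennreal (Q T * gauss T)" for T
  proof -
   have nn: "c' / h x ^ (k + 1) \<ge> 0" using c'pos hp by simp
   have eq: "gauss (x, T) * (((T $ s \<bullet> X x) * (T $ s \<bullet> X x) + h x * (T $ s \<bullet> A x (T $ s))) * (h x * h x ^ (k + 1) * \<Delta> J T) - (h x)\<^sup>2 * h x ^ (k + 1) * \<Delta> (insert s J) T) * (c' / h x ^ (k + 1))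
    = gauss x * c' * (Q T * gauss T)"
   proof -
    have "((T $ s \<bullet> X x) * (T $ s \<bullet> X x) + h x * (T $ s \<bullet> A x (T $ s))) * (h x * h x ^ (k + 1) * \<Delta> J T) - (h x)\<^sup>2 * h x ^ (k + 1) * \<Delta> (insert s J) T = h x ^ (k + 1) * Q T"
     unfolding Q_def P_def by (simp add: algebra_simps power2_eq_square)
    thus ?thesis unfolding gauss_pair[of "(x, T)"] using hp by (simp add: field_simps)
   qed
   have "R0 c (x, T) = ennreal (gauss (x, T) * (((T $ s \<bullet> X x) * (T $ s \<bullet> X x) + h x * (T $ s \<bullet> A x (T $ s))) * (h x * h x ^ (k + 1) * \<Delta> J T) - (h x)\<^sup>2 * h x ^ (k + 1) * \<Delta> (insert s J) T)) * ennreal (c' / h x ^ (k + 1))"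
    unfolding R0_def cI fst_conv snd_conv dI dS ss cc[OF x] ..
   also have "... = ennreal (gauss x * c' * (Q T * gauss T))"
    unfolding ennreal_mult''[OF nn, symmetric] eq ..
   finally show ?thesis using fQ[of T] gauss_pos[of T] by (simp add: ennreal_mult'')
  qed
  hence "(\<integral>T. R0 c (x, T)) = ennreal (gauss x * c') * ennreal (gmean Q)"
   by (simp add: nn_integral_cmult iQ)
  also have "... = ennreal (gauss x * c' * gmean Q)"
   using gauss_pos[of x] c'pos by (intro ennreal_mult'[symmetric]) auto
  also have "... = ennreal (c' * \<Gamma> * fact k) * ennreal (gauss x * (grad_form k x + newton_form k x))"
   unfolding gQ using c'pos \<Gamma> by (subst ennreal_mult'[symmetric]) (auto simp: mult_ac)
  finally show ?thesis using 1 by blast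
 qed
 have "ennreal (c' * \<Gamma> * fact k) * (\<integral>x. ennreal (gauss x * (real (k + 1) * (grad_form k x))))
  = (\<integral>x. (\<integral>T. L0 c (x, T)))"
  by (subst nn_integral_cmult[symmetric], measurable, rule nn_integral_cong_AE, use AE_lborel_nonzero in eventually_elim) (simp add: inner)
 also have "... = (\<integral>z. L0 c z)"
  unfolding lborel_prod[symmetric] by (rule lborel.nn_integral_fst) (simp add: lborel_prod)
 also note main
 also have "(\<integral>z. R0 c z) = (\<integral>x. (\<integral>T. R0 c (x, T)))"
  unfolding lborel_prod[symmetric] by (rule lborel.nn_integral_fst[symmetric]) (simp add: lborel_prod)
 also have "... = ennreal (c' * \<Gamma> * fact k) * (\<integral>x. ennreal (gauss x * (grad_form k x + newton_form k x)))"
  by (subst nn_integral_cmult[symmetric], measurable, rule nn_integral_cong_AE, use AE_lborel_nonzero in eventually_elim) (simp add: inner)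
 finally have le: "ennreal (c' * \<Gamma> * fact k) * (\<integral>x. ennreal (gauss x * (real (k + 1) * (grad_form k x))))
  \<le> ennreal (c' * \<Gamma> * fact k) * (\<integral>x. ennreal (gauss x * (grad_form k x + newton_form k x)))" .
 have C: "c' * \<Gamma> * fact k > 0" using c'pos \<Gamma> by simp
 have inv: "ennreal (1 / C) * (ennreal C * y) = y" if "C > 0" for C :: real and y
  using that by (simp add: mult.assoc[symmetric] ennreal_mult'[symmetric])
 show ?thesis
  using mult_left_mono[OF le, of "ennreal (1 / (c' * \<Gamma> * fact k))"] unfolding inv[OF C] by simp
qed

end

section \<open>Averages over the sphere\<close>

definition nrm :: "'a::euclidean_space => 'a" where
 "nrm x = x /\<^sub>R norm x"

text \<open>Up to a positive constant, the integral over the sphere with respect to surface measure.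
  The constant is immaterial, as only linear homogeneous relations between such means are
  used.\<close>

definition smean :: "('a::euclidean_space => real) => real" where
 "smean \<Theta> = (LINT x|lborel. gauss x * \<Theta> (nrm x))"

lemma gauss_nonneg [simp]: "gauss x \<ge> 0"
 by (simp add: gauss_def)

lemma norm_nrm [simp]: "x \<noteq> 0 ==> norm (nrm x) = 1"
 by (simp add: nrm_def)

lemma nrm_unit [simp]: "norm x = 1 ==> nrm x = x"
 by (simp add: nrm_def)

lemma nrm_scale: "c > 0 ==> nrm (c *R x) = nrm x"
 by (simp add: nrm_def)

lemma nrm_eq: "x = norm x *R nrm x"
 by (cases "x = 0") (simp_all add: nrm_def)

lemma continuous_on_nrm: "continuous_on (- {0}) nrm"
 unfolding nrm_def by (intro continuous_intros) auto

lemma continuous_on_nrm_compose: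
 assumes "continuous_on (sphere 0 1) \<Theta>"
 shows "continuous_on (- {0}) (\<lambda>x. \<Theta> (nrm x))"
 by (rule continuous_on_compose2[OF assms continuous_on_nrm]) (simp add: image_subset_iff)

lemma nrm_measurable:
 fixes \<Theta> :: "'a::euclidean_space => real"
 assumes "continuous_on (sphere 0 1) \<Theta>"
 shows "(\<lambda>x. \<Theta> (nrm x)) \<in> borel_measurable borel"
 by (rule borel_measurable_continuous_countable_exceptions[OF _ continuous_on_nrm_compose[OF assms]]) simp

lemma sphere_bounded:
 fixes \<Theta> :: "'a::euclidean_space => real"
 assumes "continuous_on (sphere 0 1) \<Theta>"
 obtains B where "B > 0" "\<And>x. x \<noteq> 0 ==> \<bar>\<Theta> (nrm x)\<bar> \<le> B"
proof -
 have "bounded (\<Theta> ` sphere 0 1)"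
  by (intro compact_imp_bounded compact_continuous_image assms) auto
 then obtain B where "B > 0" "\<forall>x\<in>\<Theta> ` sphere 0 1. norm x \<le> B" unfolding bounded_pos by blast
 thus ?thesis by (intro that[of B]) auto
qed

lemma integrable_radial:
 fixes \<Theta> :: "'a::euclidean_space => real"
 assumes c: "continuous_on (sphere 0 1) \<Theta>" and w: "integrable lborel w"
 shows "integrable lborel (\<lambda>x. w x * \<Theta> (nrm x))"
proof -
 obtain B where B: "B > 0" "\<And>x. x \<noteq> 0 ==> \<bar>\<Theta> (nrm x)\<bar> \<le> B" by (rule sphere_bounded[OF c]) (rule that)
 show ?thesis
 proof (rule Bochner_Integration.integrable_bound)
  show "integrable lborel (\<lambda>x. w x * B)" using w by simp
  show "(\<lambda>x. w x * \<Theta> (nrm x)) \<in> borel_measurable lborel"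
   using nrm_measurable[OF c] by (intro borel_measurable_times borel_measurable_integrable[OF w]) simp
  show "AE x in lborel. norm (w x * \<Theta> (nrm x)) \<le> norm (w x * B)"
   using AE_lborel_nonzero by eventually_elim (use B in \<open>auto simp: abs_mult intro!: mult_left_mono\<close>)
 qed
qed

lemma integrable_gauss_1: "integrable lborel (gauss :: 'a::euclidean_space => real)"
 using integrable_gauss[OF poly_bounded_const[of 1]] by simp

lemma smean_integrable:
 assumes "continuous_on (sphere 0 1) \<Theta>"
 shows "integrable lborel (\<lambda>x. gauss x * \<Theta> (nrm x))"
 by (rule integrable_radial[OF assms integrable_gauss_1])

lemma smean_add: "continuous_on (sphere 0 1) \<Theta> ==> continuous_on (sphere 0 1) \<Psi> ==> smean (\<lambda>x. \<Theta> x + \<Psi> x) = smean \<Theta> + smean \<Psi>"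
 unfolding smean_def distrib_left by (intro Bochner_Integration.integral_add smean_integrable)

lemma smean_diff: "continuous_on (sphere 0 1) \<Theta> ==> continuous_on (sphere 0 1) \<Psi> ==> smean (\<lambda>x. \<Theta> x - \<Psi> x) = smean \<Theta> - smean \<Psi>"
 unfolding smean_def right_diff_distrib by (intro Bochner_Integration.integral_diff smean_integrable)

lemma smean_cmult: "smean (\<lambda>x. c * \<Theta> x) = c * smean \<Theta>"
 unfolding smean_def by (simp add: mult.left_commute)

lemma smean_sum: "(\<And>i. i \<in> I ==> continuous_on (sphere 0 1) (\<Theta> i)) ==> smean (\<lambda>x. \<Sum>i\<in>I. \<Theta> i x) = (\<Sum>i\<in>I. smean (\<Theta> i))"
 unfolding smean_def sum_distrib_left by (intro Bochner_Integration.integral_sum smean_integrable)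

lemma smean_mono:
 assumes "continuous_on (sphere 0 1) \<Theta>" "continuous_on (sphere 0 1) \<Psi>" "\<And>x. norm x = 1 ==> \<Theta> x \<le> \<Psi> x"
 shows "smean \<Theta> \<le> smean \<Psi>"
 unfolding smean_def
 by (rule integral_mono_AE[OF smean_integrable[OF assms(1)] smean_integrable[OF assms(2)]],
   use AE_lborel_nonzero in eventually_elim) (auto intro!: mult_left_mono assms(3))

lemma smean_cong: "(\<And>x. norm x = 1 ==> \<Theta> x = \<Psi> x) ==> smean \<Theta> = smean \<Psi>"
proof -
 assume eq: "\<And>x. norm x = 1 ==> \<Theta> x = \<Psi> x"
 show ?thesis unfolding smean_def
  by (rule integral_discrete_difference[where X="{0}"]) (auto simp: eq)
qed

lemma smean_nn:
 assumes c: "continuous_on (sphere 0 1) \<Theta>" and nn: "\<And>x. norm x = 1 ==> \<Theta> x \<ge> 0"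
 shows "(\<integral>x. ennreal (gauss x * \<Theta> (nrm x))) = ennreal (smean \<Theta>)"
 unfolding smean_def
 by (rule nn_integral_eq_integral[OF smean_integrable[OF c]], use AE_lborel_nonzero in eventually_elim)
  (auto intro!: mult_nonneg_nonneg nn)

text \<open>The cone over the set where \<open>\<Theta>\<close> does not vanish is open, so it is
  empty if it is a null set.\<close>

lemma smean_zero_imp:
 assumes c: "continuous_on (sphere 0 1) \<Theta>" and nn: "\<And>x. norm x = 1 ==> \<Theta> x \<ge> 0"
  and z: "smean \<Theta> \<le> 0" and x: "norm x = 1"
 shows "\<Theta> x = 0"
proof (rule ccontr)
 assume "\<Theta> x \<noteq> 0"
 have ge: "AE x in lborel. gauss x * \<Theta> (nrm x) \<ge> 0"
  using AE_lborel_nonzero by eventually_elim (auto intro!: mult_nonneg_nonneg nn)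
 have "smean \<Theta> \<ge> 0" unfolding smean_def by (rule integral_nonneg_AE[OF ge])
 hence "(LINT x|lborel. gauss x * \<Theta> (nrm x)) = 0" using z unfolding smean_def by simp
 hence "AE x in lborel. gauss x * \<Theta> (nrm x) = 0"
  using integral_nonneg_eq_0_iff_AE[OF smean_integrable[OF c] ge] by simp
 hence ae: "AE x in lborel. \<Theta> (nrm x) = 0"
  by eventually_elim (use gauss_pos in \<open>auto simp: less_le\<close>)
 define S where "S = {x \<in> - {0}. \<Theta> (nrm x) \<noteq> 0}"
 have "open S" unfolding S_def
  using continuous_open_preimage[OF continuous_on_nrm_compose[OF c], of "- {0}"] by (auto simp: vimage_def Int_def)
 have "AE x in lborel. x \<notin> S" using ae by eventually_elim (simp add: S_def)
 hence "S \<in> null_sets lborel" using \<open>open S\<close> AE_iff_null_sets[of S lborel] by simp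
 hence "negligible S" using null_sets_completionI negligible_iff_null_sets by blast
 hence "S = {}" using \<open>open S\<close> open_not_negligible by blast
 moreover have "x \<in> S" using x \<open>\<Theta> x \<noteq> 0\<close> by (auto simp: S_def)
 ultimately show False by blast
qed

lemma smean_limit:
 fixes F :: "real \<times> 'a::euclidean_space => real"
 assumes F: "continuous_on ({0..1} \<times> sphere 0 1) F"
 shows "(\<lambda>n. smean (\<lambda>x. F (1 / real (Suc n), x))) \<longlonglongrightarrow> smean (\<lambda>x. F (0, x))"
proof -
 have c: "continuous_on (sphere 0 1) (\<lambda>x. F (t, x))" if "t \<in> {0..1}" for t
  by (rule continuous_on_compose2[OF F]) (use that in \<open>auto intro!: continuous_intros\<close>)
 have t: "1 / real (Suc n) \<in> {0..1}" for n by simp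
 have "bounded (F ` ({0..1} \<times> sphere 0 1))"
  by (intro compact_imp_bounded compact_continuous_image F compact_Times) auto
 then obtain B where B: "\<forall>x\<in>F ` ({0..1} \<times> sphere 0 1). norm x \<le> B" unfolding bounded_pos by blast
 show ?thesis unfolding smean_def
 proof (rule integral_dominated_convergence[where w="\<lambda>x. gauss x * B"])
  show "(\<lambda>x. gauss x * F (0, nrm x)) \<in> borel_measurable lborel"
   using borel_measurable_integrable[OF smean_integrable[OF c[of 0]]] by simp
  show "(\<lambda>x. gauss x * F (1 / real (Suc n), nrm x)) \<in> borel_measurable lborel" for n
   using borel_measurable_integrable[OF smean_integrable[OF c[OF t]]] by simp
  show "integrable lborel (\<lambda>x::'a. gauss x * B)" by (intro integrable_mult_left integrable_gauss_1)
  show "AE x in lborel. (\<lambda>n. gauss x * F (1 / real (Suc n), nrm x)) \<longlonglongrightarrow> gauss x * F (0, nrm x)"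
   using AE_lborel_nonzero
  proof eventually_elim
   case (elim x)
   have "continuous_on {0..1} (\<lambda>t. F (t, nrm x))"
    by (rule continuous_on_compose2[OF F]) (use elim in \<open>auto intro!: continuous_intros\<close>)
   hence "(\<lambda>n. F (1 / real (Suc n), nrm x)) \<longlonglongrightarrow> F (0, nrm x)"
    by (rule continuous_on_tendsto_compose) (use t LIMSEQ_inverse_real_of_nat in \<open>auto simp: inverse_eq_divide\<close>)
   thus ?case by (rule tendsto_mult_left)
  qed
  show "AE x in lborel. norm (gauss x * F (1 / real (Suc n), nrm x)) \<le> gauss x * B" for n
   using AE_lborel_nonzero
  proof eventually_elim
   case (elim x)
   have "(1 / real (Suc n), nrm x) \<in> {0..1} \<times> sphere 0 1" using elim t[of n] by simp
   hence "\<bar>F (1 / real (Suc n), nrm x)\<bar> \<le> B" using B by (metis imageI real_norm_def)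
   thus ?case using gauss_pos[of x] by (simp add: abs_mult mult_left_mono less_imp_le)
  qed
 qed
qed

text \<open>\<open>nn_integral_polar\<close> compares the weight \<open>w\<close> with the Gaussian
  one: a radial weight changes means over the sphere only by a factor independent of
  \<open>\<Theta>\<close>.\<close>

lemma smean_radial_nonneg:
 fixes \<Theta> :: "'a::euclidean_space => real" and w :: "real => real"
 assumes c: "continuous_on (sphere 0 1) \<Theta>" and nn: "\<And>x. norm x = 1 ==> \<Theta> x \<ge> 0"
  and wm: "w \<in> borel_measurable borel" and wn: "\<And>r. w r \<ge> 0"
 shows "(\<integral>x. ennreal (w (norm x) * \<Theta> (nrm x))) * ennreal (LINT x|lborel. gauss (x::'a))
  = ennreal (smean \<Theta>) * (\<integral>x. ennreal (w (norm (x::'a))))"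
proof -
 have [measurable]: "(\<lambda>x. \<Theta> (nrm x)) \<in> borel_measurable borel" by (rule nrm_measurable[OF c])
 note wm [measurable]
 have g: "(\<integral>x. ennreal (exp (- (norm (x::'a))\<^sup>2 / 2))) = ennreal (LINT x|lborel. gauss (x::'a))"
  unfolding gauss_def[symmetric] by (rule nn_integral_eq_integral[OF integrable_gauss_1]) (simp add: less_imp_le[OF gauss_pos])
 have gp: "(LINT x|lborel. gauss (x::'a)) > 0"
 proof -
  have "smean (\<lambda>x::'a. 1) > 0"
  proof (rule ccontr)
   assume "\<not> smean (\<lambda>x::'a. 1) > 0"
   moreover obtain x :: 'a where "norm x = 1" using vector_choose_size[of 1] by auto
   ultimately show False using smean_zero_imp[of "\<lambda>x::'a. 1" x] by auto
  qed
  thus ?thesis by (simp add: smean_def)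
 qed
 have "(\<integral>x. ennreal (w (norm x)) * ennreal (\<Theta> (nrm x))) * (\<integral>y. ennreal (exp (- (norm (y::'a))\<^sup>2 / 2))) =
  (\<integral>x. ennreal (exp (- (norm x)\<^sup>2 / 2)) * ennreal (\<Theta> (nrm x))) * (\<integral>y. ennreal (w (norm (y::'a))))"
 proof (rule nn_integral_polar)
  show "(\<integral>x. ennreal (exp (- (norm (x::'a))\<^sup>2 / 2))) \<noteq> 0" "(\<integral>x. ennreal (exp (- (norm (x::'a))\<^sup>2 / 2))) \<noteq> \<infinity>"
   unfolding g using gp by auto
 qed (auto simp: nrm_scale)
 moreover have "(\<integral>x. ennreal (w (norm x)) * ennreal (\<Theta> (nrm x))) = (\<integral>x. ennreal (w (norm x) * \<Theta> (nrm x)))"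
  by (rule nn_integral_cong_AE, use AE_lborel_nonzero in eventually_elim) (simp add: nn ennreal_mult'')
 moreover have "(\<integral>x. ennreal (exp (- (norm x)\<^sup>2 / 2)) * ennreal (\<Theta> (nrm x))) = (\<integral>x. ennreal (gauss x * \<Theta> (nrm x)))"
  by (rule nn_integral_cong_AE, use AE_lborel_nonzero in eventually_elim) (simp add: nn ennreal_mult'' gauss_def)
 moreover have "(\<integral>x. ennreal (gauss x * \<Theta> (nrm x))) = ennreal (smean \<Theta>)"
  by (rule smean_nn[OF c nn])
 ultimately show ?thesis unfolding g by simp
qed

lemma gauss_integral_pos: "(LINT x|lborel. gauss (x::'a::euclidean_space)) > 0"
proof -
 have "smean (\<lambda>x::'a. 1) > 0"
 proof (rule ccontr)
  assume "\<not> smean (\<lambda>x::'a. 1) > 0"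
  moreover obtain x :: 'a where "norm x = 1" using vector_choose_size[of 1] by auto
  ultimately show False using smean_zero_imp[of "\<lambda>x::'a. 1" x] by auto
 qed
 thus ?thesis by (simp add: smean_def)
qed

text \<open>Reduction to the nonnegative case: \<open>\<Theta>\<close> is shifted by a bound
  \<open>B\<close>, and \<open>w\<close> is split into its positive and negative parts.\<close>

lemma smean_radial:
 fixes \<Theta> :: "'a::euclidean_space => real" and w :: "real => real"
 assumes c: "continuous_on (sphere 0 1) \<Theta>" and wm: "w \<in> borel_measurable borel"
  and wi: "integrable lborel (\<lambda>x::'a. w (norm x))"
 shows "(LINT x|lborel. w (norm x) * \<Theta> (nrm x)) * (LINT x|lborel. gauss (x::'a))
  = smean \<Theta> * (LINT x|lborel. w (norm (x::'a)))"
proof -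
 have 1: "(LINT x|lborel. w (norm x) * \<Theta> (nrm x)) * (LINT x|lborel. gauss (x::'a)) = smean \<Theta> * (LINT x|lborel. w (norm (x::'a)))"
  if c: "continuous_on (sphere 0 1) \<Theta>" and nn: "\<And>x. norm x = 1 ==> \<Theta> x \<ge> 0" and wm: "w \<in> borel_measurable borel" and wn: "\<And>r. w r \<ge> 0"
   and wi: "integrable lborel (\<lambda>x::'a. w (norm x))" for \<Theta> :: "'a => real" and w
 proof -
  have "(\<integral>x. ennreal (w (norm x) * \<Theta> (nrm x))) = ennreal (LINT x|lborel. w (norm x) * \<Theta> (nrm x))"
   by (rule nn_integral_eq_integral[OF integrable_radial[OF c wi]], use AE_lborel_nonzero in eventually_elim)
    (auto intro!: mult_nonneg_nonneg nn wn)
  moreover have "(\<integral>x. ennreal (w (norm (x::'a)))) = ennreal (LINT x|lborel. w (norm (x::'a)))"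
   by (rule nn_integral_eq_integral[OF wi]) (simp add: wn)
  moreover have "(\<integral>x. ennreal (w (norm x) * \<Theta> (nrm x))) * ennreal (LINT x|lborel. gauss (x::'a))
   = ennreal (smean \<Theta>) * (\<integral>x. ennreal (w (norm (x::'a))))"
   by (rule smean_radial_nonneg[OF c nn wm wn])
  ultimately have eq: "ennreal (LINT x|lborel. w (norm x) * \<Theta> (nrm x)) * ennreal (LINT x|lborel. gauss (x::'a)) = ennreal (smean \<Theta>) * ennreal (LINT x|lborel. w (norm (x::'a)))"
   by simp
  have p: "(LINT x|lborel. w (norm (x::'a))) \<ge> 0" by (rule Bochner_Integration.integral_nonneg) (rule wn)
  have q: "(LINT x|lborel. w (norm x) * \<Theta> (nrm x)) \<ge> 0"
   by (rule integral_nonneg_AE, use AE_lborel_nonzero in eventually_elim) (auto intro!: mult_nonneg_nonneg nn wn)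
  have s: "smean \<Theta> \<ge> 0" unfolding smean_def
   by (rule integral_nonneg_AE, use AE_lborel_nonzero in eventually_elim) (auto intro!: mult_nonneg_nonneg nn)
  show ?thesis using eq p q s gauss_integral_pos[where 'a='a]
   by (simp add: ennreal_mult'[symmetric] less_imp_le)
 qed
 obtain B where B: "B > 0" "\<And>x. x \<noteq> 0 ==> \<bar>\<Theta> (nrm x)\<bar> \<le> B" by (rule sphere_bounded[OF c]) (rule that)
 have cB: "continuous_on (sphere 0 1) (\<lambda>x. \<Theta> x + B)" and cc: "continuous_on (sphere 0 1) (\<lambda>x::'a. B)" by (intro continuous_intros c)+
 have nB: "\<Theta> x + B \<ge> 0" if "norm x = 1" for x
 proof -
  have "x \<noteq> 0" using that by auto
  thus ?thesis using B(2)[of x] that by simp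
 qed
 have 2: "(LINT x|lborel. w (norm x) * \<Theta> (nrm x)) * (LINT x|lborel. gauss (x::'a)) = smean \<Theta> * (LINT x|lborel. w (norm (x::'a)))"
  if wm: "w \<in> borel_measurable borel" and wn: "\<And>r. w r \<ge> 0"
   and wi: "integrable lborel (\<lambda>x::'a. w (norm x))" for w
 proof -
  have e1: "(LINT x|lborel. w (norm x) * (\<Theta> (nrm x) + B)) = (LINT x|lborel. w (norm x) * \<Theta> (nrm x)) + (LINT x|lborel. w (norm (x::'a)) * B)"
   unfolding distrib_left by (intro Bochner_Integration.integral_add integrable_radial[OF c wi] integrable_radial[OF cc wi])
  have e2: "smean (\<lambda>x. \<Theta> x + B) = smean \<Theta> + smean (\<lambda>x::'a. B)" by (rule smean_add[OF c cc])
  have e3: "(LINT x|lborel. w (norm x) * (\<Theta> (nrm x) + B)) * (LINT x|lborel. gauss (x::'a)) = smean (\<lambda>x. \<Theta> x + B) * (LINT x|lborel. w (norm (x::'a)))"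
   by (rule 1[OF cB nB wm wn wi])
  have e4: "(LINT x|lborel. w (norm (x::'a)) * B) * (LINT x|lborel. gauss (x::'a)) = smean (\<lambda>x::'a. B) * (LINT x|lborel. w (norm (x::'a)))"
   using B(1) by (intro 1[OF cc _ wm wn wi]) simp
  show ?thesis using e3[unfolded e1 e2 distrib_right] e4 by linarith
 qed
 define w1 w2 where "w1 r = max 0 (w r)" and "w2 r = max 0 (- w r)" for r
 note wm [measurable]
 have m: "w1 \<in> borel_measurable borel" "w2 \<in> borel_measurable borel" unfolding w1_def[abs_def] w2_def[abs_def] by measurable
 have i: "integrable lborel (\<lambda>x::'a. w1 (norm x))" "integrable lborel (\<lambda>x::'a. w2 (norm x))"
  unfolding w1_def w2_def using wi by (intro integrable_max integrable_zero; simp)+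
 have d: "w r = w1 r - w2 r" for r by (simp add: w1_def w2_def max_def)
 have "(LINT x|lborel. w (norm x) * \<Theta> (nrm x)) = (LINT x|lborel. w1 (norm x) * \<Theta> (nrm x)) - (LINT x|lborel. w2 (norm x) * \<Theta> (nrm x))"
  unfolding d left_diff_distrib by (intro Bochner_Integration.integral_diff integrable_radial[OF c] i)
 moreover have "(LINT x|lborel. w (norm (x::'a))) = (LINT x|lborel. w1 (norm (x::'a))) - (LINT x|lborel. w2 (norm (x::'a)))"
  unfolding d by (intro Bochner_Integration.integral_diff i)
 moreover have "(LINT x|lborel. w1 (norm x) * \<Theta> (nrm x)) * (LINT x|lborel. gauss (x::'a)) = smean \<Theta> * (LINT x|lborel. w1 (norm (x::'a)))"
  by (rule 2[OF m(1) _ i(1)]) (simp add: w1_def)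
 moreover have "(LINT x|lborel. w2 (norm x) * \<Theta> (nrm x)) * (LINT x|lborel. gauss (x::'a)) = smean \<Theta> * (LINT x|lborel. w2 (norm (x::'a)))"
  by (rule 2[OF m(2) _ i(2)]) (simp add: w2_def)
 ultimately show ?thesis by (simp only: left_diff_distrib right_diff_distrib)
qed

section \<open>Homogeneous weights near the origin\<close>

lemma dyadic_bound:
 assumes "0 < r" "r \<le> (1::real)"
 shows "\<exists>j. r \<le> (1/2) ^ j \<and> (1/2) ^ Suc j < r"
proof -
 obtain m where "(1/2) ^ m < r" using real_arch_pow_inv[OF assms(1), of "1/2"] by auto
 define j where "j = (LEAST j. (1/2) ^ j < r)"
 have j: "(1/2) ^ j < r" unfolding j_def by (rule LeastI) fact
 hence "j \<noteq> 0" using assms(2) by (metis less_irrefl not_le power_0)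
 then obtain i where i: "j = Suc i" by (cases j) auto
 have "\<not> (1/2) ^ i < r" using not_less_Least[of i "\<lambda>j. (1/2) ^ j < r"] i unfolding j_def by simp
 thus ?thesis using j i by (auto intro!: exI[of _ i])
qed

text \<open>Between the radii \<open>(1/2) ^ Suc j\<close> and \<open>(1/2) ^ j\<close> the singular
  factor is at most \<open>(2 ^ Suc j) ^ a\<close>, and the volumes of the balls make the series
  geometric as \<open>a\<close> is less than the dimension. Such weights arise because
  \<open>grad_form k\<close> has degree \<open>1 - k\<close>.\<close>

lemma singular_weight_finite:
 assumes a: "a < DIM('a)"
 shows "(\<integral>x. ennreal (inverse (norm (x::'a::euclidean_space)) ^ a * gauss x)) < \<infinity>"
proof -
 let ?N = "DIM('a)"
 have "(\<integral>x. ennreal (inverse (norm (x::'a)) ^ a * gauss x))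
  \<le> (\<integral>x. ennreal (gauss (x::'a)) + (\<Sum>j. ennreal ((2 ^ Suc j) ^ a) * indicator (cball 0 ((1/2) ^ j)) x))"
 proof (rule nn_integral_mono_AE, use AE_lborel_nonzero in eventually_elim)
  fix x :: 'a assume x: "x \<noteq> 0"
  show "ennreal (inverse (norm x) ^ a * gauss x) \<le> ennreal (gauss x) + (\<Sum>j. ennreal ((2 ^ Suc j) ^ a) * indicator (cball 0 ((1/2) ^ j)) x)"
  proof (cases "norm x \<le> 1")
   case False
   hence "inverse (norm x) ^ a \<le> 1" by (intro power_le_one) (auto simp: inverse_le_1_iff)
   hence "inverse (norm x) ^ a * gauss x \<le> 1 * gauss x" by (intro mult_right_mono) auto
   hence "ennreal (inverse (norm x) ^ a * gauss x) \<le> ennreal (gauss x)" by (simp add: ennreal_leI)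
   thus ?thesis by (rule order_trans) simp
  next
   case True
   then obtain j where j: "norm x \<le> (1/2) ^ j" "(1/2) ^ Suc j < norm x" using dyadic_bound[of "norm x"] x by auto
   have "inverse (norm x) \<le> inverse ((1/2) ^ Suc j)" using j x by (intro le_imp_inverse_le) auto
   also have "inverse ((1/2) ^ Suc j) = (2::real) ^ Suc j" by (simp add: power_one_over del: power_Suc)
   finally have "inverse (norm x) ^ a \<le> (2 ^ Suc j) ^ a" by (intro power_mono) auto
   moreover have "gauss x \<le> 1" by (simp add: gauss_def)
   ultimately have "inverse (norm x) ^ a * gauss x \<le> (2 ^ Suc j) ^ a * 1" by (intro mult_mono) auto
   hence "ennreal (inverse (norm x) ^ a * gauss x) \<le> ennreal ((2 ^ Suc j) ^ a) * indicator (cball 0 ((1/2) ^ j)) x"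
    using j(1) by (simp add: ennreal_leI)
   also have "... \<le> (\<Sum>j. ennreal ((2 ^ Suc j) ^ a) * indicator (cball 0 ((1/2) ^ j)) x)"
   proof -
    have "f j \<le> suminf f" for f :: "nat => ennreal"
     using sum_le_suminf[of f "{j}"] by simp
    thus ?thesis .
   qed
   also have "... \<le> ennreal (gauss x) + (\<Sum>j. ennreal ((2 ^ Suc j) ^ a) * indicator (cball 0 ((1/2) ^ j)) x)" by simp
   finally show ?thesis .
  qed
 qed
 also have "... = (\<integral>x. ennreal (gauss (x::'a))) + (\<Sum>j. \<integral>\<^sup>+x. ennreal ((2 ^ Suc j) ^ a) * indicator (cball (0::'a) ((1/2) ^ j)) x \<partial>lborel)"
 proof -
  have m: "(\<lambda>x. ennreal ((2 ^ Suc j) ^ a) * indicator (cball (0::'a) ((1/2) ^ j)) x) \<in> borel_measurable lborel" for j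
   by (intro borel_measurable_times_ennreal borel_measurable_const borel_measurable_indicator) simp
  hence "(\<lambda>x. \<Sum>j. ennreal ((2 ^ Suc j) ^ a) * indicator (cball (0::'a) ((1/2) ^ j)) x) \<in> borel_measurable lborel"
   by (rule borel_measurable_suminf_order)
  thus ?thesis by (subst nn_integral_add) (simp_all only: nn_integral_suminf[OF m], measurable)
 qed
 also have "... < \<infinity>"
 proof -
  have g: "(\<integral>x. ennreal (gauss (x::'a))) < \<infinity>"
   using integrable_gauss_1[where 'a='a] by (subst nn_integral_eq_integral) auto
  have "(\<integral>x. ennreal ((2 ^ Suc j) ^ a) * indicator (cball (0::'a) ((1/2) ^ j)) x) \<le> ennreal (2 ^ a * unit_ball_vol (real ?N) * (1/2) ^ j)" for j
  proof -
   have "(\<integral>x. ennreal ((2 ^ Suc j) ^ a) * indicator (cball (0::'a) ((1/2) ^ j)) x) = ennreal ((2 ^ Suc j) ^ a) * ennreal (unit_ball_vol (real ?N) * ((1/2) ^ j) ^ ?N)"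
    by (subst nn_integral_cmult_indicator) (auto simp: emeasure_cball)
   also have "... = ennreal ((2 ^ Suc j) ^ a * (unit_ball_vol (real ?N) * ((1/2) ^ j) ^ ?N))" by (simp add: ennreal_mult')
   also have "... \<le> ennreal (2 ^ a * unit_ball_vol (real ?N) * (1/2) ^ j)"
   proof (rule ennreal_leI)
    obtain d where d: "?N = a + Suc d" using less_imp_Suc_add[OF a] by auto
    have "(2 ^ Suc j) ^ a * ((1/2::real) ^ j) ^ ?N = 2 ^ a * ((2 ^ j) ^ a * ((1/2) ^ j) ^ a) * ((1/2) ^ j * ((1/2) ^ j) ^ d)"
     unfolding d by (simp add: power_add power_mult_distrib)
    also have "(2 ^ j) ^ a * ((1/2::real) ^ j) ^ a = 1"
     by (simp only: power_mult_distrib[symmetric]) simp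
    also have "2 ^ a * 1 * ((1/2) ^ j * ((1/2) ^ j) ^ d) \<le> 2 ^ a * 1 * ((1/2::real) ^ j * 1)"
     by (intro mult_left_mono power_le_one) (auto simp: power_le_one)
    finally have "(2 ^ Suc j) ^ a * ((1/2::real) ^ j) ^ ?N * unit_ball_vol (real ?N) \<le> 2 ^ a * (1/2) ^ j * unit_ball_vol (real ?N)"
     by (intro mult_right_mono) simp_all
    thus "(2 ^ Suc j) ^ a * (unit_ball_vol (real ?N) * ((1/2) ^ j) ^ ?N) \<le> 2 ^ a * unit_ball_vol (real ?N) * (1/2) ^ j"
     by (simp only: mult_ac)
   qed
   finally show ?thesis .
  qed
  hence "(\<Sum>j. \<integral>\<^sup>+x. ennreal ((2 ^ Suc j) ^ a) * indicator (cball (0::'a) ((1/2) ^ j)) x \<partial>lborel)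
   \<le> (\<Sum>j. ennreal (2 ^ a * unit_ball_vol (real ?N) * (1/2) ^ j))" by (intro suminf_le) auto
  also have "... = ennreal (\<Sum>j. 2 ^ a * unit_ball_vol (real ?N) * (1/2) ^ j)"
   by (rule suminf_ennreal2) (auto intro!: summable_mult summable_geometric)
  also have "... < \<infinity>" by simp
  finally show ?thesis using g by (simp only: infinity_ennreal_def ennreal_add_less_top)
 qed
 finally show ?thesis .
qed

section \<open>Scaling laws and Newton's inequality\<close>

lemma esym_scale: "esym k (c *R M) = c ^ k * esym k M"
proof -
 have "char_poly_rev (c *R M) = pcompose (char_poly_rev M) [:0, c:]"
  by (rule poly_eq_poly_eq_iff[THEN iffD1]) (simp add: fun_eq_iff poly_pcompose poly_char_poly_rev mult.commute)
 thus ?thesis by (simp add: esym_def coeff_pcompose_linear)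
qed

text \<open>Comparison of coefficients after differentiating the product of the factors
  \<open>1 + l i * s\<close> in \<open>s\<close>.\<close>

lemma elem_sym_remove_sum:
 fixes l :: "'i => real"
 assumes I: "finite I"
 shows "(\<Sum>i\<in>I. l i * elem_sym k (I - {i}) l) = real (k + 1) * elem_sym (k + 1) I l"
proof -
 have "real (k + 1) * coeff (\<Prod>i\<in>I. [:1, l i:]) (k + 1) = coeff (pderiv (\<Prod>i\<in>I. [:1, l i:])) k"
  by (simp add: coeff_pderiv)
 also have "pderiv (\<Prod>i\<in>I. [:1, l i:]) = (\<Sum>i\<in>I. smult (l i) (\<Prod>j\<in>I - {i}. [:1, l j:]))"
  by (simp add: pderiv_prod pderiv_pCons)
 also have "coeff ... k = (\<Sum>i\<in>I. l i * elem_sym k (I - {i}) l)"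
  using I by (simp add: coeff_sum coeff_prod_linear)
 finally show ?thesis using I by (simp add: coeff_prod_linear)
qed

lemma elem_sym_remove_le:
 fixes l :: "'i => real"
 assumes "finite I" "\<And>i. l i \<ge> 0"
 shows "elem_sym k (I - J) l \<le> elem_sym k I l"
 unfolding elem_sym_def using assms by (intro sum_mono2) (auto intro: prod_nonneg)

context even_support
begin

lemma e_hess_scale: "c > 0 ==> x \<noteq> 0 ==> e_hess k (c *R x) = (1 / c) ^ k * e_hess k x"
proof -
 assume "c > 0" "x \<noteq> 0"
 hence "matrix (A (c *R x)) = (1 / c) *R matrix (A x)"
  by (simp add: matrix_def A_scale vec_eq_iff)
 thus ?thesis by (simp add: e_hess_def esym_scale)
qed

lemma h_nrm: "h x = norm x * h (nrm x)"
 by (metis abs_norm_cancel hom nrm_eq)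

lemma X_nrm: "x \<noteq> 0 ==> X x = X (nrm x)"
 using X_scale[of "inverse (norm x)" x] by (simp add: nrm_def)

lemma e_hess_nrm: "x \<noteq> 0 ==> e_hess k x = inverse (norm x) ^ k * e_hess k (nrm x)"
proof -
 assume x: "x \<noteq> 0"
 have "e_hess k (norm x *R nrm x) = (1 / norm x) ^ k * e_hess k (nrm x)"
  by (rule e_hess_scale) (use x in \<open>auto simp: nrm_def\<close>)
 thus ?thesis by (simp add: nrm_eq[symmetric] inverse_eq_divide)
qed

text \<open>For nonnegative eigenvalues, omitting an index can only lower a symmetric function, and
  \<open>elem_sym_remove_sum\<close> expresses the left side through such reduced functions.\<close>

lemma e_hess_newton: "x \<noteq> 0 ==> real (k + 1) * e_hess (k + 1) x \<le> e_hess 1 x * e_hess k x"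
proof -
 assume x: "x \<noteq> 0"
 obtain l :: "'m => real" where l: "\<forall>i. l i \<ge> 0" "\<forall>k. e_hess k x = elem_sym k UNIV l"
  by (rule hess_eigenbasis[OF x]) (rule that)
 have "real (k + 1) * elem_sym (k + 1) UNIV l = (\<Sum>i\<in>UNIV. l i * elem_sym k (UNIV - {i}) l)"
  by (rule elem_sym_remove_sum[symmetric]) simp
 also have "... \<le> (\<Sum>i\<in>UNIV. l i * elem_sym k UNIV l)"
  using l(1) by (intro sum_mono mult_left_mono elem_sym_remove_le) auto
 finally show ?thesis unfolding l(2)[rule_format] by (simp add: elem_sym_1 sum_distrib_right)
qed

lemma cont_sphere:
 "continuous_on (sphere 0 1) h" "continuous_on (sphere 0 1) X" "continuous_on (sphere 0 1) (e_hess k)"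
 by (rule continuous_on_subset[OF cont_h] continuous_on_subset[OF cont_X] continuous_on_subset[OF cont_e_hess]; auto)+

end

context strict_even_support
begin

text \<open>Apart from the Gaussian factor both integrands of \<open>Kubota_row_sets\<close> have
  degree \<open>1 - k\<close>. They share one radial weight, whose integral is positive and finite
  since \<open>k - 1\<close> is less than the dimension, and it cancels.\<close>

lemma Kubota_smean:
 assumes k: "k \<ge> 1" "k < CARD('m)"
 shows "smean (\<lambda>x. real k * (grad_form k x)) \<le> smean (\<lambda>x. newton_form k x)"
proof -
 define B where "B x = grad_form k x" for x
 define D where "D x = newton_form k x" for x
 define L where "L x = real (k + 1) * B x" for x
 define R where "R x = B x + D x" for x
 have cB: "continuous_on (sphere 0 1) B" and cD: "continuous_on (sphere 0 1) D"
  unfolding B_def D_def by (intro continuous_intros cont_sphere)+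
 have cL: "continuous_on (sphere 0 1) L" and cR: "continuous_on (sphere 0 1) R"
  unfolding L_def R_def by (intro continuous_intros cB cD)+
 have nz: "x \<noteq> 0" if "norm x = 1" for x :: "real^'m" using that by auto
 have nB: "B x \<ge> 0" if "x \<noteq> 0" for x unfolding B_def using h_nonneg e_hess_nonneg[OF that] by simp
 have nD: "D x \<ge> 0" if "x \<noteq> 0" for x unfolding D_def using e_hess_newton[OF that, of k] by simp
 have nL: "L x \<ge> 0" and nR: "R x \<ge> 0" if "norm x = 1" for x
  using nB[OF nz[OF that]] nD[OF nz[OF that]] by (simp_all add: L_def R_def)
 define w where "w r = inverse r ^ (k - 1) * exp (- r\<^sup>2 / 2)" for r :: real
 have pw: "inverse r ^ k * r = inverse r ^ (k - 1)" "inverse r ^ (k + 1) * r^2 = inverse r ^ (k - 1)" if "r > 0" for r :: real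
 proof -
  obtain j where j: "k = Suc j" using k by (cases k) auto
  show "inverse r ^ k * r = inverse r ^ (k - 1)" "inverse r ^ (k + 1) * r^2 = inverse r ^ (k - 1)"
   using that by (simp_all add: j power2_eq_square field_simps)
 qed
 have hB: "B x = inverse (norm x) ^ (k - 1) * B (nrm x)" if "x \<noteq> 0" for x
  unfolding B_def h_nrm[of x] X_nrm[OF that] e_hess_nrm[OF that, of k] using pw(1)[of "norm x"] that
  by (simp add: mult_ac)
 have hD: "D x = inverse (norm x) ^ (k - 1) * D (nrm x)" if x: "x \<noteq> 0" for x
 proof -
  have "D x = (norm x)^2 * inverse (norm x) ^ (k + 1) * D (nrm x)"
   unfolding D_def h_nrm[of x] e_hess_nrm[OF x, of k] e_hess_nrm[OF x, of 1] e_hess_nrm[OF x, of "k + 1"]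
   by (simp add: power_mult_distrib algebra_simps)
  thus ?thesis using pw(2)[of "norm x"] x by (simp add: mult.commute)
 qed
 have gL: "gauss x * L x = w (norm x) * L (nrm x)" and gR: "gauss x * R x = w (norm x) * R (nrm x)" if "x \<noteq> 0" for x
  unfolding L_def R_def w_def gauss_def hB[OF that] hD[OF that] by (simp_all add: algebra_simps)
 \<comment> \<open>The index type must hold \<open>k\<close> Gaussian vectors, the base point and
   the transversal vector; \<open>2 * CARD('m)\<close> indices suffice for
   \<open>1 \<le> k < CARD('m)\<close>.\<close>
 define s :: "'m bit0" where "s = 0"
 define a0 :: "'m bit0" where "a0 = 1"
 have sa: "s \<noteq> a0" by (simp add: s_def a0_def)
 have "k \<le> card (UNIV - {s, a0})"
 proof -
  have "card (UNIV - {s, a0}) = CARD('m bit0) - 2" using sa by (subst card_Diff_subset) auto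
  thus ?thesis using k by simp
 qed
 then obtain J where J: "J \<subseteq> UNIV - {s, a0}" "card J = k" "finite J" by (rule obtain_subset_with_card_n)
 have "(\<integral>x. ennreal (gauss x * L x)) \<le> (\<integral>x. ennreal (gauss x * R x))"
  using Kubota_row_sets[of a0 J s] J sa unfolding L_def R_def B_def D_def by auto
 moreover have "(\<integral>x. ennreal (gauss x * L x)) = (\<integral>x. ennreal (w (norm x) * L (nrm x)))"
  by (rule nn_integral_cong_AE, use AE_lborel_nonzero in eventually_elim) (simp add: gL)
 moreover have "(\<integral>x. ennreal (gauss x * R x)) = (\<integral>x. ennreal (w (norm x) * R (nrm x)))"
  by (rule nn_integral_cong_AE, use AE_lborel_nonzero in eventually_elim) (simp add: gR)
 ultimately have le: "(\<integral>x. ennreal (w (norm x) * L (nrm x))) \<le> (\<integral>x. ennreal (w (norm x) * R (nrm x)))" by simp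
 \<comment> \<open>\<open>w\<close> can be negative at negative arguments, which are not norms;
   \<open>w'\<close> has the global sign required for comparing radial weights.\<close>
 define w' where "w' r = max 0 (w r)" for r
 have ww: "w' (norm x) = w (norm x)" for x :: "real^'m" by (simp add: w'_def w_def)
 have wm: "w' \<in> borel_measurable borel" unfolding w'_def[abs_def] w_def by measurable
 have wn: "w' r \<ge> 0" for r by (simp add: w'_def)
 note rad = smean_radial_nonneg[where 'a="real^'m" and w=w', unfolded ww]
 let ?W = "\<integral>\<^sup>+x. ennreal (w (norm (x::real^'m))) \<partial>lborel" and ?Z = "LINT x|lborel. gauss (x::real^'m)"
 have eL: "(\<integral>x. ennreal (w (norm x) * L (nrm x))) * ennreal ?Z = ennreal (smean L) * ?W"
  by (rule rad[OF cL nL wm wn])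
 have eR: "(\<integral>x. ennreal (w (norm x) * R (nrm x))) * ennreal ?Z = ennreal (smean R) * ?W"
  by (rule rad[OF cR nR wm wn])
 have "?W < \<infinity>"
  using singular_weight_finite[where 'a="real^'m", of "k - 1"] k by (simp add: w_def gauss_def)
 moreover have "?W \<noteq> 0"
 proof
  assume "?W = 0"
  hence "AE x in lborel. ennreal (w (norm (x::real^'m))) = 0"
   by (subst (asm) nn_integral_0_iff_AE) (use wm[unfolded w'_def[abs_def]] in \<open>auto simp: w_def\<close>)
  hence "AE x in (lborel :: (real^'m) measure). False"
   using AE_lborel_nonzero
  proof eventually_elim
   case (elim x)
   have "w (norm x) > 0" unfolding w_def using elim(2) by (intro mult_pos_pos zero_less_power) auto
   thus False using elim(1) by (simp add: ennreal_eq_0_iff)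
  qed
  thus False by (simp add: ae_filter_eq_bot_iff)
 qed
 ultimately obtain \<omega> where \<omega>: "?W = ennreal \<omega>" "\<omega> > 0"
  by (cases ?W) (auto simp: less_le)
 have "ennreal (smean L) * ennreal \<omega> \<le> ennreal (smean R) * ennreal \<omega>"
  using mult_right_mono[OF le, of "ennreal ?Z"] unfolding eL eR \<omega>(1) by simp
 moreover have s0: "smean L \<ge> 0" "smean R \<ge> 0"
  using smean_mono[of "\<lambda>x. 0" L] smean_mono[of "\<lambda>x. 0" R] cL cR nL nR by (auto simp: smean_def)
 ultimately have "smean L \<le> smean R" using \<omega>(2) by (simp add: ennreal_mult'[symmetric])
 also have "smean R = smean B + smean D" unfolding R_def by (rule smean_add[OF cB cD])
 also have "smean L = real (k + 1) * smean B" unfolding L_def by (rule smean_cmult)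
 finally have "real k * smean B \<le> smean D" by (simp add: distrib_right)
 thus ?thesis unfolding B_def D_def smean_cmult .
qed

end

section \<open>Removing strict convexity\<close>

lemma has_derivative_norm_nrm: "x \<noteq> 0 ==> (norm has_derivative (\<lambda>v. nrm x \<bullet> v)) (at x)"
 using GDERIV_norm[of x] by (simp add: gderiv_def sgn_div_norm nrm_def inner_commute divide_inverse)

lemma has_derivative_nrm:
 fixes x :: "'a::euclidean_space"
 assumes x: "x \<noteq> 0"
 shows "(nrm has_derivative (\<lambda>v. (1 / norm x) *R (v - (nrm x \<bullet> v) *R nrm x))) (at x)"
proof -
 have "((\<lambda>y. inverse (norm y) *R y) has_derivative (\<lambda>v. inverse (norm x) *R v + (- (inverse (norm x) * (nrm x \<bullet> v) * inverse (norm x))) *R x)) (at x)"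
  by (rule has_derivative_scaleR[OF Deriv.has_derivative_inverse[OF _ has_derivative_norm_nrm[OF x]] has_derivative_ident])
   (use x in simp)
 moreover have "(\<lambda>v. inverse (norm x) *R v + (- (inverse (norm x) * (nrm x \<bullet> v) * inverse (norm x))) *R x)
  = (\<lambda>v. (1 / norm x) *R (v - (nrm x \<bullet> v) *R nrm x))"
  by (rule ext) (simp add: scaleR_diff_right inverse_eq_divide, simp add: nrm_def divide_inverse)
 ultimately show ?thesis by (simp add: nrm_def[abs_def])
qed

context even_support
begin

text \<open>A ball of radius \<open>e\<close> is added to the convex body. The Hessian of
  \<open>e * norm x\<close> is positive definite on tangent vectors and annihilates the radial
  direction; Cauchy--Schwarz gives its sign on all vectors.\<close>

lemma strict_perturbation:
 assumes e: "e > 0"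
 shows "strict_even_support (\<lambda>x. h x + e * norm x) (\<lambda>x. X x + e *R nrm x)
  (\<lambda>x v. A x v + (e / norm x) *R (v - (nrm x \<bullet> v) *R nrm x))"
proof
 have cs: "(v - (nrm x \<bullet> v) *R nrm x) \<bullet> v \<ge> 0" if "x \<noteq> 0" for x v :: "real^'m"
 proof -
  have "(nrm x \<bullet> v)^2 \<le> (nrm x \<bullet> nrm x) * (v \<bullet> v)" by (rule Cauchy_Schwarz_ineq)
  also have "nrm x \<bullet> nrm x = 1" using that by (simp add: dot_square_norm)
  finally show ?thesis by (simp add: inner_diff_left power2_eq_square)
 qed
 show "h (c *R x) + e * norm (c *R x) = \<bar>c\<bar> * (h x + e * norm x)" for c x
  by (simp add: hom algebra_simps)
 fix x :: "real^'m" assume x: "x \<noteq> 0"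
 show "h x + e * norm x > 0" using pos[OF x] e x by (simp add: add_pos_pos)
 have "((\<lambda>x. h x + e * norm x) has_derivative (\<lambda>v. X x \<bullet> v + e * (nrm x \<bullet> v))) (at x)"
  by (intro has_derivative_add has_derivative_mult_right dh[OF x] has_derivative_norm_nrm x)
 thus "((\<lambda>x. h x + e * norm x) has_derivative (\<lambda>v. (X x + e *R nrm x) \<bullet> v)) (at x)"
  by (simp add: inner_add_left)
 have "((\<lambda>x. X x + e *R nrm x) has_derivative (\<lambda>v. A x v + e *R ((1 / norm x) *R (v - (nrm x \<bullet> v) *R nrm x)))) (at x)"
  by (intro has_derivative_add has_derivative_scaleR_right dX[OF x] has_derivative_nrm x)
 thus "((\<lambda>x. X x + e *R nrm x) has_derivative (\<lambda>v. A x v + (e / norm x) *R (v - (nrm x \<bullet> v) *R nrm x))) (at x)"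
  by simp
 show "(A x v + (e / norm x) *R (v - (nrm x \<bullet> v) *R nrm x)) \<bullet> w = v \<bullet> (A x w + (e / norm x) *R (w - (nrm x \<bullet> w) *R nrm x))" for v w
  by (simp add: inner_add_left inner_add_right inner_diff_left inner_diff_right symA[OF x] inner_commute[of v "nrm x"])
 show "(A x v + (e / norm x) *R (v - (nrm x \<bullet> v) *R nrm x)) \<bullet> v \<ge> 0" for v
 proof -
  have "(e / norm x) * ((v - (nrm x \<bullet> v) *R nrm x) \<bullet> v) \<ge> 0"
   using cs[OF x, of v] e by (intro mult_nonneg_nonneg) auto
  thus ?thesis using psd[OF x, of v] by (simp only: inner_add_left inner_scaleR_left)
 qed
 show "(A x v + (e / norm x) *R (v - (nrm x \<bullet> v) *R nrm x)) \<bullet> v > 0" if v: "v \<noteq> 0" "v \<bullet> x = 0" for v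
 proof -
  have "nrm x \<bullet> v = 0" using v(2) by (simp add: nrm_def inner_commute)
  thus ?thesis using psd[OF x, of v] e x v(1) by (simp add: inner_add_left add_nonneg_pos)
 qed
next
 show "continuous_on (- {0}) (\<lambda>x. A x v + (e / norm x) *R (v - (nrm x \<bullet> v) *R nrm x))" for v
  by (intro continuous_intros contA continuous_on_nrm) auto
qed

text \<open>On the unit sphere the perturbed Hessian has matrix \<open>M (e, x)\<close>, continuous
  jointly in \<open>e\<close> and \<open>x\<close> down to \<open>e = 0\<close>. The strict
  inequality thus passes to the limit by \<open>smean_limit\<close>.\<close>

theorem Kubota_inequality:
 assumes k: "k \<ge> 1" "k < CARD('m)"
 shows "smean (\<lambda>x. real k * (grad_form k x)) \<le> smean (\<lambda>x. newton_form k x)"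
proof -
 define M where "M z = (\<chi> i j. A (snd z) (axis j 1) $ i + fst z * ((if i = j then 1 else 0) - snd z $ j * snd z $ i))" for z :: "real \<times> (real^'m)"
 define hh where "hh z = h (snd z) + fst z" for z
 define XX where "XX z = X (snd z) + fst z *R snd z" for z
 let ?S = "{0..1} \<times> sphere 0 1 :: (real \<times> (real^'m)) set"
 have cM: "continuous_on ?S (\<lambda>z. esym j (M z))" for j
 proof (rule continuous_on_esym)
  show "continuous_on ?S (\<lambda>z. M z $ a $ b)" for a b
  proof -
   have "continuous_on ?S (\<lambda>z. A (snd z) (axis b 1))"
    by (rule continuous_on_compose2[OF contA continuous_on_snd[OF continuous_on_id]]) auto
   thus ?thesis unfolding M_def vec_lambda_beta by (intro continuous_intros)
  qed
 qed
 have ch: "continuous_on ?S hh"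
  unfolding hh_def by (rule continuous_on_add[OF continuous_on_compose2[OF cont_h continuous_on_snd[OF continuous_on_id]]])
   (auto intro!: continuous_intros)
 have cX: "continuous_on ?S XX"
  unfolding XX_def by (rule continuous_on_add[OF continuous_on_compose2[OF cont_X continuous_on_snd[OF continuous_on_id]]])
   (auto intro!: continuous_intros)
 define FL where "FL z = real k * (hh z * (norm (XX z))^2 * esym k (M z))" for z
 define FR where "FR z = (hh z)^2 * (esym 1 (M z) * esym k (M z) - real (k + 1) * esym (k + 1) (M z))" for z
 have cF: "continuous_on ?S FL" "continuous_on ?S FR"
  unfolding FL_def FR_def by (intro continuous_intros cM ch cX)+
 have le: "smean (\<lambda>x. FL (e, x)) \<le> smean (\<lambda>x. FR (e, x))" if e: "e > 0" for e
 proof -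
  interpret S: strict_even_support "\<lambda>x. h x + e * norm x" "\<lambda>x. X x + e *R nrm x"
   "\<lambda>x v. A x v + (e / norm x) *R (v - (nrm x \<bullet> v) *R nrm x)" by (rule strict_perturbation[OF e])
  have m: "S.e_hess j x = esym j (M (e, x))" if x: "norm x = 1" for x j
  proof -
   have "matrix (\<lambda>v. A x v + (e / norm x) *R (v - (nrm x \<bullet> v) *R nrm x)) = M (e, x)"
    using x by (auto simp: matrix_def M_def vec_eq_iff inner_axis) (auto simp: axis_def)
   thus ?thesis unfolding S.e_hess_def by simp
  qed
  have "smean (\<lambda>x. FL (e, x)) = smean (\<lambda>x. real k * ((h x + e * norm x) * (norm (X x + e *R nrm x))^2 * S.e_hess k x))"
   by (rule smean_cong) (simp add: FL_def hh_def XX_def m)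
  also have "... \<le> smean (\<lambda>x. (h x + e * norm x)\<^sup>2 * (S.e_hess 1 x * S.e_hess k x - real (k + 1) * S.e_hess (k + 1) x))"
   by (rule S.Kubota_smean[OF k])
  also have "... = smean (\<lambda>x. FR (e, x))"
   by (rule smean_cong) (simp add: FR_def hh_def m)
  finally show ?thesis .
 qed
 have "smean (\<lambda>x. FL (0, x)) \<le> smean (\<lambda>x. FR (0, x))"
  by (rule LIMSEQ_le[OF smean_limit[OF cF(1)] smean_limit[OF cF(2)]]) (auto intro!: exI[of _ 0] le)
 moreover have "M (0, x) = matrix (A x)" for x by (simp add: M_def matrix_def)
 ultimately show ?thesis by (simp add: FL_def FR_def hh_def XX_def e_hess_def)
qed

end

section \<open>Divergence identities\<close>

text \<open>A permutation other than the identity moves at least two indices, so its product is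
  divisible by the square of the variable and has no linear coefficient.\<close>

lemma esym_1: "esym (Suc 0) M = (\<Sum>i\<in>UNIV. M $ i $ i)" for M :: "real^'n^'n"
proof -
 let ?t = "\<lambda>p. coeff (of_int (sign p) * (\<Prod>i\<in>UNIV. [:if i = p i then 1 else 0, M $ i $ p i:])) (Suc 0)"
 have "esym (Suc 0) M = (\<Sum>p\<in>{p. p permutes (UNIV :: 'n set)}. ?t p)"
  unfolding esym_def char_poly_rev_def det_def by (simp add: coeff_sum)
 also have "... = (\<Sum>p\<in>{id :: 'n => 'n}. ?t p)"
 proof (rule sum.mono_neutral_right)
  show "\<forall>p\<in>{p. p permutes (UNIV :: 'n set)} - {id}. ?t p = 0"
  proof
   fix p :: "'n => 'n" assume p: "p \<in> {p. p permutes UNIV} - {id}"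
   then obtain a where a: "p a \<noteq> a" by (auto simp: fun_eq_iff)
   have b: "p (p a) \<noteq> p a" using p a by (metis DiffD1 mem_Collect_eq permutes_inj injD)
   let ?f = "\<lambda>i. [:if i = p i then 1 else 0, M $ i $ p i:]"
   have "(\<Prod>i\<in>UNIV. ?f i) = ?f a * (?f (p a) * (\<Prod>i\<in>UNIV - {a} - {p a}. ?f i))"
    using a by (simp add: prod.remove[of UNIV a] prod.remove[of "UNIV - {a}" "p a"])
   also have "... = [:0, M $ a $ p a:] * ([:0, M $ p a $ p (p a):] * (\<Prod>i\<in>UNIV - {a} - {p a}. ?f i))"
    using a b by (auto simp: eq_commute)
   finally have eq: "(\<Prod>i\<in>UNIV. ?f i) = [:0, M $ a $ p a:] * ([:0, M $ p a $ p (p a):] * (\<Prod>i\<in>UNIV - {a} - {p a}. ?f i))" .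
   have "coeff (\<Prod>i\<in>UNIV. ?f i) (Suc 0) = 0" unfolding eq by (simp add: coeff_mult)
   thus "?t p = 0" unfolding of_int_poly by (simp only: mult_pCons_left mult_zero_left pCons_0_0 add_0_right coeff_smult mult_zero_right)
  qed
 qed (auto simp: permutes_id)
 also have "... = coeff (\<Prod>i\<in>UNIV. [:1, M $ i $ i:]) (Suc 0)" by simp
 also have "... = (\<Sum>i\<in>UNIV. M $ i $ i)" by (simp add: coeff_prod_linear elem_sym_1)
 finally show ?thesis .
qed

text \<open>The squared positive part is C^1, which is all the smoothness that the cutoff has to
  provide.\<close>

lemma DERIV_max_square: "((\<lambda>t::real. (max 0 t)\<^sup>2) has_real_derivative 2 * max 0 t) (at t)"
 unfolding has_field_derivative_def has_derivative_at_alt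
proof (intro conjI allI impI)
 fix e :: real assume e: "e > 0"
 have "\<bar>(max 0 y)\<^sup>2 - (max 0 t)\<^sup>2 - 2 * max 0 t * (y - t)\<bar> \<le> e * \<bar>y - t\<bar>" if "\<bar>y - t\<bar> < e" for y
 proof -
  have "\<bar>(max 0 y)\<^sup>2 - (max 0 t)\<^sup>2 - 2 * max 0 t * (y - t)\<bar> \<le> (y - t)^2"
  proof (cases "t \<ge> 0")
   case True
   hence "(max 0 y)^2 - (max 0 t)\<^sup>2 - 2 * max 0 t * (y - t) = (y - t)^2 - (min 0 y)\<^sup>2"
    by (simp add: max_def min_def power2_eq_square algebra_simps)
   moreover have "(min 0 y)^2 \<le> (y - t)^2" using True by (simp add: abs_le_square_iff[symmetric] min_def)
   ultimately show ?thesis by simp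
  next
   case False
   thus ?thesis by (simp add: abs_le_square_iff[symmetric] max_def)
  qed
  also have "... = \<bar>y - t\<bar> * \<bar>y - t\<bar>" by (simp add: power2_eq_square)
  also have "... \<le> e * \<bar>y - t\<bar>" using that by (intro mult_right_mono) auto
  finally show ?thesis .
 qed
 thus "\<exists>d>0. \<forall>y. norm (y - t) < d \<longrightarrow> norm ((max 0 y)^2 - (max 0 t)\<^sup>2 - 2 * max 0 t * (y - t)) \<le> e * norm (y - t)"
  using e by auto
qed (rule bounded_linear_mult_right)

text \<open>The argument will be \<open>x \<bullet> x\<close>, so the cutoff lives on the shell
  between the radii 1 and 2, away from the singularity of homogeneous fields at the origin.\<close>

locale cutoff =
 fixes \<kappa> \<kappa>' :: "real => real"
 assumes d\<kappa>: "\<And>t. (\<kappa> has_real_derivative \<kappa>' t) (at t)"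
  and cont_\<kappa>': "continuous_on UNIV \<kappa>'"
  and \<kappa>_nonneg: "\<And>t. \<kappa> t \<ge> 0"
  and \<kappa>_pos: "\<And>t. 1 < t ==> t < 4 ==> \<kappa> t > 0"
  and \<kappa>_zero: "\<And>t. t \<le> 1 \<or> t \<ge> 4 ==> \<kappa> t = 0 \<and> \<kappa>' t = 0"

lemma cutoff_exists: "cutoff (\<lambda>t. (max 0 (t - 1))\<^sup>2 * (max 0 (4 - t))^2)
  (\<lambda>t. 2 * max 0 (t - 1) * (max 0 (4 - t))^2 + (max 0 (t - 1))^2 * (2 * max 0 (4 - t) * (-1)))"
proof
 fix t :: real
 have "((\<lambda>t. (max 0 (t - 1))\<^sup>2) has_real_derivative 2 * max 0 (t - 1) * 1) (at t)"
  by (rule DERIV_chain2[OF DERIV_max_square]) (auto intro!: derivative_eq_intros)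
 hence 1: "((\<lambda>t. (max 0 (t - 1))\<^sup>2) has_real_derivative 2 * max 0 (t - 1)) (at t)" by simp
 have 2: "((\<lambda>t. (max 0 (4 - t))\<^sup>2) has_real_derivative 2 * max 0 (4 - t) * (-1)) (at t)"
  by (rule DERIV_chain2[OF DERIV_max_square]) (auto intro!: derivative_eq_intros)
 show "((\<lambda>t. (max 0 (t - 1))\<^sup>2 * (max 0 (4 - t))^2) has_real_derivative
  2 * max 0 (t - 1) * (max 0 (4 - t))^2 + (max 0 (t - 1))^2 * (2 * max 0 (4 - t) * (-1))) (at t)"
  by (rule DERIV_cong[OF DERIV_mult[OF 1 2]]) (simp add: mult_ac)
qed (auto intro!: continuous_intros)

lemma integrable_annulus:
 fixes f :: "'a::euclidean_space => real"
 assumes f: "continuous_on (- {0}) f" "\<And>x. x \<bullet> x \<le> 1 \<or> x \<bullet> x \<ge> 4 ==> f x = 0"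
 shows "integrable lborel f"
proof -
 let ?K = "cball 0 2 - ball 0 1 :: 'a set"
 have K: "compact ?K" by (rule compact_diff) auto
 have c: "continuous_on ?K f" by (rule continuous_on_subset[OF f(1)]) auto
 have int: "integrable lborel (\<lambda>x. indicator ?K x *R f x)"
  by (rule borel_integrable_compact[OF K c])
 have eq: "indicator ?K x *R f x = f x" for x
 proof (cases "x \<in> ?K")
  case False
  have "x \<bullet> x \<le> 1 \<or> x \<bullet> x \<ge> 4"
  proof (cases "norm x < 1")
   case True
   hence "(norm x)^2 \<le> 1" by (intro power_le_one) auto
   thus ?thesis by (simp add: dot_square_norm)
  next
   case n: False
   hence "norm x > 2" using False by (auto simp: not_less)
   hence "(norm x)^2 \<ge> 2\<^sup>2" by (intro power_mono) auto
   thus ?thesis by (simp add: dot_square_norm)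
  qed
  thus ?thesis using False f(2) by simp
 qed simp
 show ?thesis using int unfolding eq .
qed

lemma integral_annulus_pos:
 fixes f :: "'a::euclidean_space => real"
 assumes f: "continuous_on (- {0}) f" "\<And>x. x \<bullet> x \<le> 1 \<or> x \<bullet> x \<ge> 4 ==> f x = 0"
  and pos: "\<And>x. 1 < x \<bullet> x ==> x \<bullet> x < 4 ==> f x > 0"
 shows "(LINT x|lborel. f x) > 0"
proof (rule ccontr)
 have ge: "f x \<ge> 0" for x using f(2)[of x] pos[of x] by force
 assume "\<not> (LINT x|lborel. f x) > 0"
 moreover have "(LINT x|lborel. f x) \<ge> 0" by (rule Bochner_Integration.integral_nonneg) (rule ge)
 ultimately have "(LINT x|lborel. f x) = 0" by linarith
 hence ae: "AE x in lborel. f x = 0"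
  using integral_nonneg_eq_0_iff_AE[OF integrable_annulus[OF f]] ge by simp
 define S where "S = {x :: 'a. 1 < x \<bullet> x \<and> x \<bullet> x < 4}"
 have op: "open S" unfolding S_def by (intro open_Collect_conj open_Collect_less continuous_intros)
 have "AE x in lborel. x \<notin> S" using ae
 proof eventually_elim
  case (elim x)
  thus ?case using pos[of x] by (auto simp: S_def)
 qed
 hence "S \<in> null_sets lborel" using op AE_iff_null_sets[of S lborel] by simp
 hence "negligible S" using null_sets_completionI negligible_iff_null_sets by blast
 hence "S = {}" using op open_not_negligible by blast
 moreover obtain x :: 'a where "norm x = 3 / 2" using vector_choose_size[of "3/2"] by auto
 hence "x \<bullet> x = (3 / 2)^2" by (simp only: dot_square_norm)
 hence "x \<in> S" by (simp add: S_def power2_eq_square)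
 ultimately show False by blast
qed

context cutoff
begin

text \<open>\<open>esym (Suc k)\<close> of the derivative of a field has degree
  \<open>Suc k\<close>, so this power of the cutoff and its derivative become the effective radial
  weights.\<close>

lemma cutoff_power: "cutoff (\<lambda>t. \<kappa> t ^ Suc k) (\<lambda>t. real (Suc k) * (\<kappa> t ^ k * \<kappa>' t))"
proof
 show "((\<lambda>t. \<kappa> t ^ Suc k) has_real_derivative real (Suc k) * (\<kappa> t ^ k * \<kappa>' t)) (at t)" for t
  using DERIV_power_Suc[OF d\<kappa>[of t], of k] by (simp add: mult_ac algebra_simps)
 have "continuous_on UNIV \<kappa>" using d\<kappa> by (intro DERIV_continuous_on) blast
 thus "continuous_on UNIV (\<lambda>t. real (Suc k) * (\<kappa> t ^ k * \<kappa>' t))" by (intro continuous_intros cont_\<kappa>')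
qed (use \<kappa>_nonneg \<kappa>_pos \<kappa>_zero in auto)

lemma cont_\<kappa>: "continuous_on S \<kappa>"
 by (rule DERIV_continuous_on) (rule has_field_derivative_at_within[OF d\<kappa>])

lemma \<kappa>'_zero_of_\<kappa>: "\<kappa> t = 0 ==> \<kappa>' t = 0"
 using \<kappa>_pos[of t] \<kappa>_zero[of t] by force

lemma cutoff_measurable [measurable]: "\<kappa> \<in> borel_measurable borel" "\<kappa>' \<in> borel_measurable borel"
 using cont_\<kappa> cont_\<kappa>' by (auto intro: borel_measurable_continuous_onI)

theorem cutoff_identity:
 fixes Z :: "real^'m => real^'m"
 assumes dZ: "\<And>x. x \<noteq> 0 ==> (Z has_derivative Z' x) (at x)"
  and cZ': "\<And>v. continuous_on (- {0}) (\<lambda>x. Z' x v)" and k: "k > 0"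
 shows "(LINT x|lborel. esym k (matrix (\<lambda>v. (2 * \<kappa>' (x \<bullet> x) * (x \<bullet> v)) *R Z x + \<kappa> (x \<bullet> x) *R Z' x v))) = 0"
proof -
 let ?Y = "\<lambda>x. \<kappa> (x \<bullet> x) *R Z x"
 let ?Y' = "\<lambda>x v. (2 * \<kappa>' (x \<bullet> x) * (x \<bullet> v)) *R Z x + \<kappa> (x \<bullet> x) *R Z' x v"
 have small: "\<kappa> (x \<bullet> x) = 0 \<and> \<kappa>' (x \<bullet> x) = 0" if "norm x \<le> 1 \<or> norm x \<ge> 2" for x :: "real^'m"
 proof (rule \<kappa>_zero)
  show "x \<bullet> x \<le> 1 \<or> x \<bullet> x \<ge> 4"
  proof (cases "norm x \<le> 1")
   case True
   hence "(norm x)^2 \<le> 1" by (intro power_le_one) auto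
   thus ?thesis by (simp add: dot_square_norm)
  next
   case False
   hence "(norm x)^2 \<ge> 2\<^sup>2" using that by (intro power_mono) auto
   thus ?thesis by (simp add: dot_square_norm)
  qed
 qed
 have cZ: "continuous_on (- {0}) Z"
  using dZ by (intro continuous_at_imp_continuous_on) (auto intro: has_derivative_continuous)
 have int: "(LINT x|lborel. indicator (cball 0 2) x *R esym k (matrix (?Y' x))) = 0"
 proof (rule integral_esym_derivative[OF _ _ _ k])
  fix x :: "real^'m"
  show "(?Y has_derivative ?Y' x) (at x)"
  proof (cases "x = 0")
   case True
   have "((\<lambda>x. 0) has_derivative (\<lambda>v. 0)) (at (0::real^'m))" by simp
   hence "(?Y has_derivative (\<lambda>v. 0)) (at 0)"
    by (rule has_derivative_transform_within_open[of _ _ _ _ "ball 0 1"]) (auto simp: small)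
   thus ?thesis using True small[of 0] by simp
  next
   case False
   have 1: "((\<lambda>x. \<kappa> (x \<bullet> x)) has_derivative (\<lambda>v. \<kappa>' (x \<bullet> x) * (x \<bullet> v + v \<bullet> x))) (at x)"
    by (rule has_derivative_compose[OF has_derivative_inner[OF has_derivative_ident has_derivative_ident] d\<kappa>[unfolded has_field_derivative_def]])
   show ?thesis
    by (rule has_derivative_eq_rhs[OF has_derivative_scaleR[OF 1 dZ[OF False]]])
     (auto simp: fun_eq_iff inner_commute mult_ac)
  qed
  show "?Y x = 0" if "norm x \<ge> 2" using small that by simp
 next
  fix v
  have "continuous_on (- {0}) (\<lambda>x. ?Y' x v)"
   by (intro continuous_intros cZ cZ' continuous_on_compose2[OF cont_\<kappa>[of UNIV]] continuous_on_compose2[OF cont_\<kappa>']) auto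
  moreover have "continuous_on (ball 0 1) (\<lambda>x. ?Y' x v)"
  proof (rule continuous_on_eq[of _ "\<lambda>x. 0"])
   show "0 = ?Y' x v" if "x \<in> ball 0 1" for x using small[of x] that by simp
  qed simp
  ultimately have "continuous_on (- {0} \<union> ball 0 1) (\<lambda>x. ?Y' x v)"
   by (intro continuous_on_open_Un) auto
  moreover have "- {0} \<union> ball 0 1 = (UNIV :: (real^'m) set)" by auto
  ultimately show "continuous_on UNIV (\<lambda>x. ?Y' x v)" by simp
 qed
 have eq: "indicator (cball 0 2) x *R esym k (matrix (?Y' x)) = esym k (matrix (?Y' x))" for x
 proof (cases "x \<in> cball 0 2")
  case False
  hence "matrix (?Y' x) = 0" using small[of x] by (simp add: matrix_def vec_eq_iff)
  thus ?thesis using esym_0_matrix[OF k] False by simp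
 qed simp
 show ?thesis using int unfolding eq .
qed

end

lemma elem_sym_remove_zero:
 fixes l :: "'i => real"
 assumes "finite I" "i \<in> I" "l i = 0"
 shows "elem_sym k (I - {i}) l = elem_sym k I l"
proof (cases k)
 case 0
 thus ?thesis using assms by simp
next
 case (Suc j)
 have "elem_sym (Suc j) (insert i (I - {i})) l = elem_sym (Suc j) (I - {i}) l + l i * elem_sym j (I - {i}) l"
  by (rule elem_sym_insert) (use assms in auto)
 thus ?thesis using assms Suc by (simp add: insert_absorb)
qed

lemma trace_rank_one: "(\<Sum>i\<in>UNIV. (c * (b \<bullet> axis i 1)) * (a :: real^'n) $ i) = c * (b \<bullet> a)"
 by (simp add: inner_axis) (simp add: inner_vec_def sum_distrib_left mult.assoc)

context cutoff
begin

text \<open>The trace case of \<open>cutoff_identity\<close> for the field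
  \<open>(x \<bullet> x) powr s *R x\<close>, that is, integration by parts in the radial variable.
  It will trade the weight with \<open>\<kappa>'\<close> for the one with
  \<open>\<kappa>\<close>.\<close>

lemma radial_identity:
 fixes s :: real
 shows "(LINT x|lborel. (CARD('m) + 2 * s) * (\<kappa> (x \<bullet> x) * (x \<bullet> x) powr s) + 2 * (\<kappa>' (x \<bullet> x) * (x \<bullet> (x :: real^'m)) powr (s + 1))) = 0"
proof -
 let ?Z = "\<lambda>x :: real^'m. (x \<bullet> x) powr s *R x"
 let ?Z' = "\<lambda>x v :: real^'m. (2 * s * (x \<bullet> x) powr (s - 1) * (x \<bullet> v)) *R x + (x \<bullet> x) powr s *R v"
 have dp: "((\<lambda>x :: real^'m. (x \<bullet> x) powr s) has_derivative (\<lambda>v. s * (x \<bullet> x) powr (s - 1) * (x \<bullet> v + v \<bullet> x))) (at x)" if "x \<noteq> 0" for x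
 proof (rule has_derivative_compose[OF has_derivative_inner[OF has_derivative_ident has_derivative_ident]])
  show "((\<lambda>t. t powr s) has_derivative (*) (s * (x \<bullet> x) powr (s - 1))) (at (x \<bullet> x))"
   using has_real_derivative_powr[of "x \<bullet> x" s] that by (simp add: has_field_derivative_def)
 qed
 have "(LINT x|lborel. esym 1 (matrix (\<lambda>v. (2 * \<kappa>' (x \<bullet> x) * (x \<bullet> v)) *R ?Z x + \<kappa> (x \<bullet> x) *R ?Z' x v))) = 0"
 proof (rule cutoff_identity)
  fix x :: "real^'m" assume x: "x \<noteq> 0"
  show "(?Z has_derivative ?Z' x) (at x)"
   by (rule has_derivative_eq_rhs[OF has_derivative_scaleR[OF dp[OF x] has_derivative_ident]])
    (auto simp: fun_eq_iff inner_commute algebra_simps)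
 next
  show "continuous_on (- {0}) (\<lambda>x. ?Z' x v)" for v by (intro continuous_intros) auto
 qed simp
 moreover have "esym 1 (matrix (\<lambda>v. (2 * \<kappa>' (x \<bullet> x) * (x \<bullet> v)) *R ?Z x + \<kappa> (x \<bullet> x) *R ?Z' x v))
  = (CARD('m) + 2 * s) * (\<kappa> (x \<bullet> x) * (x \<bullet> x) powr s) + 2 * (\<kappa>' (x \<bullet> x) * (x \<bullet> x) powr (s + 1))" for x :: "real^'m"
 proof (cases "x = 0")
  case True
  thus ?thesis using \<kappa>_zero[of 0] by (simp add: esym_1 matrix_def)
 next
  case False
  have p: "(x \<bullet> x) powr (s + 1) = (x \<bullet> x) powr s * (x \<bullet> x)" "(x \<bullet> x) powr (s - 1) * (x \<bullet> x) = (x \<bullet> x) powr s"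
   using False by (simp_all add: powr_add powr_diff)
  have "esym 1 (matrix (\<lambda>v. (2 * \<kappa>' (x \<bullet> x) * (x \<bullet> v)) *R ?Z x + \<kappa> (x \<bullet> x) *R ?Z' x v))
   = (\<Sum>i\<in>UNIV. (2 * \<kappa>' (x \<bullet> x) * (x \<bullet> x) powr s * (x \<bullet> axis i 1)) * x $ i
     + ((\<kappa> (x \<bullet> x) * (2 * s * (x \<bullet> x) powr (s - 1)) * (x \<bullet> axis i 1)) * x $ i + \<kappa> (x \<bullet> x) * (x \<bullet> x) powr s))"
   by (simp add: esym_1 matrix_def algebra_simps)
  also have "... = 2 * \<kappa>' (x \<bullet> x) * (x \<bullet> x) powr s * (x \<bullet> x) + (\<kappa> (x \<bullet> x) * (2 * s * (x \<bullet> x) powr (s - 1)) * (x \<bullet> x) + CARD('m) * (\<kappa> (x \<bullet> x) * (x \<bullet> x) powr s))"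
   unfolding sum.distrib trace_rank_one by simp
  also have "... = 2 * (\<kappa>' (x \<bullet> x) * ((x \<bullet> x) powr s * (x \<bullet> x))) + (2 * s * (\<kappa> (x \<bullet> x) * ((x \<bullet> x) powr (s - 1) * (x \<bullet> x))) + CARD('m) * (\<kappa> (x \<bullet> x) * (x \<bullet> x) powr s))"
   by (simp only: mult_ac)
  finally show ?thesis unfolding p by (simp add: algebra_simps)
 qed
 ultimately show ?thesis by simp
qed

end

section \<open>The inequality of Minkowski type\<close>

context even_support
begin

text \<open>The field is \<open>h powr (2 / (k + 1)) * X\<close>: the exponent makes the pure term of degree \<open>k + 1\<close> in the
 expansion come with the weight \<open>h\<^sup>2\<close>.\<close>

theorem Minkowski_inequality:
 shows "(real (CARD('m) + 1) - real k) * smean (\<lambda>x. h x ^ 3 * e_hess k x) - 2 * smean (\<lambda>x. grad_form k x)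
  \<le> real (k + 1) * smean (\<lambda>x. (h x)\<^sup>2 * e_hess (k + 1) x)"
proof -
 obtain \<kappa> \<kappa>' where "cutoff \<kappa> \<kappa>'" using cutoff_exists by blast
 then interpret C: cutoff \<kappa> \<kappa>' .
 define K where "K t = \<kappa> t ^ Suc k" for t
 define K' where "K' t = real (Suc k) * (\<kappa> t ^ k * \<kappa>' t)" for t
 interpret K: cutoff K K' unfolding K_def[abs_def] K'_def[abs_def] by (rule C.cutoff_power)
 define m where "m = 2 / real (k + 1)"
 let ?Z = "\<lambda>x. h x powr m *R X x"
 let ?Z' = "\<lambda>x v. (m * h x powr (m - 1) * (X x \<bullet> v)) *R X x + h x powr m *R A x v"
 define Y' where "Y' x v = (2 * \<kappa>' (x \<bullet> x) * (x \<bullet> v)) *R ?Z x + \<kappa> (x \<bullet> x) *R ?Z' x v" for x v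
 \<comment> \<open>A pointwise upper bound for the integrand. Its three terms come from the Hessian
   alone, from the derivative of the cutoff, and from the derivative of the power of
   \<open>h\<close>.\<close>
 define T where "T x = K (x \<bullet> x) * ((h x)^2 * e_hess (k + 1) x) + 2 / real (k + 1) * (K' (x \<bullet> x) * (h x ^ 3 * e_hess k x)
  + K (x \<bullet> x) * (grad_form k x))" for x
 have hp: "h x > 0" if "x \<noteq> 0" for x using pos[OF that] .
 have dhm: "((\<lambda>x. h x powr m) has_derivative (\<lambda>v. m * h x powr (m - 1) * (X x \<bullet> v))) (at x)" if x: "x \<noteq> 0" for x
 proof (rule has_derivative_compose[OF dh[OF x]])
  show "((\<lambda>t. t powr m) has_derivative (*) (m * h x powr (m - 1))) (at (h x))"
   using has_real_derivative_powr[of "h x" m] hp[OF x] by (simp add: has_field_derivative_def)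
 qed
 have cZ': "continuous_on (- {0}) (\<lambda>x. ?Z' x v)" for v
  by (intro continuous_intros cont_h cont_X contA) (use hp in force)+
 have cZ: "continuous_on (- {0}) ?Z"
  by (intro continuous_intros cont_h cont_X) (use hp in force)+
 have int0: "(LINT x|lborel. esym (Suc k) (matrix (Y' x))) = 0"
  unfolding Y'_def
 proof (rule C.cutoff_identity[OF _ cZ'])
  fix x :: "real^'m" assume x: "x \<noteq> 0"
  show "(?Z has_derivative ?Z' x) (at x)"
   by (rule has_derivative_eq_rhs[OF has_derivative_scaleR[OF dhm[OF x] dX[OF x]]]) (simp add: fun_eq_iff add.commute)
 qed simp
 have cY': "continuous_on (- {0}) (\<lambda>x. Y' x v)" for v
  unfolding Y'_def
  by (intro continuous_on_add continuous_on_scaleR continuous_on_mult continuous_on_const continuous_on_inner continuous_on_id cZ cZ'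
    continuous_on_compose2[OF C.cont_\<kappa>[of UNIV]] continuous_on_compose2[OF C.cont_\<kappa>']) auto
 have intE: "integrable lborel (\<lambda>x. esym (Suc k) (matrix (Y' x)))"
 proof (rule integrable_annulus)
  show "continuous_on (- {0}) (\<lambda>x. esym (Suc k) (matrix (Y' x)))"
   by (rule continuous_on_esym) (auto simp: matrix_def intro!: continuous_intros cY')
  show "esym (Suc k) (matrix (Y' x)) = 0" if "x \<bullet> x \<le> 1 \<or> x \<bullet> x \<ge> 4" for x
  proof -
   have "matrix (Y' x) = 0" using C.\<kappa>_zero[OF that] by (simp add: Y'_def matrix_def vec_eq_iff)
   thus ?thesis by (simp add: esym_0_matrix)
  qed
 qed
 have intT: "integrable lborel T"
 proof (rule integrable_annulus)
  show "continuous_on (- {0}) T"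
   unfolding T_def
   by (intro continuous_on_add continuous_on_mult continuous_on_power continuous_on_norm continuous_on_const cont_h cont_X cont_e_hess
    continuous_on_compose2[OF K.cont_\<kappa>[of UNIV]] continuous_on_compose2[OF K.cont_\<kappa>'] continuous_on_inner continuous_on_id) auto
  show "T x = 0" if "x \<bullet> x \<le> 1 \<or> x \<bullet> x \<ge> 4" for x
   using K.\<kappa>_zero[OF that] by (simp add: T_def)
 qed
 have le: "esym (Suc k) (matrix (Y' x)) \<le> T x" if x: "x \<noteq> 0" for x
 proof (cases "\<kappa> (x \<bullet> x) = 0")
  case True
  hence "matrix (Y' x) = 0" using C.\<kappa>'_zero_of_\<kappa>[OF True] by (simp add: Y'_def matrix_def vec_eq_iff)
  moreover have "K (x \<bullet> x) = 0" "K' (x \<bullet> x) = 0" using True C.\<kappa>'_zero_of_\<kappa>[OF True] by (simp_all add: K_def K'_def)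
  ultimately show ?thesis by (simp add: esym_0_matrix T_def)
 next
  case False
  define c where "c = \<kappa> (x \<bullet> x) * h x powr m"
  have c: "c > 0" using False C.\<kappa>_nonneg[of "x \<bullet> x"] hp[OF x] by (simp add: c_def less_le)
  \<comment> \<open>\<open>b\<close> collects the derivatives of the two scalar factors: the
    derivative of the field is \<open>c *R A x v\<close> plus the rank-one term
    \<open>(b \<bullet> v) *R X x\<close>.\<close>
  define b where "b = (2 * \<kappa>' (x \<bullet> x) * h x powr m) *R x + (\<kappa> (x \<bullet> x) * (m * h x powr (m - 1))) *R X x"
  obtain v :: "'m => real^'m" and l i0 where vl: "\<forall>i j. v i \<bullet> v j = (if i = j then 1 else 0)" "\<forall>i. l i \<ge> 0" "\<forall>k. e_hess k x = elem_sym k UNIV l"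
   "\<forall>a b k. esym (Suc k) (matrix (A x) + (\<chi> i j. a $ i * b $ j)) = elem_sym (Suc k) UNIV l + (\<Sum>i\<in>UNIV. (a \<bullet> v i) * (b \<bullet> v i) * elem_sym k (UNIV - {i}) l)"
   "v i0 = x /\<^sub>R norm x" "l i0 = 0"
   by (rule hess_eigenbasis[OF x]) (erule that, assumption+)
  have "matrix (Y' x) = c *R (matrix (A x) + (\<chi> i j. X x $ i * ((1 / c) *R b) $ j))"
  proof -
   have "Y' x (axis j 1) $ i = c * (A x (axis j 1) $ i) + X x $ i * b $ j" for i j
    unfolding Y'_def b_def by (simp add: inner_axis c_def algebra_simps)
   thus ?thesis using c by (simp add: vec_eq_iff matrix_def distrib_left)
  qed
  hence "esym (Suc k) (matrix (Y' x)) = c ^ Suc k * (elem_sym (Suc k) UNIV l + (\<Sum>i\<in>UNIV. (X x \<bullet> v i) * (((1 / c) *R b) \<bullet> v i) * elem_sym k (UNIV - {i}) l))"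
   by (simp only: esym_scale vl(4)[rule_format])
  also have "... = c ^ Suc k * elem_sym (Suc k) UNIV l + c ^ k * (\<Sum>i\<in>UNIV. (X x \<bullet> v i) * (b \<bullet> v i) * elem_sym k (UNIV - {i}) l)"
   using c by (simp add: distrib_left sum_distrib_left mult_ac)
  also have "c ^ k * (\<Sum>i\<in>UNIV. (X x \<bullet> v i) * (b \<bullet> v i) * elem_sym k (UNIV - {i}) l)
   = 2 / real (k + 1) * (K' (x \<bullet> x) * (h x)^2 * (\<Sum>i\<in>UNIV. (X x \<bullet> v i) * (x \<bullet> v i) * elem_sym k (UNIV - {i}) l)
    + K (x \<bullet> x) * h x * (\<Sum>i\<in>UNIV. (X x \<bullet> v i)\<^sup>2 * elem_sym k (UNIV - {i}) l))"
  proof -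
   have mk: "m * real (k + 1) = 2" by (simp add: m_def del: of_nat_Suc of_nat_add)
   have hm: "(h x powr m) ^ k * h x powr m = (h x)^2" "(h x powr m) ^ k * h x powr (m - 1) = h x"
   proof -
    have "(h x powr m) ^ k * h x powr m = h x powr (m * real (k + 1))"
     using hp[OF x] by (simp add: powr_power powr_add[symmetric] algebra_simps)
    thus 1: "(h x powr m) ^ k * h x powr m = (h x)^2" unfolding mk using hp[OF x] by (simp add: powr_numeral)
    have "(h x powr m) ^ k * h x powr (m - 1) = (h x)^2 / h x"
     unfolding 1[symmetric] using hp[OF x] by (simp add: powr_diff)
    thus "(h x powr m) ^ k * h x powr (m - 1) = h x" using hp[OF x] by (simp add: power2_eq_square)
   qed
   have c1: "c ^ k * (2 * \<kappa>' (x \<bullet> x) * h x powr m) = 2 / real (k + 1) * (K' (x \<bullet> x) * (h x)^2)"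
   proof -
    have "c ^ k * (2 * \<kappa>' (x \<bullet> x) * h x powr m) = 2 * (\<kappa> (x \<bullet> x) ^ k * \<kappa>' (x \<bullet> x)) * ((h x powr m) ^ k * h x powr m)"
     by (simp add: c_def power_mult_distrib mult_ac)
    thus ?thesis unfolding hm by (simp add: K'_def del: of_nat_Suc)
   qed
   have c2: "c ^ k * (\<kappa> (x \<bullet> x) * (m * h x powr (m - 1))) = 2 / real (k + 1) * (K (x \<bullet> x) * h x)"
   proof -
    have "c ^ k * (\<kappa> (x \<bullet> x) * (m * h x powr (m - 1))) = m * K (x \<bullet> x) * ((h x powr m) ^ k * h x powr (m - 1))"
     by (simp add: c_def K_def power_mult_distrib mult_ac)
    thus ?thesis unfolding hm by (simp add: m_def)
   qed
   have "c ^ k * (\<Sum>i\<in>UNIV. (X x \<bullet> v i) * (b \<bullet> v i) * elem_sym k (UNIV - {i}) l)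
    = (c ^ k * (2 * \<kappa>' (x \<bullet> x) * h x powr m)) * (\<Sum>i\<in>UNIV. (X x \<bullet> v i) * (x \<bullet> v i) * elem_sym k (UNIV - {i}) l)
    + (c ^ k * (\<kappa> (x \<bullet> x) * (m * h x powr (m - 1)))) * (\<Sum>i\<in>UNIV. (X x \<bullet> v i)\<^sup>2 * elem_sym k (UNIV - {i}) l)"
    unfolding sum_distrib_left sum.distrib[symmetric] b_def
    by (rule sum.cong) (simp_all add: inner_add_left power2_eq_square algebra_simps)
   thus ?thesis unfolding c1 c2 by (simp add: algebra_simps)
  qed
  also have "c ^ Suc k = K (x \<bullet> x) * (h x)^2"
  proof -
   have "(h x powr m) ^ Suc k = (h x)^2"
   proof -
    have "m * real (Suc k) = 2" by (simp add: m_def del: of_nat_Suc)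
    moreover have "(h x powr m) ^ Suc k = h x powr (m * real (Suc k))"
     using hp[OF x] by (subst powr_power) (auto simp: mult.commute)
    ultimately show ?thesis using hp[OF x] by (simp only: powr_numeral)
   qed
   thus ?thesis by (simp add: c_def K_def power_mult_distrib del: power_Suc)
  qed
  \<comment> \<open>Only the radial index \<open>i0\<close> contributes, and omitting its eigenvalue
    0 changes nothing. Equality matters here, as the factor \<open>K'\<close> has no sign.\<close>
  also have "(\<Sum>i\<in>UNIV. (X x \<bullet> v i) * (x \<bullet> v i) * elem_sym k (UNIV - {i}) l) = h x * elem_sym k UNIV l"
  proof -
   have "x \<bullet> v i = (if i = i0 then norm x else 0)" for i
   proof -
    have "x = norm x *R v i0" using x by (simp add: vl(5))
    hence "x \<bullet> v i = norm x * (v i0 \<bullet> v i)" by (metis inner_scaleR_left)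
    thus ?thesis using vl(1) by simp
   qed
   hence "(\<Sum>i\<in>UNIV. (X x \<bullet> v i) * (x \<bullet> v i) * elem_sym k (UNIV - {i}) l) = (\<Sum>i\<in>UNIV. if i = i0 then (X x \<bullet> v i) * norm x * elem_sym k (UNIV - {i}) l else 0)"
    by (intro sum.cong) auto
   also have "... = (X x \<bullet> v i0) * norm x * elem_sym k UNIV l"
    using elem_sym_remove_zero[of UNIV i0 l k] vl(6) by simp
   also have "(X x \<bullet> v i0) * norm x = h x" using x by (simp add: vl(5) X_inner[OF x])
   finally show ?thesis .
  qed
  \<comment> \<open>The only estimate in this pointwise bound: omitted eigenvalues are put back. Its
    factor \<open>K (x \<bullet> x) * h x\<close> is nonnegative.\<close>
  also have "(\<Sum>i\<in>UNIV. (X x \<bullet> v i)\<^sup>2 * elem_sym k (UNIV - {i}) l) \<le> (norm (X x))^2 * elem_sym k UNIV l"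
  proof -
   have "(norm (X x))^2 = (\<Sum>i\<in>UNIV. (X x \<bullet> v i)\<^sup>2)"
   proof -
    have "X x \<bullet> X x = X x \<bullet> (\<Sum>i\<in>UNIV. (X x \<bullet> v i) *R v i)" using orthonormal_expansion[of v "X x"] vl(1) by simp
    thus ?thesis by (simp add: inner_sum_right dot_square_norm power2_eq_square)
   qed
   moreover have "(\<Sum>i\<in>UNIV. (X x \<bullet> v i)\<^sup>2 * elem_sym k (UNIV - {i}) l) \<le> (\<Sum>i\<in>UNIV. (X x \<bullet> v i)\<^sup>2 * elem_sym k UNIV l)"
    by (intro sum_mono mult_left_mono elem_sym_remove_le) (use vl(2) in auto)
   ultimately show ?thesis by (simp only: sum_distrib_right)
  qed
  finally have "esym (Suc k) (matrix (Y' x)) \<le> K (x \<bullet> x) * (h x)^2 * elem_sym (Suc k) UNIV l + 2 / real (k + 1) * (K' (x \<bullet> x) * (h x)^2 * (h x * elem_sym k UNIV l)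
    + K (x \<bullet> x) * h x * ((norm (X x))^2 * elem_sym k UNIV l))"
   using K.\<kappa>_nonneg[of "x \<bullet> x"] hp[OF x] by (simp add: mult_left_mono divide_right_mono)
  thus ?thesis unfolding T_def vl(3)[rule_format] by (simp add: power3_eq_cube power2_eq_square mult_ac)
 qed
 have T0: "0 \<le> (LINT x|lborel. T x)"
  unfolding int0[symmetric]
  by (rule integral_mono_AE[OF intE intT], use AE_lborel_nonzero in eventually_elim) (rule le)
 \<comment> \<open>\<open>h^2 e_(k+1)\<close> and \<open>grad_form k\<close> have degree
   \<open>1 - k = 2 * s\<close>, while \<open>h^3 e_k\<close> has degree \<open>2 * s + 2\<close>;
   \<open>wa\<close> and \<open>wb\<close> absorb these powers of the radius.\<close>
 define s where "s = (1 - real k) / 2"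
 define wa where "wa r = K (r^2) * r\<^sup>2 powr s" for r :: real
 define wb where "wb r = K' (r^2) * r\<^sup>2 powr (s + 1)" for r :: real
 define T1 where "T1 x = (h x)^2 * e_hess (k + 1) x" for x
 define T2 where "T2 x = h x ^ 3 * e_hess k x" for x
 define T3 where "T3 x = grad_form k x" for x
 have cT: "continuous_on (sphere 0 1) T1" "continuous_on (sphere 0 1) T2" "continuous_on (sphere 0 1) T3"
  unfolding T1_def T2_def T3_def by (intro continuous_intros cont_sphere)+
 have ra: "(norm x)\<^sup>2 powr s = norm x * inverse (norm x) ^ k" "(norm x)\<^sup>2 powr (s + 1) = norm x ^ 3 * inverse (norm x) ^ k" if "x \<noteq> 0" for x :: "real^'m"
 proof -
  have r: "norm x > 0" using that by simp
  have "(norm x)\<^sup>2 powr s = norm x powr (2 * s)" using r by (simp add: powr_powr[symmetric])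
  also have "... = norm x powr 1 / norm x powr real k"
  proof -
   have "2 * s = 1 - real k" unfolding s_def by simp
   thus ?thesis by (simp only: powr_diff)
  qed
  finally show 1: "(norm x)\<^sup>2 powr s = norm x * inverse (norm x) ^ k" using r by (simp add: powr_realpow power_inverse divide_inverse)
  show "(norm x)\<^sup>2 powr (s + 1) = norm x ^ 3 * inverse (norm x) ^ k"
  proof -
   have "(norm x)\<^sup>2 powr (s + 1) = (norm x)\<^sup>2 powr s * (norm x)^2" using r by (simp add: powr_add)
   thus ?thesis unfolding 1 by (simp only: power2_eq_square power3_eq_cube mult_ac)
  qed
 qed
 have Teq: "T x = wa (norm x) * T1 (nrm x) + 2 / real (k + 1) * (wb (norm x) * T2 (nrm x) + wa (norm x) * T3 (nrm x))" if x: "x \<noteq> 0" for x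
 proof -
  have "(h x)^2 * e_hess (k + 1) x = norm x * inverse (norm x) ^ k * T1 (nrm x)"
   unfolding T1_def h_nrm[of x] e_hess_nrm[OF x, of "k + 1"] using x by (simp add: power2_eq_square field_simps)
  moreover have "h x ^ 3 * e_hess k x = norm x ^ 3 * inverse (norm x) ^ k * T2 (nrm x)"
   unfolding T2_def h_nrm[of x] e_hess_nrm[OF x, of k] by (simp add: power_mult_distrib mult_ac)
  moreover have "grad_form k x = norm x * inverse (norm x) ^ k * T3 (nrm x)"
   unfolding T3_def h_nrm[of x] X_nrm[OF x] e_hess_nrm[OF x, of k] by (simp add: mult_ac)
  ultimately show ?thesis unfolding T_def wa_def wb_def ra[OF x] dot_square_norm by (simp only: mult_ac)
 qed
 have ia: "integrable lborel (\<lambda>x :: real^'m. wa (norm x))" and ib: "integrable lborel (\<lambda>x :: real^'m. wb (norm x))"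
  and Wa: "(LINT x|lborel. wa (norm (x :: real^'m))) > 0"
 proof -
  have ca: "continuous_on (- {0}) (\<lambda>x :: real^'m. wa (norm x))"
   unfolding wa_def dot_square_norm[symmetric]
   by (intro continuous_on_mult continuous_on_compose2[OF K.cont_\<kappa>[of UNIV]] continuous_intros) auto
  have cb: "continuous_on (- {0}) (\<lambda>x :: real^'m. wb (norm x))"
   unfolding wb_def dot_square_norm[symmetric]
   by (intro continuous_on_mult continuous_on_compose2[OF K.cont_\<kappa>'] continuous_intros) auto
  have z: "wa (norm x) = 0" "wb (norm x) = 0" if "x \<bullet> x \<le> 1 \<or> x \<bullet> x \<ge> 4" for x :: "real^'m"
   using K.\<kappa>_zero[OF that] by (simp_all add: wa_def wb_def dot_square_norm)
  show "integrable lborel (\<lambda>x :: real^'m. wa (norm x))" by (rule integrable_annulus[OF ca z(1)])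
  show "integrable lborel (\<lambda>x :: real^'m. wb (norm x))" by (rule integrable_annulus[OF cb z(2)])
  show "(LINT x|lborel. wa (norm (x :: real^'m))) > 0"
  proof (rule integral_annulus_pos[OF ca z(1)])
   fix x :: "real^'m" assume "1 < x \<bullet> x" "x \<bullet> x < 4"
   hence "K (x \<bullet> x) > 0" "x \<bullet> x \<noteq> 0" using K.\<kappa>_pos[of "x \<bullet> x"] by auto
   hence "K (x \<bullet> x) * (x \<bullet> x) powr s > 0" by (intro mult_pos_pos) (simp_all only: powr_gt_zero not_False_eq_True)
   thus "wa (norm x) > 0" by (simp only: wa_def dot_square_norm)
  qed
 qed
 have rad: "(CARD('m) + 2 * s) * (LINT x|lborel. wa (norm (x :: real^'m))) + 2 * (LINT x|lborel. wb (norm (x :: real^'m))) = 0"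
 proof -
  have "(LINT x|lborel. (CARD('m) + 2 * s) * wa (norm (x :: real^'m)) + 2 * wb (norm x)) = 0"
   using K.radial_identity[where 'm='m and s=s] unfolding wa_def wb_def dot_square_norm .
  thus ?thesis using ia ib by simp
 qed
 have wm: "wa \<in> borel_measurable borel" "wb \<in> borel_measurable borel" unfolding wa_def wb_def by measurable
 let ?g = "LINT x|lborel. gauss (x :: real^'m)" and ?Wa = "LINT x|lborel. wa (norm (x :: real^'m))" and ?Wb = "LINT x|lborel. wb (norm (x :: real^'m))"
 have e: "(LINT x|lborel. wa (norm x) * T1 (nrm x)) * ?g = smean T1 * ?Wa" "(LINT x|lborel. wb (norm x) * T2 (nrm x)) * ?g = smean T2 * ?Wb"
  "(LINT x|lborel. wa (norm x) * T3 (nrm x)) * ?g = smean T3 * ?Wa"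
  by (rule smean_radial[OF cT(1) wm(1) ia] smean_radial[OF cT(2) wm(2) ib] smean_radial[OF cT(3) wm(1) ia])+
 have "(LINT x|lborel. T x) = (LINT x|lborel. wa (norm x) * T1 (nrm x) + 2 / real (k + 1) * (wb (norm x) * T2 (nrm x) + wa (norm x) * T3 (nrm x)))"
  by (rule integral_discrete_difference[where X="{0}"]) (auto simp: Teq)
 also have "... = (LINT x|lborel. wa (norm x) * T1 (nrm x)) + 2 / real (k + 1) * ((LINT x|lborel. wb (norm x) * T2 (nrm x)) + (LINT x|lborel. wa (norm x) * T3 (nrm x)))"
  using integrable_radial[OF cT(1) ia] integrable_radial[OF cT(2) ib] integrable_radial[OF cT(3) ia]
  by (subst Bochner_Integration.integral_add; (simp only: integral_mult_right_zero)?; (subst Bochner_Integration.integral_add)?) auto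
 finally have Tint: "(LINT x|lborel. T x) * ?g = smean T1 * ?Wa + 2 / real (k + 1) * (smean T2 * ?Wb + smean T3 * ?Wa)"
  unfolding e[symmetric] by (simp add: algebra_simps)
 have "0 \<le> (LINT x|lborel. T x) * ?g" using T0 gauss_integral_pos[where 'a="real^'m"] by simp
 hence "0 \<le> real (k + 1) * (smean T1 * ?Wa + 2 / real (k + 1) * (smean T2 * ?Wb + smean T3 * ?Wa))"
  unfolding Tint by (intro mult_nonneg_nonneg) auto
 also have "... = real (k + 1) * (smean T1 * ?Wa) + (2 * ?Wb) * smean T2 + 2 * (smean T3 * ?Wa)"
  by (simp add: distrib_left)
 \<comment> \<open>\<open>radial_identity\<close> eliminates the weight with \<open>K'\<close>; the
   factor \<open>CARD('m) + 2 * s\<close> is the \<open>CARD('m) + 1 - k\<close> of the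
   conclusion.\<close>
 also have "2 * ?Wb = - (CARD('m) + 2 * s) * ?Wa" using rad unfolding minus_mult_left[symmetric] by linarith
 finally have "0 \<le> (real (k + 1) * smean T1 - (CARD('m) + 2 * s) * smean T2 + 2 * smean T3) * ?Wa"
  by (simp add: algebra_simps)
 hence "0 \<le> real (k + 1) * smean T1 - (CARD('m) + 2 * s) * smean T2 + 2 * smean T3"
  using Wa by (simp add: zero_le_mult_iff)
 moreover have "real CARD('m) + 2 * s = real (CARD('m) + 1) - real k" by (simp add: s_def)
 ultimately have "(real (CARD('m) + 1) - real k) * smean T2 - 2 * smean T3 \<le> real (k + 1) * smean T1" by simp
 thus ?thesis unfolding T1_def[abs_def] T2_def[abs_def] T3_def[abs_def] .
qed

end

lemma trace_functional: "(\<Sum>i\<in>UNIV. (b \<bullet> axis i 1) * (a :: real^'n) $ i) = b \<bullet> a"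
 using trace_rank_one[of 1 b a] by simp

context even_support
begin

text \<open>The divergence theorem on the sphere for \<open>P\<close> times the spherical gradient
  \<open>X x - h x *R x\<close>. Its extension \<open>Z\<close> of degree 0 is tangent to all
  spheres around the origin, so the derivative of the cutoff drops out. The factor
  \<open>CARD('m) - 1\<close> arises since \<open>Q\<close> has degree \<open>- 1\<close>, which
  lowers the divergence of \<open>Q x *R x\<close> by one copy of \<open>Q\<close>.\<close>

theorem divergence_identity:
 assumes dP: "\<And>x. x \<noteq> 0 ==> (P has_derivative (\<lambda>v. dP x \<bullet> v)) (at x)"
  and cdP: "continuous_on (- {0}) dP" and homP: "\<And>c x. c > 0 ==> x \<noteq> 0 ==> P (c *R x) = P x"
 shows "smean (\<lambda>x. dP x \<bullet> (X x - h x *R x) + P x * (e_hess 1 x - (real CARD('m) - 1) * h x)) = 0"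
proof -
 obtain \<kappa> \<kappa>' where "cutoff \<kappa> \<kappa>'" using cutoff_exists by blast
 then interpret C: cutoff \<kappa> \<kappa>' .
 define \<Theta> where "\<Theta> x = dP x \<bullet> (X x - h x *R x) + P x * (e_hess 1 x - (real CARD('m) - 1) * h x)" for x
 have cP: "continuous_on (- {0}) P"
  using dP by (intro continuous_at_imp_continuous_on) (auto intro: has_derivative_continuous)
 have c\<Theta>: "continuous_on (sphere 0 1) \<Theta>"
  unfolding \<Theta>_def by (intro continuous_intros cont_sphere continuous_on_subset[OF cP] continuous_on_subset[OF cdP]) auto
 have dPs: "dP (c *R x) = (1 / c) *R dP x" if c: "c > 0" and x: "x \<noteq> 0" for c x
 proof -
  have "((\<lambda>y. P (c *R y)) has_derivative (\<lambda>v. dP (c *R x) \<bullet> (c *R v))) (at x)"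
   by (rule has_derivative_compose[OF _ dP]) (use c x in \<open>auto intro!: derivative_eq_intros\<close>)
  moreover have "((\<lambda>y. P (c *R y)) has_derivative (\<lambda>v. dP x \<bullet> v)) (at x)"
   by (rule has_derivative_transform_within_open[OF dP[OF x], of "- {0}"]) (use c x homP in auto)
  ultimately have "(\<lambda>v. dP (c *R x) \<bullet> (c *R v)) = (\<lambda>v. dP x \<bullet> v)" by (rule has_derivative_unique)
  hence "dP (c *R x) \<bullet> (c *R v) = dP x \<bullet> v" for v by metis
  hence "(c *R dP (c *R x)) \<bullet> v = dP x \<bullet> v" for v by simp
  hence "c *R dP (c *R x) = dP x" by (metis vector_eq_rdot)
  thus ?thesis using c by (metis divide_self_if less_irrefl scaleR_one scaleR_scaleR times_divide_eq_left mult_1)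
 qed
 define Q where "Q x = h x / (x \<bullet> x)" for x
 define dQ where "dQ x v = (X x \<bullet> v) / (x \<bullet> x) - h x * (2 * (x \<bullet> v)) / (x \<bullet> x)^2" for x v
 define Z where "Z x = P x *R (X x - Q x *R x)" for x
 define Z' where "Z' x v = (dP x \<bullet> v) *R (X x - Q x *R x) + P x *R (A x v - (Q x *R v + dQ x v *R x))" for x v
 have dQ: "(Q has_derivative dQ x) (at x)" if x: "x \<noteq> 0" for x
 proof -
  have "((\<lambda>x. h x / (x \<bullet> x)) has_derivative (\<lambda>v. ((X x \<bullet> v) * (x \<bullet> x) - h x * (x \<bullet> v + v \<bullet> x)) / ((x \<bullet> x) * (x \<bullet> x)))) (at x)"
   by (rule has_derivative_divide'[OF dh[OF x] has_derivative_inner[OF has_derivative_ident has_derivative_ident]]) (use x in simp)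
  moreover have "((X x \<bullet> v) * (x \<bullet> x) - h x * (x \<bullet> v + v \<bullet> x)) / ((x \<bullet> x) * (x \<bullet> x)) = dQ x v" for v
   using x by (simp add: dQ_def diff_divide_distrib inner_commute[of v x] power2_eq_square)
  ultimately show ?thesis by (simp add: Q_def[abs_def])
 qed
 have dZ: "(Z has_derivative Z' x) (at x)" if x: "x \<noteq> 0" for x
 proof -
  have "((\<lambda>x. P x *R (X x - Q x *R x)) has_derivative
   (\<lambda>v. P x *R (A x v - (Q x *R v + dQ x v *R x)) + (dP x \<bullet> v) *R (X x - Q x *R x))) (at x)"
   by (intro has_derivative_scaleR has_derivative_diff dP[OF x] dX[OF x] dQ[OF x] has_derivative_ident)
  thus ?thesis by (simp add: Z_def[abs_def] Z'_def[abs_def] add.commute)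
 qed
 have cQ: "continuous_on (- {0}) Q" unfolding Q_def by (intro continuous_intros cont_h) auto
 have cZ': "continuous_on (- {0}) (\<lambda>x. Z' x v)" for v
  unfolding Z'_def dQ_def by (intro continuous_intros cont_h cont_X contA cP cdP cQ) auto
 have tr: "esym 1 (matrix (\<lambda>v. (2 * \<kappa>' (x \<bullet> x) * (x \<bullet> v)) *R Z x + \<kappa> (x \<bullet> x) *R Z' x v)) = \<kappa> ((norm x)^2) * inverse (norm x) * \<Theta> (nrm x)"
  if x: "x \<noteq> 0" for x
 proof -
  have xx: "x \<bullet> x \<noteq> 0" using x by simp
  have xZ: "x \<bullet> Z x = 0" using xx by (simp add: Z_def Q_def inner_diff_right inner_commute[of x "X x"] X_inner[OF x])
  have tA: "(\<Sum>i\<in>UNIV. A x (axis i 1) $ i) = e_hess 1 x" by (simp add: e_hess_def esym_1 matrix_def)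
  have tQ: "(\<Sum>i\<in>UNIV. dQ x (axis i 1) * x $ i) = - Q x"
  proof -
   have "(\<Sum>i\<in>UNIV. dQ x (axis i 1) * x $ i) = (\<Sum>i\<in>UNIV. (1 / (x \<bullet> x) * (X x \<bullet> axis i 1)) * x $ i - (2 * h x / (x \<bullet> x)^2 * (x \<bullet> axis i 1)) * x $ i)"
    by (rule sum.cong) (simp_all add: dQ_def algebra_simps)
   also have "... = 1 / (x \<bullet> x) * (X x \<bullet> x) - 2 * h x / (x \<bullet> x)^2 * (x \<bullet> x)"
    unfolding sum_subtractf trace_rank_one ..
   also have "... = - Q x" using xx by (simp add: X_inner[OF x] Q_def power2_eq_square)
   finally show ?thesis .
  qed
  have tZ': "(\<Sum>i\<in>UNIV. Z' x (axis i 1) $ i) = dP x \<bullet> (X x - Q x *R x) + P x * (e_hess 1 x - (real CARD('m) - 1) * Q x)"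
  proof -
   have "(\<Sum>i\<in>UNIV. Z' x (axis i 1) $ i) = (\<Sum>i\<in>UNIV. (dP x \<bullet> axis i 1) * (X x - Q x *R x) $ i + P x * (A x (axis i 1) $ i - (Q x + dQ x (axis i 1) * x $ i)))"
    by (rule sum.cong) (simp_all add: Z'_def)
   also have "... = dP x \<bullet> (X x - Q x *R x) + P x * (e_hess 1 x - (real CARD('m) * Q x + - Q x))"
    unfolding sum.distrib trace_functional sum_distrib_left[symmetric] sum_subtractf tA tQ by simp
   finally show ?thesis by (simp add: algebra_simps)
  qed
  have "esym 1 (matrix (\<lambda>v. (2 * \<kappa>' (x \<bullet> x) * (x \<bullet> v)) *R Z x + \<kappa> (x \<bullet> x) *R Z' x v))
   = (\<Sum>i\<in>UNIV. (2 * \<kappa>' (x \<bullet> x) * (x \<bullet> axis i 1)) * Z x $ i + \<kappa> (x \<bullet> x) * Z' x (axis i 1) $ i)"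
   by (simp add: esym_1 matrix_def)
  also have "... = \<kappa> (x \<bullet> x) * (\<Sum>i\<in>UNIV. Z' x (axis i 1) $ i)"
   unfolding sum.distrib trace_rank_one xZ by (simp add: sum_distrib_left)
  also have "(\<Sum>i\<in>UNIV. Z' x (axis i 1) $ i) = inverse (norm x) * \<Theta> (nrm x)"
  proof -
   have n: "norm x > 0" "nrm x \<noteq> 0" using x by (auto simp: nrm_def)
   have P: "P x = P (nrm x)" using homP[of "norm x" "nrm x"] n by (simp add: nrm_eq[symmetric])
   have dPn: "dP x = inverse (norm x) *R dP (nrm x)" using dPs[of "norm x" "nrm x"] n by (simp add: nrm_eq[symmetric] inverse_eq_divide)
   have Q: "Q x = inverse (norm x) * h (nrm x)" "Q x *R x = h (nrm x) *R nrm x"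
    using n by (simp_all add: Q_def h_nrm[of x] dot_square_norm power2_eq_square field_simps nrm_def)
   show ?thesis unfolding tZ' Q(2) unfolding Q(1) \<Theta>_def P dPn X_nrm[OF x] e_hess_nrm[OF x, of 1] by (simp add: algebra_simps)
  qed
  finally show ?thesis by (simp only: dot_square_norm mult.assoc)
 qed
 define wa where "wa r = \<kappa> (r^2) * inverse r" for r :: real
 have wm: "wa \<in> borel_measurable borel" unfolding wa_def by measurable
 have ca: "continuous_on (- {0}) (\<lambda>x :: real^'m. wa (norm x))"
  unfolding wa_def dot_square_norm[symmetric]
  by (intro continuous_on_mult continuous_on_compose2[OF C.cont_\<kappa>[of UNIV]] continuous_intros) auto
 have z: "wa (norm x) = 0" if "x \<bullet> x \<le> 1 \<or> x \<bullet> x \<ge> 4" for x :: "real^'m"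
  using C.\<kappa>_zero[OF that] by (simp add: wa_def dot_square_norm)
 have ia: "integrable lborel (\<lambda>x :: real^'m. wa (norm x))" by (rule integrable_annulus[OF ca z])
 have Wa: "(LINT x|lborel. wa (norm (x :: real^'m))) > 0"
 proof (rule integral_annulus_pos[OF ca z])
  fix x :: "real^'m" assume a: "1 < x \<bullet> x" "x \<bullet> x < 4"
  hence "\<kappa> ((norm x)^2) > 0" using C.\<kappa>_pos[of "x \<bullet> x"] by (simp add: dot_square_norm)
  moreover have "x \<noteq> 0" using a by auto
  ultimately show "wa (norm x) > 0" by (simp add: wa_def)
 qed
 have "(LINT x|lborel. esym 1 (matrix (\<lambda>v. (2 * \<kappa>' (x \<bullet> x) * (x \<bullet> v)) *R Z x + \<kappa> (x \<bullet> x) *R Z' x v))) = 0"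
  by (rule C.cutoff_identity[OF dZ cZ']) simp_all
 also have "(LINT x|lborel. esym 1 (matrix (\<lambda>v. (2 * \<kappa>' (x \<bullet> x) * (x \<bullet> v)) *R Z x + \<kappa> (x \<bullet> x) *R Z' x v))) = (LINT x|lborel. wa (norm x) * \<Theta> (nrm x))"
  by (rule integral_discrete_difference[where X="{0}"]) (auto simp: tr[unfolded One_nat_def] wa_def)
 finally have "smean \<Theta> * (LINT x|lborel. wa (norm (x :: real^'m))) = 0"
  using smean_radial[OF c\<Theta> wm ia] by simp
 thus ?thesis using Wa unfolding \<Theta>_def[abs_def] by simp
qed

text \<open>The index \<open>l\<close> enters through \<open>2 - real k \<le> 2 - real l\<close>
  whenever \<open>\<alpha> k\<close> is not 0; the equation then sums the terms \<open>B k\<close>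
  back to \<open>\<phi>\<close> times the squared gradient \<open>g\<close>. A nonnegative function
  with nonpositive mean vanishes, and the strict hypothesis \<open>phi1\<close> leaves
  \<open>g = 0\<close>.\<close>

theorem gradient_vanishes:
 fixes \<phi> \<phi>1 \<phi>2 :: "real \<times> real => real" and \<alpha> :: "nat => real"
 assumes dim: "CARD('m) = n + 1"
  and phi_pos: "\<And>p. p \<in> pos_quadrant ==> \<phi> p > 0"
  and dphi: "\<And>p. p \<in> pos_quadrant ==> (\<phi> has_derivative (\<lambda>v. \<phi>1 p * fst v + \<phi>2 p * snd v)) (at p)"
  and cphi: "continuous_on pos_quadrant \<phi>1" "continuous_on pos_quadrant \<phi>2"
  and phi1: "\<And>p. p \<in> pos_quadrant ==> real l - 1 + fst p * (\<phi>1 p / \<phi> p) > 0"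
  and phi2: "\<And>p. p \<in> pos_quadrant ==> \<phi>2 p \<ge> 0"
  and alpha: "\<And>k. k \<in> {1..n} ==> \<alpha> k \<ge> 0" "\<And>k. k \<in> {1..n} ==> \<alpha> k \<noteq> 0 ==> l \<le> k"
  and eq: "\<And>x. norm x = 1 ==> (\<Sum>k=1..n. \<alpha> k * h x * e_hess k x) = \<phi> (h x, norm (X x))"
  and x: "norm x = 1"
 shows "X x = h x *R x"
proof -
 have nz: "x \<noteq> 0" if "norm x = 1" for x :: "real^'m" using that by auto
 \<comment> \<open>\<open>a\<close> and \<open>b\<close> extend \<open>h\<close> and
   \<open>norm X\<close> from the sphere with degree 0, so that \<open>P\<close> has the homogeneity
   that \<open>divergence_identity\<close> asks for.\<close>
 define a where "a x = h x / norm x" for x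
 define b where "b x = norm (X x)" for x
 define da where "da x = (1 / norm x) *R (X x - a x *R nrm x)" for x
 define db where "db x = (1 / b x) *R A x (X x)" for x
 define P where "P x = a x * \<phi> (a x, b x)" for x
 define dP where "dP x = \<phi> (a x, b x) *R da x + a x *R (\<phi>1 (a x, b x) *R da x + \<phi>2 (a x, b x) *R db x)" for x
 have X0: "X x \<noteq> 0" if "x \<noteq> 0" for x using X_inner[OF that] pos[OF that] by auto
 have ab: "(a x, b x) \<in> pos_quadrant" if "x \<noteq> 0" for x
  using pos[OF that] X0[OF that] that by (simp add: pos_quadrant_def a_def b_def)
 have daD: "(a has_derivative (\<lambda>v. da x \<bullet> v)) (at x)" if x: "x \<noteq> 0" for x
 proof -
  have "((\<lambda>x. h x / norm x) has_derivative (\<lambda>v. ((X x \<bullet> v) * norm x - h x * (nrm x \<bullet> v)) / (norm x * norm x))) (at x)"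
   by (rule has_derivative_divide'[OF dh[OF x] has_derivative_norm_nrm[OF x]]) (use x in simp)
  moreover have "((X x \<bullet> v) * norm x - h x * (nrm x \<bullet> v)) / (norm x * norm x) = da x \<bullet> v" for v
   using x by (simp add: da_def a_def inner_diff_left field_simps)
  ultimately show ?thesis by (simp add: a_def[abs_def])
 qed
 have dbD: "(b has_derivative (\<lambda>v. db x \<bullet> v)) (at x)" if x: "x \<noteq> 0" for x
 proof -
  have "((\<lambda>x. norm (X x)) has_derivative (\<lambda>v. nrm (X x) \<bullet> A x v)) (at x)"
   by (rule has_derivative_compose[OF dX[OF x] has_derivative_norm_nrm[OF X0[OF x]]])
  moreover have "nrm (X x) \<bullet> A x v = db x \<bullet> v" for v
   using symA[OF x, of "X x" v] by (simp add: nrm_def db_def b_def inverse_eq_divide)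
  ultimately show ?thesis by (simp add: b_def[abs_def])
 qed
 have dPD: "(P has_derivative (\<lambda>v. dP x \<bullet> v)) (at x)" if x: "x \<noteq> 0" for x
 proof -
  have "((\<lambda>x. \<phi> (a x, b x)) has_derivative (\<lambda>v. \<phi>1 (a x, b x) * (da x \<bullet> v) + \<phi>2 (a x, b x) * (db x \<bullet> v))) (at x)"
   using has_derivative_compose[OF has_derivative_Pair[OF daD[OF x] dbD[OF x]] dphi[OF ab[OF x]]] by simp
  from has_derivative_mult[OF daD[OF x] this] show ?thesis
   by (simp add: P_def[abs_def] dP_def inner_add_left algebra_simps)
 qed
 have ca: "continuous_on (- {0}) a" unfolding a_def by (intro continuous_intros cont_h) auto
 have cb: "continuous_on (- {0}) b" unfolding b_def by (intro continuous_intros cont_X)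
 have cab: "continuous_on (- {0}) (\<lambda>x. f (a x, b x))" if "continuous_on pos_quadrant f" for f :: "real \<times> real => real"
  by (rule continuous_on_compose2[OF that continuous_on_Pair[OF ca cb]]) (use ab in auto)
 have cphi0: "continuous_on pos_quadrant \<phi>"
  using dphi by (intro continuous_at_imp_continuous_on) (auto intro: has_derivative_continuous)
 have cAX: "continuous_on (- {0}) (\<lambda>x. A x (X x))"
 proof (rule continuous_on_eq[of _ "\<lambda>x. \<Sum>i\<in>UNIV. X x $ i *R A x (axis i 1)"])
  show "continuous_on (- {0}) (\<lambda>x. \<Sum>i\<in>UNIV. X x $ i *R A x (axis i 1))" by (intro continuous_intros contA cont_X)
  fix x :: "real^'m" assume "x \<in> - {0}"
  hence L: "linear (A x)" using linA by simp
  have "A x (X x) = A x (\<Sum>i\<in>UNIV. X x $ i *R axis i 1)"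
   by (simp add: basis_expansion[of "X x", unfolded scalar_mult_eq_scaleR])
  thus "(\<Sum>i\<in>UNIV. X x $ i *R A x (axis i 1)) = A x (X x)" by (simp add: linear_sum[OF L] linear_scale[OF L])
 qed
 have b0: "b x \<noteq> 0" if "x \<noteq> 0" for x using X0[OF that] by (simp add: b_def)
 have cda: "continuous_on (- {0}) da" unfolding da_def by (intro continuous_intros cont_X ca continuous_on_nrm) auto
 have cdb: "continuous_on (- {0}) db" unfolding db_def by (intro continuous_intros cb cAX) (use b0 in auto)
 have cdP: "continuous_on (- {0}) dP"
  unfolding dP_def by (intro continuous_intros cab cphi cphi0 cda cdb ca)
 have homP: "P (c *R x) = P x" if "c > 0" "x \<noteq> 0" for c x
  using that by (simp add: P_def a_def b_def hom X_scale)
 have id0: "smean (\<lambda>x. dP x \<bullet> (X x - h x *R x) + P x * (e_hess 1 x - real n * h x)) = 0"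
  using divergence_identity[OF dPD cdP homP] by (simp add: dim)
 define g where "g x = (norm (X x - h x *R x))^2" for x
 define f where "f x = \<phi> (h x, norm (X x))" for x
 define f1 where "f1 x = \<phi>1 (h x, norm (X x))" for x
 have Xg: "(norm (X x))^2 = (h x)^2 + g x" if "norm x = 1" for x
 proof -
  have "x \<bullet> x = 1" using that by (simp add: norm_eq_1)
  hence "(X x - h x *R x) \<bullet> (X x - h x *R x) = X x \<bullet> X x - h x * h x"
   using X_inner[OF nz[OF that]] by (simp add: inner_diff_left inner_diff_right inner_commute[of x "X x"])
  thus ?thesis unfolding g_def power2_norm_eq_inner by (simp add: power2_eq_square)
 qed
 have uab: "a x = h x" "b x = norm (X x)" "nrm x = x" if "norm x = 1" for x using that by (simp_all add: a_def b_def)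
 \<comment> \<open>The term with \<open>\<phi>2\<close> is dropped: along the spherical gradient the
   derivative of \<open>norm X\<close> is a nonnegative multiple of the Hessian form, and
   \<open>\<phi>2 \<ge> 0\<close>.\<close>
 have lower: "f x * g x + h x * f1 x * g x + h x * f x * (e_hess 1 x - real n * h x)
   \<le> dP x \<bullet> (X x - h x *R x) + P x * (e_hess 1 x - real n * h x)" if x: "norm x = 1" for x
 proof -
  let ?v = "X x - h x *R x"
  have da: "da x = ?v" using uab[OF x] x by (simp add: da_def)
  have "A x ?v = A x (X x)" by (simp add: linear_diff[OF linA[OF nz[OF x]]] linear_scale[OF linA[OF nz[OF x]]] A_radial[OF nz[OF x]])
  hence "db x \<bullet> ?v = (1 / b x) * (A x ?v \<bullet> ?v)" by (simp add: db_def)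
  also have "... \<ge> 0" using psd[OF nz[OF x]] by (simp add: b_def)
  finally have "h x * (\<phi>2 (h x, norm (X x)) * (db x \<bullet> ?v)) \<ge> 0"
   using phi2[OF ab[OF nz[OF x]]] h_nonneg[of x] uab[OF x] by simp
  moreover have "dP x \<bullet> ?v = f x * g x + h x * f1 x * g x + h x * (\<phi>2 (h x, norm (X x)) * (db x \<bullet> ?v))"
  proof -
   define w where "w = ?v"
   have "dP x = f x *R w + h x *R (f1 x *R w + \<phi>2 (h x, norm (X x)) *R db x)"
    unfolding dP_def da uab[OF x] f_def f1_def w_def ..
   moreover have "g x = w \<bullet> w" by (simp add: g_def w_def power2_norm_eq_inner)
   ultimately show ?thesis unfolding w_def[symmetric] by (simp add: inner_add_left algebra_simps)
  qed
  moreover have "P x = h x * f x" by (simp add: P_def uab[OF x] f_def)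
  ultimately show ?thesis by simp
 qed
 have cs: "continuous_on (sphere 0 1) (\<lambda>x. F (h x, norm (X x)))" if "continuous_on pos_quadrant F" for F :: "real \<times> real => real"
 proof (rule continuous_on_eq[OF continuous_on_subset[OF cab[OF that]]])
  show "F (a x, b x) = F (h x, norm (X x))" if "x \<in> sphere 0 1" for x using uab[of x] that by simp
 qed auto
 have cf: "continuous_on (sphere 0 1) f" "continuous_on (sphere 0 1) f1"
  unfolding f_def f1_def by (intro cs cphi cphi0)+
 have cg: "continuous_on (sphere 0 1) g" unfolding g_def by (intro continuous_intros cont_sphere)
 have cdPs: "continuous_on (sphere 0 1) dP" "continuous_on (sphere 0 1) P"
  by (rule continuous_on_subset[OF cdP], force)
   (rule continuous_on_subset[of "- {0}"], use dPD in \<open>auto intro!: continuous_at_imp_continuous_on intro: has_derivative_continuous\<close>)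
 define B where "B k x = h x * e_hess k x * g x" for k x
 have cB: "continuous_on (sphere 0 1) (B k)" for k unfolding B_def by (intro continuous_intros cont_sphere cg)
 \<comment> \<open>In the sum of the two inequalities the means of \<open>h^2 e_(k+1)\<close>
   cancel; the splitting \<open>(norm X)^2 = h^2 + g\<close> then leaves \<open>2 - k\<close> times
   the mean of \<open>B k\<close>.\<close>
 have key: "real n * smean (\<lambda>x. h x ^ 3 * e_hess k x) - smean (\<lambda>x. (h x)\<^sup>2 * (e_hess 1 x * e_hess k x)) \<le> (2 - real k) * smean (B k)"
  if k: "k \<in> {1..n}" for k
 proof -
  define s1 where "s1 = smean (\<lambda>x. (h x)\<^sup>2 * e_hess (k + 1) x)"
  define s2 where "s2 = smean (\<lambda>x. h x ^ 3 * e_hess k x)"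
  define s3 where "s3 = smean (\<lambda>x. grad_form k x)"
  define s4 where "s4 = smean (\<lambda>x. (h x)\<^sup>2 * (e_hess 1 x * e_hess k x))"
  have 1: "real k * s3 \<le> s4 - real (k + 1) * s1"
  proof -
   have "smean (\<lambda>x. newton_form k x) = smean (\<lambda>x. (h x)\<^sup>2 * (e_hess 1 x * e_hess k x) - real (k + 1) * ((h x)^2 * e_hess (k + 1) x))"
    by (simp add: algebra_simps)
   also have "... = s4 - smean (\<lambda>x. real (k + 1) * ((h x)^2 * e_hess (k + 1) x))"
    unfolding s4_def by (rule smean_diff) (intro continuous_intros cont_sphere)+
   also have "smean (\<lambda>x. real (k + 1) * ((h x)^2 * e_hess (k + 1) x)) = real (k + 1) * s1" unfolding s1_def by (rule smean_cmult)
   finally show ?thesis using Kubota_inequality[of k] k dim unfolding s3_def smean_cmult by simp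
  qed
  have 2: "(real n + 2 - real k) * s2 - 2 * s3 \<le> real (k + 1) * s1"
   using Minkowski_inequality[of k] unfolding s1_def s2_def s3_def dim by (simp add: algebra_simps)
  have "s3 = smean (\<lambda>x. h x ^ 3 * e_hess k x + B k x)"
   unfolding s3_def
   by (rule smean_cong, subst Xg, assumption) (simp add: B_def power2_eq_square power3_eq_cube algebra_simps)
  also have "... = s2 + smean (B k)" unfolding s2_def by (rule smean_add) (intro continuous_intros cont_sphere cB)+
  finally have 3: "s3 = s2 + smean (B k)" .
  have "real n * s2 - s4 \<le> real n * s2 - real k * s3 - ((real n + 2 - real k) * s2 - 2 * s3)" using 1 2 by linarith
  also have "... = (2 - real k) * smean (B k)" unfolding 3 by (simp add: algebra_simps)
  finally show ?thesis unfolding s2_def s4_def .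
 qed
 have e0: "e_hess k x \<ge> 0" if "norm x = 1" for k x using e_hess_nonneg[OF nz[OF that]] .
 have f_eq: "f x = (\<Sum>k=1..n. \<alpha> k * (h x * e_hess k x))" if "norm x = 1" for x
  using eq[OF that] by (simp add: f_def mult.assoc)
 have "smean (\<lambda>x. f x * g x + h x * f1 x * g x + h x * f x * (e_hess 1 x - real n * h x)) \<le> 0"
  unfolding id0[symmetric]
  by (rule smean_mono[OF _ _ lower]) (intro continuous_intros cont_sphere cf cg cdPs)+
 moreover have "smean (\<lambda>x. f x * g x + h x * f1 x * g x + h x * f x * (e_hess 1 x - real n * h x))
  = smean (\<lambda>x. f x * g x + h x * f1 x * g x) - (\<Sum>k=1..n. \<alpha> k * (real n * smean (\<lambda>x. h x ^ 3 * e_hess k x) - smean (\<lambda>x. (h x)\<^sup>2 * (e_hess 1 x * e_hess k x))))"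
 proof -
  let ?D = "\<lambda>x. \<Sum>k=1..n. \<alpha> k * (real n * (h x ^ 3 * e_hess k x) - (h x)\<^sup>2 * (e_hess 1 x * e_hess k x))"
  have "smean (\<lambda>x. f x * g x + h x * f1 x * g x + h x * f x * (e_hess 1 x - real n * h x)) = smean (\<lambda>x. (f x * g x + h x * f1 x * g x) - ?D x)"
  proof (rule smean_cong)
   fix x :: "real^'m" assume x: "norm x = 1"
   have "h x * f x * (e_hess 1 x - real n * h x) = - ?D x"
    unfolding f_eq[OF x] sum_distrib_left sum_distrib_right sum_negf[symmetric]
    by (rule sum.cong) (simp_all add: power2_eq_square power3_eq_cube algebra_simps)
   thus "f x * g x + h x * f1 x * g x + h x * f x * (e_hess 1 x - real n * h x) = (f x * g x + h x * f1 x * g x) - ?D x" by simp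
  qed
  also have "... = smean (\<lambda>x. f x * g x + h x * f1 x * g x) - smean ?D"
   by (rule smean_diff) (intro continuous_intros cont_sphere cf cg)+
  also have "smean ?D = (\<Sum>k=1..n. smean (\<lambda>x. \<alpha> k * (real n * (h x ^ 3 * e_hess k x) - (h x)\<^sup>2 * (e_hess 1 x * e_hess k x))))"
   by (rule smean_sum) (intro continuous_intros cont_sphere)+
  also have "... = (\<Sum>k=1..n. \<alpha> k * (real n * smean (\<lambda>x. h x ^ 3 * e_hess k x) - smean (\<lambda>x. (h x)\<^sup>2 * (e_hess 1 x * e_hess k x))))"
  proof (rule sum.cong[OF refl])
   fix k
   have "smean (\<lambda>x. real n * (h x ^ 3 * e_hess k x) - (h x)\<^sup>2 * (e_hess 1 x * e_hess k x)) = smean (\<lambda>x. real n * (h x ^ 3 * e_hess k x)) - smean (\<lambda>x. (h x)\<^sup>2 * (e_hess 1 x * e_hess k x))"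
    by (rule smean_diff) (intro continuous_intros cont_sphere)+
   thus "smean (\<lambda>x. \<alpha> k * (real n * (h x ^ 3 * e_hess k x) - (h x)\<^sup>2 * (e_hess 1 x * e_hess k x))) = \<alpha> k * (real n * smean (\<lambda>x. h x ^ 3 * e_hess k x) - smean (\<lambda>x. (h x)\<^sup>2 * (e_hess 1 x * e_hess k x)))"
    by (simp only: smean_cmult)
  qed
  finally show ?thesis .
 qed
 moreover have "(\<Sum>k=1..n. \<alpha> k * (real n * smean (\<lambda>x. h x ^ 3 * e_hess k x) - smean (\<lambda>x. (h x)\<^sup>2 * (e_hess 1 x * e_hess k x))))
  \<le> (\<Sum>k=1..n. \<alpha> k * ((2 - real k) * smean (B k)))"
  by (intro sum_mono mult_left_mono key alpha)
 ultimately have main: "smean (\<lambda>x. f x * g x + h x * f1 x * g x) - (\<Sum>k=1..n. \<alpha> k * ((2 - real k) * smean (B k))) \<le> 0" by linarith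
 define R where "R x = f x * g x + h x * f1 x * g x - (\<Sum>k=1..n. \<alpha> k * ((2 - real k) * B k x))" for x
 have cR: "continuous_on (sphere 0 1) R" unfolding R_def by (intro continuous_intros cont_sphere cf cg cB)
 have "smean R = smean (\<lambda>x. f x * g x + h x * f1 x * g x) - smean (\<lambda>x. \<Sum>k=1..n. \<alpha> k * ((2 - real k) * B k x))"
  unfolding R_def by (rule smean_diff) (intro continuous_intros cont_sphere cf cg cB)+
 also have "smean (\<lambda>x. \<Sum>k=1..n. \<alpha> k * ((2 - real k) * B k x)) = (\<Sum>k=1..n. \<alpha> k * ((2 - real k) * smean (B k)))"
 proof -
  have "smean (\<lambda>x. \<Sum>k=1..n. \<alpha> k * ((2 - real k) * B k x)) = (\<Sum>k=1..n. smean (\<lambda>x. \<alpha> k * ((2 - real k) * B k x)))"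
   by (rule smean_sum) (intro continuous_intros cB)+
  thus ?thesis unfolding smean_cmult .
 qed
 finally have R0: "smean R \<le> 0" using main by simp
 have Rge: "R x \<ge> f x * g x * (real l - 1 + h x * (f1 x / f x))" if x: "norm x = 1" for x
 proof -
  have fp: "f x > 0" unfolding f_def using phi_pos[OF ab[OF nz[OF x]]] uab[OF x] by simp
  have gp: "g x \<ge> 0" by (simp add: g_def)
  have "(\<Sum>k=1..n. \<alpha> k * ((2 - real k) * B k x)) \<le> (\<Sum>k=1..n. \<alpha> k * ((2 - real l) * B k x))"
  proof (rule sum_mono)
   fix k assume k: "k \<in> {1..n}"
   show "\<alpha> k * ((2 - real k) * B k x) \<le> \<alpha> k * ((2 - real l) * B k x)"
   proof (cases "\<alpha> k = 0")
    case False
    hence "real l \<le> real k" using alpha(2)[OF k] by simp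
    moreover have "B k x \<ge> 0" unfolding B_def using h_nonneg[of x] e0[OF x] gp by simp
    ultimately show ?thesis using alpha(1)[OF k] by (intro mult_left_mono mult_right_mono) auto
   qed simp
  qed
  also have "... = (2 - real l) * (f x * g x)"
   unfolding f_eq[OF x] B_def sum_distrib_left sum_distrib_right by (rule sum.cong) (simp_all add: mult_ac)
  finally have "R x \<ge> f x * g x + h x * f1 x * g x - (2 - real l) * (f x * g x)" by (simp add: R_def)
  moreover have "f x * g x * (real l - 1 + h x * (f1 x / f x)) = f x * g x + h x * f1 x * g x - (2 - real l) * (f x * g x)"
   using fp by (simp add: field_simps)
  ultimately show ?thesis by simp
 qed
 have fac: "f x * (real l - 1 + h x * (f1 x / f x)) > 0" if x: "norm x = 1" for x
 proof (rule mult_pos_pos)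
  show "f x > 0" unfolding f_def using phi_pos[OF ab[OF nz[OF x]]] uab[OF x] by simp
  show "real l - 1 + h x * (f1 x / f x) > 0" using phi1[OF ab[OF nz[OF x]]] uab[OF x] by (simp add: f_def f1_def)
 qed
 have Rn: "R x \<ge> g x * (f x * (real l - 1 + h x * (f1 x / f x)))" if "norm x = 1" for x
  using Rge[OF that] by (simp add: mult_ac)
 have gn: "g x \<ge> 0" for x by (simp add: g_def)
 have Rnn: "R x \<ge> 0" if "norm x = 1" for x
  using Rn[OF that] mult_nonneg_nonneg[OF gn less_imp_le[OF fac[OF that]], of x] by linarith
 have "R x = 0" by (rule smean_zero_imp[OF cR Rnn R0 x])
 hence "g x * (f x * (real l - 1 + h x * (f1 x / f x))) \<le> 0" using Rn[OF x] by simp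
 hence "g x \<le> 0" using mult_pos_pos[OF _ fac[OF x], of "g x"] by linarith
 thus ?thesis by (simp add: g_def)
qed

end

section \<open>Functions on the unit sphere\<close>

text \<open>The mean value theorem in the direction \<open>v\<close> reduces the second difference
  to a difference of gradients, which differentiability of \<open>X\<close> at the single point
  \<open>x\<close> evaluates.\<close>

lemma second_difference:
 fixes f :: "'a::euclidean_space => real" and X :: "'a => 'a"
 assumes f: "\<And>y. norm (y - x) < r ==> (f has_derivative (\<lambda>v. X y \<bullet> v)) (at y)"
  and d: "\<And>y. norm (y - x) < r ==> norm (X y - X x - A (y - x)) \<le> e * norm (y - x)"
  and A: "linear A" and t: "0 < t" "t * (norm v + norm w) < r" and e: "e \<ge> 0"
 shows "\<bar>(f (x + t *R v + t *R w) - f (x + t *R v) - f (x + t *R w) + f x) - t\<^sup>2 * (A w \<bullet> v)\<bar>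
  \<le> 2 * e * (norm v + norm w)^2 * t^2"
proof -
 let ?K = "norm v + norm w"
 have small: "norm (s *R v + t' *R w) \<le> t * ?K" if "0 \<le> s" "s \<le> t" "0 \<le> t'" "t' \<le> t" for s t'
 proof -
  have "norm (s *R v + t' *R w) \<le> s * norm v + t' * norm w" using norm_triangle_ineq[of "s *R v" "t' *R w"] that by simp
  also have "... \<le> t * norm v + t * norm w" using that by (intro add_mono mult_right_mono) auto
  finally show ?thesis by (simp add: distrib_left)
 qed
 define \<phi> where "\<phi> s = f (x + s *R v + t *R w) - f (x + s *R v)" for s
 have d\<phi>: "(\<phi> has_real_derivative (X (x + s *R v + t *R w) - X (x + s *R v)) \<bullet> v) (at s)" if s: "0 \<le> s" "s \<le> t" for s
 proof -
  have 1: "norm ((x + s *R v + t *R w) - x) < r" using small[OF s, of t] t by (simp add: add.assoc)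
  have 2: "norm ((x + s *R v) - x) < r" using small[OF s, of 0] t by simp
  have "((\<lambda>s. f (x + s *R v + t *R w)) has_derivative (\<lambda>c. X (x + s *R v + t *R w) \<bullet> (c *R v))) (at s)"
   by (rule has_derivative_compose[where f="\<lambda>s. x + s *R v + t *R w" and g=f, OF _ f[OF 1]]) (auto intro!: derivative_eq_intros)
  moreover have "((\<lambda>s. f (x + s *R v)) has_derivative (\<lambda>c. X (x + s *R v) \<bullet> (c *R v))) (at s)"
   by (rule has_derivative_compose[where f="\<lambda>s. x + s *R v" and g=f, OF _ f[OF 2]]) (auto intro!: derivative_eq_intros)
  ultimately have "(\<phi> has_derivative (\<lambda>c. X (x + s *R v + t *R w) \<bullet> (c *R v) - X (x + s *R v) \<bullet> (c *R v))) (at s)"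
   unfolding \<phi>_def[abs_def] by (rule has_derivative_diff)
  thus ?thesis by (rule has_derivative_imp_has_field_derivative) (simp add: inner_diff_left algebra_simps)
 qed
 obtain s where s: "0 < s" "s < t" "\<phi> t - \<phi> 0 = (t - 0) * ((X (x + s *R v + t *R w) - X (x + s *R v)) \<bullet> v)"
  using MVT2[of 0 t \<phi> "\<lambda>s. (X (x + s *R v + t *R w) - X (x + s *R v)) \<bullet> v"] t(1) d\<phi> by auto
 let ?y = "s *R v + t *R w" and ?z = "s *R v + 0 *R w"
 have ny: "norm ?y \<le> t * ?K" and nz: "norm ?z \<le> t * ?K" using small[of s t] small[of s 0] s t(1) by auto
 have e1: "norm (X (x + ?y) - X x - A ?y) \<le> e * (t * ?K)"
 proof -
  have "norm (X (x + ?y) - X x - A (x + ?y - x)) \<le> e * norm (x + ?y - x)"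
   by (rule d) (use ny t in simp)
  also have "... \<le> e * (t * ?K)" using ny e by (intro mult_left_mono) auto
  finally show ?thesis by simp
 qed
 have e2: "norm (X (x + ?z) - X x - A ?z) \<le> e * (t * ?K)"
 proof -
  have "norm (X (x + ?z) - X x - A (x + ?z - x)) \<le> e * norm (x + ?z - x)"
   by (rule d) (use nz t in simp)
  also have "... \<le> e * (t * ?K)" using nz e by (intro mult_left_mono) auto
  finally show ?thesis by simp
 qed
 have Ayz: "A ?y - A ?z = t *R A w" by (simp add: linear_add[OF A] linear_scale[OF A])
 have "norm (X (x + ?y) - X (x + ?z) - t *R A w) \<le> norm (X (x + ?y) - X x - A ?y) + norm (X (x + ?z) - X x - A ?z)"
  unfolding Ayz[symmetric] by (rule order_trans[OF _ norm_triangle_ineq4]) (simp add: algebra_simps)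
 also have "... \<le> 2 * e * (t * ?K)" using e1 e2 by simp
 finally have n: "norm (X (x + ?y) - X (x + ?z) - t *R A w) \<le> 2 * e * (t * ?K)" .
 have eq: "(f (x + t *R v + t *R w) - f (x + t *R v) - f (x + t *R w) + f x) - t\<^sup>2 * (A w \<bullet> v) = t * ((X (x + ?y) - X (x + ?z) - t *R A w) \<bullet> v)"
  using s(3) by (simp add: \<phi>_def add.assoc inner_diff_left power2_eq_square algebra_simps)
 have "\<bar>t * ((X (x + ?y) - X (x + ?z) - t *R A w) \<bullet> v)\<bar> = t * \<bar>(X (x + ?y) - X (x + ?z) - t *R A w) \<bullet> v\<bar>"
  using t(1) by (simp add: abs_mult)
 also have "... \<le> t * (norm (X (x + ?y) - X (x + ?z) - t *R A w) * norm v)"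
  using t(1) by (intro mult_left_mono Cauchy_Schwarz_ineq2) auto
 also have "... \<le> t * ((2 * e * (t * ?K)) * ?K)"
  using t(1) n e by (intro mult_left_mono mult_mono) auto
 also have "... = 2 * e * ?K\<^sup>2 * t^2" by (simp add: power2_eq_square)
 finally show ?thesis unfolding eq .
qed

text \<open>Schwarz's theorem: the second difference is symmetric in \<open>v\<close> and
  \<open>w\<close> and approximates both \<open>t^2 * (A w \<bullet> v)\<close> and
  \<open>t^2 * (A v \<bullet> w)\<close>.\<close>

lemma symmetric_second_derivative:
 fixes f :: "'a::euclidean_space => real" and X :: "'a => 'a"
 assumes r: "r > 0" and f: "\<And>y. norm (y - x) < r ==> (f has_derivative (\<lambda>v. X y \<bullet> v)) (at y)"
  and X: "(X has_derivative A) (at x)"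
 shows "A w \<bullet> v = A v \<bullet> w"
proof (rule ccontr)
 assume ne: "A w \<bullet> v \<noteq> A v \<bullet> w"
 have A: "linear A" using X has_derivative_linear by blast
 define K where "K = norm v + norm w"
 have K: "K \<ge> 0" by (simp add: K_def)
 define D where "D = \<bar>A w \<bullet> v - A v \<bullet> w\<bar>"
 have D: "D > 0" using ne by (simp add: D_def)
 \<comment> \<open>Two errors of size \<open>2 * e * K^2 * t^2\<close> then add up to at most half
   of the gap \<open>D * t^2\<close>.\<close>
 define e where "e = D / (8 * (K^2 + 1))"
 have e: "e > 0" using D by (simp add: e_def add_nonneg_pos)
 obtain d where d: "d > 0" "\<And>y. norm (y - x) < d ==> norm (X y - X x - A (y - x)) \<le> e * norm (y - x)"
  using X e unfolding has_derivative_at_alt by blast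
 define r' where "r' = min r d"
 have r': "r' > 0" using r d by (simp add: r'_def)
 define t where "t = r' / (2 * (K + 1))"
 have t: "t > 0" using r' K by (simp add: t_def)
 have tK: "t * K < r'"
 proof -
  have "t * K \<le> t * (K + 1)" using t by (intro mult_left_mono) auto
  also have "t * (K + 1) = r' / 2"
  proof -
   have "r' / (2 * L) * L = r' / 2" if "L \<noteq> 0" for L :: real using that by simp
   thus ?thesis unfolding t_def using K by (metis add_nonneg_eq_0_iff zero_le_one zero_neq_one)
  qed
  finally show ?thesis using r' by linarith
 qed
 let ?\<Delta> = "f (x + t *R v + t *R w) - f (x + t *R v) - f (x + t *R w) + f x"
 have 1: "\<bar>?\<Delta> - t\<^sup>2 * (A w \<bullet> v)\<bar> \<le> 2 * e * K^2 * t^2"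
  unfolding K_def
  by (rule second_difference[where X=X and A=A and r=r']) (use f d A t tK e in \<open>auto simp: r'_def K_def less_imp_le\<close>)
 have "\<bar>(f (x + t *R w + t *R v) - f (x + t *R w) - f (x + t *R v) + f x) - t\<^sup>2 * (A v \<bullet> w)\<bar> \<le> 2 * e * (norm w + norm v)^2 * t^2"
  by (rule second_difference[where X=X and A=A and r=r']) (use f d A t tK e in \<open>auto simp: r'_def K_def less_imp_le add.commute\<close>)
 hence 2: "\<bar>?\<Delta> - t\<^sup>2 * (A v \<bullet> w)\<bar> \<le> 2 * e * K^2 * t^2" unfolding K_def by (simp add: algebra_simps)
 have "\<bar>t\<^sup>2 * (A w \<bullet> v) - t\<^sup>2 * (A v \<bullet> w)\<bar> \<le> 4 * e * K^2 * t^2" using 1 2 by linarith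
 moreover have "\<bar>t\<^sup>2 * (A w \<bullet> v) - t\<^sup>2 * (A v \<bullet> w)\<bar> = D * t^2"
  unfolding D_def right_diff_distrib[symmetric] abs_mult by simp
 ultimately have "D * t^2 \<le> (4 * e * K^2) * t^2" by simp
 hence "D \<le> 4 * e * K^2" using t by simp
 also have "4 * e * K^2 \<le> 4 * e * (K^2 + 1)" using e by (intro mult_left_mono) auto
 also have "4 * e * (K^2 + 1) = D / 2"
 proof -
  have "K^2 + 1 \<noteq> 0" by (metis add_nonneg_pos less_irrefl zero_le_power2 zero_less_one)
  moreover have "4 * (D / (8 * L)) * L = D / 2" if "L \<noteq> 0" for L :: real using that by simp
  ultimately show ?thesis unfolding e_def by blast
 qed
 finally show False using D by simp
qed

lemma tproj_tangent: "v \<bullet> x = 0 ==> tproj x v = v"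
 by (simp add: tproj_def)

lemma sderiv_radial: "x \<in> unit_sphere ==> f differentiable (at x within unit_sphere) ==> sderiv f x x = 0"
proof -
 assume x: "x \<in> unit_sphere" and f: "f differentiable (at x within unit_sphere)"
 have "x \<bullet> x = 1" using x by (simp add: norm_eq_1[symmetric])
 hence "tproj x x = 0" by (simp add: tproj_def)
 moreover have "linear (frechet_derivative f (at x within unit_sphere))"
  using f frechet_derivative_works has_derivative_linear by blast
 ultimately show ?thesis by (simp add: sderiv_def linear_0)
qed

section \<open>The support function attached to \<open>u\<close>\<close>

locale convex_sphere_function =
 fixes u :: "real^'m => real"
 assumes C2: "sphere_C2 u" and pos: "\<forall>x\<in>unit_sphere. u x > 0"
  and even: "sphere_even u" and convex: "sphere_convex u"
begin

lemma diff_u: "x \<in> unit_sphere ==> u differentiable (at x within unit_sphere)"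
 and diff_grad: "x \<in> unit_sphere ==> sgrad u differentiable (at x within unit_sphere)"
 using C2 by (auto simp: sphere_C2_def sphere_C1_def differentiable_on_def)

text \<open>The extension of \<open>Du\<close> with degree 0, which is the gradient of
  \<open>hom1_ext u\<close>.\<close>

definition XX :: "real^'m => real^'m" where "XX y = sgrad u (nrm y) + u (nrm y) *R nrm y"

text \<open>The Hessian of \<open>hom1_ext u\<close>: the product rule for \<open>XX\<close> at the
  unit vector \<open>nrm y\<close>, rescaled to degree \<open>- 1\<close>.\<close>

definition AA :: "real^'m => real^'m => real^'m" where
 "AA y v = (1 / norm y) *R (sderiv (sgrad u) (nrm y) v + (sderiv u (nrm y) v *R nrm y + u (nrm y) *R tproj (nrm y) v))"

lemma nrm_sphere: "y \<noteq> 0 ==> nrm y \<in> unit_sphere"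
 by simp

lemma XX_derivative_unit:
 assumes x: "x \<in> unit_sphere"
 shows "(XX has_derivative AA x) (at x)"
proof -
 have n: "norm x = 1" using x by simp
 have "((\<lambda>y. sgrad u (y /\<^sub>R norm y) + u (y /\<^sub>R norm y) *R (y /\<^sub>R norm y)) has_derivative
  (\<lambda>v. sderiv (sgrad u) x v + (u (x /\<^sub>R norm x) *R tproj x v + sderiv u x v *R (x /\<^sub>R norm x)))) (at x)"
  by (intro has_derivative_add has_derivative_scaleR has_derivative_sderiv[OF diff_grad[OF x] x] has_derivative_sderiv[OF diff_u[OF x] x] has_derivative_normalize[OF x])
 thus ?thesis
  using n by (simp add: XX_def[abs_def] AA_def[abs_def] nrm_def add.commute)
qed

lemma hom1_derivative_unit:
 assumes x: "x \<in> unit_sphere"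
 shows "(hom1_ext u has_derivative (\<lambda>v. XX x \<bullet> v)) (at x)"
proof -
 have [simp]: "norm x = 1" using x by auto
 show ?thesis
  unfolding hom1_ext_def
  by (rule has_derivative_eq_rhs[OF has_derivative_mult[OF has_derivative_norm_sphere[OF x]
     has_derivative_sderiv[OF diff_u[OF x] x]]])
   (simp add: fun_eq_iff XX_def inner_add_left sgrad_inner[OF diff_u[OF x] x, symmetric] inner_commute[of x])
qed

lemma hom1_nrm: "hom1_ext u y = norm y * u (nrm y)"
 by (simp add: hom1_ext_def nrm_def)

lemma hom1_derivative:
 assumes y: "y \<noteq> 0"
 shows "(hom1_ext u has_derivative (\<lambda>v. XX y \<bullet> v)) (at y)"
proof -
 have "((\<lambda>z. norm y * hom1_ext u ((1 / norm y) *R z)) has_derivative (\<lambda>v. norm y * (XX (nrm y) \<bullet> ((1 / norm y) *R v)))) (at y)"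
 proof (rule has_derivative_mult_right, rule has_derivative_compose[where f="\<lambda>z. (1 / norm y) *R z" and f'="(*R) (1 / norm y)" and g="hom1_ext u" and g'="\<lambda>v. XX (nrm y) \<bullet> v"])
  show "((*R) (1 / norm y) has_derivative (*R) (1 / norm y)) (at y)" by (auto intro!: derivative_eq_intros)
  have "(1 / norm y) *R y = nrm y" by (simp add: nrm_def inverse_eq_divide)
  thus "(hom1_ext u has_derivative (\<lambda>v. XX (nrm y) \<bullet> v)) (at ((1 / norm y) *R y))"
   using hom1_derivative_unit[OF nrm_sphere[OF y]] by simp
 qed
 moreover have "norm y * hom1_ext u ((1 / norm y) *R z) = hom1_ext u z" for z
  using y by (simp add: hom1_nrm nrm_scale)
 moreover have "XX (nrm y) = XX y" using y by (simp add: XX_def)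
 ultimately show ?thesis using y by simp
qed

lemma XX_derivative:
 assumes y: "y \<noteq> 0"
 shows "(XX has_derivative AA y) (at y)"
proof -
 have L: "linear (AA (nrm y))" using XX_derivative_unit[OF nrm_sphere[OF y]] has_derivative_linear by blast
 have "((\<lambda>z. XX ((1 / norm y) *R z)) has_derivative (\<lambda>v. AA (nrm y) ((1 / norm y) *R v))) (at y)"
 proof (rule has_derivative_compose[where f="\<lambda>z. (1 / norm y) *R z" and f'="(*R) (1 / norm y)" and g=XX and g'="AA (nrm y)"])
  show "((*R) (1 / norm y) has_derivative (*R) (1 / norm y)) (at y)" by (auto intro!: derivative_eq_intros)
  have "(1 / norm y) *R y = nrm y" by (simp add: nrm_def inverse_eq_divide)
  thus "(XX has_derivative AA (nrm y)) (at ((1 / norm y) *R y))"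
   using XX_derivative_unit[OF nrm_sphere[OF y]] by simp
 qed
 moreover have "XX ((1 / norm y) *R z) = XX z" for z using y by (simp add: XX_def nrm_scale)
 moreover have "AA (nrm y) ((1 / norm y) *R v) = AA y v" for v
  using y by (simp only: linear_scale[OF L]) (simp add: AA_def)
 ultimately show ?thesis by simp
qed

lemma AA_sym:
 assumes y: "y \<noteq> 0"
 shows "AA y v \<bullet> w = v \<bullet> AA y w"
proof -
 have "AA y v \<bullet> w = AA y w \<bullet> v"
 proof (rule symmetric_second_derivative[where r="norm y" and f="hom1_ext u" and X=XX])
  show "(hom1_ext u has_derivative (\<lambda>v. XX z \<bullet> v)) (at z)" if "norm (z - y) < norm y" for z
   by (rule hom1_derivative) (use that in auto)
 qed (use y XX_derivative in auto)
 thus ?thesis by (simp add: inner_commute)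
qed

lemma AA_radial: "x \<in> unit_sphere ==> AA x x = 0"
proof -
 assume x: "x \<in> unit_sphere"
 have "x \<bullet> x = 1" using x by (simp add: norm_eq_1[symmetric])
 hence "tproj x x = 0" by (simp add: tproj_def)
 thus ?thesis using x sderiv_radial[OF x diff_u[OF x]] sderiv_radial[OF x diff_grad[OF x]] by (simp add: AA_def)
qed

text \<open>Against tangent vectors the normal components of \<open>AA\<close> vanish; the
  tangential part of the derivative of the gradient and the multiple \<open>u x\<close> of the
  metric are left.\<close>

lemma hess_form_AA:
 assumes x: "x \<in> unit_sphere" and v: "v \<bullet> x = 0" and w: "w \<bullet> x = 0"
 shows "hess_form u x v w = AA x v \<bullet> w"
proof -
 have xw: "x \<bullet> w = 0" using w by (simp add: inner_commute)
 show ?thesis using x v w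
  by (simp add: hess_form_def shess_def levi_civita_def AA_def inner_add_left tproj_tangent)
   (simp add: tproj_def inner_diff_left xw)
qed

lemma AA_linear: "y \<noteq> 0 ==> linear (AA y)"
 using XX_derivative has_derivative_linear by blast

text \<open>The hypothesis of convexity speaks of the tangent space. A basis that contains
  \<open>x\<close> splits into tangent eigenvectors, covered by it, and the radial one with
  eigenvalue 0.\<close>

lemma eigenbasis:
 assumes x: "x \<in> unit_sphere"
 obtains v :: "'m => real^'m" and l :: "'m => real" and i0 where
  "\<forall>i j. v i \<bullet> v j = (if i = j then 1 else 0)" "\<forall>i. AA x (v i) = l i *R v i" "v i0 = x" "l i0 = 0" "\<forall>i. l i \<ge> 0"
proof -
 have x0: "x \<noteq> 0" and n: "norm x = 1" using x by auto
 show thesis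
 proof (rule symmetric_eigenbasis[OF AA_linear[OF x0] AA_sym[OF x0] n AA_radial[OF x]])
  fix v :: "'m => real^'m" and l :: "'m => real" and i0
  assume v: "\<And>i j. v i \<bullet> v j = (if i = j then 1 else 0)" "\<And>i. AA x (v i) = l i *R v i" "v i0 = x" "l i0 = 0"
  have "l i \<ge> 0" for i
  proof (cases "i = i0")
   case False
   have t: "v i \<bullet> x = 0" using v(1)[of i i0] v(3) False by simp
   have "v i \<in> eigenspace_on (tangent_space x) (hess_form u x) (l i)"
    unfolding eigenspace_on_def tangent_space_def using t hess_form_AA[OF x t] v(2) by auto
   moreover have "v i \<noteq> 0" using v(1)[of i i] by auto
   ultimately have "eigenvalue_on (tangent_space x) (hess_form u x) (l i)" unfolding eigenvalue_on_def by blast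
   thus ?thesis using convex x unfolding sphere_convex_def by blast
  qed (simp add: v(4))
  thus thesis using that[of v l i0] v by simp
 qed
qed

text \<open>Evenness of \<open>u\<close> upgrades positive homogeneity to the law with
  \<open>\<bar>c\<bar>\<close>; convexity gives the sign of the Hessian through the
  eigenbasis.\<close>

sublocale even_support "hom1_ext u" XX AA
proof
 show "hom1_ext u (c *R x) = \<bar>c\<bar> * hom1_ext u x" for c x
 proof (cases "c = 0 \<or> x = 0")
  case False
  hence "nrm x \<in> unit_sphere" by simp
  hence ev: "u (- nrm x) = u (nrm x)" using even by (simp add: sphere_even_def)
  have "nrm (c *R x) = nrm x \<or> nrm (c *R x) = - nrm x"
   using False by (cases "c > 0") (simp_all add: nrm_def)
  thus ?thesis using ev by (auto simp: hom1_nrm)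
 qed (auto simp: hom1_nrm)
 show "hom1_ext u x > 0" if "x \<noteq> 0" for x
  unfolding hom1_nrm using pos nrm_sphere[OF that] that by (intro mult_pos_pos) auto
 show "(hom1_ext u has_derivative (\<lambda>v. XX x \<bullet> v)) (at x)" if "x \<noteq> 0" for x by (rule hom1_derivative[OF that])
 show "(XX has_derivative AA x) (at x)" if "x \<noteq> 0" for x by (rule XX_derivative[OF that])
 show "AA x v \<bullet> w = v \<bullet> AA x w" if "x \<noteq> 0" for x v w by (rule AA_sym[OF that])
 show "continuous_on (- {0}) (\<lambda>x. AA x v)" for v
 proof -
  have cu: "continuous_on unit_sphere u"
   using C2 unfolding sphere_C2_def sphere_C1_def by (auto intro: differentiable_imp_continuous_on)
  have c1: "continuous_on unit_sphere (\<lambda>x. sderiv u x v)" "continuous_on unit_sphere (\<lambda>x. sderiv (sgrad u) x v)"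
   using C2 unfolding sphere_C2_def sphere_C1_def by auto
  have "continuous_on unit_sphere (\<lambda>x. sderiv (sgrad u) x v + (sderiv u x v *R x + u x *R tproj x v))"
   unfolding tproj_def by (intro continuous_intros cu c1)
  hence "continuous_on (- {0}) (\<lambda>y. sderiv (sgrad u) (nrm y) v + (sderiv u (nrm y) v *R nrm y + u (nrm y) *R tproj (nrm y) v))"
   by (rule continuous_on_compose2[OF _ continuous_on_nrm]) (simp add: image_subset_iff)
  thus ?thesis unfolding AA_def
   by (intro continuous_on_scaleR continuous_on_divide continuous_on_const continuous_on_norm continuous_on_id) auto
 qed
 show "AA x w \<bullet> w \<ge> 0" if x: "x \<noteq> 0" for x w
 proof -
  have s: "AA x w \<bullet> w = (1 / norm x) * (AA (nrm x) w \<bullet> w)" using x by (simp add: AA_def)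
  have nx: "nrm x \<in> unit_sphere" by (rule nrm_sphere[OF x])
  obtain v :: "'m => real^'m" and l :: "'m => real" where
   v: "\<forall>i j. v i \<bullet> v j = (if i = j then 1 else 0)" "\<forall>i. AA (nrm x) (v i) = l i *R v i" "\<forall>i. l i \<ge> 0"
   by (rule eigenbasis[OF nx]) (rule that)
  have "nrm x \<noteq> 0" using x by (simp add: nrm_def)
  hence L: "linear (AA (nrm x))" by (rule AA_linear)
  have "AA (nrm x) w = AA (nrm x) (\<Sum>i\<in>UNIV. (w \<bullet> v i) *R v i)" using orthonormal_expansion[of v w] v(1) by simp
  also have "... = (\<Sum>i\<in>UNIV. (w \<bullet> v i) *R (l i *R v i))" using v(2) by (simp add: linear_sum[OF L] linear_scale[OF L])
  finally have "AA (nrm x) w \<bullet> w = (\<Sum>i\<in>UNIV. l i * (w \<bullet> v i)^2)"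
   by (simp add: inner_sum_left inner_sum_right power2_eq_square inner_commute mult_ac)
  also have "... \<ge> 0" using v(3) by (intro sum_nonneg) simp
  finally show ?thesis unfolding s by simp
 qed
qed

text \<open>The eigenspace of \<open>c\<close> is spanned by the basis vectors with eigenvalue
  \<open>c\<close>. Hence the generating product over pairs of an eigenvalue and a counter regroups
  into the product over the basis without \<open>x\<close>, and coefficients are compared instead of
  constructing a bijection.\<close>

lemma sigma_hess_eq:
 assumes x: "x \<in> unit_sphere"
 shows "sigma_hess k u x = e_hess k x"
proof -
 have x0: "x \<noteq> 0" using x by auto
 obtain v :: "'m => real^'m" and l :: "'m => real" and i0 where
  v: "\<forall>i j. v i \<bullet> v j = (if i = j then 1 else 0)" "\<forall>i. AA x (v i) = l i *R v i" "v i0 = x" "l i0 = 0"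
  by (rule eigenbasis[OF x]) (rule that)
 let ?J = "UNIV - {i0}" and ?T = "tangent_space x" and ?B = "hess_form u x"
 have eh: "e_hess k x = elem_sym k ?J l"
 proof -
  have "matrix (AA x) *v v i = l i *R v i" for i using v(2) by (simp add: matrix_apply[OF AA_linear[OF x0]])
  hence "e_hess k x = elem_sym k UNIV l" unfolding e_hess_def using v(1) by (intro esym_eigenvalues) auto
  thus ?thesis using elem_sym_remove_zero[of UNIV i0 l k] v(4) by simp
 qed
 have ex: "w = (\<Sum>i\<in>UNIV. (w \<bullet> v i) *R v i)" for w using orthonormal_expansion[of v w] v(1) by blast
 have tv: "v j \<bullet> x = 0" if "j \<noteq> i0" for j using v(1,3) that by metis
 have es: "eigenspace_on ?T ?B c = span (v ` {j \<in> ?J. l j = c})" for c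
 proof (intro equalityI subsetI)
  fix w assume w: "w \<in> eigenspace_on ?T ?B c"
  hence wx: "w \<bullet> x = 0" and we: "\<And>z. z \<bullet> x = 0 ==> hess_form u x w z = c * (w \<bullet> z)"
   by (auto simp: eigenspace_on_def tangent_space_def)
  have z: "w \<bullet> v j = 0" if "j \<notin> {j \<in> ?J. l j = c}" for j
  proof (cases "j = i0")
   case True
   thus ?thesis using wx v(3) by simp
  next
   case False
   have "AA x w \<bullet> v j = c * (w \<bullet> v j)" using we[OF tv[OF False]] hess_form_AA[OF x wx tv[OF False]] by simp
   moreover have "AA x w \<bullet> v j = l j * (w \<bullet> v j)" using AA_sym[OF x0, of w "v j"] v(2) by simp
   ultimately show ?thesis using that False by auto
  qed
  have "w = (\<Sum>i\<in>{j \<in> ?J. l j = c}. (w \<bullet> v i) *R v i)"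
   by (subst ex) (rule sum.mono_neutral_right, use z in auto)
  also have "... \<in> span (v ` {j \<in> ?J. l j = c})"
   by (intro span_sum span_scale span_base) auto
  finally show "w \<in> span (v ` {j \<in> ?J. l j = c})" .
 next
  fix w assume w: "w \<in> span (v ` {j \<in> ?J. l j = c})"
  thus "w \<in> eigenspace_on ?T ?B c"
  proof -
   have L: "linear (AA x)" by (rule AA_linear[OF x0])
   have "w \<in> {w. w \<bullet> x = 0 \<and> AA x w = c *R w}"
    using w
   proof (rule span_induct[where P="\<lambda>w. w \<in> {w. w \<bullet> x = 0 \<and> AA x w = c *R w}"])
    show "subspace {w. w \<in> {w. w \<bullet> x = 0 \<and> AA x w = c *R w}}"
     by (auto simp: subspace_def linear_0[OF L] linear_add[OF L] linear_scale[OF L] inner_add_left scaleR_add_right)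
   qed (use tv v(2) in auto)
   thus ?thesis
    unfolding eigenspace_on_def tangent_space_def using hess_form_AA[OF x] by auto
  qed
 qed
 have dim: "dim (eigenspace_on ?T ?B c) = card {j \<in> ?J. l j = c}" for c
 proof -
  have inj: "inj v"
  proof (rule injI)
   fix i j assume "v i = v j"
   hence "v i \<bullet> v j = 1" using v(1) by metis
   thus "i = j" using v(1) by (metis zero_neq_one)
  qed
  have "pairwise orthogonal (v ` {j \<in> ?J. l j = c})" using v(1) by (auto simp: pairwise_def orthogonal_def)
  moreover have "0 \<notin> v ` {j \<in> ?J. l j = c}"
  proof
   assume "0 \<in> v ` {j \<in> ?J. l j = c}"
   then obtain j where "v j = 0" by auto
   moreover have "v j \<bullet> v j = 1" using v(1) by simp
   ultimately show False by simp
  qed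
  ultimately have "independent (v ` {j \<in> ?J. l j = c})" by (rule pairwise_orthogonal_independent)
  hence "dim (v ` {j \<in> ?J. l j = c}) = card (v ` {j \<in> ?J. l j = c})" by (rule dim_eq_card_independent)
  thus ?thesis unfolding es dim_span using inj by (simp add: card_image inj_on_subset)
 qed
 have ei: "eigen_index ?T ?B = Sigma (l ` ?J) (\<lambda>c. {..<card {j \<in> ?J. l j = c}})"
 proof -
  have "c \<in> l ` ?J" if "i < card {j \<in> ?J. l j = c}" for c i
  proof (rule ccontr)
   assume "c \<notin> l ` ?J"
   hence e: "{j \<in> ?J. l j = c} = {}" by auto
   show False using that unfolding e by simp
  qed
  thus ?thesis unfolding eigen_index_def dim by auto
 qed
 have "(\<Prod>p\<in>eigen_index ?T ?B. [:1, fst p:]) = (\<Prod>c\<in>l ` ?J. \<Prod>i\<in>{..<card {j \<in> ?J. l j = c}}. [:1, c:])"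
  unfolding ei by (subst prod.Sigma) (auto simp: case_prod_beta)
 also have "... = (\<Prod>c\<in>l ` ?J. \<Prod>j\<in>{j \<in> ?J. l j = c}. [:1, l j:])"
  by (rule prod.cong) auto
 also have "... = (\<Prod>j\<in>?J. [:1, l j:])" by (rule prod.image_gen[symmetric]) simp
 finally have pe: "(\<Prod>p\<in>eigen_index ?T ?B. [:1, fst p:]) = (\<Prod>j\<in>?J. [:1, l j:])" .
 have "finite (eigen_index ?T ?B)" unfolding ei by auto
 hence "elem_sym k (eigen_index ?T ?B) fst = elem_sym k ?J l"
  using coeff_prod_linear[of "eigen_index ?T ?B" fst k] coeff_prod_linear[of ?J l k] pe by simp
 thus ?thesis unfolding sigma_hess_def eh .
qed

end

context convex_sphere_function
begin

text \<open>The quotient \<open>hom1_ext u y / norm y\<close>, the extension with degree 0, has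
  derivative 0 on the punctured space, which is connected in dimension at least 2.\<close>

lemma constant_of_gradient:
 assumes N: "CARD('m) \<ge> 2" and X: "\<And>x. norm x = 1 ==> XX x = hom1_ext u x *R x"
 shows "u constant_on unit_sphere"
proof -
 define f where "f y = hom1_ext u y / norm y" for y
 have f: "(f has_derivative (\<lambda>v. 0)) (at y)" if y: "y \<noteq> 0" for y
 proof -
  have "((\<lambda>y. hom1_ext u y / norm y) has_derivative (\<lambda>v. ((XX y \<bullet> v) * norm y - hom1_ext u y * (nrm y \<bullet> v)) / (norm y * norm y))) (at y)"
   by (rule has_derivative_divide'[OF dh[OF y] has_derivative_norm_nrm[OF y]]) (use y in simp)
  moreover have "(XX y \<bullet> v) * norm y - hom1_ext u y * (nrm y \<bullet> v) = 0" for v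
  proof -
   have "XX y = hom1_ext u (nrm y) *R nrm y" using X[of "nrm y"] y X_nrm[OF y] by simp
   thus ?thesis using h_nrm[of y] by simp
  qed
  ultimately show ?thesis by (simp add: f_def[abs_def])
 qed
 have "connected (- {0 :: real^'m})" using N by (intro connected_punctured_universe) simp
 hence c: "f y = f z" if "y \<noteq> 0" "z \<noteq> 0" for y z
  using has_derivative_zero_unique_connected[of "- {0}" f y z] f that by auto
 have "u x = f (axis undefined 1)" if "x \<in> unit_sphere" for x
 proof -
  have "u x = f x" using that by (simp add: f_def hom1_nrm)
  also have "... = f (axis undefined 1)" by (rule c) (use that in \<open>auto simp: axis_eq_0_iff\<close>)
  finally show ?thesis .
 qed
 thus ?thesis unfolding constant_on_def by blast
qed

end

theorem theorem1p1:
  fixes \<phi> :: "real \<times> real \<Rightarrow> real" and \<alpha> :: "nat \<Rightarrow> real"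
    and n l :: nat and u :: "real ^ 'm \<Rightarrow> real"
  assumes dimension: "CARD('m) = n + 1"
    and phi_pos: "\<forall>p\<in>pos_quadrant. \<phi> p > 0"
    and phi_C1: "C1_on_open pos_quadrant \<phi>"
    and alpha_nonneg: "\<forall>k\<in>{1..n}. \<alpha> k \<ge> 0"
    and alpha_two: "card {k \<in> {1..n}. \<alpha> k \<noteq> 0} \<ge> 2"
    and ell: "l = Min {k \<in> {1..n}. \<alpha> k > 0}"
    and phi_1: "\<forall>x>0. \<forall>y>0. real l - 1 + x * partial1 (\<lambda>p. ln (\<phi> p)) x y > 0"
    and phi_2: "\<forall>x>0. \<forall>y>0. partial2 \<phi> x y \<ge> 0"
    and u_C2: "sphere_C2 u"
    and u_pos: "\<forall>x\<in>unit_sphere. u x > 0"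
    and u_even: "sphere_even u"
    and u_convex: "sphere_convex u"
    and equation: "\<forall>x\<in>unit_sphere.
      (\<Sum>k=1..n. \<alpha> k * u x * sigma_hess k u x) = \<phi> (u x, norm (Dgrad u x))"
  shows "u constant_on unit_sphere"
proof -
 interpret convex_sphere_function u by unfold_locales (fact u_C2 u_pos u_even u_convex)+
 define \<phi>1 where "\<phi>1 p = frechet_derivative \<phi> (at p) (1, 0)" for p
 define \<phi>2 where "\<phi>2 p = frechet_derivative \<phi> (at p) (0, 1)" for p
 have dphi: "(\<phi> has_derivative (\<lambda>v. \<phi>1 p * fst v + \<phi>2 p * snd v)) (at p)" if p: "p \<in> pos_quadrant" for p
 proof -
  have d: "(\<phi> has_derivative frechet_derivative \<phi> (at p)) (at p)"
   using phi_C1 p unfolding C1_on_open_def by (simp add: frechet_derivative_works)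
  hence lin: "linear (frechet_derivative \<phi> (at p))" by (rule has_derivative_linear)
  have "frechet_derivative \<phi> (at p) v = \<phi>1 p * fst v + \<phi>2 p * snd v" for v
  proof -
   have "frechet_derivative \<phi> (at p) v = frechet_derivative \<phi> (at p) (fst v *R (1, 0) + snd v *R (0, 1))" by simp
   also have "... = \<phi>1 p * fst v + \<phi>2 p * snd v"
    unfolding linear_add[OF lin] linear_scale[OF lin] \<phi>1_def \<phi>2_def by simp
   finally show ?thesis .
  qed
  hence "frechet_derivative \<phi> (at p) = (\<lambda>v. \<phi>1 p * fst v + \<phi>2 p * snd v)" by (rule ext)
  thus ?thesis using d by simp
 qed
 have D1: "((\<lambda>s. \<phi> (s, y)) has_real_derivative \<phi>1 (x, y)) (at x)" and D2: "((\<lambda>t. \<phi> (x, t)) has_real_derivative \<phi>2 (x, y)) (at y)"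
  if xy: "(x, y) \<in> pos_quadrant" for x y
 proof -
  have "((\<lambda>s. \<phi> (s, y)) has_derivative (\<lambda>v. \<phi>1 (x, y) * fst (v, 0 :: real) + \<phi>2 (x, y) * snd (v, 0 :: real))) (at x)"
   by (rule has_derivative_compose[where f="\<lambda>s. (s, y)" and g=\<phi> and f'="\<lambda>v. (v, 0)", OF _ dphi[OF xy]]) (auto intro!: derivative_eq_intros)
  thus "((\<lambda>s. \<phi> (s, y)) has_real_derivative \<phi>1 (x, y)) (at x)"
   by (rule has_derivative_imp_has_field_derivative) simp
  have "((\<lambda>t. \<phi> (x, t)) has_derivative (\<lambda>v. \<phi>1 (x, y) * fst (0 :: real, v) + \<phi>2 (x, y) * snd (0 :: real, v))) (at y)"
   by (rule has_derivative_compose[where f="\<lambda>t. (x, t)" and g=\<phi> and f'="\<lambda>v. (0, v)", OF _ dphi[OF xy]]) (auto intro!: derivative_eq_intros)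
  thus "((\<lambda>t. \<phi> (x, t)) has_real_derivative \<phi>2 (x, y)) (at y)"
   by (rule has_derivative_imp_has_field_derivative) simp
 qed
 have finA: "finite {k \<in> {1..n}. \<alpha> k > 0}" by simp
 have hom1_unit: "hom1_ext u x = u x" if "norm x = 1" for x using that by (simp add: hom1_nrm)
 show ?thesis
 proof (rule constant_of_gradient)
  \<comment> \<open>Two nonzero coefficients with indices from 1 to \<open>n\<close> force
    \<open>n \<ge> 2\<close>.\<close>
  have "card {k \<in> {1..n}. \<alpha> k \<noteq> 0} \<le> card {1..n}" by (intro card_mono) auto
  thus "CARD('m) \<ge> 2" using alpha_two dimension by simp
  fix x :: "real^'m" assume x: "norm x = 1"
  show "XX x = hom1_ext u x *R x"
  proof (rule gradient_vanishes[where \<alpha>=\<alpha> and l=l, OF dimension _ dphi _ _ _ _ _ _ _ x])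
   show "continuous_on pos_quadrant \<phi>1" "continuous_on pos_quadrant \<phi>2"
    using phi_C1 unfolding C1_on_open_def \<phi>1_def \<phi>2_def by auto
   show "\<phi> p > 0" if "p \<in> pos_quadrant" for p using phi_pos that by blast
   show "real l - 1 + fst p * (\<phi>1 p / \<phi> p) > 0" if "p \<in> pos_quadrant" for p
   proof -
    obtain a b where p: "p = (a, b)" by (cases p)
    have ab: "(a, b) \<in> pos_quadrant" using that p by simp
    hence "\<phi> (a, b) > 0" using phi_pos by blast
    hence "((\<lambda>s. ln (\<phi> (s, b))) has_real_derivative 1 / \<phi> (a, b) * \<phi>1 (a, b)) (at a)"
     by (intro DERIV_chain2[OF DERIV_ln_divide D1[OF ab]])
    hence eq: "partial1 (\<lambda>p. ln (\<phi> p)) a b = \<phi>1 (a, b) / \<phi> (a, b)"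
     unfolding partial1_def by (simp add: DERIV_imp_deriv)
    have "a > 0" "b > 0" using ab by (simp_all add: pos_quadrant_def)
    hence "real l - 1 + a * partial1 (\<lambda>p. ln (\<phi> p)) a b > 0" using phi_1 by blast
    thus ?thesis unfolding eq p fst_conv .
   qed
   show "\<phi>2 p \<ge> 0" if "p \<in> pos_quadrant" for p
   proof -
    obtain a b where p: "p = (a, b)" by (cases p)
    have ab: "(a, b) \<in> pos_quadrant" using that p by simp
    have eq: "partial2 \<phi> a b = \<phi>2 (a, b)" unfolding partial2_def by (rule DERIV_imp_deriv[OF D2[OF ab]])
    have "a > 0" "b > 0" using ab by (simp_all add: pos_quadrant_def)
    hence "partial2 \<phi> a b \<ge> 0" using phi_2 by blast
    thus ?thesis unfolding eq p .
   qed
   show "\<alpha> k \<ge> 0" if "k \<in> {1..n}" for k using alpha_nonneg that by blast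
   show "l \<le> k" if "k \<in> {1..n}" "\<alpha> k \<noteq> 0" for k
    unfolding ell by (rule Min_le[OF finA]) (use alpha_nonneg that in force)
   show "(\<Sum>k=1..n. \<alpha> k * hom1_ext u x * e_hess k x) = \<phi> (hom1_ext u x, norm (XX x))" if x: "norm x = 1" for x
   proof -
    have xs: "x \<in> unit_sphere" using x by simp
    have D: "Dgrad u x = XX x" using Dgrad_eq[OF diff_u[OF xs] xs] x by (simp add: XX_def)
    have "(\<Sum>k=1..n. \<alpha> k * u x * sigma_hess k u x) = \<phi> (u x, norm (Dgrad u x))" using equation xs by blast
    thus ?thesis unfolding D sigma_hess_eq[OF xs] hom1_unit[OF x] .
   qed
  qed
 qed
qed

end
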